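(* Let $a\in(0,\infty)^{n-2d}$, $q,b\in(0,\infty)^d$, let $\mathbf I\subseteq\{\lambda\in\Sigma:0\le\lambda_i\le a_i,\ 1\le i\le n-2d\}$ be measurable, and let $\mathcal K$ be a band-limited closed left-invariant subspace of $L^2(N)$ such that $\mathcal P(\mathcal K)=\int_{\mathbf I}^\oplus L^2(\mathbb R^d)\otimes\mathbb C^{m(\lambda)}\,d\mu(\lambda)$. If $\phi\in\mathcal K$ is a continuous wavelet such that $\{L(\gamma)\phi\}_{\gamma\in\Gamma_{a,q,b}}$ forms a Parseval frame in $\mathcal K$, then $$m(\lambda)\le\frac{1}{a_1\cdots a_{n-2d}\,|\det B(\lambda)|}\quad\text{for a.e. }\lambda\in\mathbf I,$$ and $$\|\phi\|^2\le\int_{\mathbf I}b_1\cdots b_d\,q_1\cdots q_d\,d\lambda.$$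
   Context: Setting. $\mathfrak n$ is a real two-step nilpotent Lie algebra of dimension $n$ with center $\mathfrak z$ and a basis $Z_1,\dots,Z_{n-2d},Y_1,\dots,Y_d,X_1,\dots,X_d$ ($d\ge1$) such that the $Z_k$ span $\mathfrak z$, the $Z_k,Y_j$ span a commutative ideal, the $X_j$ span a commutative subalgebra, and $[X_i,Y_j]\in\mathfrak z$. $N=\exp\mathfrak n$ is the connected, simply connected Lie group. For $\lambda\in\mathfrak n^*$ let $B(\lambda)=\big[-\lambda([X_i,Y_j])\big]_{1\le i,j\le d}$; it is assumed that $\det B(\lambda)$ is not identically zero (i.e. $N$ is square-integrable modulo its center). $\Sigma=\{\lambda\in\mathfrak n^*:\lambda(Y_j)=\lambda(X_j)=0\ \forall j,\ \det B(\lambda)\ne0\}$, identified with an open co-null subset of $\mathbb R^{n-2d}$ via $\lambda_k=\lambda(Z_k)$. For $\lambda\in\Sigma$, $\pi_\lambda$ is the irreducible unitary representation of $N$ on $L^2(\mathbb R^d)$, $$\pi_\lambda\Big(\exp(\textstyle\sum z_kZ_k)\exp(\sum y_jY_j)\exp(\sum t_jX_j)\Big)F(x)=e^{2\pi i\sum_k\lambda_kz_k}e^{2\pi i\langle x,B(\lambda)y\rangle}F(x-t).$$ Haar measure on $N$ is Lebesgue measure in the coordinates $(z,y,t)$; $d\mu(\lambda)=|\det B(\lambda)|\,d\lambda$. The Plancherel transform $\mathcal P:L^2(N)\to\int_\Sigma^\oplus L^2(\mathbb R^d)\otimes L^2(\mathbb R^d)\,d\mu(\lambda)$ is the unitary extension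 of $f\mapsto\big(\int_Nf(n)\pi_\lambda(n)\,dn\big)_\lambda$ (with $L^2(\mathbb R^d)\otimes L^2(\mathbb R^d)$ the Hilbert–Schmidt operators, $f\otimes u$ being $h\mapsto\langle h,u\rangle f$). $L$ is the left regular representation; $\mathcal P(L(x)f)(\lambda)=\pi_\lambda(x)\mathcal Pf(\lambda)$. Every closed left-invariant subspace $\mathcal K$ satisfies $\mathcal P(\mathcal K)=\int_\Sigma^\oplus L^2(\mathbb R^d)\otimes P_\lambda(L^2(\mathbb R^d))\,d\mu(\lambda)$ for a measurable field of orthogonal projections $P_\lambda$ on $L^2(\mathbb R^d)$; put $m(\lambda)=\mathrm{rank}\,P_\lambda$. Writing $\mathcal P(\mathcal K)=\int_{\mathbf I}^\oplus L^2(\mathbb R^d)\otimes\mathbb C^{m(\lambda)}\,d\mu(\lambda)$ means that $P_\lambda=0$ for a.e. $\lambda\notin\mathbf I$ and that the range of $P_\lambda$ is identified isometrically with $\mathbb C^{m(\lambda)}$ for $\lambda\in\mathbf I$. Quasi-lattice: $\Gamma_{a,q,b}=\Big\{\prod_{j=1}^{n-2d}\exp(\tfrac{m_j}{a_j}Z_j)\prod_{j=1}^d\exp(\tfrac{k_j}{q_j}Y_j)\prod_{j=1}^d\exp(\tfrac{n_j}{b_j}X_j):m_j,k_j,n_j\in\mathbb Z\Big\}$. Parseval frame in $\mathcal K$: $\sum_i|\langle f,f_i\rangle|^2=\|f\|^2$ for all $f\in\mathcal K$. A vector $\phi\in\mathcal K$ is a continuous wavelet (admissible vector) if $\psi\mapsto\big(x\mapsto\langle\psi,L(x)\phi\rangle\big)$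 is an isometry from $\mathcal K$ into $L^2(N)$. *)

theory Defs
  imports "HOL-Analysis.Analysis"
begin

section \<open>Square-integrable functions and operators on them\<close>

text \<open>Elements of \<open>L\<^sup>2(M)\<close> are represented by functions; equality of elements is equality
  almost everywhere.\<close>

definition L2 :: "'a measure \<Rightarrow> ('a \<Rightarrow> complex) set" where
  "L2 M = {f. f \<in> borel_measurable M \<and> integrable M (\<lambda>x. (cmod (f x))\<^sup>2)}"

definition l2_inner :: "'a measure \<Rightarrow> ('a \<Rightarrow> complex) \<Rightarrow> ('a \<Rightarrow> complex) \<Rightarrow> complex" where
  "l2_inner M f g = (LINT x|M. f x * cnj (g x))"

definition l2_norm :: "'a measure \<Rightarrow> ('a \<Rightarrow> complex) \<Rightarrow> real" where
  "l2_norm M f = sqrt (LINT x|M. (cmod (f x))\<^sup>2)"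

text \<open>Since subspaces are sets of representatives, the last conjunct also makes them saturated
  under almost-everywhere equality.\<close>

definition closed_subspace :: "'a measure \<Rightarrow> ('a \<Rightarrow> complex) set \<Rightarrow> bool" where
  "closed_subspace M K \<longleftrightarrow>
     K \<subseteq> L2 M \<and> (\<lambda>x. 0) \<in> K \<and>
     (\<forall>f\<in>K. \<forall>g\<in>K. (\<lambda>x. f x + g x) \<in> K) \<and>
     (\<forall>c. \<forall>f\<in>K. (\<lambda>x. c * f x) \<in> K) \<and>
     (\<forall>f g. (\<forall>k::nat. f k \<in> K) \<longrightarrow> g \<in> L2 M \<longrightarrow>
        (\<lambda>k. l2_norm M (\<lambda>x. f k x - g x)) \<longlonglongrightarrow> 0 \<longrightarrow> g \<in> K)"

type_synonym 'a l2_operator = "('a \<Rightarrow> complex) \<Rightarrow> ('a \<Rightarrow> complex)"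

text \<open>Boundedness and linearity imply that almost everywhere equal arguments have almost everywhere
  equal images.\<close>

definition bounded_operator :: "'a measure \<Rightarrow> 'a l2_operator \<Rightarrow> bool" where
  "bounded_operator M T \<longleftrightarrow>
     (\<forall>f\<in>L2 M. T f \<in> L2 M) \<and>
     (\<forall>f\<in>L2 M. \<forall>g\<in>L2 M. AE x in M. T (\<lambda>y. f y + g y) x = T f x + T g x) \<and>
     (\<forall>c. \<forall>f\<in>L2 M. AE x in M. T (\<lambda>y. c * f y) x = c * T f x) \<and>
     (\<exists>C. \<forall>f\<in>L2 M. l2_norm M (T f) \<le> C * l2_norm M f)"

definition orthonormal_basis :: "'a measure \<Rightarrow> (nat \<Rightarrow> 'a \<Rightarrow> complex) \<Rightarrow> bool" where
  "orthonormal_basis M e \<longleftrightarrow>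
     (\<forall>i. e i \<in> L2 M) \<and>
     (\<forall>i j. l2_inner M (e i) (e j) = (if i = j then 1 else 0)) \<and>
     (\<forall>f\<in>L2 M. (\<forall>i. l2_inner M f (e i) = 0) \<longrightarrow> (AE x in M. f x = 0))"

text \<open>The squared Hilbert--Schmidt norm; for bounded operators it does not depend on the choice of
  the basis. It is used only where \<open>L\<^sup>2(M)\<close> is separable and infinite-dimensional.\<close>

definition hs_norm2 :: "'a measure \<Rightarrow> 'a l2_operator \<Rightarrow> ennreal" where
  "hs_norm2 M T =
     (let e = (SOME e. orthonormal_basis M e) in \<Sum>i. ennreal ((l2_norm M (T (e i)))\<^sup>2))"

definition hilbert_schmidt :: "'a measure \<Rightarrow> 'a l2_operator \<Rightarrow> bool" where
  "hilbert_schmidt M T \<longleftrightarrow> bounded_operator M T \<and> hs_norm2 M T < \<infinity>"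

definition orthogonal_projection :: "'a measure \<Rightarrow> 'a l2_operator \<Rightarrow> bool" where
  "orthogonal_projection M P \<longleftrightarrow>
     bounded_operator M P \<and>
     (\<forall>f\<in>L2 M. AE x in M. P (P f) x = P f x) \<and>
     (\<forall>f\<in>L2 M. \<forall>g\<in>L2 M. l2_inner M (P f) g = l2_inner M f (P g))"

definition lin_indep :: "'a measure \<Rightarrow> nat \<Rightarrow> (nat \<Rightarrow> 'a \<Rightarrow> complex) \<Rightarrow> bool" where
  "lin_indep M n v \<longleftrightarrow>
     (\<forall>c :: nat \<Rightarrow> complex. (AE x in M. (\<Sum>i<n. c i * v i x) = 0) \<longrightarrow> (\<forall>i<n. c i = 0))"

definition operator_rank :: "'a measure \<Rightarrow> 'a l2_operator \<Rightarrow> enat" where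
  "operator_rank M T = Sup {enat n | n. \<exists>v. (\<forall>i<n. v i \<in> T ` L2 M) \<and> lin_indep M n v}"

text \<open>The operator \<open>f \<otimes> u\<close>.\<close>

definition rank_one :: "'a measure \<Rightarrow> ('a \<Rightarrow> complex) \<Rightarrow> ('a \<Rightarrow> complex) \<Rightarrow> 'a l2_operator" where
  "rank_one M f u h = (\<lambda>x. l2_inner M h u * f x)"

text \<open>\<open>L\<^sup>2(M) \<otimes> V\<close>: the closed span, in the Hilbert--Schmidt operators, of all \<open>f \<otimes> u\<close>
  with \<open>u \<in> V\<close>.\<close>

definition l2_tensor :: "'a measure \<Rightarrow> ('a \<Rightarrow> complex) set \<Rightarrow> 'a l2_operator set" where
  "l2_tensor M V =
     {T. hilbert_schmidt M T \<and>
         (\<forall>\<epsilon>>0. \<exists>n f u. (\<forall>i<n::nat. f i \<in> L2 M \<and> u i \<in> V) \<and>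
            hs_norm2 M (\<lambda>h x. T h x - (\<Sum>i<n. rank_one M (f i) (u i) h x)) < ennreal \<epsilon>)}"


section \<open>The group and its Plancherel transform\<close>

definition B_matrix ::
  "('v \<Rightarrow> 'v \<Rightarrow> 'v) \<Rightarrow> ('d \<Rightarrow> 'v) \<Rightarrow> ('d \<Rightarrow> 'v) \<Rightarrow> ('v \<Rightarrow> real) \<Rightarrow> real^'d^'d" where
  "B_matrix br Y X l = (\<chi> i j. - l (br (X i) (Y j)))"

text \<open>The dimensions are \<open>d = CARD('d)\<close>, \<open>n - 2 d = CARD('k)\<close> and \<open>n = DIM('v)\<close>.
  Nothing depends on the inner product of \<open>'v\<close>. A nonempty index type \<open>'k\<close> is no
  restriction, because \<open>n = 2 d\<close> would make the determinant vanish identically.\<close>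

locale two_step =
  fixes br :: "'v::euclidean_space \<Rightarrow> 'v \<Rightarrow> 'v"
    and Z :: "'k::finite \<Rightarrow> 'v"
    and Y X :: "'d::finite \<Rightarrow> 'v"
  assumes bilinear_br: "bilinear br"
    and br_self: "\<And>u. br u u = 0"
    and jacobi: "\<And>u v w. br u (br v w) + br v (br w u) + br w (br u v) = 0"
    and two_step: "\<And>u v w. br u (br v w) = 0"
    and nonabelian: "\<exists>u v. br u v \<noteq> 0"
    and basis_inj: "inj (case_sum Z (case_sum Y X))"
    and basis_independent: "independent (range Z \<union> range Y \<union> range X)"
    and basis_span: "span (range Z \<union> range Y \<union> range X) = UNIV"
    and center: "span (range Z) = {u. \<forall>v. br u v = 0}"
    and ideal: "\<And>u v. v \<in> span (range Z \<union> range Y) \<Longrightarrow> br u v \<in> span (range Z \<union> range Y)"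
    and ideal_commutative:
      "\<And>u v. u \<in> span (range Z \<union> range Y) \<Longrightarrow> v \<in> span (range Z \<union> range Y) \<Longrightarrow> br u v = 0"
    and X_commutative: "\<And>u v. u \<in> span (range X) \<Longrightarrow> v \<in> span (range X) \<Longrightarrow> br u v = 0"
    and br_X_Y: "\<And>i j. br (X i) (Y j) \<in> span (range Z)"
    and square_integrable: "\<exists>l. linear l \<and> det (B_matrix br Y X l) \<noteq> 0"
begin

text \<open>The simply connected group is realised on the Lie algebra itself by the
  Baker--Campbell--Hausdorff product, so that the exponential map is the identity, the unit is
  \<open>0\<close> and inversion is negation.\<close>

definition gmult :: "'v \<Rightarrow> 'v \<Rightarrow> 'v" (infixl "\<odot>" 70) where
  "u \<odot> v = u + v + (1/2) *\<^sub>R br u v"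

definition chart :: "(real^'k) \<times> (real^'d) \<times> (real^'d) \<Rightarrow> 'v" where
  "chart = (\<lambda>(z, y, t).
     (\<Sum>k\<in>UNIV. z $ k *\<^sub>R Z k) \<odot> (\<Sum>j\<in>UNIV. y $ j *\<^sub>R Y j) \<odot> (\<Sum>j\<in>UNIV. t $ j *\<^sub>R X j))"

definition haar :: "'v measure" where
  "haar = distr lborel borel chart"

text \<open>The functional on the Lie algebra that vanishes on all \<open>Y\<^sub>j\<close>, \<open>X\<^sub>j\<close> and is identified with
  the vector \<open>(\<lambda>(Z\<^sub>1), \<dots>, \<lambda>(Z\<^bsub>n-2d\<^esub>))\<close>.\<close>

definition functional :: "real^'k \<Rightarrow> 'v \<Rightarrow> real" where
  "functional lam = (THE l. linear l \<and> (\<forall>k. l (Z k) = lam $ k) \<and> (\<forall>j. l (Y j) = 0 \<and> l (X j) = 0))"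

definition B :: "real^'k \<Rightarrow> real^'d^'d" where
  "B lam = B_matrix br Y X (functional lam)"

definition Sig :: "(real^'k) set" where
  "Sig = {lam. det (B lam) \<noteq> 0}"

definition mu :: "(real^'k) measure" where
  "mu = density (restrict_space lborel Sig) (\<lambda>lam. ennreal \<bar>det (B lam)\<bar>)"

definition pi_rep :: "real^'k \<Rightarrow> 'v \<Rightarrow> (real^'d) l2_operator" where
  "pi_rep lam n F = (\<lambda>x. case inv chart n of (z, y, t) \<Rightarrow>
     cis (2 * pi * (lam \<bullet> z)) * cis (2 * pi * (x \<bullet> (B lam *v y))) * F (x - t))"

definition left_translate :: "'v \<Rightarrow> ('v \<Rightarrow> complex) \<Rightarrow> 'v \<Rightarrow> complex" where
  "left_translate x f = (\<lambda>n. f ((- x) \<odot> n))"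

definition left_invariant :: "('v \<Rightarrow> complex) set \<Rightarrow> bool" where
  "left_invariant K \<longleftrightarrow> (\<forall>x. \<forall>f\<in>K. left_translate x f \<in> K)"

text \<open>\<open>\<integral> f(n) \<pi>\<^sub>\<lambda>(n) dn\<close> for integrable \<open>f\<close>. By Fubini the integral converges absolutely at
  almost every \<open>x\<close> and represents the weak operator-valued integral.\<close>

definition pi_integral :: "real^'k \<Rightarrow> ('v \<Rightarrow> complex) \<Rightarrow> (real^'d) l2_operator" where
  "pi_integral lam f h = (\<lambda>x. LINT n|haar. f n * pi_rep lam n h x)"

definition measurable_field :: "(real^'k \<Rightarrow> (real^'d) l2_operator) \<Rightarrow> bool" where
  "measurable_field F \<longleftrightarrow>
     (\<forall>h\<in>L2 lborel. \<forall>u\<in>L2 lborel. (\<lambda>lam. l2_inner lborel (F lam h) u) \<in> borel_measurable mu)"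

text \<open>The direct integral over \<open>\<Sigma>\<close> of the Hilbert--Schmidt operators on \<open>L\<^sup>2(\<real>\<^sup>d)\<close>.\<close>

definition hs_fields :: "(real^'k \<Rightarrow> (real^'d) l2_operator) set" where
  "hs_fields = {F. (\<forall>lam\<in>Sig. hilbert_schmidt lborel (F lam)) \<and> measurable_field F \<and>
     (\<integral>\<^sup>+ lam. hs_norm2 lborel (F lam) \<partial>mu) < \<infinity>}"

text \<open>\<open>F\<close> represents the Plancherel transform of \<open>f\<close>: the extension by continuity from
  \<open>L\<^sup>1 \<inter> L\<^sup>2\<close>.\<close>

definition is_plancherel :: "('v \<Rightarrow> complex) \<Rightarrow> (real^'k \<Rightarrow> (real^'d) l2_operator) \<Rightarrow> bool" where
  "is_plancherel f F \<longleftrightarrow> f \<in> L2 haar \<and> F \<in> hs_fields \<and>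
     (\<exists>g. (\<forall>i::nat. integrable haar (g i) \<and> g i \<in> L2 haar) \<and>
          (\<lambda>i. l2_norm haar (\<lambda>n. g i n - f n)) \<longlonglongrightarrow> 0 \<and>
          (\<lambda>i. \<integral>\<^sup>+ lam. hs_norm2 lborel (\<lambda>h x. pi_integral lam (g i) h x - F lam h x) \<partial>mu)
             \<longlonglongrightarrow> 0)"

definition band_limited :: "('v \<Rightarrow> complex) set \<Rightarrow> bool" where
  "band_limited K \<longleftrightarrow> (\<exists>E. E \<in> sets lebesgue \<and> bounded E \<and> E \<subseteq> Sig \<and>
     (\<forall>f\<in>K. \<forall>F. is_plancherel f F \<longrightarrow> (AE lam in mu. lam \<notin> E \<longrightarrow> hs_norm2 lborel (F lam) = 0)))"

text \<open>The image of \<open>K\<close> under the Plancherel transform is the direct integral over \<open>I\<close> of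
  \<open>L\<^sup>2(\<real>\<^sup>d) \<otimes> \<complex>\<^bsup>m(\<lambda>)\<^esup>\<close>; the fibre range of \<open>P\<^sub>\<lambda>\<close> is isometric to
  \<open>\<complex>\<^bsup>m(\<lambda>)\<^esup>\<close> (to \<open>\<ell>\<^sup>2\<close> if \<open>m(\<lambda>) = \<infinity>\<close>) exactly because \<open>m(\<lambda>)\<close> is its dimension.\<close>

definition plancherel_image ::
  "('v \<Rightarrow> complex) set \<Rightarrow> (real^'k) set \<Rightarrow> (real^'k \<Rightarrow> enat) \<Rightarrow> bool" where
  "plancherel_image K I m \<longleftrightarrow> (\<exists>P.
     (\<forall>lam\<in>Sig. orthogonal_projection lborel (P lam)) \<and> measurable_field P \<and>
     {F. \<exists>f\<in>K. is_plancherel f F} =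
       {F \<in> hs_fields. AE lam in mu. F lam \<in> l2_tensor lborel (P lam ` L2 lborel)} \<and>
     (AE lam in mu. lam \<notin> I \<longrightarrow> (\<forall>h\<in>L2 lborel. AE x in lborel. P lam h x = 0)) \<and>
     (\<forall>lam\<in>I. m lam = operator_rank lborel (P lam)))"

text \<open>The products over \<open>j\<close> within each of the three families of commuting factors are written as
  exponentials of sums; see \<open>gmult_list_Z\<close>, \<open>gmult_list_Y\<close>, \<open>gmult_list_X\<close> below.\<close>

definition quasi_lattice :: "real^'k \<Rightarrow> real^'d \<Rightarrow> real^'d \<Rightarrow> 'v set" where
  "quasi_lattice a q b =
     {chart (\<chi> i. of_int (m i) / a $ i, \<chi> j. of_int (k j) / q $ j, \<chi> j. of_int (n j) / b $ j)
      | m k n :: _ \<Rightarrow> int. True}"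

definition parseval_frame :: "('v \<Rightarrow> complex) set \<Rightarrow> 'v set \<Rightarrow> ('v \<Rightarrow> complex) \<Rightarrow> bool" where
  "parseval_frame K \<Gamma> \<phi> \<longleftrightarrow> (\<forall>\<gamma>\<in>\<Gamma>. left_translate \<gamma> \<phi> \<in> K) \<and>
     (\<forall>f\<in>K. ((\<lambda>\<gamma>. (cmod (l2_inner haar f (left_translate \<gamma> \<phi>)))\<^sup>2) has_sum (l2_norm haar f)\<^sup>2) \<Gamma>)"

definition continuous_wavelet :: "('v \<Rightarrow> complex) set \<Rightarrow> ('v \<Rightarrow> complex) \<Rightarrow> bool" where
  "continuous_wavelet K \<phi> \<longleftrightarrow> \<phi> \<in> K \<and>
     (\<forall>\<psi>\<in>K. (\<lambda>x. l2_inner haar \<psi> (left_translate x \<phi>)) \<in> L2 haar \<and>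
        l2_norm haar (\<lambda>x. l2_inner haar \<psi> (left_translate x \<phi>)) = l2_norm haar \<psi>)"

lemma br_br_left: "br (br u v) w = 0"
  using br_self[of "br u v + w"]
  by (simp add: bilinear_ladd[OF bilinear_br] bilinear_radd[OF bilinear_br] br_self[of w] two_step)

lemma gmult_assoc: "(u \<odot> v) \<odot> w = u \<odot> (v \<odot> w)"
  by (simp add: gmult_def bilinear_ladd[OF bilinear_br] bilinear_radd[OF bilinear_br]
      bilinear_lmul[OF bilinear_br] bilinear_rmul[OF bilinear_br] two_step br_br_left
      scaleR_add_right)

lemma gmult_zero: "0 \<odot> u = u" "u \<odot> 0 = u"
  by (simp_all add: gmult_def bilinear_lzero[OF bilinear_br] bilinear_rzero[OF bilinear_br])

lemma gmult_uminus: "(- u) \<odot> u = 0" "u \<odot> (- u) = 0"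
  by (simp_all add: gmult_def bilinear_lneg[OF bilinear_br] bilinear_rneg[OF bilinear_br] br_self)

lemma gmult_list_commuting:
  assumes "\<And>i j. br (g i) (g j) = 0" "distinct xs"
  shows "foldr (\<lambda>j w. g j \<odot> w) xs 0 = (\<Sum>j\<in>set xs. g j)"
  using assms(2)
proof (induction xs)
  case (Cons j xs)
  have "br (g j) (\<Sum>i\<in>set xs. g i) = (\<Sum>i\<in>set xs. br (g j) (g i))"
    using bilinear_br by (simp add: bilinear_def linear_sum)
  with Cons assms(1) show ?case by (simp add: gmult_def)
qed simp

lemma
  fixes c :: "'k \<Rightarrow> real" and c' :: "'d \<Rightarrow> real"
  shows gmult_list_Z: "distinct xs \<Longrightarrow> set xs = UNIV \<Longrightarrow>
      foldr (\<lambda>j w. (c j *\<^sub>R Z j) \<odot> w) xs 0 = (\<Sum>j\<in>UNIV. c j *\<^sub>R Z j)"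
    and gmult_list_Y: "distinct ys \<Longrightarrow> set ys = UNIV \<Longrightarrow>
      foldr (\<lambda>j w. (c' j *\<^sub>R Y j) \<odot> w) ys 0 = (\<Sum>j\<in>UNIV. c' j *\<^sub>R Y j)"
    and gmult_list_X: "distinct ys \<Longrightarrow> set ys = UNIV \<Longrightarrow>
      foldr (\<lambda>j w. (c' j *\<^sub>R X j) \<odot> w) ys 0 = (\<Sum>j\<in>UNIV. c' j *\<^sub>R X j)"
  using ideal_commutative X_commutative
  by (subst gmult_list_commuting; simp add: span_base span_scale)+

end

end

theory Submission
  imports Defs "HOL-Probability.Probability"
begin

text \<open>Let \<open>\<Phi>\<close> be the Plancherel transform of \<open>\<phi>\<close> and \<open>g(\<lambda>)\<close> the product of \<open>\<bar>det B(\<lambda>)\<bar>\<close> and the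
  squared Hilbert--Schmidt norm of \<open>\<Phi>(\<lambda>)\<close>. Restricting \<open>\<Phi>\<close> to a set \<open>E\<close> of frequencies gives an
  \<open>f\<close> in \<open>K\<close> whose coefficients along the central translates of \<open>\<phi>\<close> are the Fourier transform of
  \<open>1\<^sub>E g\<close>. The frame identity, averaged over a cell of the central sublattice, bounds the integral
  of \<open>g\<^sup>2\<close> over \<open>E\<close> by \<open>1/(a\<^sub>1 \<cdots> a\<^bsub>n-2d\<^esub>)\<close> times that of \<open>g\<close>. As \<open>E\<close> is arbitrary,
  \<open>g \<le> 1/(a\<^sub>1 \<cdots> a\<^bsub>n-2d\<^esub>)\<close> almost everywhere.

  The wavelet condition, tested on fields of rank-one operators \<open>e \<otimes> P\<^sub>\<lambda> e\<^sub>j\<close>, gives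
  \<open>\<Vert>P\<^sub>\<lambda> e\<^sub>j\<Vert> \<le> \<Vert>\<Phi>(\<lambda>) P\<^sub>\<lambda> e\<^sub>j\<Vert>\<close> for almost every \<open>\<lambda>\<close>; summing the squares over an orthonormal basis
  bounds the rank of \<open>P\<^sub>\<lambda>\<close> by \<open>g(\<lambda>) / \<bar>det B(\<lambda>)\<bar>\<close>. The squared norm of \<open>\<phi>\<close> is the integral of
  \<open>g\<close> over \<open>I\<close>, and comparing the wavelet and the frame condition on a fundamental tile of the
  quasi-lattice yields \<open>1 \<le> \<Prod>a \<Prod>q \<Prod>b\<close> unless \<open>\<phi> = 0\<close>.

  Plancherel's theorem for the group reduces to the Euclidean one, because \<open>\<pi>\<^sub>\<lambda>(f)\<close> is an
  integral operator whose kernel is a partial Fourier transform of \<open>f\<close>.\<close>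

text \<open>Elements of the Hilbert spaces are representatives, operators are linear only almost
  everywhere, and the transform is only a relation between functions and fields. The remedy is to
  pass to numbers: \<open>dcoef\<close> lists the matrix entries of an operator in one fixed
  orthonormal basis, and \<open>fcoef\<close> makes a field of operators a single function in L2 of
  counting measure times \<open>mu\<close>. Completeness, limits and polarisation for fields are
  then those of one scalar L2 space.

  Both averaging arguments rest on one fact: by left invariance of \<open>K\<close> the frame
  identity holds for every shifted lattice, so it may be integrated over the shift. An integrated
  inequality becomes pointwise by testing it on the set where it fails, cut down so that the
  integrals are finite.

  The constants fit as follows. With A the product of the \<open>a $ i\<close>, rank times |det B|
  is at most g, and g is at most 1/A: the first claim. The volume comparison bounds 1/A by the
  product of all \<open>q $ j\<close> and \<open>b $ j\<close>, which turns the same bound on g into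
  the second.\<close>

lemma borel_measurable_cnj [measurable (raw)]:
  "f \<in> borel_measurable M \<Longrightarrow> (\<lambda>x. cnj (f x)) \<in> borel_measurable M"
  by (rule borel_measurable_continuous_on[OF continuous_on_cnj[OF continuous_on_id]])

section \<open>Square-integrable functions: algebra, inner product, norm estimates\<close>

lemma L2_measurable: "f \<in> L2 M \<Longrightarrow> f \<in> borel_measurable M"
  by (simp add: L2_def)

lemma L2_integrable: "f \<in> L2 M \<Longrightarrow> integrable M (\<lambda>x. (cmod (f x))\<^sup>2)"
  by (simp add: L2_def)

lemma L2_iff_nn_integral:
  "f \<in> L2 M \<longleftrightarrow> f \<in> borel_measurable M \<and> (\<integral>\<^sup>+ x. ennreal ((cmod (f x))\<^sup>2) \<partial>M) < \<infinity>"
  by (auto simp: L2_def integrable_iff_bounded)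

lemma L2I_nn_integral:
  "f \<in> borel_measurable M \<Longrightarrow> (\<integral>\<^sup>+ x. ennreal ((cmod (f x))\<^sup>2) \<partial>M) < \<infinity> \<Longrightarrow> f \<in> L2 M"
  by (simp add: L2_iff_nn_integral)

lemma L2_zero [simp]: "(\<lambda>x. 0) \<in> L2 M"
  by (simp add: L2_def)

lemma L2_scale: "f \<in> L2 M \<Longrightarrow> (\<lambda>x. c * f x) \<in> L2 M"
  by (auto simp: L2_def norm_mult power_mult_distrib)

lemma L2_cnj: "f \<in> L2 M \<Longrightarrow> (\<lambda>x. cnj (f x)) \<in> L2 M"
  by (auto simp: L2_def)

lemma cmod_add_square_le: "(cmod (a + b))\<^sup>2 \<le> 2 * (cmod a)\<^sup>2 + 2 * (cmod b)\<^sup>2"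
proof -
  have "(cmod (a + b))\<^sup>2 \<le> (cmod a + cmod b)\<^sup>2"
    by (simp add: norm_triangle_ineq power_mono)
  also have "\<dots> \<le> 2 * (cmod a)\<^sup>2 + 2 * (cmod b)\<^sup>2"
    using sum_squares_bound[of "cmod a" "cmod b"] by (simp add: power2_sum)
  finally show ?thesis .
qed

lemma L2_add:
  assumes "f \<in> L2 M" "g \<in> L2 M" shows "(\<lambda>x. f x + g x) \<in> L2 M"
proof -
  have "integrable M (\<lambda>x. (cmod (f x + g x))\<^sup>2)"
  proof (rule Bochner_Integration.integrable_bound)
    show "integrable M (\<lambda>x. 2 * (cmod (f x))\<^sup>2 + 2 * (cmod (g x))\<^sup>2)"
      using assms by (auto simp: L2_def)
    show "(\<lambda>x. (cmod (f x + g x))\<^sup>2) \<in> borel_measurable M"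
      using assms by (auto simp: L2_def)
  qed (simp add: cmod_add_square_le)
  with assms show ?thesis by (auto simp: L2_def)
qed

lemma L2_diff: "f \<in> L2 M \<Longrightarrow> g \<in> L2 M \<Longrightarrow> (\<lambda>x. f x - g x) \<in> L2 M"
  using L2_add[of f M "\<lambda>x. -1 * g x"] L2_scale[of g M "-1"] by simp

lemma L2_sum: "(\<And>i. i \<in> A \<Longrightarrow> f i \<in> L2 M) \<Longrightarrow> (\<lambda>x. \<Sum>i\<in>A. f i x) \<in> L2 M"
  by (induction A rule: infinite_finite_induct) (auto intro: L2_add)

lemma L2_bound:
  assumes "f \<in> borel_measurable M" "g \<in> L2 M" "\<And>x. x \<in> space M \<Longrightarrow> cmod (f x) \<le> cmod (g x)"
  shows "f \<in> L2 M"
proof -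
  have "integrable M (\<lambda>x. (cmod (f x))\<^sup>2)"
    by (rule Bochner_Integration.integrable_bound[OF L2_integrable[OF assms(2)]])
      (use assms in \<open>auto intro!: AE_I2 power_mono\<close>)
  with assms(1) show ?thesis by (simp add: L2_def)
qed

lemma integrable_mult_L2:
  assumes "f \<in> L2 M" "g \<in> L2 M" shows "integrable M (\<lambda>x. f x * g x)"
proof (rule Bochner_Integration.integrable_bound)
  show "integrable M (\<lambda>x. (cmod (f x))\<^sup>2 + (cmod (g x))\<^sup>2)"
    using assms by (auto simp: L2_def)
  show "(\<lambda>x. f x * g x) \<in> borel_measurable M" using assms by (auto simp: L2_def)
  have "cmod (a * b) \<le> (cmod a)\<^sup>2 + (cmod b)\<^sup>2" for a b
  proof -
    have "cmod a * cmod b \<le> (cmod a)\<^sup>2 + (cmod b)\<^sup>2"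
      using sum_squares_bound[of "cmod a" "cmod b"]
        mult_nonneg_nonneg[OF norm_ge_zero[of a] norm_ge_zero[of b]]
      by linarith
    then show ?thesis by (simp add: norm_mult)
  qed
  then show "AE x in M. norm (f x * g x) \<le> norm ((cmod (f x))\<^sup>2 + (cmod (g x))\<^sup>2)" by simp
qed

lemma integrable_l2_inner:
  "f \<in> L2 M \<Longrightarrow> g \<in> L2 M \<Longrightarrow> integrable M (\<lambda>x. f x * cnj (g x))"
  by (intro integrable_mult_L2 L2_cnj)

lemma l2_norm_nonneg [simp]: "0 \<le> l2_norm M f"
  by (simp add: l2_norm_def)

lemma l2_norm_square: "(l2_norm M f)\<^sup>2 = (LINT x|M. (cmod (f x))\<^sup>2)"
  by (simp add: l2_norm_def)

lemma ennreal_l2_norm_square: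
  "f \<in> L2 M \<Longrightarrow> ennreal ((l2_norm M f)\<^sup>2) = (\<integral>\<^sup>+ x. ennreal ((cmod (f x))\<^sup>2) \<partial>M)"
  by (simp add: l2_norm_square nn_integral_eq_integral L2_integrable)

lemma l2_inner_self: "l2_inner M f f = of_real ((l2_norm M f)\<^sup>2)"
  unfolding l2_inner_def l2_norm_square
  by (subst integral_complex_of_real[symmetric]) (simp add: complex_norm_square[symmetric])

lemma l2_inner_commute: "l2_inner M g f = cnj (l2_inner M f g)"
  unfolding l2_inner_def by (subst Bochner_Integration.integral_cnj[symmetric]) (simp add: mult.commute)

lemma l2_inner_add_left:
  "f \<in> L2 M \<Longrightarrow> g \<in> L2 M \<Longrightarrow> h \<in> L2 M \<Longrightarrow>
    l2_inner M (\<lambda>x. f x + g x) h = l2_inner M f h + l2_inner M g h"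
  by (simp add: l2_inner_def distrib_right integrable_l2_inner)

lemma l2_inner_diff_left:
  "f \<in> L2 M \<Longrightarrow> g \<in> L2 M \<Longrightarrow> h \<in> L2 M \<Longrightarrow>
    l2_inner M (\<lambda>x. f x - g x) h = l2_inner M f h - l2_inner M g h"
  by (simp add: l2_inner_def left_diff_distrib integrable_l2_inner)

lemma l2_inner_add_right:
  "f \<in> L2 M \<Longrightarrow> g \<in> L2 M \<Longrightarrow> h \<in> L2 M \<Longrightarrow>
    l2_inner M h (\<lambda>x. f x + g x) = l2_inner M h f + l2_inner M h g"
  by (simp add: l2_inner_def distrib_left integrable_l2_inner)

lemma l2_inner_diff_right:
  "f \<in> L2 M \<Longrightarrow> g \<in> L2 M \<Longrightarrow> h \<in> L2 M \<Longrightarrow>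
    l2_inner M h (\<lambda>x. f x - g x) = l2_inner M h f - l2_inner M h g"
  by (simp add: l2_inner_def right_diff_distrib integrable_l2_inner)

lemma l2_inner_scale_left: "l2_inner M (\<lambda>x. c * f x) g = c * l2_inner M f g"
  by (simp add: l2_inner_def mult.assoc)

lemma l2_inner_scale_right: "l2_inner M f (\<lambda>x. c * g x) = cnj c * l2_inner M f g"
  by (simp add: l2_inner_def algebra_simps)

lemma l2_inner_sum_left:
  assumes "\<And>i. i \<in> A \<Longrightarrow> f i \<in> L2 M" "h \<in> L2 M"
  shows "l2_inner M (\<lambda>x. \<Sum>i\<in>A. f i x) h = (\<Sum>i\<in>A. l2_inner M (f i) h)"
  using assms unfolding l2_inner_def
  by (simp add: sum_distrib_right Bochner_Integration.integral_sum integrable_l2_inner)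

lemma l2_inner_sum_right:
  assumes "\<And>i. i \<in> A \<Longrightarrow> f i \<in> L2 M" "h \<in> L2 M"
  shows "l2_inner M h (\<lambda>x. \<Sum>i\<in>A. f i x) = (\<Sum>i\<in>A. l2_inner M h (f i))"
  using assms unfolding l2_inner_def
  by (simp add: sum_distrib_left Bochner_Integration.integral_sum integrable_l2_inner)

lemma l2_inner_zero [simp]: "l2_inner M (\<lambda>x. 0) f = 0" "l2_inner M f (\<lambda>x. 0) = 0"
  by (simp_all add: l2_inner_def)

lemma l2_norm_zero [simp]: "l2_norm M (\<lambda>x. 0) = 0"
  by (simp add: l2_norm_def)

lemma l2_norm_scale: "l2_norm M (\<lambda>x. c * f x) = cmod c * l2_norm M f"
  by (simp add: l2_norm_def norm_mult power_mult_distrib real_sqrt_mult)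

lemma l2_norm_minus_commute: "l2_norm M (\<lambda>x. f x - g x) = l2_norm M (\<lambda>x. g x - f x)"
  by (simp add: l2_norm_def norm_minus_commute)

lemma l2_inner_cong_AE:
  assumes "AE x in M. f x = f' x" "AE x in M. g x = g' x"
    and "f \<in> borel_measurable M" "f' \<in> borel_measurable M"
    and "g \<in> borel_measurable M" "g' \<in> borel_measurable M"
  shows "l2_inner M f g = l2_inner M f' g'"
  unfolding l2_inner_def by (rule integral_cong_AE) (use assms in auto)

lemma l2_norm_cong_AE:
  assumes "AE x in M. f x = f' x" "f \<in> borel_measurable M" "f' \<in> borel_measurable M"
  shows "l2_norm M f = l2_norm M f'"
  unfolding l2_norm_def by (rule arg_cong[where f=sqrt], rule integral_cong_AE) (use assms in auto)

lemma l2_norm_eq_zero_iff: "f \<in> L2 M \<Longrightarrow> l2_norm M f = 0 \<longleftrightarrow> (AE x in M. f x = 0)"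
  by (simp add: l2_norm_def integral_nonneg_eq_0_iff_AE L2_integrable)

lemma l2_norm_add_square:
  assumes "f \<in> L2 M" "g \<in> L2 M"
  shows "(l2_norm M (\<lambda>x. f x + g x))\<^sup>2 =
    (l2_norm M f)\<^sup>2 + (l2_norm M g)\<^sup>2 + 2 * Re (l2_inner M f g)"
proof -
  have "complex_of_real ((l2_norm M (\<lambda>x. f x + g x))\<^sup>2) =
      of_real ((l2_norm M f)\<^sup>2) + of_real ((l2_norm M g)\<^sup>2) + (l2_inner M f g + cnj (l2_inner M f g))"
    unfolding l2_inner_self[symmetric] l2_inner_commute[of M g f, symmetric] using assms
    by (simp add: l2_inner_add_left l2_inner_add_right L2_add)
  then show ?thesis
    by (simp only: complex_add_cnj of_real_add[symmetric] of_real_eq_iff)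
qed

lemma l2_norm_diff_square:
  assumes "f \<in> L2 M" "g \<in> L2 M"
  shows "(l2_norm M (\<lambda>x. f x - g x))\<^sup>2 =
    (l2_norm M f)\<^sup>2 + (l2_norm M g)\<^sup>2 - 2 * Re (l2_inner M f g)"
  using l2_norm_add_square[OF assms(1) L2_scale[OF assms(2), of "-1"]]
  by (simp add: l2_inner_scale_right[of M f "-1" g, simplified] l2_norm_scale[of M "-1" g, simplified])

text \<open>The Cauchy--Schwarz inequality for nonnegative integrals, brought back to real numbers.
  The absolute value stays inside the integral because this form also dominates the integrand of the
  Fubini argument in \<open>pi_integral_inner\<close>.\<close>

lemma integral_cmod_mult_le:
  assumes "f \<in> L2 M" "g \<in> L2 M"
  shows "(LINT x|M. cmod (f x * g x)) \<le> l2_norm M f * l2_norm M g"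
proof -
  have i: "integrable M (\<lambda>x. cmod (f x * g x))"
    using integrable_mult_L2[OF assms] by simp
  have "(\<integral>\<^sup>+ x. ennreal (cmod (f x)) * ennreal (cmod (g x)) \<partial>M)\<^sup>2 \<le>
      (\<integral>\<^sup>+ x. (ennreal (cmod (f x)))\<^sup>2 \<partial>M) * (\<integral>\<^sup>+ x. (ennreal (cmod (g x)))\<^sup>2 \<partial>M)"
    by (rule Cauchy_Schwarz_nn_integral) (use assms in \<open>auto simp: L2_def\<close>)
  also have "\<dots> = ennreal ((l2_norm M f)\<^sup>2) * ennreal ((l2_norm M g)\<^sup>2)"
    using assms by (simp add: ennreal_l2_norm_square ennreal_power)
  also have "(\<integral>\<^sup>+ x. ennreal (cmod (f x)) * ennreal (cmod (g x)) \<partial>M) = ennreal (LINT x|M. cmod (f x * g x))"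
    by (subst nn_integral_eq_integral[OF i, symmetric]) (simp_all add: norm_mult ennreal_mult)
  finally have "ennreal ((LINT x|M. cmod (f x * g x))\<^sup>2) \<le> ennreal ((l2_norm M f * l2_norm M g)\<^sup>2)"
    by (simp add: ennreal_power ennreal_mult power_mult_distrib)
  then have "(LINT x|M. cmod (f x * g x))\<^sup>2 \<le> (l2_norm M f * l2_norm M g)\<^sup>2"
    by simp
  then show ?thesis
    by (rule power2_le_imp_le) simp
qed

lemma l2_inner_cauchy_schwarz:
  assumes "f \<in> L2 M" "g \<in> L2 M"
  shows "cmod (l2_inner M f g) \<le> l2_norm M f * l2_norm M g"
proof -
  have "cmod (l2_inner M f g) \<le> (LINT x|M. cmod (f x * cnj (g x)))"
    unfolding l2_inner_def by (rule integral_norm_bound)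
  also have "\<dots> \<le> l2_norm M f * l2_norm M (\<lambda>x. cnj (g x))"
    by (rule integral_cmod_mult_le) (use assms in \<open>auto intro: L2_cnj\<close>)
  finally show ?thesis by (simp add: l2_norm_def)
qed

lemma l2_norm_triangle:
  assumes "f \<in> L2 M" "g \<in> L2 M"
  shows "l2_norm M (\<lambda>x. f x + g x) \<le> l2_norm M f + l2_norm M g"
proof (rule power2_le_imp_le)
  have "Re (l2_inner M f g) \<le> l2_norm M f * l2_norm M g"
    using complex_Re_le_cmod l2_inner_cauchy_schwarz[OF assms] by (rule order_trans)
  then show "(l2_norm M (\<lambda>x. f x + g x))\<^sup>2 \<le> (l2_norm M f + l2_norm M g)\<^sup>2"
    by (simp add: l2_norm_add_square[OF assms] power2_sum)
qed simp

lemma l2_norm_triangle_diff: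
  assumes "f \<in> L2 M" "g \<in> L2 M" "h \<in> L2 M"
  shows "l2_norm M (\<lambda>x. f x - h x) \<le> l2_norm M (\<lambda>x. f x - g x) + l2_norm M (\<lambda>x. g x - h x)"
  using l2_norm_triangle[of "\<lambda>x. f x - g x" M "\<lambda>x. g x - h x"] assms by (simp add: L2_diff)

lemma l2_norm_abs_diff:
  assumes "f \<in> L2 M" "g \<in> L2 M"
  shows "\<bar>l2_norm M f - l2_norm M g\<bar> \<le> l2_norm M (\<lambda>x. f x - g x)"
  using l2_norm_triangle[of "\<lambda>x. f x - g x" M g] l2_norm_triangle[of "\<lambda>x. g x - f x" M f] assms
  by (simp add: L2_diff l2_norm_minus_commute[of M f g])

lemma tendsto_l2_norm:
  assumes "\<And>n::nat. f n \<in> L2 M" "g \<in> L2 M" "(\<lambda>n. l2_norm M (\<lambda>x. f n x - g x)) \<longlonglongrightarrow> 0"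
  shows "(\<lambda>n. l2_norm M (f n)) \<longlonglongrightarrow> l2_norm M g"
proof -
  have "(\<lambda>n. l2_norm M (f n) - l2_norm M g) \<longlonglongrightarrow> 0"
    by (rule Lim_null_comparison[OF _ assms(3)])
      (simp add: l2_norm_abs_diff assms)
  then show ?thesis by (simp add: LIM_zero_iff)
qed

lemma tendsto_l2_inner:
  assumes "\<And>n::nat. f n \<in> L2 M" "g \<in> L2 M" "(\<lambda>n. l2_norm M (\<lambda>x. f n x - g x)) \<longlonglongrightarrow> 0"
    and "\<And>n::nat. f' n \<in> L2 M" "g' \<in> L2 M" "(\<lambda>n. l2_norm M (\<lambda>x. f' n x - g' x)) \<longlonglongrightarrow> 0"
  shows "(\<lambda>n. l2_inner M (f n) (f' n)) \<longlonglongrightarrow> l2_inner M g g'"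
proof -
  have "(\<lambda>n. l2_norm M (\<lambda>x. f n x - g x) * l2_norm M (f' n) + l2_norm M g * l2_norm M (\<lambda>x. f' n x - g' x))
      \<longlonglongrightarrow> 0 * l2_norm M g' + l2_norm M g * 0"
    by (intro tendsto_intros assms tendsto_l2_norm[OF assms(4-6)])
  then have z: "(\<lambda>n. l2_norm M (\<lambda>x. f n x - g x) * l2_norm M (f' n) + l2_norm M g * l2_norm M (\<lambda>x. f' n x - g' x))
      \<longlonglongrightarrow> 0" by simp
  have b: "norm (l2_inner M (f n) (f' n) - l2_inner M g g') \<le>
      l2_norm M (\<lambda>x. f n x - g x) * l2_norm M (f' n) + l2_norm M g * l2_norm M (\<lambda>x. f' n x - g' x)" for n
  proof -
    have eq: "l2_inner M (f n) (f' n) - l2_inner M g g' =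
        l2_inner M (\<lambda>x. f n x - g x) (f' n) + l2_inner M g (\<lambda>x. f' n x - g' x)"
      using assms(1,2,4,5) by (simp add: l2_inner_diff_left l2_inner_diff_right)
    show ?thesis unfolding eq
      by (intro norm_triangle_mono l2_inner_cauchy_schwarz L2_diff assms(1,2,4,5))
  qed
  have "(\<lambda>n. l2_inner M (f n) (f' n) - l2_inner M g g') \<longlonglongrightarrow> 0"
    by (rule Lim_null_comparison[OF always_eventually z]) (rule allI, rule b)
  then show ?thesis by (rule LIM_zero_cancel)
qed

lemma tendsto_l2_inner_left:
  assumes "\<And>n::nat. f n \<in> L2 M" "g \<in> L2 M" "(\<lambda>n. l2_norm M (\<lambda>x. f n x - g x)) \<longlonglongrightarrow> 0" "h \<in> L2 M"
  shows "(\<lambda>n. l2_inner M (f n) h) \<longlonglongrightarrow> l2_inner M g h"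
  using tendsto_l2_inner[OF assms(1-3), of "\<lambda>_. h" h] assms(4) by simp

subsection \<open>Completeness\<close>

text \<open>The absolute increments sum to a function of norm at most \<open>2\<close>, because the
  geometric series does. So the telescoping series converges absolutely almost everywhere, and the
  square of that sum dominates all the differences \<open>f n - g\<close>, which upgrades pointwise
  convergence to convergence in norm.\<close>

lemma L2_complete_fast:
  assumes f: "\<And>n::nat. f n \<in> L2 M"
    and fast: "\<And>n. l2_norm M (\<lambda>x. f (Suc n) x - f n x) \<le> (1/2)^n"
  obtains g where "g \<in> L2 M" "(\<lambda>n. l2_norm M (\<lambda>x. f n x - g x)) \<longlonglongrightarrow> 0"
proof -
  note [measurable] = L2_measurable[OF f]
  define D where "D n x = f (Suc n) x - f n x" for n x
  have D: "D n \<in> L2 M" for n unfolding D_def by (intro L2_diff f)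
  note [measurable] = L2_measurable[OF D]
  define S where "S n x = (\<Sum>k<n. cmod (D k x))" for n x
  have S_L2: "(\<lambda>x. complex_of_real (S n x)) \<in> L2 M" for n
  proof -
    have "(\<lambda>x. complex_of_real (cmod (D k x))) \<in> L2 M" for k
      by (rule L2_bound[OF _ D[of k]]) auto
    then have "(\<lambda>x. \<Sum>k<n. complex_of_real (cmod (D k x))) \<in> L2 M" by (rule L2_sum)
    then show ?thesis by (simp add: S_def)
  qed
  \<comment> \<open>The bound is the sum of \<open>(1/2)^k\<close> over \<open>k < n\<close>, kept
    in closed form so that the induction closes.\<close>
  have S_norm: "l2_norm M (\<lambda>x. complex_of_real (S n x)) \<le> 2 - 2 * (1/2)^n" for n
  proof (induction n)
    case (Suc n)
    have "(\<lambda>x. complex_of_real (cmod (D n x))) \<in> L2 M"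
      by (rule L2_bound[OF _ D[of n]]) auto
    then have "l2_norm M (\<lambda>x. complex_of_real (S n x) + complex_of_real (cmod (D n x))) \<le>
        l2_norm M (\<lambda>x. complex_of_real (S n x)) + l2_norm M (\<lambda>x. complex_of_real (cmod (D n x)))"
      by (rule l2_norm_triangle[OF S_L2])
    moreover have "l2_norm M (\<lambda>x. complex_of_real (cmod (D n x))) \<le> (1/2)^n"
      using fast[of n] by (simp add: D_def l2_norm_def)
    ultimately show ?case using Suc by (simp add: S_def)
  qed (simp add: S_def)
  have incS: "incseq (\<lambda>n. ennreal ((S n x)\<^sup>2))" for x
    by (intro incseq_SucI ennreal_leI power_mono) (auto simp: S_def intro: sum_nonneg)
  have S_nn: "(\<integral>\<^sup>+ x. ennreal ((S n x)\<^sup>2) \<partial>M) \<le> 4" for n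
  proof -
    have "(\<integral>\<^sup>+ x. ennreal ((S n x)\<^sup>2) \<partial>M) = ennreal ((l2_norm M (\<lambda>x. complex_of_real (S n x)))\<^sup>2)"
      by (simp add: ennreal_l2_norm_square[OF S_L2])
    also have "\<dots> \<le> ennreal (2\<^sup>2)"
    proof (intro ennreal_leI power_mono)
      have "0 \<le> (1/2::real)^n" by simp
      with S_norm[of n] show "l2_norm M (\<lambda>x. complex_of_real (S n x)) \<le> 2" by linarith
    qed simp
    finally show ?thesis by simp
  qed
  define T where "T x = (SUP n. ennreal ((S n x)\<^sup>2))" for x
  have T_meas [measurable]: "T \<in> borel_measurable M"
    unfolding T_def S_def by measurable
  have T4: "(\<integral>\<^sup>+ x. T x \<partial>M) \<le> 4"
  proof -
    have "(\<integral>\<^sup>+ x. T x \<partial>M) = (SUP n. \<integral>\<^sup>+ x. ennreal ((S n x)\<^sup>2) \<partial>M)"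
      unfolding T_def
      by (rule nn_integral_monotone_convergence_SUP)
        (use incS in \<open>auto simp: S_def incseq_def le_fun_def\<close>)
    also have "\<dots> \<le> 4" by (intro SUP_least S_nn)
    finally show ?thesis .
  qed
  have T_fin: "AE x in M. T x \<noteq> \<infinity>"
    by (rule nn_integral_noteq_infinite) (use T4 in \<open>auto simp: top_unique\<close>)
  have conv: "summable (\<lambda>k. cmod (D k x))" if fin: "T x \<noteq> \<infinity>" for x
  proof -
    obtain c where c: "T x = ennreal c" "c \<ge> 0" using fin by (cases "T x") auto
    have "S n x \<le> sqrt c" for n
    proof -
      have "ennreal ((S n x)\<^sup>2) \<le> T x" unfolding T_def by (rule SUP_upper) simp
      then have "(S n x)\<^sup>2 \<le> c" using c by simp
      then show ?thesis by (rule real_le_rsqrt)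
    qed
    then have "(\<Sum>k\<le>n. cmod (D k x)) \<le> sqrt c" for n
      by (simp only: S_def lessThan_Suc_atMost[symmetric])
    then show ?thesis by (intro bounded_imp_summable[where B="sqrt c"]) auto
  qed
  \<comment> \<open>Where the sequence diverges, \<open>lim\<close> is an unspecified value; this
    happens on a null set only, and the limit is Borel measurable all the same.\<close>
  define g where "g x = lim (\<lambda>n. f n x)" for x
  have g_meas [measurable]: "g \<in> borel_measurable M"
    unfolding g_def by measurable
  have lim: "(\<lambda>n. f n x) \<longlonglongrightarrow> g x" if "T x \<noteq> \<infinity>" for x
  proof -
    have "summable (\<lambda>k. D k x)" by (rule summable_norm_cancel) (use conv[OF that] in simp)
    then have "(\<lambda>n. \<Sum>k<n. D k x) \<longlonglongrightarrow> (\<Sum>k. D k x)" by (rule summable_LIMSEQ)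
    moreover have "(\<Sum>k<n. D k x) = f n x - f 0 x" for n
      unfolding D_def by (induction n) auto
    ultimately have "(\<lambda>n. f n x - f 0 x + f 0 x) \<longlonglongrightarrow> (\<Sum>k. D k x) + f 0 x"
      by (intro tendsto_intros) simp
    then have "convergent (\<lambda>n. f n x)" by (auto simp: convergent_def)
    then show ?thesis by (simp add: convergent_LIMSEQ_iff g_def)
  qed
  have tail: "(cmod (f n x - g x))\<^sup>2 \<le> c" if "T x = ennreal c" "c \<ge> 0" for x c n
  proof -
    have "(\<lambda>m. (cmod (f n x - f m x))\<^sup>2) \<longlonglongrightarrow> (cmod (f n x - g x))\<^sup>2"
      by (intro tendsto_intros lim) (use that in auto)
    moreover have "(cmod (f n x - f m x))\<^sup>2 \<le> c" if "m \<ge> n" for m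
    proof -
      have "f n x - f m x = - (\<Sum>k\<in>{n..<m}. D k x)"
        unfolding D_def using sum_Suc_diff'[OF that, of "\<lambda>k. f k x"] by simp
      then have "cmod (f n x - f m x) \<le> (\<Sum>k\<in>{n..<m}. cmod (D k x))"
        by (simp add: norm_sum)
      also have "\<dots> \<le> S m x" unfolding S_def by (intro sum_mono2) auto
      finally have "(cmod (f n x - f m x))\<^sup>2 \<le> (S m x)\<^sup>2" by (simp add: power_mono)
      moreover have "ennreal ((S m x)\<^sup>2) \<le> T x" unfolding T_def by (rule SUP_upper) simp
      ultimately show ?thesis using \<open>T x = ennreal c\<close> \<open>c \<ge> 0\<close> by simp
    qed
    ultimately show ?thesis
      by (intro tendsto_upperbound[where f="\<lambda>m. (cmod (f n x - f m x))\<^sup>2" and F=sequentially])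
        (auto simp: eventually_sequentially)
  qed
  have lim_nn: "(\<lambda>n. \<integral>\<^sup>+ x. ennreal ((cmod (f n x - g x))\<^sup>2) \<partial>M) \<longlonglongrightarrow> (\<integral>\<^sup>+ x. 0 \<partial>M)"
  proof (rule nn_integral_dominated_convergence[where w=T])
    show "integral\<^sup>N M T < \<infinity>" using T4 by (auto simp: less_top[symmetric] top_unique)
    show "AE x in M. ennreal ((cmod (f j x - g x))\<^sup>2) \<le> T x" for j
      using T_fin
    proof eventually_elim
      case (elim x)
      then obtain c where "T x = ennreal c" "c \<ge> 0" by (cases "T x") auto
      with tail[OF this] show ?case by simp
    qed
    show "AE x in M. (\<lambda>n. ennreal ((cmod (f n x - g x))\<^sup>2)) \<longlonglongrightarrow> 0"
      using T_fin
    proof eventually_elim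
      case (elim x)
      have "(\<lambda>n. (cmod (f n x - g x))\<^sup>2) \<longlonglongrightarrow> (cmod (g x - g x))\<^sup>2"
        by (intro tendsto_intros lim elim)
      then have "(\<lambda>n. ennreal ((cmod (f n x - g x))\<^sup>2)) \<longlonglongrightarrow> ennreal 0"
        by (intro tendsto_ennrealI) simp
      then show ?case by simp
    qed
  qed auto
  have dL2: "(\<lambda>x. f 0 x - g x) \<in> L2 M"
  proof (rule L2I_nn_integral)
    have "(\<integral>\<^sup>+ x. ennreal ((cmod (f 0 x - g x))\<^sup>2) \<partial>M) \<le> (\<integral>\<^sup>+ x. T x \<partial>M)"
    proof (rule nn_integral_mono_AE)
      show "AE x in M. ennreal ((cmod (f 0 x - g x))\<^sup>2) \<le> T x"
        using T_fin
      proof eventually_elim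
        case (elim x)
        then obtain c where "T x = ennreal c" "c \<ge> 0" by (cases "T x") auto
        with tail[OF this] show ?case by simp
      qed
    qed
    also have "\<dots> < \<infinity>" using T4 by (auto simp: less_top[symmetric] top_unique)
    finally show "(\<integral>\<^sup>+ x. ennreal ((cmod (f 0 x - g x))\<^sup>2) \<partial>M) < \<infinity>" .
  qed measurable
  have g: "g \<in> L2 M" using L2_diff[OF f[of 0] dL2] by simp
  have "(\<lambda>n. ennreal ((l2_norm M (\<lambda>x. f n x - g x))\<^sup>2)) \<longlonglongrightarrow> ennreal 0"
    using lim_nn by (simp add: ennreal_l2_norm_square L2_diff f g)
  then have "(\<lambda>n. (l2_norm M (\<lambda>x. f n x - g x))\<^sup>2) \<longlonglongrightarrow> 0"
    by (subst (asm) tendsto_ennreal_iff) auto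
  then have "(\<lambda>n. sqrt ((l2_norm M (\<lambda>x. f n x - g x))\<^sup>2)) \<longlonglongrightarrow> sqrt 0"
    by (rule tendsto_real_sqrt)
  with g show ?thesis by (intro that) simp_all
qed

lemma L2_complete:
  assumes f: "\<And>n::nat. f n \<in> L2 M"
    and cauchy: "\<And>e. e > 0 \<Longrightarrow> \<exists>N. \<forall>m\<ge>N. \<forall>n\<ge>N. l2_norm M (\<lambda>x. f m x - f n x) < e"
  obtains g where "g \<in> L2 M" "(\<lambda>n. l2_norm M (\<lambda>x. f n x - g x)) \<longlonglongrightarrow> 0"
proof -
  have "\<forall>k. \<exists>N. \<forall>m\<ge>N. \<forall>n\<ge>N. l2_norm M (\<lambda>x. f m x - f n x) < (1/2)^k"
    using cauchy by simp
  then obtain N where N: "\<And>k m n. m \<ge> N k \<Longrightarrow> n \<ge> N k \<Longrightarrow> l2_norm M (\<lambda>x. f m x - f n x) < (1/2)^k"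
    by metis
  \<comment> \<open>Partial sums of \<open>N\<close> give indices that do not decrease and stay
    above \<open>N k\<close>, so consecutive terms of the subsequence are within
    \<open>(1/2)^k\<close>.\<close>
  define r where "r k = (\<Sum>j\<le>k. N j)" for k
  have rN: "N k \<le> r k" for k unfolding r_def by (rule member_le_sum) auto
  have r_mono: "r k \<le> r (Suc k)" for k unfolding r_def by simp
  have "l2_norm M (\<lambda>x. f (r (Suc k)) x - f (r k) x) \<le> (1/2)^k" for k
    using N[of k "r (Suc k)" "r k"] rN[of k] r_mono[of k] by simp
  then obtain g where g: "g \<in> L2 M" "(\<lambda>n. l2_norm M (\<lambda>x. f (r n) x - g x)) \<longlonglongrightarrow> 0"
    using L2_complete_fast[of "\<lambda>n. f (r n)" M] f by blast
  have "(\<lambda>n. l2_norm M (\<lambda>x. f n x - g x)) \<longlonglongrightarrow> 0"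
  proof (rule LIMSEQ_I)
    fix e :: real assume e: "e > 0"
    obtain K where K: "\<And>k. k \<ge> K \<Longrightarrow> l2_norm M (\<lambda>x. f (r k) x - g x) < e/2"
      using LIMSEQ_D[OF g(2), of "e/2"] e by auto
    obtain k0 where k0: "(1/2::real)^k0 < e/2"
      using real_arch_pow_inv[of "e/2" "1/2"] e by auto
    define k where "k = max K k0"
    have "(1/2::real)^k \<le> (1/2)^k0" by (rule power_decreasing) (auto simp: k_def)
    with k0 have k2: "(1/2::real)^k < e/2" by linarith
    have "l2_norm M (\<lambda>x. f n x - g x) < e" if "n \<ge> N k" for n
    proof -
      have "l2_norm M (\<lambda>x. f n x - g x) \<le>
          l2_norm M (\<lambda>x. f n x - f (r k) x) + l2_norm M (\<lambda>x. f (r k) x - g x)"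
        by (intro l2_norm_triangle_diff f g)
      moreover have "l2_norm M (\<lambda>x. f n x - f (r k) x) < (1/2)^k"
        using N[OF that rN] .
      ultimately show ?thesis using K[of k] k2 by (simp add: k_def)
    qed
    then show "\<exists>no. \<forall>n\<ge>no. norm (l2_norm M (\<lambda>x. f n x - g x) - 0) < e" by auto
  qed
  with g that show ?thesis by blast
qed

subsection \<open>Orthonormal expansions\<close>

text \<open>The index set is arbitrary so that one notion covers finite families, sequences, and
  sets of functions indexed by themselves (\<open>\<lambda>f. f\<close>), the form to which Zorn's
  lemma applies.\<close>

definition orthonormal_family :: "'a measure \<Rightarrow> 'i set \<Rightarrow> ('i \<Rightarrow> 'a \<Rightarrow> complex) \<Rightarrow> bool" where
  "orthonormal_family M A u \<longleftrightarrow> (\<forall>i\<in>A. u i \<in> L2 M) \<and>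
     (\<forall>i\<in>A. \<forall>j\<in>A. l2_inner M (u i) (u j) = (if i = j then 1 else 0))"

lemma orthonormal_family_subset: "orthonormal_family M A u \<Longrightarrow> A' \<subseteq> A \<Longrightarrow> orthonormal_family M A' u"
  unfolding orthonormal_family_def by blast

lemma l2_inner_orthonormal_sum:
  assumes "orthonormal_family M A u" "finite A"
  shows "l2_inner M (\<lambda>x. \<Sum>i\<in>A. c i * u i x) (\<lambda>x. \<Sum>i\<in>A. d i * u i x) = (\<Sum>i\<in>A. c i * cnj (d i))"
proof -
  have L: "\<And>i. i \<in> A \<Longrightarrow> u i \<in> L2 M" using assms by (simp add: orthonormal_family_def)
  have "l2_inner M (\<lambda>x. \<Sum>i\<in>A. c i * u i x) (\<lambda>x. \<Sum>i\<in>A. d i * u i x) =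
      (\<Sum>i\<in>A. \<Sum>j\<in>A. c i * (cnj (d j) * l2_inner M (u i) (u j)))"
    using L by (simp add: l2_inner_sum_left l2_inner_sum_right L2_scale L2_sum
        l2_inner_scale_left l2_inner_scale_right sum_distrib_left)
  also have "\<dots> = (\<Sum>i\<in>A. \<Sum>j\<in>A. if j = i then c i * cnj (d i) else 0)"
    using assms by (intro sum.cong refl) (auto simp: orthonormal_family_def)
  also have "\<dots> = (\<Sum>i\<in>A. c i * cnj (d i))" using assms(2) by simp
  finally show ?thesis .
qed

lemma l2_norm_orthonormal_sum:
  assumes "orthonormal_family M A u" "finite A"
  shows "(l2_norm M (\<lambda>x. \<Sum>i\<in>A. c i * u i x))\<^sup>2 = (\<Sum>i\<in>A. (cmod (c i))\<^sup>2)"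
proof -
  have "complex_of_real ((l2_norm M (\<lambda>x. \<Sum>i\<in>A. c i * u i x))\<^sup>2) = of_real (\<Sum>i\<in>A. (cmod (c i))\<^sup>2)"
    unfolding l2_inner_self[symmetric] l2_inner_orthonormal_sum[OF assms]
    by (simp only: of_real_sum complex_norm_square)
  then show ?thesis by (simp only: of_real_eq_iff)
qed

text \<open>The inner product of \<open>f\<close> with its projection equals the squared norm of the
  projection, so the three terms of the expanded square collapse to a difference.\<close>

lemma bessel_residual:
  assumes "orthonormal_family M A u" "finite A" "f \<in> L2 M"
  shows "(l2_norm M (\<lambda>x. f x - (\<Sum>i\<in>A. l2_inner M f (u i) * u i x)))\<^sup>2 =
    (l2_norm M f)\<^sup>2 - (\<Sum>i\<in>A. (cmod (l2_inner M f (u i)))\<^sup>2)"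
proof -
  have L: "\<And>i. i \<in> A \<Longrightarrow> u i \<in> L2 M" using assms by (simp add: orthonormal_family_def)
  have S: "(\<lambda>x. \<Sum>i\<in>A. l2_inner M f (u i) * u i x) \<in> L2 M"
    by (intro L2_sum L2_scale L)
  have "l2_inner M f (\<lambda>x. \<Sum>i\<in>A. l2_inner M f (u i) * u i x) =
      of_real (\<Sum>i\<in>A. (cmod (l2_inner M f (u i)))\<^sup>2)"
    using L assms(3) unfolding of_real_sum complex_norm_square
    by (simp add: l2_inner_sum_right L2_scale l2_inner_scale_right mult.commute[of "cnj _"])
  then show ?thesis
    by (simp only: l2_norm_diff_square[OF assms(3) S] l2_norm_orthonormal_sum[OF assms(1,2)]
        Re_complex_of_real)
qed

lemma bessel:
  assumes "orthonormal_family M A u" "finite A" "f \<in> L2 M"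
  shows "(\<Sum>i\<in>A. (cmod (l2_inner M f (u i)))\<^sup>2) \<le> (l2_norm M f)\<^sup>2"
  using bessel_residual[OF assms] zero_le_power2[of "l2_norm M (\<lambda>x. f x - (\<Sum>i\<in>A. l2_inner M f (u i) * u i x))"]
  by linarith

lemma orthonormal_basis_family: "orthonormal_basis M e \<Longrightarrow> orthonormal_family M A e"
  by (simp add: orthonormal_basis_def orthonormal_family_def)

lemma orthonormal_basis_L2: "orthonormal_basis M e \<Longrightarrow> e i \<in> L2 M"
  by (simp add: orthonormal_basis_def)

text \<open>By orthonormality the squared distance of two partial sums is a segment of the series of
  squares, so summability makes the partial sums Cauchy and completeness supplies
  \<open>g\<close>.\<close>

lemma riesz_fischer:
  fixes e :: "nat \<Rightarrow> 'a \<Rightarrow> complex"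
  assumes e: "orthonormal_family M UNIV e" and c: "summable (\<lambda>i. (cmod (c i))\<^sup>2)"
  obtains g where "g \<in> L2 M" "\<And>i. l2_inner M g (e i) = c i"
    "(\<lambda>n. l2_norm M (\<lambda>x. (\<Sum>i<n. c i * e i x) - g x)) \<longlonglongrightarrow> 0"
proof -
  have L: "e i \<in> L2 M" for i using e by (simp add: orthonormal_family_def)
  define S where "S n x = (\<Sum>i<n. c i * e i x)" for n x
  have S: "S n \<in> L2 M" for n unfolding S_def by (intro L2_sum L2_scale L)
  have diff: "(l2_norm M (\<lambda>x. S m x - S n x))\<^sup>2 = (\<Sum>i\<in>{n..<m}. (cmod (c i))\<^sup>2)" if "n \<le> m" for m n
  proof -
    have "S m x - S n x = (\<Sum>i\<in>{n..<m}. c i * e i x)" for x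
      unfolding S_def using that sum_diff_nat_ivl[of 0 n m "\<lambda>i. c i * e i x"]
      by (simp add: atLeast0LessThan)
    then show ?thesis
      using l2_norm_orthonormal_sum[OF orthonormal_family_subset[OF e], of "{n..<m}" c] by simp
  qed
  have cauchy: "\<exists>N. \<forall>m\<ge>N. \<forall>n\<ge>N. l2_norm M (\<lambda>x. S m x - S n x) < \<epsilon>" if pos: "\<epsilon> > 0" for \<epsilon>
  proof -
    have "0 < \<epsilon>\<^sup>2" using pos by simp
    then obtain N where N: "\<And>m n. m \<ge> N \<Longrightarrow> norm (\<Sum>i\<in>{m..<n}. (cmod (c i))\<^sup>2) < \<epsilon>\<^sup>2"
      using c unfolding summable_Cauchy by blast
    have "l2_norm M (\<lambda>x. S m x - S n x) < \<epsilon>" if "m \<ge> N" "n \<ge> N" "n \<le> m" for m n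
    proof (rule power2_less_imp_less)
      show "(l2_norm M (\<lambda>x. S m x - S n x))\<^sup>2 < \<epsilon>\<^sup>2"
        unfolding diff[OF that(3)] using N[OF that(2), of m] by (simp add: sum_nonneg)
    qed (use \<open>\<epsilon> > 0\<close> in simp)
    then have "l2_norm M (\<lambda>x. S m x - S n x) < \<epsilon>" if "m \<ge> N" "n \<ge> N" for m n
    proof (cases "n \<le> m")
      case False
      then show ?thesis
        using that \<open>\<And>m n. m \<ge> N \<Longrightarrow> n \<ge> N \<Longrightarrow> n \<le> m \<Longrightarrow> l2_norm M (\<lambda>x. S m x - S n x) < \<epsilon>\<close>[of n m]
        by (subst l2_norm_minus_commute) simp
    qed (use that \<open>\<And>m n. m \<ge> N \<Longrightarrow> n \<ge> N \<Longrightarrow> n \<le> m \<Longrightarrow> l2_norm M (\<lambda>x. S m x - S n x) < \<epsilon>\<close> in simp)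
    then show ?thesis by blast
  qed
  obtain g where g: "g \<in> L2 M" "(\<lambda>n. l2_norm M (\<lambda>x. S n x - g x)) \<longlonglongrightarrow> 0"
    using L2_complete[of S M, OF S cauchy] by blast
  have "l2_inner M g (e i) = c i" for i
  proof -
    have "(\<lambda>n. l2_inner M (S n) (e i)) \<longlonglongrightarrow> l2_inner M g (e i)"
      by (rule tendsto_l2_inner_left) (use S g L in auto)
    moreover have "eventually (\<lambda>n. l2_inner M (S n) (e i) = c i) sequentially"
      using eventually_gt_at_top[of i]
    proof eventually_elim
      case (elim n)
      have "l2_inner M (S n) (e i) = (\<Sum>j<n. c j * l2_inner M (e j) (e i))"
        unfolding S_def using L by (simp add: l2_inner_sum_left L2_scale l2_inner_scale_left)
      also have "\<dots> = (\<Sum>j<n. if j = i then c i else 0)"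
        using e by (intro sum.cong) (auto simp: orthonormal_family_def)
      also have "\<dots> = c i" using elim by simp
      finally show ?case .
    qed
    ultimately show ?thesis
      by (rule LIMSEQ_unique[OF _ tendsto_eventually])
  qed
  with g that show ?thesis unfolding S_def by blast
qed

lemma bessel_summable:
  fixes e :: "nat \<Rightarrow> 'a \<Rightarrow> complex"
  assumes "orthonormal_family M UNIV e" "f \<in> L2 M"
  shows "summable (\<lambda>i. (cmod (l2_inner M f (e i)))\<^sup>2)"
proof (rule bounded_imp_summable)
  show "(\<Sum>i\<le>n. (cmod (l2_inner M f (e i)))\<^sup>2) \<le> (l2_norm M f)\<^sup>2" for n
    by (intro bessel orthonormal_family_subset[OF assms(1)] assms(2)) auto
qed simp

text \<open>Riesz--Fischer gives a limit with the same coefficients as \<open>f\<close>; totality of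
  the basis identifies it with \<open>f\<close> almost everywhere.\<close>

lemma orthonormal_expansion:
  assumes e: "orthonormal_basis M e" and f: "f \<in> L2 M"
  shows "(\<lambda>n. l2_norm M (\<lambda>x. (\<Sum>i<n. l2_inner M f (e i) * e i x) - f x)) \<longlonglongrightarrow> 0"
proof -
  obtain g where g: "g \<in> L2 M" "\<And>i. l2_inner M g (e i) = l2_inner M f (e i)"
    "(\<lambda>n. l2_norm M (\<lambda>x. (\<Sum>i<n. l2_inner M f (e i) * e i x) - g x)) \<longlonglongrightarrow> 0"
    using riesz_fischer[OF orthonormal_basis_family[OF e] bessel_summable[OF orthonormal_basis_family[OF e] f]]
    by blast
  have "l2_inner M (\<lambda>x. f x - g x) (e i) = 0" for i
    using f g orthonormal_basis_L2[OF e] by (simp add: l2_inner_diff_left)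
  then have eq: "AE x in M. f x - g x = 0"
    using e L2_diff[OF f g(1)] unfolding orthonormal_basis_def by blast
  have [measurable]: "f \<in> borel_measurable M" "g \<in> borel_measurable M" "\<And>i. e i \<in> borel_measurable M"
    using f g(1) orthonormal_basis_L2[OF e] by (blast intro: L2_measurable)+
  have "l2_norm M (\<lambda>x. (\<Sum>i<n. l2_inner M f (e i) * e i x) - g x) =
      l2_norm M (\<lambda>x. (\<Sum>i<n. l2_inner M f (e i) * e i x) - f x)" for n
    by (rule l2_norm_cong_AE) (use eq in \<open>auto\<close>)
  with g(3) show ?thesis by simp
qed

lemma parseval_sums:
  assumes e: "orthonormal_basis M e" and f: "f \<in> L2 M"
  shows "(\<lambda>i. (cmod (l2_inner M f (e i)))\<^sup>2) sums (l2_norm M f)\<^sup>2"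
proof -
  have L: "e i \<in> L2 M" for i using e by (rule orthonormal_basis_L2)
  have "(\<lambda>n. l2_norm M (\<lambda>x. \<Sum>i<n. l2_inner M f (e i) * e i x)) \<longlonglongrightarrow> l2_norm M f"
    by (rule tendsto_l2_norm[OF _ f orthonormal_expansion[OF e f]]) (intro L2_sum L2_scale L)
  then have "(\<lambda>n. (l2_norm M (\<lambda>x. \<Sum>i<n. l2_inner M f (e i) * e i x))\<^sup>2) \<longlonglongrightarrow> (l2_norm M f)\<^sup>2"
    by (rule tendsto_power)
  then show ?thesis
    by (simp add: sums_def l2_norm_orthonormal_sum[OF orthonormal_basis_family[OF e]])
qed

lemma parseval_suminf:
  assumes "orthonormal_basis M e" "f \<in> L2 M"
  shows "(\<Sum>i. ennreal ((cmod (l2_inner M f (e i)))\<^sup>2)) = ennreal ((l2_norm M f)\<^sup>2)"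
  using parseval_sums[OF assms] by (intro suminf_ennreal_eq) auto

lemma parseval_inner:
  assumes e: "orthonormal_basis M e" and f: "f \<in> L2 M" and g: "g \<in> L2 M"
  shows "(\<lambda>i. l2_inner M f (e i) * cnj (l2_inner M g (e i))) sums l2_inner M f g"
proof -
  have L: "e i \<in> L2 M" for i using e by (rule orthonormal_basis_L2)
  have "(\<lambda>n. l2_inner M (\<lambda>x. \<Sum>i<n. l2_inner M f (e i) * e i x) (\<lambda>x. \<Sum>i<n. l2_inner M g (e i) * e i x))
      \<longlonglongrightarrow> l2_inner M f g"
    by (rule tendsto_l2_inner[OF _ f orthonormal_expansion[OF e f] _ g orthonormal_expansion[OF e g]])
      (intro L2_sum L2_scale L)+
  then show ?thesis
    by (simp add: sums_def l2_inner_orthonormal_sum[OF orthonormal_basis_family[OF e]])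
qed

section \<open>Totality of indicator functions and existence of orthonormal bases\<close>

lemma L2_indicator:
  assumes "A \<in> sets M" "emeasure M A < \<infinity>"
  shows "(\<lambda>x. complex_of_real (indicator A x)) \<in> L2 M"
proof (rule L2I_nn_integral)
  show "(\<lambda>x. complex_of_real (indicator A x)) \<in> borel_measurable M" using assms by measurable
  have "(\<integral>\<^sup>+ x. ennreal ((cmod (complex_of_real (indicator A x)))\<^sup>2) \<partial>M) = (\<integral>\<^sup>+ x. indicator A x \<partial>M)"
    by (intro nn_integral_cong) (auto simp: indicator_def)
  then show "(\<integral>\<^sup>+ x. ennreal ((cmod (complex_of_real (indicator A x)))\<^sup>2) \<partial>M) < \<infinity>"
    using assms by simp
qed

lemma AE_zero_if_set_integrals_zero:
  fixes f :: "'a \<Rightarrow> complex"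
  assumes f: "integrable M f" and z: "\<And>A. A \<in> sets M \<Longrightarrow> (LINT x|M. indicator A x *\<^sub>R f x) = 0"
  shows "AE x in M. f x = 0"
proof -
  have "AE x in M. Re (f x) = 0"
  proof (rule density_unique_real)
    fix A assume A: "A \<in> sets M"
    have "(LINT x:A|M. Re (f x)) = Re (LINT x|M. indicator A x *\<^sub>R f x)"
      unfolding set_lebesgue_integral_def
      by (subst integral_Re[symmetric]) (use f A in \<open>auto intro: integrable_mult_indicator\<close>)
    then show "(LINT x:A|M. Re (f x)) = (LINT x:A|M. 0)" using z[OF A] by simp
  qed (use f in auto)
  moreover have "AE x in M. Im (f x) = 0"
  proof (rule density_unique_real)
    fix A assume A: "A \<in> sets M"
    have "(LINT x:A|M. Im (f x)) = Im (LINT x|M. indicator A x *\<^sub>R f x)"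
      unfolding set_lebesgue_integral_def
      by (subst integral_Im[symmetric]) (use f A in \<open>auto intro: integrable_mult_indicator\<close>)
    then show "(LINT x:A|M. Im (f x)) = (LINT x:A|M. 0)" using z[OF A] by simp
  qed (use f in auto)
  ultimately show ?thesis by eventually_elim (simp add: complex_eq_iff)
qed

text \<open>Closing a countable basis under finite intersections keeps it countable and yields the
  intersection-stable generator of the Borel sets that Dynkin's theorem needs.\<close>

lemma countable_Int_closed_basis:
  obtains B :: "'a::second_countable_topology set set"
  where "countable B" "topological_basis B" "Int_stable B"
proof -
  obtain B0 :: "'a set set" where B0: "countable B0" "topological_basis B0"
    using ex_countable_basis by blast
  define B where "B = Inter ` {F. F \<subseteq> B0 \<and> finite F}"
  have "countable B"
    unfolding B_def using countable_Collect_finite_subset[OF B0(1)] by (simp add: conj_commute)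
  moreover have "topological_basis B"
    unfolding topological_basis_def
  proof (intro conjI allI impI ballI)
    fix b assume "b \<in> B"
    then show "open b" unfolding B_def using topological_basis_open[OF B0(2)] by auto
  next
    fix U :: "'a set" assume "open U"
    then obtain B' where "B' \<subseteq> B0" "\<Union>B' = U" using B0(2) unfolding topological_basis_def by blast
    moreover have "B0 \<subseteq> B"
    proof
      fix b assume "b \<in> B0"
      then have "{b} \<in> {F. F \<subseteq> B0 \<and> finite F}" by simp
      then have "\<Inter>{b} \<in> B" unfolding B_def by (rule imageI)
      then show "b \<in> B" by simp
    qed
    ultimately show "\<exists>B'\<subseteq>B. \<Union>B' = U" by blast
  qed
  moreover have "Int_stable B"
  proof (rule Int_stableI)
    fix a b assume "a \<in> B" "b \<in> B"
    then obtain F G where "F \<subseteq> B0" "finite F" "a = \<Inter>F" "G \<subseteq> B0" "finite G" "b = \<Inter>G"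
      unfolding B_def by blast
    then have "F \<union> G \<in> {F. F \<subseteq> B0 \<and> finite F}" "a \<inter> b = \<Inter>(F \<union> G)" by auto
    then show "a \<inter> b \<in> B" unfolding B_def by (simp add: image_eqI[of _ Inter "F \<union> G"])
  qed
  ultimately show ?thesis using that by blast
qed

text \<open>The Borel sets over which \<open>f\<close> integrates to zero are closed under disjoint
  countable unions and, by the hypothesis on the whole space, under complements; they contain an
  intersection-stable generator and hence are all Borel sets.\<close>

lemma AE_zero_if_basis_integrals_zero:
  fixes f :: "'a::euclidean_space \<Rightarrow> complex"
  assumes f: "integrable lborel f" and B: "countable B" "topological_basis B" "Int_stable B"
    and U: "(LINT x|lborel. f x) = 0"
    and z: "\<And>A. A \<in> B \<Longrightarrow> (LINT x|lborel. indicator A x *\<^sub>R f x) = 0"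
  shows "AE x in lborel. f x = 0"
proof (rule AE_zero_if_set_integrals_zero[OF f])
  have "sets (borel :: 'a measure) = sets (sigma UNIV B)"
    by (rule arg_cong[OF borel_eq_countable_basis[OF B(1,2)]])
  also have "\<dots> = sigma_sets UNIV B" by (rule sets_measure_of) simp
  finally have borel: "sets (borel :: 'a measure) = sigma_sets UNIV B" .
  have meas: "C \<in> sets lborel" if "C \<in> sigma_sets UNIV B" for C :: "'a set"
    using that borel by simp
  have i: "integrable lborel (\<lambda>x. indicator C x *\<^sub>R f x)" if "C \<in> sigma_sets UNIV B" for C
    by (rule integrable_mult_indicator[OF meas[OF that] f])
  fix A :: "'a set" assume "A \<in> sets lborel"
  then have A: "A \<in> sigma_sets UNIV B" using borel by simp
  have "B \<subseteq> Pow UNIV" by simp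
  from B(3) this A show "(LINT x|lborel. indicator A x *\<^sub>R f x) = 0"
  proof (induction rule: sigma_sets_induct_disjoint)
    case (compl A)
    have "(LINT x|lborel. indicator (UNIV - A) x *\<^sub>R f x) = (LINT x|lborel. f x - indicator A x *\<^sub>R f x)"
      by (intro Bochner_Integration.integral_cong) (auto simp: indicator_def)
    also have "\<dots> = 0" using f i[OF compl(1)] compl(2) U by simp
    finally show ?case .
  next
    case (union A)
    have "(LINT x:(\<Union>i. A i)|lborel. f x) = (\<Sum>i. LINT x:A i|lborel. f x)"
    proof (rule lebesgue_integral_countable_add)
      show "A i \<in> sets lborel" for i using union(2) meas by blast
      show "A i \<inter> A j = {}" if "i \<noteq> j" for i j using union(1) that by (auto simp: disjoint_family_on_def)
      show "set_integrable lborel (\<Union>i. A i) f"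
        unfolding set_integrable_def using f union(2) meas
        by (intro integrable_mult_indicator) auto
    qed
    then show ?case using union(3) by (simp add: set_lebesgue_integral_def)
  qed (use z in auto)
qed

lemma orthonormal_pairwise:
  "orthonormal_family M S (\<lambda>f. f) \<Longrightarrow> a \<in> S \<Longrightarrow> b \<in> S \<Longrightarrow> l2_inner M a b = (if a = b then 1 else 0)"
  by (simp add: orthonormal_family_def)

text \<open>By Bessel's inequality only finitely many members of \<open>S\<close> have a squared
  coefficient above \<open>1 / (n + 1)\<close> against a given \<open>t k\<close>. Totality gives
  every member a nonzero coefficient against some \<open>t k\<close>, so \<open>S\<close> is a
  countable union of finite sets.\<close>

lemma countable_orthonormal:
  fixes t :: "nat \<Rightarrow> 'a \<Rightarrow> complex"
  assumes t: "\<And>k. t k \<in> L2 M"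
    and total: "\<And>f. f \<in> L2 M \<Longrightarrow> (\<And>k. l2_inner M (t k) f = 0) \<Longrightarrow> AE x in M. f x = 0"
    and S: "orthonormal_family M S (\<lambda>f. f)"
  shows "countable S"
proof -
  have L: "f \<in> L2 M" if "f \<in> S" for f using S that by (simp add: orthonormal_family_def)
  define T where "T k n = {f \<in> S. (cmod (l2_inner M (t k) f))\<^sup>2 > 1 / real (Suc n)}" for k n
  have "finite (T k n)" for k n
  proof (rule ccontr)
    assume inf: "infinite (T k n)"
    obtain N :: nat where N: "real (Suc n) * (l2_norm M (t k))\<^sup>2 < real N"
      using reals_Archimedean2 by blast
    obtain A where A: "finite A" "card A = N" "A \<subseteq> T k n"
      using infinite_arbitrarily_large[OF inf, of N] by blast
    have "real N * (1 / real (Suc n)) = (\<Sum>f\<in>A. 1 / real (Suc n))" using A by simp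
    also have "\<dots> \<le> (\<Sum>f\<in>A. (cmod (l2_inner M (t k) f))\<^sup>2)"
      using A by (intro sum_mono) (auto simp: T_def)
    also have "\<dots> \<le> (l2_norm M (t k))\<^sup>2"
      using A by (intro bessel orthonormal_family_subset[OF S] t) (auto simp: T_def)
    finally have "real (Suc n) * (real N * (1 / real (Suc n))) \<le> real (Suc n) * (l2_norm M (t k))\<^sup>2"
      by (intro mult_left_mono) simp_all
    moreover have "real (Suc n) * (real N * (1 / real (Suc n))) = real N" by simp
    ultimately show False using N by linarith
  qed
  then have "countable (\<Union>k n. T k n)"
    by (intro countable_UN countableI_type countable_finite)
  moreover have "S \<subseteq> (\<Union>k n. T k n)"
  proof
    fix f assume f: "f \<in> S"
    have "\<exists>k. l2_inner M (t k) f \<noteq> 0"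
    proof (rule ccontr)
      assume "\<not> ?thesis"
      then have "AE x in M. f x = 0" by (intro total L f) simp
      then have "l2_norm M f = 0" using L[OF f] by (simp add: l2_norm_eq_zero_iff)
      then show False using orthonormal_pairwise[OF S f f] by (simp add: l2_inner_self)
    qed
    then obtain k where "0 < (cmod (l2_inner M (t k) f))\<^sup>2" by auto
    then obtain n where "1 / real (Suc n) < (cmod (l2_inner M (t k) f))\<^sup>2"
      using nat_approx_posE by blast
    with f have "f \<in> T k n" unfolding T_def by blast
    then show "f \<in> (\<Union>k n. T k n)" by blast
  qed
  ultimately show ?thesis by (rule countable_subset[rotated])
qed

lemma maximal_orthonormal:
  assumes "orthonormal_family M S0 (\<lambda>f. f)"
  obtains S where "S0 \<subseteq> S" "orthonormal_family M S (\<lambda>f. f)"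
    "\<And>S'. S \<subseteq> S' \<Longrightarrow> orthonormal_family M S' (\<lambda>f. f) \<Longrightarrow> S' = S"
proof -
  let ?A = "{S. S0 \<subseteq> S \<and> orthonormal_family M S (\<lambda>f. f)}"
  have "\<exists>S\<in>?A. \<forall>X\<in>?A. S \<subseteq> X \<longrightarrow> X = S"
  proof (rule subset_Zorn_nonempty)
    show "?A \<noteq> {}" using assms by blast
  next
    fix \<C> assume ne: "\<C> \<noteq> {}" and ch: "subset.chain ?A \<C>"
    have sub: "\<C> \<subseteq> ?A" and cmp: "\<And>X Y. X \<in> \<C> \<Longrightarrow> Y \<in> \<C> \<Longrightarrow> X \<subseteq> Y \<or> Y \<subseteq> X"
      using ch by (simp_all add: subset_chain_def)
    have C: "S0 \<subseteq> X" "orthonormal_family M X (\<lambda>f. f)" if "X \<in> \<C>" for X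
      using subsetD[OF sub that] by simp_all
    have "orthonormal_family M (\<Union>\<C>) (\<lambda>f. f)"
      unfolding orthonormal_family_def
    proof (intro conjI ballI)
      fix f assume "f \<in> \<Union>\<C>"
      then show "f \<in> L2 M" using C by (auto simp: orthonormal_family_def)
    next
      fix f g assume "f \<in> \<Union>\<C>" "g \<in> \<Union>\<C>"
      then obtain X Y where XY: "X \<in> \<C>" "f \<in> X" "Y \<in> \<C>" "g \<in> Y" by blast
      then obtain Z where "Z \<in> \<C>" "f \<in> Z" "g \<in> Z" using cmp[OF XY(1,3)] by blast
      then show "l2_inner M f g = (if f = g then 1 else 0)" by (intro orthonormal_pairwise[OF C(2)])
    qed
    moreover obtain X where "X \<in> \<C>" using ne by blast
    then have "S0 \<subseteq> \<Union>\<C>" using C(1) by blast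
    ultimately show "\<Union>\<C> \<in> ?A" by simp
  qed
  then obtain S where S: "S \<in> ?A" and max: "\<forall>X\<in>?A. S \<subseteq> X \<longrightarrow> X = S" by (rule bexE)
  show ?thesis
  proof (rule that)
    show S0: "S0 \<subseteq> S" "orthonormal_family M S (\<lambda>f. f)" using S by simp_all
    fix S' assume S': "S \<subseteq> S'" "orthonormal_family M S' (\<lambda>f. f)"
    then have "S' \<in> ?A" using S0 by simp
    with max S'(1) show "S' = S" by simp
  qed
qed

text \<open>A maximal orthonormal set containing \<open>S0\<close> is infinite because
  \<open>S0\<close> is and countable because of the total sequence, so it can be enumerated by the
  natural numbers, as \<open>orthonormal_basis\<close> demands. A nonzero vector orthogonal to it
  could be normalised and added.\<close>

lemma exists_orthonormal_basis:
  fixes t :: "nat \<Rightarrow> 'a \<Rightarrow> complex"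
  assumes t: "\<And>k. t k \<in> L2 M"
    and total: "\<And>f. f \<in> L2 M \<Longrightarrow> (\<And>k. l2_inner M (t k) f = 0) \<Longrightarrow> AE x in M. f x = 0"
    and S0: "orthonormal_family M S0 (\<lambda>f. f)" "infinite S0"
  shows "\<exists>e. orthonormal_basis M e"
proof -
  obtain S where S: "S0 \<subseteq> S" "orthonormal_family M S (\<lambda>f. f)"
    "\<And>S'. S \<subseteq> S' \<Longrightarrow> orthonormal_family M S' (\<lambda>f. f) \<Longrightarrow> S' = S"
    using maximal_orthonormal[OF S0(1)] by blast
  have "infinite S" using S(1) S0(2) finite_subset by blast
  moreover have "countable S" by (rule countable_orthonormal[OF t total S(2)])
  ultimately have bij: "bij_betw (from_nat_into S) UNIV S" by (intro bij_betw_from_nat_into)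
  define e where "e = from_nat_into S"
  have eS: "e i \<in> S" for i using bij unfolding e_def bij_betw_def by blast
  have einj: "e i = e j \<longleftrightarrow> i = j" for i j using bij unfolding e_def bij_betw_def inj_on_def by blast
  have L: "f \<in> L2 M" if "f \<in> S" for f using S(2) that by (simp add: orthonormal_family_def)
  have "orthonormal_basis M e"
    unfolding orthonormal_basis_def
  proof (intro conjI allI ballI impI)
    show "e i \<in> L2 M" for i by (rule L[OF eS])
    show "l2_inner M (e i) (e j) = (if i = j then 1 else 0)" for i j
      using orthonormal_pairwise[OF S(2) eS eS] by (simp add: einj)
  next
    fix f assume f: "f \<in> L2 M" and z: "\<forall>i. l2_inner M f (e i) = 0"
    have z': "l2_inner M f g = 0" if "g \<in> S" for g
    proof -
      have "g \<in> range e" using bij that unfolding e_def bij_betw_def by simp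
      with z show ?thesis by auto
    qed
    show "AE x in M. f x = 0"
    proof (rule ccontr)
      assume "\<not> ?thesis"
      then have n: "l2_norm M f \<noteq> 0" using f by (simp add: l2_norm_eq_zero_iff)
      define g where "g = (\<lambda>x. complex_of_real (1 / l2_norm M f) * f x)"
      have g: "g \<in> L2 M" unfolding g_def by (intro L2_scale f)
      have gg: "l2_inner M g g = 1"
        unfolding g_def l2_inner_scale_left l2_inner_scale_right l2_inner_self
        using n by (simp add: power2_eq_square)
      have gS: "l2_inner M g h = 0" if "h \<in> S" for h
        unfolding g_def l2_inner_scale_left z'[OF that] by simp
      have Sg: "l2_inner M h g = 0" if "h \<in> S" for h
        using gS[OF that] l2_inner_commute[of M h g] by simp
      have "g \<notin> S" using gS gg by force
      then have "orthonormal_family M (insert g S) (\<lambda>f. f)"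
        unfolding orthonormal_family_def
        using g L gg gS Sg orthonormal_pairwise[OF S(2)] by auto
      then have "g \<in> S" using S(3)[of "insert g S"] by blast
      from gS[OF this] gg show False by simp
    qed
  qed
  then show ?thesis by blast
qed

text \<open>The test functions are indicators of sets of a countable generator intersected with
  balls. The balls make the measures finite; a function orthogonal to all of them vanishes almost
  everywhere on each ball.\<close>

lemma total_lborel:
  obtains t :: "nat \<Rightarrow> 'a::euclidean_space \<Rightarrow> complex"
  where "\<And>k. t k \<in> L2 lborel"
    "\<And>f. f \<in> L2 lborel \<Longrightarrow> (\<And>k. l2_inner lborel (t k) f = 0) \<Longrightarrow> AE x in lborel. f x = 0"
proof -
  obtain B :: "'a set set" where B: "countable B" "topological_basis B" "Int_stable B"
    using countable_Int_closed_basis by blast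
  have B_meas: "A \<in> sets lborel" if "A \<in> B" for A using topological_basis_open[OF B(2) that] by simp
  define R where "R n = (ball 0 (real n) :: 'a set)" for n
  have R: "R n \<in> sets lborel" "emeasure lborel (R n) < \<infinity>" for n
    unfolding R_def using emeasure_lborel_ball_finite by auto
  \<comment> \<open>\<open>UNIV\<close> is inserted so that the balls themselves are tested: this is
    the hypothesis on the whole space in \<open>AE_zero_if_basis_integrals_zero\<close>.\<close>
  define Q where "Q = (\<Union>A\<in>insert UNIV B. range (\<lambda>n. A \<inter> R n))"
  have "countable Q" unfolding Q_def using B(1) by auto
  have "Q \<noteq> {}" unfolding Q_def by auto
  have Q: "A \<in> sets lborel" "emeasure lborel A < \<infinity>" if "A \<in> Q" for A
  proof -
    from that obtain n C where A: "A = C \<inter> R n" "C \<in> insert UNIV B" unfolding Q_def by blast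
    show m: "A \<in> sets lborel" using A B_meas R(1)[of n] by auto
    have "emeasure lborel A \<le> emeasure lborel (R n)" using A R by (intro emeasure_mono) auto
    from this R(2)[of n] show "emeasure lborel A < \<infinity>" by (rule le_less_trans)
  qed
  define t where "t k x = complex_of_real (indicator (from_nat_into Q k) x)" for k x
  show ?thesis
  proof (rule that)
    show "t k \<in> L2 lborel" for k
      unfolding t_def using from_nat_into[OF \<open>Q \<noteq> {}\<close>, of k] by (intro L2_indicator Q)
  next
    fix f :: "'a \<Rightarrow> complex" assume f: "f \<in> L2 lborel" and z: "\<And>k. l2_inner lborel (t k) f = 0"
    have zQ: "(LINT x|lborel. indicator A x *\<^sub>R f x) = 0" if AQ: "A \<in> Q" for A
    proof -
      obtain k where k: "from_nat_into Q k = A" using from_nat_into_surj[OF \<open>countable Q\<close> AQ] by blast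
      have "cnj (l2_inner lborel (t k) f) = 0" using z by simp
      then show ?thesis
        unfolding l2_inner_commute[symmetric] by (simp add: l2_inner_def t_def k scaleR_conv_of_real mult.commute)
    qed
    have "AE x in lborel. indicator (R n) x *\<^sub>R f x = 0" for n
    proof (rule AE_zero_if_basis_integrals_zero[OF _ B])
      show "integrable lborel (\<lambda>x. indicator (R n) x *\<^sub>R f x)"
        using integrable_mult_L2[OF L2_indicator[OF R] f] by (simp add: scaleR_conv_of_real)
      show "(LINT x|lborel. indicator (R n) x *\<^sub>R f x) = 0"
        using zQ[of "UNIV \<inter> R n"] by (auto simp: Q_def)
      show "(LINT x|lborel. indicator A x *\<^sub>R (indicator (R n) x *\<^sub>R f x)) = 0" if "A \<in> B" for A
        using zQ[of "A \<inter> R n"] that by (auto simp: Q_def indicator_inter_arith)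
    qed
    then have "AE x in lborel. \<forall>n. indicator (R n) x *\<^sub>R f x = 0" by (rule AE_all_countable[THEN iffD2, OF allI])
    then show "AE x in lborel. f x = 0"
    proof eventually_elim
      case (elim x)
      obtain n where "norm x < real n" using reals_Archimedean2 by blast
      then have "x \<in> R n" by (simp add: R_def)
      with elim[rule_format, of n] show ?case by simp
    qed
  qed
qed

text \<open>Indicators of the open unit cubes along the diagonal are disjointly supported and have
  norm 1.\<close>

lemma infinite_orthonormal_lborel:
  obtains S :: "('a::euclidean_space \<Rightarrow> complex) set"
  where "orthonormal_family lborel S (\<lambda>f. f)" "infinite S"
proof -
  define A :: "nat \<Rightarrow> 'a set" where "A n = box (real n *\<^sub>R One) (real (Suc n) *\<^sub>R One)" for n
  have A: "A n \<in> sets lborel" "emeasure lborel (A n) = 1" for n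
  proof -
    have "emeasure lborel (A n) = (\<Prod>b\<in>Basis. (real (Suc n) *\<^sub>R One - real n *\<^sub>R One :: 'a) \<bullet> b)"
      unfolding A_def by (rule emeasure_lborel_box) simp
    also have "\<dots> = 1" by (simp flip: scaleR_diff_left)
    finally show "emeasure lborel (A n) = 1" .
  qed (simp add: A_def)
  have disj: "A m \<inter> A n = {}" if "m \<noteq> n" for m n
  proof (rule ccontr)
    assume "A m \<inter> A n \<noteq> {}"
    then obtain x where x: "x \<in> A m" "x \<in> A n" by blast
    obtain i :: 'a where i: "i \<in> Basis" using nonempty_Basis by blast
    have "real m < x \<bullet> i" "x \<bullet> i < real (Suc m)" "real n < x \<bullet> i" "x \<bullet> i < real (Suc n)"
      using x i by (auto simp: A_def mem_box)
    then show False using that by linarith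
  qed
  define u where "u n x = complex_of_real (indicator (A n) x)" for n x
  have uL: "u n \<in> L2 lborel" for n
    unfolding u_def by (rule L2_indicator) (use A in auto)
  have inner: "l2_inner lborel (u m) (u n) = (if m = n then 1 else 0)" for m n
  proof -
    have "l2_inner lborel (u m) (u n) = (LINT x|lborel. complex_of_real (indicator (A m \<inter> A n) x))"
      unfolding l2_inner_def u_def by (intro Bochner_Integration.integral_cong) (auto simp: indicator_def)
    also have "\<dots> = of_real (measure lborel (A m \<inter> A n))" using A(1)[of m] A(1)[of n] by simp
    also have "\<dots> = (if m = n then 1 else 0)" using disj[of m n] A(2)[of n] by (auto simp: measure_def)
    finally show ?thesis .
  qed
  have inj: "inj u"
  proof (rule injI)
    fix m n assume "u m = u n"
    with inner[of m n] inner[of n n] show "m = n" by (auto split: if_splits)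
  qed
  show ?thesis
  proof (rule that)
    show "infinite (range u)" using inj by (simp add: finite_image_iff)
    show "orthonormal_family lborel (range u) (\<lambda>f. f)"
      unfolding orthonormal_family_def using uL inner inj by (auto dest: injD)
  qed
qed

theorem exists_orthonormal_basis_lborel: "\<exists>e. orthonormal_basis (lborel :: 'a::euclidean_space measure) e"
proof -
  obtain t :: "nat \<Rightarrow> 'a \<Rightarrow> complex" where t: "\<And>k. t k \<in> L2 lborel"
    "\<And>f. f \<in> L2 lborel \<Longrightarrow> (\<And>k. l2_inner lborel (t k) f = 0) \<Longrightarrow> AE x in lborel. f x = 0"
    using total_lborel by blast
  obtain S :: "('a \<Rightarrow> complex) set" where S: "orthonormal_family lborel S (\<lambda>f. f)" "infinite S"
    using infinite_orthonormal_lborel by blast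
  show ?thesis by (rule exists_orthonormal_basis[OF t S])
qed

section \<open>Lebesgue integrals under translation and scaling\<close>

lemma borel_measurable_cis [measurable]: "cis \<in> borel_measurable borel"
  by (intro borel_measurable_continuous_onI) (simp add: cis_conv_exp continuous_on_exp continuous_intros)

lemma integrable_pair_mult:
  fixes f :: "'a \<Rightarrow> 'c::{real_normed_field,banach,second_countable_topology}" and g :: "'b \<Rightarrow> 'c"
  assumes "sigma_finite_measure M" "sigma_finite_measure N" "integrable M f" "integrable N g"
  shows "integrable (M \<Otimes>\<^sub>M N) (\<lambda>p. f (fst p) * g (snd p))"
proof -
  interpret pair_sigma_finite M N using assms(1,2) by (simp add: pair_sigma_finite_def)
  note [measurable] = borel_measurable_integrable[OF assms(3)] borel_measurable_integrable[OF assms(4)]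
  show ?thesis
  proof (rule Fubini_integrable)
    show "(\<lambda>p. f (fst p) * g (snd p)) \<in> borel_measurable (M \<Otimes>\<^sub>M N)" by measurable
    show "integrable M (\<lambda>x. LINT y|N. norm (f (fst (x, y)) * g (snd (x, y))))"
      using assms(3,4) by (simp add: norm_mult)
    show "AE x in M. integrable N (\<lambda>y. f (fst (x, y)) * g (snd (x, y)))"
      using assms(4) by simp
  qed
qed

text \<open>Translation preserves measurability in both directions, so a nonmeasurable
  \<open>f\<close> is covered too: both sides are then nonintegrable and both integrals take the
  default value 0.\<close>

lemma lborel_translate:
  fixes f :: "'a::euclidean_space \<Rightarrow> 'b::{banach, second_countable_topology}"
  shows integral_lborel_translate: "(LINT x|lborel. f (c + x)) = (LINT x|lborel. f x)"
    and integrable_lborel_translate_iff: "integrable lborel (\<lambda>x. f (c + x)) \<longleftrightarrow> integrable lborel f"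
proof -
  have m: "(\<lambda>x. f (c + x)) \<in> borel_measurable borel \<longleftrightarrow> f \<in> borel_measurable borel"
  proof
    assume "(\<lambda>x. f (c + x)) \<in> borel_measurable borel"
    from measurable_compose[OF _ this, of "(+) (- c)" borel]
    show "f \<in> borel_measurable borel" by simp
  next
    assume "f \<in> borel_measurable borel"
    from measurable_compose[OF _ this, of "(+) c" borel]
    show "(\<lambda>x. f (c + x)) \<in> borel_measurable borel" by simp
  qed
  show "integrable lborel (\<lambda>x. f (c + x)) \<longleftrightarrow> integrable lborel f"
  proof (cases "f \<in> borel_measurable borel")
    case True
    then show ?thesis
      by (subst (2) lborel_distr_plus[of c, symmetric]) (simp add: integrable_distr_eq)
  next
    case False
    then show ?thesis using m by (auto dest!: borel_measurable_integrable)
  qed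
  show "(LINT x|lborel. f (c + x)) = (LINT x|lborel. f x)"
  proof (cases "f \<in> borel_measurable borel")
    case True
    then show ?thesis
      by (subst (2) lborel_distr_plus[of c, symmetric]) (simp add: integral_distr)
  next
    case False
    then have "\<not> integrable lborel (\<lambda>x. f (c + x))" "\<not> integrable lborel f"
      using m by (auto dest!: borel_measurable_integrable)
    then show ?thesis by (simp add: not_integrable_integral_eq)
  qed
qed

lemma nn_integral_lborel_translate:
  fixes f :: "'a::euclidean_space \<Rightarrow> ennreal"
  assumes [measurable]: "f \<in> borel_measurable borel"
  shows "(\<integral>\<^sup>+x. f (c + x) \<partial>lborel) = (\<integral>\<^sup>+x. f x \<partial>lborel)"
  by (subst (2) lborel_distr_plus[of c, symmetric]) (simp add: nn_integral_distr)

lemma integral_lborel_scale: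
  fixes f :: "'a::euclidean_space \<Rightarrow> 'b::{banach, second_countable_topology}"
  assumes "c \<noteq> 0" and [measurable]: "f \<in> borel_measurable borel"
  shows "(LINT x|lborel. f x) = \<bar>c\<bar> ^ DIM('a) *\<^sub>R (LINT x|lborel. f (c *\<^sub>R x))"
  by (subst lborel_affine[OF assms(1), of 0])
    (simp add: integral_density integral_distr)

lemma integrable_lborel_scale:
  fixes f :: "'a::euclidean_space \<Rightarrow> 'b::{banach, second_countable_topology}"
  assumes c: "c \<noteq> 0" and f: "integrable lborel f"
  shows "integrable lborel (\<lambda>x. f (c *\<^sub>R x))"
proof -
  have [measurable]: "f \<in> borel_measurable borel" using f by auto
  have "integrable (density (distr lborel borel (\<lambda>x. 0 + c *\<^sub>R x)) (\<lambda>_. ennreal (\<bar>c\<bar> ^ DIM('a)))) f"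
    using f lborel_affine[OF c, of "0::'a"] by (simp add: ennreal_power)
  then have "integrable lborel (\<lambda>x. \<bar>c\<bar> ^ DIM('a) *\<^sub>R f (c *\<^sub>R x))"
    by (subst (asm) integrable_density) (auto simp: integrable_distr_eq)
  then have "integrable lborel (\<lambda>x. (1 / \<bar>c\<bar> ^ DIM('a)) *\<^sub>R (\<bar>c\<bar> ^ DIM('a) *\<^sub>R f (c *\<^sub>R x)))"
    by (rule integrable_scaleR_right)
  then show ?thesis using c by simp
qed

subsection \<open>Continuity of translation in the mean\<close>

text \<open>Three thirds of \<open>e\<close>: by translation invariance the translate of
  \<open>f\<close> is as close to the translate of \<open>h\<close> as \<open>f\<close> is to
  \<open>h\<close>, and the middle term is the property of \<open>h\<close>.\<close>

lemma translation_L1_approx: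
  fixes f :: "'a::euclidean_space \<Rightarrow> complex"
  assumes f: "integrable lborel f" and v: "v \<longlonglongrightarrow> 0"
    and approx: "\<And>e. e > 0 \<Longrightarrow> \<exists>h. integrable lborel h \<and> (LINT x|lborel. cmod (f x - h x)) < e \<and>
      (\<lambda>k::nat. LINT x|lborel. cmod (h (v k + x) - h x)) \<longlonglongrightarrow> 0"
  shows "(\<lambda>k. LINT x|lborel. cmod (f (v k + x) - f x)) \<longlonglongrightarrow> 0"
proof (rule LIMSEQ_I)
  fix e :: real assume e: "e > 0"
  obtain h where h: "integrable lborel h" "(LINT x|lborel. cmod (f x - h x)) < e/3"
    "(\<lambda>k. LINT x|lborel. cmod (h (v k + x) - h x)) \<longlonglongrightarrow> 0"
    using approx[of "e/3"] e by auto
  obtain N where N: "\<And>k. k \<ge> N \<Longrightarrow> norm ((LINT x|lborel. cmod (h (v k + x) - h x)) - 0) < e/3"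
    using LIMSEQ_D[OF h(3), of "e/3"] e by auto
  have "(LINT x|lborel. cmod (f (v k + x) - f x)) < e" if "k \<ge> N" for k
  proof -
    have i: "integrable lborel (\<lambda>x. f (v k + x))" "integrable lborel (\<lambda>x. h (v k + x))"
      using f h by (simp_all add: integrable_lborel_translate_iff)
    have "(LINT x|lborel. cmod (f (v k + x) - f x)) \<le>
        (LINT x|lborel. cmod (f (v k + x) - h (v k + x)) + cmod (h (v k + x) - h x) + cmod (f x - h x))"
    proof (rule integral_mono)
      fix x
      show "cmod (f (v k + x) - f x) \<le>
          cmod (f (v k + x) - h (v k + x)) + cmod (h (v k + x) - h x) + cmod (f x - h x)"
        using norm_triangle_ineq4[of "(f (v k + x) - h (v k + x)) + (h (v k + x) - h x)" "f x - h x"]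
          norm_triangle_ineq[of "f (v k + x) - h (v k + x)" "h (v k + x) - h x"] by simp
    qed (use f h i in auto)
    also have "\<dots> = (LINT x|lborel. cmod (f (v k + x) - h (v k + x))) +
        (LINT x|lborel. cmod (h (v k + x) - h x)) + (LINT x|lborel. cmod (f x - h x))"
      using f h i by simp
    also have "(LINT x|lborel. cmod (f (v k + x) - h (v k + x))) = (LINT x|lborel. cmod (f x - h x))"
      by (rule integral_lborel_translate[of "\<lambda>x. cmod (f x - h x)"])
    finally show ?thesis using h(2) N[OF that] by simp
  qed
  moreover have "0 \<le> (LINT x|lborel. cmod (f (v k + x) - f x))" for k by simp
  ultimately show "\<exists>N. \<forall>k\<ge>N. norm ((LINT x|lborel. cmod (f (v k + x) - f x)) - 0) < e"
    by (intro exI[of _ N]) (simp add: abs_of_nonneg)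
qed

text \<open>The difference of the two indicators has absolute value equal to their sum minus twice
  their product. Openness makes the product tend pointwise to the indicator of \<open>U\<close>,
  which also dominates it.\<close>

lemma translation_L1_open:
  fixes U :: "'a::euclidean_space set"
  assumes U: "open U" "emeasure lborel U < \<infinity>" and v: "v \<longlonglongrightarrow> 0"
  shows "(\<lambda>k::nat. LINT x|lborel. cmod (complex_of_real (indicator U (v k + x)) * c - complex_of_real (indicator U x) * c)) \<longlonglongrightarrow> 0"
proof -
  have [measurable]: "U \<in> sets borel" using U by simp
  let ?I = "\<lambda>x. indicator U x :: real"
  have iU: "integrable lborel ?I" using U by simp
  have iT: "integrable lborel (\<lambda>x. ?I (v k + x))" for k
    using iU by (simp add: integrable_lborel_translate_iff)
  have iP: "integrable lborel (\<lambda>x. ?I (v k + x) * ?I x)" for k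
    by (rule Bochner_Integration.integrable_bound[OF iU]) (auto simp: indicator_def)
  have lim: "(\<lambda>k. LINT x|lborel. ?I (v k + x) * ?I x) \<longlonglongrightarrow> (LINT x|lborel. ?I x)"
  proof (rule integral_dominated_convergence[where w="?I"])
    show "AE x in lborel. (\<lambda>k. ?I (v k + x) * ?I x) \<longlonglongrightarrow> ?I x"
    proof (rule AE_I2)
      fix x
      show "(\<lambda>k. ?I (v k + x) * ?I x) \<longlonglongrightarrow> ?I x"
      proof (cases "x \<in> U")
        case True
        have "(\<lambda>k. v k + x) \<longlonglongrightarrow> 0 + x" by (intro tendsto_intros v)
        then have "eventually (\<lambda>k. v k + x \<in> U) sequentially"
          using U(1) True by (intro topological_tendstoD) auto
        then have "eventually (\<lambda>k. ?I (v k + x) * ?I x = ?I x) sequentially"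
          by eventually_elim simp
        then show ?thesis by (rule tendsto_eventually)
      qed simp
    qed
  qed (use iU in \<open>auto simp: indicator_def\<close>)
  have "(LINT x|lborel. cmod (complex_of_real (?I (v k + x)) * c - complex_of_real (?I x) * c)) =
      cmod c * (2 * (LINT x|lborel. ?I x) - 2 * (LINT x|lborel. ?I (v k + x) * ?I x))" for k
  proof -
    have "(LINT x|lborel. cmod (complex_of_real (?I (v k + x)) * c - complex_of_real (?I x) * c)) =
        (LINT x|lborel. cmod c * (?I (v k + x) + ?I x - 2 * (?I (v k + x) * ?I x)))"
      by (intro Bochner_Integration.integral_cong refl) (auto simp: indicator_def norm_mult)
    also have "\<dots> = cmod c * ((LINT x|lborel. ?I (v k + x)) + (LINT x|lborel. ?I x) - 2 * (LINT x|lborel. ?I (v k + x) * ?I x))"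
      using iU iT[of k] iP[of k] by simp
    also have "(LINT x|lborel. ?I (v k + x)) = (LINT x|lborel. ?I x)"
      by (rule integral_lborel_translate[of ?I])
    finally show ?thesis by simp
  qed
  moreover have "(\<lambda>k. cmod c * (2 * (LINT x|lborel. ?I x) - 2 * (LINT x|lborel. ?I (v k + x) * ?I x)))
      \<longlonglongrightarrow> cmod c * (2 * (LINT x|lborel. ?I x) - 2 * (LINT x|lborel. ?I x))"
    by (intro tendsto_intros lim)
  ultimately show ?thesis by simp
qed

text \<open>Measurable sets are approximated from outside by open sets, for which pointwise
  convergence is available; sums and limits of simple functions then follow by approximation in the
  mean.\<close>

lemma translation_L1:
  fixes f :: "'a::euclidean_space \<Rightarrow> complex"
  assumes f: "integrable lborel f" and v: "v \<longlonglongrightarrow> 0"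
  shows "(\<lambda>k::nat. LINT x|lborel. cmod (f (v k + x) - f x)) \<longlonglongrightarrow> 0"
  using f
proof (induction rule: integrable_induct)
  case (base A c)
  then have [measurable]: "A \<in> sets borel" by simp
  have iA: "integrable lborel (\<lambda>x. indicator A x *\<^sub>R c)" using base by simp
  show ?case
  proof (rule translation_L1_approx[OF iA v])
    fix e :: real assume e: "e > 0"
    \<comment> \<open>The \<open>+ 1\<close> in the denominator covers \<open>c = 0\<close>.\<close>
    define \<eta> where "\<eta> = e / (cmod c + 1)"
    have \<eta>: "\<eta> > 0" using e by (simp add: \<eta>_def add_nonneg_pos)
    obtain U where U: "open U" "A \<subseteq> U" "emeasure lborel (U - A) < \<eta>"
      using outer_regular_lborel[of A \<eta>] \<eta> by auto
    have [measurable]: "U \<in> sets borel" using U by simp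
    have "emeasure lborel U = emeasure lborel (A \<union> (U - A))" using U by (simp add: Un_absorb1)
    also have "\<dots> \<le> emeasure lborel A + emeasure lborel (U - A)"
      by (rule emeasure_subadditive) auto
    also have "\<dots> < \<infinity>" using base U(3) by (auto simp: less_top[symmetric])
    finally have Ufin: "emeasure lborel U < \<infinity>" .
    have mU: "measure lborel (U - A) < \<eta>"
    proof -
      have "emeasure lborel (U - A) \<noteq> \<top>" using U(3) by force
      then show ?thesis
        using U(3) \<eta> by (simp add: emeasure_eq_ennreal_measure ennreal_less_iff)
    qed
    have "(LINT x|lborel. cmod (indicator A x *\<^sub>R c - complex_of_real (indicator U x) * c)) =
        (LINT x|lborel. indicator (U - A) x * cmod c)"
      by (intro Bochner_Integration.integral_cong refl)
        (use U(2) in \<open>auto simp: indicator_def\<close>)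
    also have "\<dots> = measure lborel (U - A) * cmod c" by simp
    also have "\<dots> \<le> \<eta> * cmod c" using mU by (intro mult_right_mono) auto
    also have "\<dots> < e" using e by (simp add: \<eta>_def divide_simps add_nonneg_pos)
    finally show "\<exists>h. integrable lborel h \<and> (LINT x|lborel. cmod (indicator A x *\<^sub>R c - h x)) < e \<and>
      (\<lambda>k. LINT x|lborel. cmod (h (v k + x) - h x)) \<longlonglongrightarrow> 0"
      using translation_L1_open[OF U(1) Ufin v, of c] Ufin
      by (intro exI[of _ "\<lambda>x. complex_of_real (indicator U x) * c"]) auto
  qed
next
  case (add f g)
  have i: "integrable lborel (\<lambda>x. f (v k + x))" "integrable lborel (\<lambda>x. g (v k + x))" for k
    using add by (simp_all add: integrable_lborel_translate_iff)
  have z: "(\<lambda>k. (LINT x|lborel. cmod (f (v k + x) - f x)) + (LINT x|lborel. cmod (g (v k + x) - g x))) \<longlonglongrightarrow> 0"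
    using tendsto_add[OF add(3,4)] by simp
  have "norm (LINT x|lborel. cmod (f (v k + x) + g (v k + x) - (f x + g x))) \<le>
      (LINT x|lborel. cmod (f (v k + x) - f x)) + (LINT x|lborel. cmod (g (v k + x) - g x))" for k
  proof -
    have "(LINT x|lborel. cmod (f (v k + x) + g (v k + x) - (f x + g x))) \<le>
        (LINT x|lborel. cmod (f (v k + x) - f x) + cmod (g (v k + x) - g x))"
      by (rule integral_mono) (use add i[of k] in \<open>auto simp: add_diff_add norm_triangle_ineq\<close>)
    also have "\<dots> = (LINT x|lborel. cmod (f (v k + x) - f x)) + (LINT x|lborel. cmod (g (v k + x) - g x))"
      using add i[of k] by simp
    finally show ?thesis by simp
  qed
  then show ?case by (intro Lim_null_comparison[OF always_eventually z] allI)
next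
  case (lim f s)
  \<comment> \<open>The approximating simple functions satisfy
    \<open>cmod (s i x) \<le> 2 * cmod (f x)\<close>, whence the factor 3 in the dominating
    function.\<close>
  have l: "(\<lambda>i. LINT x|lborel. cmod (f x - s i x)) \<longlonglongrightarrow> (LINT x|(lborel::'a measure). 0)"
  proof (rule integral_dominated_convergence[where w="\<lambda>x. 3 * cmod (f x)"])
    show "AE x in lborel. (\<lambda>i. cmod (f x - s i x)) \<longlonglongrightarrow> 0"
    proof (rule AE_I2)
      fix x
      have "(\<lambda>i. s i x) \<longlonglongrightarrow> f x" using lim by auto
      then have "(\<lambda>i. cmod (f x - s i x)) \<longlonglongrightarrow> cmod (f x - f x)"
        by (intro tendsto_diff tendsto_norm tendsto_const)
      then show "(\<lambda>i. cmod (f x - s i x)) \<longlonglongrightarrow> 0" by simp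
    qed
    show "AE x in lborel. norm (cmod (f x - s i x)) \<le> 3 * cmod (f x)" for i
    proof (rule AE_I2)
      fix x
      show "norm (cmod (f x - s i x)) \<le> 3 * cmod (f x)"
        using lim.hyps(3)[of x i] norm_triangle_ineq4[of "f x" "s i x"] by simp
    qed
  qed (use lim in auto)
  show ?case
  proof (rule translation_L1_approx[OF lim.hyps(4) v])
    fix e :: real assume "e > 0"
    then obtain i where "norm ((LINT x|lborel. cmod (f x - s i x)) - (LINT x|(lborel::'a measure). 0)) < e"
      using LIMSEQ_D[OF l] by blast
    then show "\<exists>h. integrable lborel h \<and> (LINT x|lborel. cmod (f x - h x)) < e \<and>
      (\<lambda>k. LINT x|lborel. cmod (h (v k + x) - h x)) \<longlonglongrightarrow> 0"
      using lim.hyps(1) lim.IH by (intro exI[of _ "s i"]) simp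
  qed
qed

text \<open>Splitting off the part where \<open>f\<close> is large reduces this to \<open>L\<^sup>1\<close>-continuity.\<close>

lemma autocorrelation_continuous:
  fixes f :: "'a::euclidean_space \<Rightarrow> complex"
  assumes f1: "integrable lborel f" and f2: "f \<in> L2 lborel" and v: "v \<longlonglongrightarrow> 0"
  shows "(\<lambda>k::nat. LINT x|lborel. f x * cnj (f (v k + x))) \<longlonglongrightarrow> of_real ((l2_norm lborel f)\<^sup>2)"
proof -
  have [measurable]: "f \<in> borel_measurable borel" using f2 by (simp add: L2_def)
  define T where "T k x = f (v k + x)" for k x
  have T1: "integrable lborel (T k)" for k
    unfolding T_def using f1 by (simp add: integrable_lborel_translate_iff)
  have T2: "T k \<in> L2 lborel" for k
    using f2 unfolding T_def L2_def by (auto simp: integrable_lborel_translate_iff[of "\<lambda>x. (cmod (f x))\<^sup>2"])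
  have Tn: "l2_norm lborel (T k) = l2_norm lborel f" for k
    unfolding T_def l2_norm_def by (simp add: integral_lborel_translate[of "\<lambda>x. (cmod (f x))\<^sup>2"])
  define g where "g n x = (if cmod (f x) \<le> real n then f x else 0)" for n :: nat and x
  have [measurable]: "g n \<in> borel_measurable borel" for n unfolding g_def by measurable
  have g2: "g n \<in> L2 lborel" for n
    by (rule L2_bound[OF _ f2]) (auto simp: g_def)
  have gb: "cmod (g n x) \<le> real n" for n x by (simp add: g_def)
  have glim: "(\<lambda>n. l2_norm lborel (\<lambda>x. f x - g n x)) \<longlonglongrightarrow> 0"
  proof -
    have "(\<lambda>n. LINT x|lborel. (cmod (f x - g n x))\<^sup>2) \<longlonglongrightarrow> (LINT x|(lborel::'a measure). 0)"
    proof (rule integral_dominated_convergence[where w="\<lambda>x. (cmod (f x))\<^sup>2"])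
      show "AE x in lborel. (\<lambda>n. (cmod (f x - g n x))\<^sup>2) \<longlonglongrightarrow> 0"
      proof (rule AE_I2)
        fix x
        obtain N :: nat where N: "cmod (f x) \<le> real N" using real_arch_simple by blast
        have "eventually (\<lambda>n. (cmod (f x - g n x))\<^sup>2 = 0) sequentially"
          using eventually_ge_at_top[of N]
          by eventually_elim (use N in \<open>auto simp: g_def\<close>)
        then show "(\<lambda>n. (cmod (f x - g n x))\<^sup>2) \<longlonglongrightarrow> 0" by (rule tendsto_eventually)
      qed
    qed (use f2 in \<open>auto simp: g_def L2_def\<close>)
    then have "(\<lambda>n. sqrt (LINT x|lborel. (cmod (f x - g n x))\<^sup>2)) \<longlonglongrightarrow> sqrt 0"
      by (intro tendsto_real_sqrt) simp
    then show ?thesis by (simp add: l2_norm_def)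
  qed
  have bound: "cmod (l2_inner lborel f (T k) - l2_inner lborel f f) \<le>
      real n * (LINT x|lborel. cmod (T k x - f x)) +
      l2_norm lborel (\<lambda>x. f x - g n x) * (2 * l2_norm lborel f)" for k n
  proof -
    have d2: "(\<lambda>x. T k x - f x) \<in> L2 lborel" by (intro L2_diff T2 f2)
    have fg2: "(\<lambda>x. f x - g n x) \<in> L2 lborel" by (intro L2_diff g2 f2)
    have "l2_inner lborel f (T k) - l2_inner lborel f f =
        l2_inner lborel (\<lambda>x. g n x + (f x - g n x)) (\<lambda>x. T k x - f x)"
      using f2 T2[of k] by (simp add: l2_inner_diff_right)
    also have "\<dots> = l2_inner lborel (g n) (\<lambda>x. T k x - f x) + l2_inner lborel (\<lambda>x. f x - g n x) (\<lambda>x. T k x - f x)"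
      by (rule l2_inner_add_left[OF g2 fg2 d2])
    also have "cmod \<dots> \<le> real n * (LINT x|lborel. cmod (T k x - f x)) +
        l2_norm lborel (\<lambda>x. f x - g n x) * (2 * l2_norm lborel f)"
    proof (rule norm_triangle_mono)
      have "cmod (l2_inner lborel (g n) (\<lambda>x. T k x - f x)) \<le> (LINT x|lborel. real n * cmod (T k x - f x))"
        unfolding l2_inner_def
      proof (rule order_trans[OF integral_norm_bound integral_mono])
        show "integrable lborel (\<lambda>x. cmod (g n x * cnj (T k x - f x)))"
          by (intro integrable_norm integrable_l2_inner[OF g2 d2])
        show "integrable lborel (\<lambda>x. real n * cmod (T k x - f x))" using T1[of k] f1 by auto
        show "cmod (g n x * cnj (T k x - f x)) \<le> real n * cmod (T k x - f x)" for x
          unfolding norm_mult complex_mod_cnj by (rule mult_right_mono[OF gb]) simp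
      qed
      then show "cmod (l2_inner lborel (g n) (\<lambda>x. T k x - f x)) \<le> real n * (LINT x|lborel. cmod (T k x - f x))"
        by simp
      have "l2_norm lborel (\<lambda>x. T k x - f x) \<le> 2 * l2_norm lborel f"
        using l2_norm_triangle[OF T2[of k] L2_scale[OF f2, of "-1"]] l2_norm_scale[of lborel "-1" f]
        by (simp add: Tn)
      then show "cmod (l2_inner lborel (\<lambda>x. f x - g n x) (\<lambda>x. T k x - f x)) \<le>
          l2_norm lborel (\<lambda>x. f x - g n x) * (2 * l2_norm lborel f)"
        by (intro order_trans[OF l2_inner_cauchy_schwarz[OF fg2 d2]] mult_left_mono) auto
    qed
    finally show ?thesis .
  qed
  have "(\<lambda>k. l2_inner lborel f (T k)) \<longlonglongrightarrow> l2_inner lborel f f"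
  proof (rule LIMSEQ_I)
    fix e :: real assume e: "e > 0"
    have "(\<lambda>n. l2_norm lborel (\<lambda>x. f x - g n x) * (2 * l2_norm lborel f)) \<longlonglongrightarrow> 0 * (2 * l2_norm lborel f)"
      by (intro tendsto_intros glim)
    then have "eventually (\<lambda>n. l2_norm lborel (\<lambda>x. f x - g n x) * (2 * l2_norm lborel f) < e/2) sequentially"
      using e by (intro order_tendstoD(2)) auto
    then obtain n where n: "l2_norm lborel (\<lambda>x. f x - g n x) * (2 * l2_norm lborel f) < e/2"
      by (auto simp: eventually_sequentially)
    have "(\<lambda>k. real n * (LINT x|lborel. cmod (T k x - f x))) \<longlonglongrightarrow> real n * 0"
      unfolding T_def by (intro tendsto_intros translation_L1 f1 v)
    then have "eventually (\<lambda>k. real n * (LINT x|lborel. cmod (T k x - f x)) < e/2) sequentially"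
      using e by (intro order_tendstoD(2)) auto
    then obtain N where N: "\<And>k. k \<ge> N \<Longrightarrow> real n * (LINT x|lborel. cmod (T k x - f x)) < e/2"
      by (auto simp: eventually_sequentially)
    have "norm (l2_inner lborel f (T k) - l2_inner lborel f f) < e" if "k \<ge> N" for k
      using bound[of k n] N[OF that] n by simp
    then show "\<exists>N. \<forall>k\<ge>N. norm (l2_inner lborel f (T k) - l2_inner lborel f f) < e" by blast
  qed
  then show ?thesis unfolding l2_inner_self by (simp add: l2_inner_def T_def)
qed


subsection \<open>Plancherel's theorem on Euclidean space\<close>

text \<open>The standard normal density without its constant; its transform is then read off from
  the characteristic function of the normal distribution.\<close>

definition gauss :: "'a::euclidean_space \<Rightarrow> real" where
  "gauss x = exp (- (norm x)\<^sup>2 / 2)"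

lemma gauss_measurable [measurable]: "gauss \<in> borel_measurable borel"
  unfolding gauss_def by measurable

lemma gauss_pos: "0 < gauss x"
  by (simp_all add: gauss_def)

lemma gauss_prod: "gauss x = (\<Prod>b\<in>Basis. exp (- (x \<bullet> b)\<^sup>2 / 2))"
proof -
  have "(norm x)\<^sup>2 = (\<Sum>b\<in>Basis. (x \<bullet> b)\<^sup>2)"
    unfolding power2_norm_eq_inner by (subst euclidean_inner) (simp add: power2_eq_square)
  then show ?thesis
    unfolding gauss_def exp_sum[OF finite_Basis, symmetric]
    by (simp add: sum_negf sum_divide_distrib)
qed

lemma integrable_gauss_1d: "integrable lborel (\<lambda>s::real. exp (- s\<^sup>2 / 2))"
  and integral_gauss_cis_1d:
    "(LINT s|lborel. complex_of_real (exp (- s\<^sup>2 / 2)) * cis (t * s)) = of_real (sqrt (2 * pi) * exp (- t\<^sup>2 / 2))"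
proof -
  have e: "exp (- s\<^sup>2 / 2) = sqrt (2 * pi) * std_normal_density s" for s :: real
    by (simp add: std_normal_density_def)
  show "integrable lborel (\<lambda>s::real. exp (- s\<^sup>2 / 2))"
    unfolding e by simp
  have "(LINT s|lborel. complex_of_real (exp (- s\<^sup>2 / 2)) * cis (t * s)) =
      of_real (sqrt (2 * pi)) * (LINT s|lborel. std_normal_density s *\<^sub>R cis (t * s))"
    unfolding e by (simp add: scaleR_conv_of_real mult.assoc)
  also have "(LINT s|lborel. std_normal_density s *\<^sub>R cis (t * s)) = char std_normal_distribution t"
    unfolding char_def by (subst integral_density) (auto simp: cis_conv_exp normal_density_nonneg)
  finally show "(LINT s|lborel. complex_of_real (exp (- s\<^sup>2 / 2)) * cis (t * s)) = of_real (sqrt (2 * pi) * exp (- t\<^sup>2 / 2))"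
    by (simp add: char_std_normal_distribution)
qed

lemma cis_sum: "finite A \<Longrightarrow> cis (\<Sum>i\<in>A. f i) = (\<Prod>i\<in>A. cis (f i))"
  by (induction A rule: finite_induct) (simp_all add: cis_mult[symmetric])

lemma integrable_gauss: "integrable lborel (gauss :: 'a::euclidean_space \<Rightarrow> real)"
proof (rule integrableI_bounded)
  have "(\<integral>\<^sup>+ x. ennreal (norm (gauss (x::'a))) \<partial>lborel) =
      (\<integral>\<^sup>+ x. (\<Prod>b\<in>(Basis::'a set). ennreal (exp (- (x \<bullet> b)\<^sup>2 / 2))) \<partial>lborel)"
    by (intro nn_integral_cong) (simp add: prod_ennreal gauss_prod prod_nonneg)
  also have "\<dots> = (\<Prod>b\<in>(Basis::'a set). (\<integral>\<^sup>+ s. ennreal (exp (- s\<^sup>2 / 2)) \<partial>lborel))"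
    by (rule nn_integral_lborel_prod[of "\<lambda>b s. ennreal (exp (- s\<^sup>2 / 2))"]) auto
  also have "\<dots> < \<infinity>"
    using integrable_gauss_1d
    by (auto simp: less_top[symmetric] power_eq_top_ennreal integrable_iff_bounded)
  finally show "(\<integral>\<^sup>+ x. ennreal (norm (gauss (x::'a))) \<partial>lborel) < \<infinity>" .
qed measurable

lemma integral_gauss_cis:
  fixes v :: "'a::euclidean_space"
  shows "(LINT x|lborel. complex_of_real (gauss x) * cis (v \<bullet> x)) =
    of_real (sqrt (2 * pi) ^ DIM('a) * gauss v)"
proof -
  interpret product_sigma_finite "\<lambda>_::'a. lborel :: real measure" ..
  let ?F = "\<lambda>b s. complex_of_real (exp (- s\<^sup>2 / 2)) * cis ((v \<bullet> b) * s)"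
  have "complex_of_real (gauss x) * cis (v \<bullet> x) = (\<Prod>b\<in>Basis. ?F b (x \<bullet> b))" for x :: 'a
    unfolding gauss_prod euclidean_inner[of v x] cis_sum[OF finite_Basis] of_real_prod prod.distrib ..
  then have "(LINT x|lborel. complex_of_real (gauss x) * cis (v \<bullet> x)) =
      (LINT x|lborel. (\<Prod>b\<in>Basis. ?F b (x \<bullet> b)))" by simp
  also have "\<dots> = (LINT y|(\<Pi>\<^sub>M b\<in>(Basis::'a set). lborel). (\<Prod>b\<in>Basis. ?F b (y b)))"
    by (subst lborel_eq) (simp add: integral_distr)
  also have "\<dots> = (\<Prod>b\<in>(Basis::'a set). LINT s|lborel. ?F b s)"
  proof (rule product_integral_prod)
    show "integrable lborel (?F b)" for b
      by (rule Bochner_Integration.integrable_bound[OF integrable_gauss_1d]) (auto simp: norm_mult)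
  qed simp
  also have "\<dots> = (\<Prod>b\<in>(Basis::'a set). of_real (sqrt (2 * pi) * exp (- (v \<bullet> b)\<^sup>2 / 2)))"
    by (simp only: integral_gauss_cis_1d)
  also have "\<dots> = of_real (sqrt (2 * pi) ^ DIM('a) * gauss v)"
    by (simp add: prod.distrib gauss_prod of_real_prod[symmetric] del: of_real_prod of_real_mult)
  finally show ?thesis .
qed

text \<open>The sign and the factor \<open>2 * pi\<close> are those of the characters in
  \<open>pi_rep\<close>; with this normalisation Plancherel's identity carries no constant.\<close>

definition ft :: "('a::euclidean_space \<Rightarrow> complex) \<Rightarrow> 'a \<Rightarrow> complex" where
  "ft f \<xi> = (LINT x|lborel. f x * cis (2 * pi * (\<xi> \<bullet> x)))"

lemma ft_measurable [measurable]:
  assumes [measurable]: "f \<in> borel_measurable borel"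
  shows "ft f \<in> borel_measurable borel"
  unfolding ft_def by measurable

lemma cmod_ft_le: "cmod (ft f \<xi>) \<le> (LINT x|lborel. cmod (f x))"
  unfolding ft_def by (rule order_trans[OF integral_norm_bound]) (simp add: norm_mult)

lemma integrable_mult_bounded:
  fixes f g :: "'a \<Rightarrow> complex"
  assumes "integrable M f" "g \<in> borel_measurable M" "\<And>x. cmod (g x) \<le> C"
  shows "integrable M (\<lambda>x. f x * g x)"
proof (rule Bochner_Integration.integrable_bound)
  show "integrable M (\<lambda>x. C * cmod (f x))" using assms(1) by simp
  have "cmod (f x) * cmod (g x) \<le> \<bar>C\<bar> * cmod (f x)" for x
    using mult_left_mono[OF order_trans[OF assms(3)[of x] abs_ge_self] norm_ge_zero[of "f x"]]
    by (simp add: mult.commute)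
  then show "AE x in M. norm (f x * g x) \<le> norm (C * cmod (f x))" by (simp add: norm_mult abs_mult)
qed (use assms in measurable)

text \<open>The Gaussian cutoff makes all integrals absolutely convergent, so the squared transform
  can be written as a double integral over \<open>x\<close> and \<open>y\<close> and the frequency
  integrated first. That produces another Gaussian in \<open>x - y\<close>, and the right side
  becomes a Gaussian average, of width proportional to \<open>e\<close>, of the autocorrelation of
  \<open>f\<close>.\<close>

lemma ft_gauss_identity:
  fixes f :: "'a::euclidean_space \<Rightarrow> complex"
  assumes f: "integrable lborel f" and e: "e > 0"
  shows "(LINT \<xi>|lborel. of_real (gauss (e *\<^sub>R \<xi>)) * (ft f \<xi> * cnj (ft f \<xi>))) =
    of_real ((1 / sqrt (2 * pi)) ^ DIM('a)) *
    (LINT w|lborel. of_real (gauss w) * (LINT x|lborel. f x * cnj (f ((e / (2 * pi)) *\<^sub>R w + x))))"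
proof -
  let ?n = "DIM('a)"
  have [measurable]: "f \<in> borel_measurable borel" using f by auto
  define C where "C = (LINT x|lborel. cmod (f x))"
  have C: "cmod (ft f \<xi>) \<le> C" for \<xi> unfolding C_def by (rule cmod_ft_le)
  define G where "G \<xi> = complex_of_real (gauss (e *\<^sub>R \<xi>))" for \<xi> :: 'a
  have [measurable]: "G \<in> borel_measurable borel" unfolding G_def by measurable
  have Gi: "integrable lborel G"
  proof -
    have "integrable lborel (\<lambda>x::'a. gauss (e *\<^sub>R x))"
      by (rule integrable_lborel_scale[OF _ integrable_gauss]) (use e in simp)
    then show ?thesis unfolding G_def by (rule integrable_of_real)
  qed
  \<comment> \<open>The transform of the cutoff, to be evaluated at the difference of two space
    variables.\<close>
  define K where "K v = (LINT \<xi>|lborel. G \<xi> * cis (2 * pi * (\<xi> \<bullet> v)))" for v :: 'a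
  have K_meas [measurable]: "K \<in> borel_measurable borel" unfolding K_def by measurable
  have K: "K v = of_real ((sqrt (2 * pi) / e) ^ ?n * gauss ((2 * pi / e) *\<^sub>R v))" for v
  proof -
    have "K v = of_real ((1/e) ^ ?n) * (LINT \<xi>|lborel. of_real (gauss \<xi>) * cis (((2 * pi / e) *\<^sub>R v) \<bullet> \<xi>))"
      unfolding K_def G_def using e
      by (subst integral_lborel_scale[of "1/e"])
        (auto simp: scaleR_conv_of_real inner_commute field_simps)
    also have "\<dots> = of_real ((1/e) ^ ?n) * of_real (sqrt (2 * pi) ^ ?n * gauss ((2 * pi / e) *\<^sub>R v))"
      by (simp only: integral_gauss_cis)
    finally show ?thesis by (simp add: power_divide power_one_over)
  qed
  have K_bound: "cmod (K v) \<le> (LINT x|lborel. cmod (G x))" for v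
    unfolding K_def by (rule order_trans[OF integral_norm_bound]) (simp add: norm_mult)
  have "(LINT \<xi>|lborel. G \<xi> * (ft f \<xi> * cnj (ft f \<xi>))) =
      (LINT \<xi>|lborel. LINT x|lborel. f x * (G \<xi> * cis (2 * pi * (\<xi> \<bullet> x)) * cnj (ft f \<xi>)))"
  proof (rule Bochner_Integration.integral_cong[OF refl])
    fix \<xi> :: 'a
    have "(LINT x|lborel. f x * (G \<xi> * cis (2 * pi * (\<xi> \<bullet> x)) * cnj (ft f \<xi>))) =
        (LINT x|lborel. (G \<xi> * cnj (ft f \<xi>)) * (f x * cis (2 * pi * (\<xi> \<bullet> x))))"
      by (rule Bochner_Integration.integral_cong) (simp_all add: mult_ac)
    also have "\<dots> = (G \<xi> * cnj (ft f \<xi>)) * ft f \<xi>"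
      by (subst integral_mult_right_zero) (simp add: ft_def)
    finally show "G \<xi> * (ft f \<xi> * cnj (ft f \<xi>)) = (LINT x|lborel. f x * (G \<xi> * cis (2 * pi * (\<xi> \<bullet> x)) * cnj (ft f \<xi>)))"
      by (simp only: mult_ac)
  qed
  also have "\<dots> = (LINT x|lborel. LINT \<xi>|lborel. f x * (G \<xi> * cis (2 * pi * (\<xi> \<bullet> x)) * cnj (ft f \<xi>)))"
  proof (rule lborel_pair.Fubini_integral)
    have "integrable (lborel \<Otimes>\<^sub>M lborel) (\<lambda>p. (f (fst p) * G (snd p)) *
        (cis (2 * pi * (snd p \<bullet> fst p)) * cnj (ft f (snd p))))"
    proof (rule integrable_mult_bounded[where C=C])
      show "integrable (lborel \<Otimes>\<^sub>M lborel) (\<lambda>p. f (fst p) * G (snd p))"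
        by (intro integrable_pair_mult sigma_finite_lborel f Gi)
      show "cmod (cis (2 * pi * (snd p \<bullet> fst p)) * cnj (ft f (snd p))) \<le> C" for p :: "'a \<times> 'a"
        by (simp add: norm_mult C)
    qed measurable
    also have "(\<lambda>p. (f (fst p) * G (snd p)) * (cis (2 * pi * (snd p \<bullet> fst p)) * cnj (ft f (snd p)))) =
        (\<lambda>(x, \<xi>). f x * (G \<xi> * cis (2 * pi * (\<xi> \<bullet> x)) * cnj (ft f \<xi>)))"
      by (simp add: fun_eq_iff mult.assoc)
    finally show "integrable (lborel \<Otimes>\<^sub>M lborel) (\<lambda>(x, \<xi>). f x * (G \<xi> * cis (2 * pi * (\<xi> \<bullet> x)) * cnj (ft f \<xi>)))" .
  qed
  also have "\<dots> = (LINT x|lborel. f x * (LINT y|lborel. cnj (f y) * K (x - y)))"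
  proof (rule Bochner_Integration.integral_cong[OF refl])
    fix x :: 'a
    have "(LINT \<xi>|lborel. G \<xi> * cis (2 * pi * (\<xi> \<bullet> x)) * cnj (ft f \<xi>)) =
        (LINT \<xi>|lborel. LINT y|lborel. cnj (f y) * (G \<xi> * cis (2 * pi * (\<xi> \<bullet> (x - y)))))"
    proof (rule Bochner_Integration.integral_cong[OF refl])
      fix \<xi> :: 'a
      have "cis (2 * pi * (\<xi> \<bullet> (x - y))) = cis (2 * pi * (\<xi> \<bullet> x)) * cnj (cis (2 * pi * (\<xi> \<bullet> y)))" for y
        by (simp add: cis_cnj cis_mult inner_diff_right right_diff_distrib)
      then have "(LINT y|lborel. cnj (f y) * (G \<xi> * cis (2 * pi * (\<xi> \<bullet> (x - y))))) =
          (LINT y|lborel. (G \<xi> * cis (2 * pi * (\<xi> \<bullet> x))) * cnj (f y * cis (2 * pi * (\<xi> \<bullet> y))))"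
        by (intro Bochner_Integration.integral_cong) (simp_all add: mult_ac)
      also have "\<dots> = G \<xi> * cis (2 * pi * (\<xi> \<bullet> x)) * cnj (ft f \<xi>)"
        unfolding ft_def Bochner_Integration.integral_cnj[symmetric] by (rule integral_mult_right_zero)
      finally show "G \<xi> * cis (2 * pi * (\<xi> \<bullet> x)) * cnj (ft f \<xi>) =
          (LINT y|lborel. cnj (f y) * (G \<xi> * cis (2 * pi * (\<xi> \<bullet> (x - y)))))" ..
    qed
    also have "\<dots> = (LINT y|lborel. LINT \<xi>|lborel. cnj (f y) * (G \<xi> * cis (2 * pi * (\<xi> \<bullet> (x - y)))))"
    proof (rule lborel_pair.Fubini_integral)
      have "integrable (lborel \<Otimes>\<^sub>M lborel) (\<lambda>p. (cnj (f (fst p)) * G (snd p)) *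
          cis (2 * pi * (snd p \<bullet> (x - fst p))))"
      proof (rule integrable_mult_bounded[where C=1])
        show "integrable (lborel \<Otimes>\<^sub>M lborel) (\<lambda>p. cnj (f (fst p)) * G (snd p))"
          using f by (intro integrable_pair_mult[of lborel lborel "\<lambda>x. cnj (f x)"] sigma_finite_lborel Gi) simp
        show "(\<lambda>p. cis (2 * pi * (snd p \<bullet> (x - fst p)))) \<in> borel_measurable (lborel \<Otimes>\<^sub>M lborel)"
          by (rule measurable_compose[OF _ borel_measurable_cis]) measurable
      qed simp
      then show "integrable (lborel \<Otimes>\<^sub>M lborel) (\<lambda>(y, \<xi>). cnj (f y) * (G \<xi> * cis (2 * pi * (\<xi> \<bullet> (x - y)))))"
        by (simp add: split_beta' mult.assoc)
    qed
    also have "\<dots> = (LINT y|lborel. cnj (f y) * K (x - y))" by (simp add: K_def)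
    finally show "(LINT \<xi>|lborel. f x * (G \<xi> * cis (2 * pi * (\<xi> \<bullet> x)) * cnj (ft f \<xi>))) =
        f x * (LINT y|lborel. cnj (f y) * K (x - y))" by simp
  qed
  \<comment> \<open>Substitute \<open>y = x + v\<close>; since \<open>K\<close> is even the sign of
    \<open>v\<close> disappears.\<close>
  also have "\<dots> = (LINT x|lborel. LINT v|lborel. f x * (cnj (f (x + v)) * K v))"
  proof (rule Bochner_Integration.integral_cong[OF refl])
    fix x :: 'a
    have "(LINT y|lborel. cnj (f y) * K (x - y)) = (LINT v|lborel. cnj (f (x + v)) * K (x - (x + v)))"
      by (rule integral_lborel_translate[symmetric])
    also have "\<dots> = (LINT v|lborel. cnj (f (x + v)) * K v)" by (simp add: K gauss_def)
    finally show "f x * (LINT y|lborel. cnj (f y) * K (x - y)) = (LINT v|lborel. f x * (cnj (f (x + v)) * K v))"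
      by simp
  qed
  also have "\<dots> = (LINT v|lborel. LINT x|lborel. f x * (cnj (f (x + v)) * K v))"
  proof (rule lborel_pair.Fubini_integral)
    have m: "(\<lambda>p. f (snd p) * cnj (f (snd p + fst p))) \<in> borel_measurable (lborel \<Otimes>\<^sub>M lborel)"
      by measurable
    have i: "integrable (lborel \<Otimes>\<^sub>M lborel) (\<lambda>p. f (fst p) * cnj (f (fst p + snd p)))"
    proof (rule lborel_pair.Fubini_integrable)
      have eq: "(LINT y|lborel. cmod (f (x + y))) = C" for x
        unfolding C_def by (rule integral_lborel_translate)
      show "integrable lborel (\<lambda>x. LINT y|lborel. norm (f (fst (x, y)) * cnj (f (fst (x, y) + snd (x, y)))))"
        using f by (simp add: norm_mult eq)
      show "AE x in lborel. integrable lborel (\<lambda>y. f (fst (x, y)) * cnj (f (fst (x, y) + snd (x, y))))"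
        using f by (simp add: integrable_lborel_translate_iff)
    qed measurable
    have "integrable (lborel \<Otimes>\<^sub>M lborel) (\<lambda>p. f (fst p) * cnj (f (fst p + snd p)) * K (snd p))"
      by (rule integrable_mult_bounded[OF i _ K_bound]) measurable
    then have "integrable (lborel \<Otimes>\<^sub>M lborel) (\<lambda>(x, v). f x * (cnj (f (x + v)) * K v))"
      by (simp add: split_beta' mult.assoc)
    from lborel_pair.integrable_product_swap[OF this]
    show "integrable (lborel \<Otimes>\<^sub>M lborel) (\<lambda>(v, x). f x * (cnj (f (x + v)) * K v))"
      by (simp add: split_beta')
  qed
  also have "\<dots> = (LINT v|lborel. K v * (LINT x|lborel. f x * cnj (f (v + x))))"
  proof (rule Bochner_Integration.integral_cong[OF refl])
    fix v :: 'a
    have "(LINT x|lborel. f x * (cnj (f (x + v)) * K v)) = (LINT x|lborel. K v * (f x * cnj (f (v + x))))"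
      by (rule Bochner_Integration.integral_cong) (simp_all add: add.commute)
    then show "(LINT x|lborel. f x * (cnj (f (x + v)) * K v)) = K v * (LINT x|lborel. f x * cnj (f (v + x)))"
      by simp
  qed
  \<comment> \<open>With \<open>v = (e / (2 * pi)) *\<^sub>R w\<close> the factor \<open>K\<close>
    becomes a fixed Gaussian up to a constant, so under the integral \<open>e\<close> survives only
    in the shift of \<open>f\<close>.\<close>
  also have "\<dots> = of_real ((e / (2 * pi)) ^ ?n) *
      (LINT w|lborel. K ((e / (2 * pi)) *\<^sub>R w) * (LINT x|lborel. f x * cnj (f ((e / (2 * pi)) *\<^sub>R w + x))))"
    using e by (subst integral_lborel_scale[of "e / (2 * pi)"]) (auto simp: scaleR_conv_of_real)
  also have "\<dots> = of_real ((e / (2 * pi)) ^ ?n) * (of_real ((sqrt (2 * pi) / e) ^ ?n) *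
      (LINT w|lborel. of_real (gauss w) * (LINT x|lborel. f x * cnj (f ((e / (2 * pi)) *\<^sub>R w + x)))))"
    using e by (simp add: K mult.assoc)
  also have "\<dots> = of_real ((1 / sqrt (2 * pi)) ^ ?n) *
      (LINT w|lborel. of_real (gauss w) * (LINT x|lborel. f x * cnj (f ((e / (2 * pi)) *\<^sub>R w + x))))"
  proof -
    have "(e / (2 * pi)) * (sqrt (2 * pi) / e) = 1 / sqrt (2 * pi)"
      using e real_sqrt_mult_self[of "2 * pi"] by (simp add: field_simps)
    then have "(e / (2 * pi)) ^ ?n * (sqrt (2 * pi) / e) ^ ?n = (1 / sqrt (2 * pi)) ^ ?n"
      by (simp only: power_mult_distrib[symmetric])
    then show ?thesis by (simp only: mult.assoc[symmetric] of_real_mult[symmetric])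
  qed
  finally show ?thesis by (simp add: G_def)
qed

text \<open>Let \<open>e\<close> tend to 0 in the Gaussian identity. The left side increases to the
  integral of the squared transform; the right side tends, by dominated convergence, to the
  autocorrelation at 0, which is the squared norm.\<close>

theorem plancherel_euclidean:
  fixes f :: "'a::euclidean_space \<Rightarrow> complex"
  assumes f1: "integrable lborel f" and f2: "f \<in> L2 lborel"
  shows "(\<integral>\<^sup>+ \<xi>. ennreal ((cmod (ft f \<xi>))\<^sup>2) \<partial>lborel) = ennreal ((l2_norm lborel f)\<^sup>2)"
proof -
  let ?n = "DIM('a)"
  have [measurable]: "f \<in> borel_measurable borel" using f1 by auto
  \<comment> \<open>A decreasing null sequence, so that the Gaussian factors increase to 1 and
    monotone convergence applies.\<close>
  define e where "e k = 1 / real (Suc k)" for k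
  have e: "e k > 0" for k by (simp add: e_def)
  have e0: "e \<longlonglongrightarrow> 0" unfolding e_def using LIMSEQ_inverse_real_of_nat by (simp add: inverse_eq_divide)
  have e_dec: "e (Suc k) \<le> e k" for k by (simp add: e_def field_simps)
  define A where "A v = (LINT x|lborel. f x * cnj (f (v + x)))" for v
  have [measurable]: "A \<in> borel_measurable borel" unfolding A_def by measurable
  have A_bound: "cmod (A v) \<le> (l2_norm lborel f)\<^sup>2" for v
  proof -
    have "(\<lambda>x. f (v + x)) \<in> L2 lborel"
      using f2 unfolding L2_def by (auto simp: integrable_lborel_translate_iff[of "\<lambda>x. (cmod (f x))\<^sup>2"])
    moreover have "l2_norm lborel (\<lambda>x. f (v + x)) = l2_norm lborel f"
      unfolding l2_norm_def by (simp add: integral_lborel_translate[of "\<lambda>x. (cmod (f x))\<^sup>2"])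
    ultimately show ?thesis
      using l2_inner_cauchy_schwarz[OF f2, of "\<lambda>x. f (v + x)"]
      by (simp add: A_def l2_inner_def power2_eq_square)
  qed
  have total: "(LINT w|lborel. complex_of_real (gauss (w::'a))) = of_real (sqrt (2 * pi) ^ ?n)"
    using integral_gauss_cis[of "0::'a"] by (simp add: gauss_def)
  have "(\<lambda>k. LINT w|lborel. of_real (gauss w) * A ((e k / (2 * pi)) *\<^sub>R w)) \<longlonglongrightarrow>
      (LINT w|(lborel::'a measure). of_real (gauss w) * of_real ((l2_norm lborel f)\<^sup>2))"
  proof (rule integral_dominated_convergence[where w="\<lambda>w. gauss w * (l2_norm lborel f)\<^sup>2"])
    show "AE w in lborel. (\<lambda>k. of_real (gauss w) * A ((e k / (2 * pi)) *\<^sub>R w)) \<longlonglongrightarrow>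
        of_real (gauss w) * of_real ((l2_norm lborel f)\<^sup>2)"
    proof (rule AE_I2)
      fix w :: 'a
      have "(\<lambda>k. (e k / (2 * pi)) *\<^sub>R w) \<longlonglongrightarrow> (0 / (2 * pi)) *\<^sub>R w"
        by (intro tendsto_intros e0) simp
      then have "(\<lambda>k. A ((e k / (2 * pi)) *\<^sub>R w)) \<longlonglongrightarrow> of_real ((l2_norm lborel f)\<^sup>2)"
        unfolding A_def by (intro autocorrelation_continuous f1 f2) simp
      then show "(\<lambda>k. of_real (gauss w) * A ((e k / (2 * pi)) *\<^sub>R w)) \<longlonglongrightarrow>
        of_real (gauss w) * of_real ((l2_norm lborel f)\<^sup>2)"
        by (intro tendsto_intros)
    qed
    show "AE w in lborel. norm (of_real (gauss w) * A ((e k / (2 * pi)) *\<^sub>R w)) \<le> gauss w * (l2_norm lborel f)\<^sup>2" for k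
      by (rule AE_I2) (simp add: norm_mult gauss_pos less_imp_le A_bound)
  qed (use integrable_gauss in auto)
  then have "(\<lambda>k. of_real ((1 / sqrt (2 * pi)) ^ ?n) * (LINT w|lborel. of_real (gauss w) * A ((e k / (2 * pi)) *\<^sub>R w)))
      \<longlonglongrightarrow> of_real ((1 / sqrt (2 * pi)) ^ ?n) * (of_real (sqrt (2 * pi) ^ ?n) * of_real ((l2_norm lborel f)\<^sup>2))"
    using total by (intro tendsto_intros) simp
  also have "of_real ((1 / sqrt (2 * pi)) ^ ?n) * (of_real (sqrt (2 * pi) ^ ?n) * of_real ((l2_norm lborel f)\<^sup>2)) =
      complex_of_real ((l2_norm lborel f)\<^sup>2)"
    by (simp add: power_divide)
  finally have lim: "(\<lambda>k. LINT \<xi>|lborel. of_real (gauss (e k *\<^sub>R \<xi>)) * (ft f \<xi> * cnj (ft f \<xi>)))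
      \<longlonglongrightarrow> complex_of_real ((l2_norm lborel f)\<^sup>2)"
    unfolding A_def by (simp only: ft_gauss_identity[OF f1 e])
  define J where "J k = (LINT \<xi>|lborel. gauss (e k *\<^sub>R \<xi>) * (cmod (ft f \<xi>))\<^sup>2)" for k
  have Jc: "(LINT \<xi>|lborel. of_real (gauss (e k *\<^sub>R \<xi>)) * (ft f \<xi> * cnj (ft f \<xi>))) = complex_of_real (J k)" for k
    unfolding J_def complex_norm_square[symmetric] of_real_mult[symmetric] by (rule integral_complex_of_real)
  have limJ: "J \<longlonglongrightarrow> (l2_norm lborel f)\<^sup>2"
    using lim unfolding Jc by (simp only: tendsto_of_real_iff)
  have Ji: "integrable lborel (\<lambda>\<xi>. gauss (e k *\<^sub>R \<xi>) * (cmod (ft f \<xi>))\<^sup>2)" for k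
  proof (rule Bochner_Integration.integrable_bound)
    have "integrable lborel (\<lambda>x::'a. gauss (e k *\<^sub>R x))"
      by (rule integrable_lborel_scale[OF _ integrable_gauss]) (use e[of k] in simp)
    then show "integrable lborel (\<lambda>\<xi>::'a. gauss (e k *\<^sub>R \<xi>) * (LINT x|lborel. cmod (f x))\<^sup>2)" by simp
    show "AE \<xi> in lborel. norm (gauss (e k *\<^sub>R \<xi>) * (cmod (ft f \<xi>))\<^sup>2) \<le>
        norm (gauss (e k *\<^sub>R \<xi>) * (LINT x|lborel. cmod (f x))\<^sup>2)"
      by (rule AE_I2) (auto simp: abs_mult gauss_pos less_imp_le intro!: mult_left_mono power_mono cmod_ft_le)
  qed measurable
  have mono: "gauss (e k *\<^sub>R \<xi>) \<le> gauss (e (Suc k) *\<^sub>R \<xi>)" for k and \<xi> :: 'a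
    using e_dec[of k] e[of "Suc k"] by (auto simp: gauss_def power_mult_distrib intro!: mult_right_mono power_mono)
  have sup: "(SUP k. ennreal (gauss (e k *\<^sub>R \<xi>) * (cmod (ft f \<xi>))\<^sup>2)) = ennreal ((cmod (ft f \<xi>))\<^sup>2)" for \<xi>
  proof (rule LIMSEQ_unique[OF LIMSEQ_SUP])
    show "incseq (\<lambda>k. ennreal (gauss (e k *\<^sub>R \<xi>) * (cmod (ft f \<xi>))\<^sup>2))"
      by (intro incseq_SucI ennreal_leI mult_right_mono mono) simp
    have "(\<lambda>k. exp (- (norm (e k *\<^sub>R \<xi>))\<^sup>2 / 2) * (cmod (ft f \<xi>))\<^sup>2) \<longlonglongrightarrow>
        exp (- (norm (0 *\<^sub>R \<xi>))\<^sup>2 / 2) * (cmod (ft f \<xi>))\<^sup>2"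
      by (intro tendsto_intros e0) simp
    then show "(\<lambda>k. ennreal (gauss (e k *\<^sub>R \<xi>) * (cmod (ft f \<xi>))\<^sup>2)) \<longlonglongrightarrow> ennreal ((cmod (ft f \<xi>))\<^sup>2)"
      unfolding gauss_def by (intro tendsto_ennrealI) simp
  qed
  have "(\<integral>\<^sup>+ \<xi>. ennreal ((cmod (ft f \<xi>))\<^sup>2) \<partial>lborel) = (SUP k. \<integral>\<^sup>+ \<xi>. ennreal (gauss (e k *\<^sub>R \<xi>) * (cmod (ft f \<xi>))\<^sup>2) \<partial>lborel)"
    unfolding sup[symmetric]
    by (rule nn_integral_monotone_convergence_SUP)
      (auto intro!: incseq_SucI le_funI ennreal_leI mult_right_mono mono)
  also have "\<dots> = (SUP k. ennreal (J k))"
    unfolding J_def by (intro SUP_cong refl nn_integral_eq_integral Ji) (auto simp: gauss_pos less_imp_le)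
  also have "\<dots> = ennreal ((l2_norm lborel f)\<^sup>2)"
  proof (rule LIMSEQ_unique[OF LIMSEQ_SUP])
    show "incseq (\<lambda>k. ennreal (J k))"
      unfolding J_def by (intro incseq_SucI ennreal_leI integral_mono Ji mult_right_mono mono) simp
    show "(\<lambda>k. ennreal (J k)) \<longlonglongrightarrow> ennreal ((l2_norm lborel f)\<^sup>2)"
      by (intro tendsto_ennrealI limJ)
  qed
  finally show ?thesis .
qed

subsection \<open>Hilbert--Schmidt operators\<close>

text \<open>The very choice made inside \<open>hs_norm2\<close>. All computations with
  Hilbert--Schmidt norms refer to this one basis.\<close>

definition onb :: "'a measure \<Rightarrow> nat \<Rightarrow> 'a \<Rightarrow> complex" where
  "onb M = (SOME e. orthonormal_basis M e)"

lemma orthonormal_basis_onb: "\<exists>e. orthonormal_basis M e \<Longrightarrow> orthonormal_basis M (onb M)"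
  unfolding onb_def by (erule someI_ex[of "orthonormal_basis M"])

lemma hs_norm2_eq: "hs_norm2 M T = (\<Sum>i. ennreal ((l2_norm M (T (onb M i)))\<^sup>2))"
  by (simp add: hs_norm2_def onb_def)

lemma bounded_operatorD:
  assumes "bounded_operator M T"
  shows bounded_operator_L2: "f \<in> L2 M \<Longrightarrow> T f \<in> L2 M"
    and bounded_operator_add: "f \<in> L2 M \<Longrightarrow> g \<in> L2 M \<Longrightarrow> AE x in M. T (\<lambda>y. f y + g y) x = T f x + T g x"
    and bounded_operator_scale: "f \<in> L2 M \<Longrightarrow> AE x in M. T (\<lambda>y. c * f y) x = c * T f x"
  using assms by (simp_all add: bounded_operator_def)

lemma bounded_operator_bound:
  assumes "bounded_operator M T"
  obtains C where "0 \<le> C" "\<And>f. f \<in> L2 M \<Longrightarrow> l2_norm M (T f) \<le> C * l2_norm M f"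
proof -
  obtain C where C: "\<And>f. f \<in> L2 M \<Longrightarrow> l2_norm M (T f) \<le> C * l2_norm M f"
    using assms unfolding bounded_operator_def by blast
  have "l2_norm M (T f) \<le> \<bar>C\<bar> * l2_norm M f" if "f \<in> L2 M" for f
    using C[OF that] mult_right_mono[OF abs_ge_self[of C] l2_norm_nonneg[of M f]] by linarith
  then show ?thesis using that[of "\<bar>C\<bar>"] by simp
qed

lemma bounded_operator_diff:
  assumes T: "bounded_operator M T" and f: "f \<in> L2 M" and g: "g \<in> L2 M"
  shows "AE x in M. T (\<lambda>y. f y - g y) x = T f x - T g x"
  using bounded_operator_add[OF T f L2_scale[OF g, of "-1"]] bounded_operator_scale[OF T g, of "-1"]
  by eventually_elim simp

lemma bounded_operator_cong_AE:
  assumes T: "bounded_operator M T" and f: "f \<in> L2 M" and g: "g \<in> L2 M" and eq: "AE x in M. f x = g x"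
  shows "AE x in M. T f x = T g x"
proof -
  obtain C where C: "\<And>f. f \<in> L2 M \<Longrightarrow> l2_norm M (T f) \<le> C * l2_norm M f"
    using bounded_operator_bound[OF T] by blast
  have d: "(\<lambda>x. f x - g x) \<in> L2 M" by (rule L2_diff[OF f g])
  have "l2_norm M (\<lambda>x. f x - g x) = 0"
    unfolding l2_norm_eq_zero_iff[OF d] using eq by eventually_elim simp
  then have "l2_norm M (T (\<lambda>x. f x - g x)) = 0"
    using C[OF d] l2_norm_nonneg[of M "T (\<lambda>x. f x - g x)"] by simp
  then have "AE x in M. T (\<lambda>x. f x - g x) x = 0"
    using l2_norm_eq_zero_iff[OF bounded_operator_L2[OF T d]] by simp
  with bounded_operator_diff[OF T f g] show ?thesis by eventually_elim simp
qed

text \<open>Operators respect sums only almost everywhere; after pairing with \<open>w\<close> this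
  becomes an exact identity of numbers.\<close>

lemma bounded_operator_inner_sum:
  assumes T: "bounded_operator M T" and v: "\<And>i. i \<in> A \<Longrightarrow> v i \<in> L2 M" and w: "w \<in> L2 M" and A: "finite A"
  shows "l2_inner M (T (\<lambda>x. \<Sum>i\<in>A. c i * v i x)) w = (\<Sum>i\<in>A. c i * l2_inner M (T (v i)) w)"
  using A v
proof (induction A rule: finite_induct)
  case empty
  have "AE x in M. T (\<lambda>y. 0 * (0::complex)) x = 0 * T (\<lambda>y. 0) x"
    by (rule bounded_operator_scale[OF T L2_zero])
  then have "AE x in M. T (\<lambda>y. 0) x = 0" by simp
  then have "l2_inner M (T (\<lambda>y. 0)) w = l2_inner M (\<lambda>x. 0) w"
    by (intro l2_inner_cong_AE) (use w bounded_operator_L2[OF T L2_zero] in \<open>auto simp: L2_measurable\<close>)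
  then show ?case by simp
next
  case (insert i A)
  have vi: "v i \<in> L2 M" and cv: "(\<lambda>x. c i * v i x) \<in> L2 M"
    and S: "(\<lambda>x. \<Sum>i\<in>A. c i * v i x) \<in> L2 M"
    using insert.prems by (auto intro!: L2_sum L2_scale)
  note TL = bounded_operator_L2[OF T]
  have ae: "AE x in M. T (\<lambda>x. c i * v i x + (\<Sum>i\<in>A. c i * v i x)) x =
      c i * T (v i) x + T (\<lambda>x. \<Sum>i\<in>A. c i * v i x) x"
    using bounded_operator_add[OF T cv S] bounded_operator_scale[OF T vi, of "c i"] by eventually_elim simp
  have "l2_inner M (T (\<lambda>x. c i * v i x + (\<Sum>i\<in>A. c i * v i x))) w =
      l2_inner M (\<lambda>x. c i * T (v i) x + T (\<lambda>x. \<Sum>i\<in>A. c i * v i x) x) w"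
    by (rule l2_inner_cong_AE[OF ae])
      (intro AE_I2 refl L2_measurable TL L2_add L2_scale cv S vi w)+
  also have "\<dots> = c i * l2_inner M (T (v i)) w + l2_inner M (T (\<lambda>x. \<Sum>i\<in>A. c i * v i x)) w"
    by (simp add: l2_inner_add_left L2_scale TL vi S w l2_inner_scale_left)
  finally show ?case using insert by simp
qed

lemma bounded_operator_inner_expand:
  assumes e: "orthonormal_basis M e" and T: "bounded_operator M T" and f: "f \<in> L2 M" and w: "w \<in> L2 M"
  shows "(\<lambda>i. l2_inner M f (e i) * l2_inner M (T (e i)) w) sums l2_inner M (T f) w"
proof -
  note L = orthonormal_basis_L2[OF e]
  note TL = bounded_operator_L2[OF T]
  obtain C where C: "0 \<le> C" "\<And>f. f \<in> L2 M \<Longrightarrow> l2_norm M (T f) \<le> C * l2_norm M f"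
    using bounded_operator_bound[OF T] by blast
  define S where "S n = (\<lambda>x. \<Sum>i<n. l2_inner M f (e i) * e i x)" for n
  have S: "S n \<in> L2 M" for n unfolding S_def by (intro L2_sum L2_scale L)
  have lim: "(\<lambda>n. l2_norm M (\<lambda>x. T (S n) x - T f x)) \<longlonglongrightarrow> 0"
  proof (rule Lim_null_comparison)
    have "(\<lambda>n. C * l2_norm M (\<lambda>x. S n x - f x)) \<longlonglongrightarrow> C * 0"
      unfolding S_def by (intro tendsto_mult tendsto_const orthonormal_expansion[OF e f])
    then show "(\<lambda>n. C * l2_norm M (\<lambda>x. S n x - f x)) \<longlonglongrightarrow> 0" by simp
    have "l2_norm M (\<lambda>x. T (S n) x - T f x) \<le> C * l2_norm M (\<lambda>x. S n x - f x)" for n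
    proof -
      have "l2_norm M (\<lambda>x. T (S n) x - T f x) = l2_norm M (T (\<lambda>x. S n x - f x))"
      proof (rule l2_norm_cong_AE)
        show "AE x in M. T (S n) x - T f x = T (\<lambda>x. S n x - f x) x"
          using bounded_operator_diff[OF T S f, of n] by eventually_elim simp
      qed (intro L2_measurable TL L2_diff S f)+
      then show ?thesis using C(2)[OF L2_diff[OF S f]] by simp
    qed
    then show "\<forall>\<^sub>F n in sequentially. norm (l2_norm M (\<lambda>x. T (S n) x - T f x)) \<le> C * l2_norm M (\<lambda>x. S n x - f x)"
      by simp
  qed
  have "(\<lambda>n. l2_inner M (T (S n)) w) \<longlonglongrightarrow> l2_inner M (T f) w"
    by (rule tendsto_l2_inner_left[OF _ _ lim w]) (intro TL S f)+
  moreover have "l2_inner M (T (S n)) w = (\<Sum>i<n. l2_inner M f (e i) * l2_inner M (T (e i)) w)" for n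
    unfolding S_def by (rule bounded_operator_inner_sum[OF T L w]) simp
  ultimately show ?thesis by (simp add: sums_def)
qed

lemma hs_norm2_double:
  assumes e: "orthonormal_basis M (onb M)" and T: "\<And>j. T (onb M j) \<in> L2 M"
  shows "hs_norm2 M T = (\<Sum>j. \<Sum>i. ennreal ((cmod (l2_inner M (T (onb M j)) (onb M i)))\<^sup>2))"
  unfolding hs_norm2_eq by (simp add: parseval_suminf[OF e T])

lemma suminf_ennreal_swap:
  fixes f :: "nat \<Rightarrow> nat \<Rightarrow> ennreal"
  shows "(\<Sum>i. \<Sum>j. f i j) = (\<Sum>j. \<Sum>i. f i j)"
proof -
  have "(\<Sum>i. \<Sum>j. f i j) = (\<integral>\<^sup>+ i. (\<Sum>j. f i j) \<partial>count_space UNIV)"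
    by (rule nn_integral_count_space_nat[symmetric])
  also have "\<dots> = (\<Sum>j. \<integral>\<^sup>+ i. f i j \<partial>count_space UNIV)"
    by (rule nn_integral_suminf) simp
  also have "\<dots> = (\<Sum>j. \<Sum>i. f i j)" by (simp only: nn_integral_count_space_nat)
  finally show ?thesis .
qed

lemma orthonormal_basis_norm: "orthonormal_basis M e \<Longrightarrow> l2_norm M (e i) = 1"
proof -
  assume "orthonormal_basis M e"
  then have "l2_inner M (e i) (e i) = 1" by (simp add: orthonormal_basis_def)
  then have "(l2_norm M (e i))\<^sup>2 = 1" unfolding l2_inner_self by (simp only: of_real_eq_1_iff)
  then show ?thesis using l2_norm_nonneg[of M "e i"] by (simp add: power2_eq_1_iff)
qed

lemma hs_norm2_inner_le:
  assumes e: "orthonormal_basis M (onb M)" and T: "\<And>j. T (onb M j) \<in> L2 M"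
  shows "(\<Sum>j. ennreal ((cmod (l2_inner M (T (onb M j)) (onb M i)))\<^sup>2)) \<le> hs_norm2 M T"
proof -
  have "ennreal ((cmod (l2_inner M (T (onb M j)) (onb M i)))\<^sup>2) \<le> ennreal ((l2_norm M (T (onb M j)))\<^sup>2)" for j
  proof (intro ennreal_leI power_mono)
    show "cmod (l2_inner M (T (onb M j)) (onb M i)) \<le> l2_norm M (T (onb M j))"
      using l2_inner_cauchy_schwarz[OF T[of j] orthonormal_basis_L2[OF e, of i]]
      by (simp add: orthonormal_basis_norm[OF e])
  qed simp
  then show ?thesis unfolding hs_norm2_eq by (intro suminf_le) auto
qed

text \<open>The vector \<open>w'\<close> is the image of \<open>w\<close> under the adjoint of
  \<open>T\<close>, built from its coefficients, the conjugates of the pairings of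
  \<open>T (onb M j)\<close> with \<open>w\<close>. Their square summability is the hypothesis
  \<open>fin\<close>, so Riesz--Fischer applies.\<close>

lemma adjoint_vector:
  assumes e: "orthonormal_basis M (onb M)" and T: "bounded_operator M T"
    and fin: "(\<Sum>j. ennreal ((cmod (l2_inner M (T (onb M j)) w))\<^sup>2)) < \<infinity>" and w: "w \<in> L2 M"
  obtains w' where "w' \<in> L2 M" "\<And>f. f \<in> L2 M \<Longrightarrow> l2_inner M (T f) w = l2_inner M f w'"
    "ennreal ((l2_norm M w')\<^sup>2) = (\<Sum>j. ennreal ((cmod (l2_inner M (T (onb M j)) w))\<^sup>2))"
proof -
  have "summable (\<lambda>j. (cmod (l2_inner M (T (onb M j)) w))\<^sup>2)"
    using fin by (intro summable_suminf_not_top) (auto simp: less_top)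
  then have "summable (\<lambda>j. (cmod (cnj (l2_inner M (T (onb M j)) w)))\<^sup>2)" by simp
  then obtain w' where w': "w' \<in> L2 M" "\<And>j. l2_inner M w' (onb M j) = cnj (l2_inner M (T (onb M j)) w)"
    by (rule riesz_fischer[OF orthonormal_basis_family[OF e]]) blast
  show ?thesis
  proof (rule that[OF w'(1)])
    fix f assume f: "f \<in> L2 M"
    have "(\<lambda>i. l2_inner M f (onb M i) * l2_inner M (T (onb M i)) w) sums l2_inner M f w'"
      using parseval_inner[OF e f w'(1)] by (simp add: w'(2))
    with bounded_operator_inner_expand[OF e T f w] show "l2_inner M (T f) w = l2_inner M f w'"
      by (rule sums_unique2)
  next
    show "ennreal ((l2_norm M w')\<^sup>2) = (\<Sum>j. ennreal ((cmod (l2_inner M (T (onb M j)) w))\<^sup>2))"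
      using parseval_suminf[OF e w'(1)] by (simp add: w'(2))
  qed
qed

text \<open>Moving \<open>T\<close> to the other side turns the pairing into one of \<open>f\<close>
  with the adjoint applied to \<open>onb M i\<close>, whose squared norm is one row of the double
  sum for the Hilbert--Schmidt norm.\<close>

lemma hs_operator_bound:
  assumes e: "orthonormal_basis M (onb M)" and T: "bounded_operator M T" and f: "f \<in> L2 M"
  shows "ennreal ((cmod (l2_inner M (T f) (onb M i)))\<^sup>2) \<le> ennreal ((l2_norm M f)\<^sup>2) * hs_norm2 M T"
proof (cases "hs_norm2 M T = \<infinity>")
  case True
  \<comment> \<open>In \<open>ennreal\<close> the product of 0 and \<infinity> is 0, so a function
    of norm 0 needs its own argument.\<close>
  show ?thesis
  proof (cases "l2_norm M f = 0")
    case True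
    then have ae: "AE x in M. f x = 0" using f by (simp add: l2_norm_eq_zero_iff)
    obtain C where "l2_norm M (T f) \<le> C * l2_norm M f" using bounded_operator_bound[OF T] f by blast
    then have "l2_norm M (T f) = 0" using True l2_norm_nonneg[of M "T f"] by simp
    then show ?thesis
      using l2_inner_cauchy_schwarz[OF bounded_operator_L2[OF T f] orthonormal_basis_L2[OF e, of i]] by simp
  qed (use True in \<open>simp add: ennreal_mult_top\<close>)
next
  case False
  have le: "(\<Sum>j. ennreal ((cmod (l2_inner M (T (onb M j)) (onb M i)))\<^sup>2)) \<le> hs_norm2 M T"
    by (intro hs_norm2_inner_le e bounded_operator_L2[OF T] orthonormal_basis_L2[OF e])
  then have "(\<Sum>j. ennreal ((cmod (l2_inner M (T (onb M j)) (onb M i)))\<^sup>2)) < \<infinity>"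
    by (rule le_less_trans) (use False in \<open>simp add: less_top\<close>)
  then obtain w' where w': "w' \<in> L2 M" "\<And>f. f \<in> L2 M \<Longrightarrow> l2_inner M (T f) (onb M i) = l2_inner M f w'"
    "ennreal ((l2_norm M w')\<^sup>2) = (\<Sum>j. ennreal ((cmod (l2_inner M (T (onb M j)) (onb M i)))\<^sup>2))"
    using adjoint_vector[OF e T _ orthonormal_basis_L2[OF e, of i]] by blast
  have "ennreal ((cmod (l2_inner M (T f) (onb M i)))\<^sup>2) \<le> ennreal ((l2_norm M f * l2_norm M w')\<^sup>2)"
    unfolding w'(2)[OF f] by (intro ennreal_leI power_mono l2_inner_cauchy_schwarz f w'(1)) simp
  also have "\<dots> = ennreal ((l2_norm M f)\<^sup>2) * ennreal ((l2_norm M w')\<^sup>2)"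
    by (simp add: power_mult_distrib ennreal_mult)
  also have "\<dots> \<le> ennreal ((l2_norm M f)\<^sup>2) * hs_norm2 M T"
    unfolding w'(3) by (intro mult_left_mono le) simp
  finally show ?thesis .
qed

section \<open>Orthogonal projections, their traces and ranks\<close>

lemma orthogonal_projectionD:
  assumes "orthogonal_projection M P"
  shows projection_bounded: "bounded_operator M P"
    and projection_idem: "f \<in> L2 M \<Longrightarrow> AE x in M. P (P f) x = P f x"
    and projection_selfadjoint: "f \<in> L2 M \<Longrightarrow> g \<in> L2 M \<Longrightarrow> l2_inner M (P f) g = l2_inner M f (P g)"
  using assms by (simp_all add: orthogonal_projection_def)

lemma projection_norm_le:
  assumes P: "orthogonal_projection M P" and f: "f \<in> L2 M"
  shows "l2_norm M (P f) \<le> l2_norm M f"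
proof -
  note PL = bounded_operator_L2[OF projection_bounded[OF P]]
  have "l2_inner M (P f) (P f) = l2_inner M f (P (P f))"
    by (rule projection_selfadjoint[OF P f PL[OF f]])
  also have "\<dots> = l2_inner M f (P f)"
    by (rule l2_inner_cong_AE) (use projection_idem[OF P f] PL f in \<open>auto simp: L2_measurable\<close>)
  finally have "(l2_norm M (P f))\<^sup>2 = cmod (l2_inner M f (P f))"
    unfolding l2_inner_self by (metis norm_of_real abs_power2)
  also have "\<dots> \<le> l2_norm M f * l2_norm M (P f)"
    by (rule l2_inner_cauchy_schwarz[OF f PL[OF f]])
  finally have "l2_norm M (P f) * l2_norm M (P f) \<le> l2_norm M f * l2_norm M (P f)"
    by (simp add: power2_eq_square)
  then show ?thesis
    using l2_norm_nonneg[of M "P f"] l2_norm_nonneg[of M f]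
    by (cases "l2_norm M (P f) = 0") (auto simp: mult_le_cancel_right)
qed

text \<open>\<open>\<Vert>TP\<Vert>\<^sub>H\<^sub>S \<le> \<Vert>T\<Vert>\<^sub>H\<^sub>S\<close>, by passing to the adjoint \<open>P T\<^sup>*\<close>.\<close>

lemma hs_norm2_comp_projection_le:
  assumes e: "orthonormal_basis M (onb M)" and T: "hilbert_schmidt M T" and P: "orthogonal_projection M P"
  shows "(\<Sum>j. ennreal ((l2_norm M (T (P (onb M j))))\<^sup>2)) \<le> hs_norm2 M T"
proof -
  have Tb: "bounded_operator M T" and fin: "hs_norm2 M T < \<infinity>" using T by (auto simp: hilbert_schmidt_def)
  note L = orthonormal_basis_L2[OF e]
  note TL = bounded_operator_L2[OF Tb]
  note PL = bounded_operator_L2[OF projection_bounded[OF P]]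
  have "(\<Sum>j. ennreal ((l2_norm M (T (P (onb M j))))\<^sup>2)) =
      (\<Sum>j. \<Sum>i. ennreal ((cmod (l2_inner M (T (P (onb M j))) (onb M i)))\<^sup>2))"
    by (simp add: parseval_suminf[OF e TL[OF PL[OF L]]])
  also have "\<dots> = (\<Sum>i. \<Sum>j. ennreal ((cmod (l2_inner M (T (P (onb M j))) (onb M i)))\<^sup>2))"
    by (rule suminf_ennreal_swap)
  also have "\<dots> \<le> (\<Sum>i. \<Sum>j. ennreal ((cmod (l2_inner M (T (onb M j)) (onb M i)))\<^sup>2))"
  proof (rule suminf_le)
    fix i
    have "(\<Sum>j. ennreal ((cmod (l2_inner M (T (onb M j)) (onb M i)))\<^sup>2)) < \<infinity>"
      using hs_norm2_inner_le[of M T, OF e TL[OF L]] fin by (rule le_less_trans)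
    then obtain w where w: "w \<in> L2 M" "\<And>f. f \<in> L2 M \<Longrightarrow> l2_inner M (T f) (onb M i) = l2_inner M f w"
      "ennreal ((l2_norm M w)\<^sup>2) = (\<Sum>j. ennreal ((cmod (l2_inner M (T (onb M j)) (onb M i)))\<^sup>2))"
      using adjoint_vector[OF e Tb _ L[of i]] by blast
    have "cmod (l2_inner M (T (P (onb M j))) (onb M i)) = cmod (l2_inner M (P w) (onb M j))" for j
      unfolding w(2)[OF PL[OF L]] projection_selfadjoint[OF P L w(1)]
      by (subst l2_inner_commute) simp
    then have "(\<Sum>j. ennreal ((cmod (l2_inner M (T (P (onb M j))) (onb M i)))\<^sup>2)) = ennreal ((l2_norm M (P w))\<^sup>2)"
      by (simp add: parseval_suminf[OF e PL[OF w(1)]])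
    also have "\<dots> \<le> ennreal ((l2_norm M w)\<^sup>2)"
      by (intro ennreal_leI power_mono projection_norm_le P w(1)) simp
    finally show "(\<Sum>j. ennreal ((cmod (l2_inner M (T (P (onb M j))) (onb M i)))\<^sup>2)) \<le>
        (\<Sum>j. ennreal ((cmod (l2_inner M (T (onb M j)) (onb M i)))\<^sup>2))"
      unfolding w(3) .
  qed auto
  also have "\<dots> = hs_norm2 M T"
    unfolding hs_norm2_double[of M T, OF e TL[OF L]] by (rule suminf_ennreal_swap)
  finally show ?thesis .
qed

text \<open>The coefficients \<open>c\<close> are carried through the induction so that the next
  residual is known to be a combination of the \<open>v j\<close>; independence is about such
  combinations and is what makes the residual nonzero.\<close>

lemma gram_schmidt:
  assumes v: "\<And>i. i < n \<Longrightarrow> v i \<in> V" and V: "V \<subseteq> L2 M"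
    and add: "\<And>f g. f \<in> V \<Longrightarrow> g \<in> V \<Longrightarrow> (\<lambda>x. f x + g x) \<in> V"
    and scale: "\<And>c f. f \<in> V \<Longrightarrow> (\<lambda>x. c * f x) \<in> V"
    and indep: "lin_indep M n v"
  shows "\<exists>u c. orthonormal_family M {..<n} u \<and> (\<forall>i<n. u i \<in> V \<and> (\<forall>x. u i x = (\<Sum>j<n. c i j * v j x)))"
  using v indep
proof (induction n)
  case 0
  then show ?case by (simp add: orthonormal_family_def)
next
  case (Suc n)
  have "lin_indep M n v"
    unfolding lin_indep_def
  proof (intro allI impI)
    fix c i assume c: "AE x in M. (\<Sum>i<n. c i * v i x) = 0" and i: "i < n"
    have "AE x in M. (\<Sum>i<Suc n. (if i < n then c i else 0) * v i x) = 0" using c by simp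
    then have "\<forall>i<Suc n. (if i < n then c i else 0) = 0"
      by (rule spec[OF Suc.prems(2)[unfolded lin_indep_def], THEN mp])
    from this[rule_format, of i] i show "c i = 0" by simp
  qed
  then obtain u c where u: "orthonormal_family M {..<n} u"
    and uV: "\<And>i. i < n \<Longrightarrow> u i \<in> V" and uc: "\<And>i x. i < n \<Longrightarrow> u i x = (\<Sum>j<n. c i j * v j x)"
    using Suc.IH Suc.prems(1) by (auto simp: less_Suc_eq)
  define a where "a i = l2_inner M (v n) (u i)" for i
  \<comment> \<open>Coefficients of the residual \<open>r\<close> in the \<open>v j\<close>. The
    entry 1 at \<open>n\<close> contradicts independence if \<open>r\<close> has norm 0.\<close>
  define d where "d j = (if j = n then 1 else - (\<Sum>i<n. a i * c i j))" for j
  define r where "r = (\<lambda>x. v n x + (\<Sum>i<n. - a i * u i x))"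
  have vn: "v n \<in> V" using Suc.prems(1) by simp
  have zero: "(\<lambda>x. 0) \<in> V" using scale[OF vn, of 0] by simp
  have "(\<lambda>x. \<Sum>i\<in>A. - a i * u i x) \<in> V" if "finite A" "A \<subseteq> {..<n}" for A
    using that
  proof (induction A rule: finite_induct)
    case (insert i A)
    then have "(\<lambda>x. - a i * u i x + (\<Sum>i\<in>A. - a i * u i x)) \<in> V" by (intro add scale uV) auto
    with insert show ?case by simp
  qed (simp add: zero)
  then have sV: "(\<lambda>x. \<Sum>i<n. - a i * u i x) \<in> V" by blast
  have rV: "r \<in> V" unfolding r_def by (intro add vn sV)
  have rL: "r \<in> L2 M" and vnL: "v n \<in> L2 M" and uL: "\<And>i. i < n \<Longrightarrow> u i \<in> L2 M"
    using rV vn uV V by auto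
  have rd: "r x = (\<Sum>j<Suc n. d j * v j x)" for x
  proof -
    have "(\<Sum>i<n. - a i * u i x) = (\<Sum>i<n. \<Sum>j<n. - (a i * c i j) * v j x)"
      by (simp add: uc sum_distrib_left sum_negf mult.assoc)
    also have "\<dots> = (\<Sum>j<n. \<Sum>i<n. - (a i * c i j) * v j x)" by (rule sum.swap)
    also have "\<dots> = (\<Sum>j<n. d j * v j x)" by (simp add: d_def sum_distrib_right sum_negf)
    finally show ?thesis by (simp add: r_def d_def)
  qed
  have rn: "l2_norm M r \<noteq> 0"
  proof
    assume "l2_norm M r = 0"
    then have "AE x in M. (\<Sum>j<Suc n. d j * v j x) = 0"
      using l2_norm_eq_zero_iff[OF rL] by (simp only: rd)
    then have "d n = 0" using Suc.prems(2) unfolding lin_indep_def by blast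
    then show False by (simp add: d_def)
  qed
  have orth: "l2_inner M r (u i) = 0" if i: "i < n" for i
  proof -
    have "l2_inner M r (u i) = l2_inner M (v n) (u i) + (\<Sum>k<n. - a k * l2_inner M (u k) (u i))"
    proof -
      have sL: "(\<lambda>x. \<Sum>k<n. - a k * u k x) \<in> L2 M" using sV V by blast
      have "l2_inner M (\<lambda>x. \<Sum>k<n. - a k * u k x) (u i) = (\<Sum>k<n. l2_inner M (\<lambda>x. - a k * u k x) (u i))"
        by (rule l2_inner_sum_left[OF L2_scale[OF uL] uL[OF i]]) simp
      then show ?thesis
        unfolding r_def l2_inner_add_left[OF vnL sL uL[OF i]] by (simp only: l2_inner_scale_left)
    qed
    also have "(\<Sum>k<n. - a k * l2_inner M (u k) (u i)) = (\<Sum>k<n. if k = i then - a i else 0)"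
      using u i by (intro sum.cong) (auto simp: orthonormal_family_def)
    also have "\<dots> = - a i" using i by simp
    finally show ?thesis by (simp add: a_def)
  qed
  define un where "un = (\<lambda>x. complex_of_real (1 / l2_norm M r) * r x)"
  have unV: "un \<in> V" unfolding un_def by (rule scale[OF rV])
  have un1: "l2_inner M un un = 1"
    unfolding un_def l2_inner_scale_left l2_inner_scale_right l2_inner_self using rn
    by (simp add: power2_eq_square)
  have un0: "l2_inner M un (u i) = 0" "l2_inner M (u i) un = 0" if "i < n" for i
    unfolding un_def l2_inner_scale_left l2_inner_scale_right l2_inner_commute[of M "u i" r] orth[OF that]
    by simp_all
  define u' where "u' = u(n := un)"
  define c' where "c' = (\<lambda>i j. if i = n then complex_of_real (1 / l2_norm M r) * d j else if j = n then 0 else c i j)"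
  have "orthonormal_family M {..<Suc n} u'"
    unfolding orthonormal_family_def u'_def
    using u uL un1 un0 unV V by (auto simp: less_Suc_eq orthonormal_family_def)
  moreover have "u' i \<in> V \<and> (\<forall>x. u' i x = (\<Sum>j<Suc n. c' i j * v j x))" if "i < Suc n" for i
  proof (cases "i = n")
    case True
    then show ?thesis using unV
      by (auto simp: u'_def un_def c'_def rd sum_distrib_left mult.assoc distrib_left simp del: of_real_divide)
  next
    case False
    then have "i < n" using that by simp
    then show ?thesis using uV by (auto simp: u'_def c'_def uc intro!: sum.cong)
  qed
  ultimately show ?case by blast
qed

text \<open>The squared Hilbert--Schmidt norm of a projection is its trace. Each of \<open>n\<close>
  orthonormal vectors in the range contributes exactly 1, by Parseval over the basis, and by Bessel
  the contributions at one basis vector add up to at most the squared norm of its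
  projection.\<close>

lemma operator_rank_le_hs_norm2:
  assumes e: "orthonormal_basis M (onb M)" and P: "orthogonal_projection M P"
  shows "ennreal_of_enat (operator_rank M P) \<le> hs_norm2 M P"
proof -
  note L = orthonormal_basis_L2[OF e]
  note PL = bounded_operator_L2[OF projection_bounded[OF P]]
  \<comment> \<open>Functions fixed by \<open>P\<close> almost everywhere. This set contains the
    image of \<open>P\<close> and, as it ignores the choice of representatives, is closed under
    pointwise sums and multiples, as \<open>gram_schmidt\<close> requires.\<close>
  define V where "V = {f \<in> L2 M. AE x in M. P f x = f x}"
  have bound: "ennreal (real n) \<le> hs_norm2 M P" if v: "\<forall>i<n. v i \<in> P ` L2 M" "lin_indep M n v" for n v
  proof -
    have "v i \<in> V" if "i < n" for i
      using v(1) that projection_idem[OF P] PL by (auto simp: V_def)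
    moreover have "(\<lambda>x. f x + g x) \<in> V" if "f \<in> V" "g \<in> V" for f g
    proof -
      have "AE x in M. P (\<lambda>x. f x + g x) x = f x + g x"
        using that bounded_operator_add[OF projection_bounded[OF P], of f g] unfolding V_def
        by (auto elim: eventually_elim2 eventually_rev_mp)
      with that show ?thesis by (simp add: V_def L2_add)
    qed
    moreover have "(\<lambda>x. c * f x) \<in> V" if "f \<in> V" for c f
    proof -
      have f: "f \<in> L2 M" "AE x in M. P f x = f x" using that by (auto simp: V_def)
      have "AE x in M. P (\<lambda>x. c * f x) x = c * f x"
        using bounded_operator_scale[OF projection_bounded[OF P] f(1), of c] f(2) by eventually_elim simp
      with f show ?thesis by (simp add: V_def L2_scale)
    qed
    ultimately obtain u where u: "orthonormal_family M {..<n} u" "\<And>i. i < n \<Longrightarrow> u i \<in> V"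
      using gram_schmidt[of n v V M] v(2) unfolding V_def by blast
    have uL: "u i \<in> L2 M" and uP: "AE x in M. P (u i) x = u i x" if "i < n" for i
      using u(2)[OF that] by (auto simp: V_def)
    have one: "(\<Sum>j. ennreal ((cmod (l2_inner M (P (onb M j)) (u i)))\<^sup>2)) = 1" if i: "i < n" for i
    proof -
      have "cmod (l2_inner M (P (onb M j)) (u i)) = cmod (l2_inner M (u i) (onb M j))" for j
      proof -
        have "l2_inner M (P (onb M j)) (u i) = l2_inner M (onb M j) (P (u i))"
          by (rule projection_selfadjoint[OF P L uL[OF i]])
        also have "\<dots> = l2_inner M (onb M j) (u i)"
          by (rule l2_inner_cong_AE) (use uP[OF i] L uL[OF i] PL in \<open>auto simp: L2_measurable\<close>)
        finally show ?thesis by (subst (2) l2_inner_commute) simp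
      qed
      moreover have "(l2_norm M (u i))\<^sup>2 = 1"
      proof -
        have "l2_inner M (u i) (u i) = 1" using u(1) i by (simp add: orthonormal_family_def)
        then show ?thesis unfolding l2_inner_self by (simp only: of_real_eq_1_iff)
      qed
      ultimately show ?thesis by (simp add: parseval_suminf[OF e uL[OF i]])
    qed
    have "ennreal (real n) = (\<Sum>i<n. \<Sum>j. ennreal ((cmod (l2_inner M (P (onb M j)) (u i)))\<^sup>2))"
    proof -
      have "(\<Sum>i<n. \<Sum>j. ennreal ((cmod (l2_inner M (P (onb M j)) (u i)))\<^sup>2)) = (\<Sum>i<n. 1)"
        by (rule sum.cong[OF refl]) (simp only: one lessThan_iff)
      then show ?thesis by (simp add: ennreal_of_nat_eq_real_of_nat)
    qed
    also have "\<dots> = (\<Sum>j. \<Sum>i<n. ennreal ((cmod (l2_inner M (P (onb M j)) (u i)))\<^sup>2))"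
      by (rule suminf_sum[symmetric]) simp
    also have "\<dots> \<le> hs_norm2 M P"
      unfolding hs_norm2_eq
    proof (rule suminf_le)
      show "(\<Sum>i<n. ennreal ((cmod (l2_inner M (P (onb M j)) (u i)))\<^sup>2)) \<le> ennreal ((l2_norm M (P (onb M j)))\<^sup>2)" for j
        using bessel[OF u(1) _ PL[OF L]] by (subst sum_ennreal) (auto intro!: ennreal_leI)
    qed auto
    finally show ?thesis .
  qed
  show ?thesis
  proof (cases "hs_norm2 M P")
    case (real r)
    \<comment> \<open>The rank is a supremum of natural numbers, so a real bound may be rounded
      down.\<close>
    have "operator_rank M P \<le> enat (nat \<lfloor>r\<rfloor>)"
      unfolding operator_rank_def
    proof (rule Sup_least, clarify)
      fix n v assume "\<forall>i<n. v i \<in> P ` L2 M" "lin_indep M n v"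
      then have "real n \<le> r" using bound[of n v] real by simp
      then show "enat n \<le> enat (nat \<lfloor>r\<rfloor>)" by (simp add: le_nat_floor)
    qed
    then have "ennreal_of_enat (operator_rank M P) \<le> ennreal_of_enat (enat (nat \<lfloor>r\<rfloor>))"
      by (rule iffD2[OF ennreal_of_enat_le_iff])
    also have "\<dots> = ennreal (real (nat \<lfloor>r\<rfloor>))" by (simp add: ennreal_of_nat_eq_real_of_nat)
    also have "\<dots> \<le> ennreal r" using real by (intro ennreal_leI) simp
    finally show ?thesis using real by simp
  qed simp
qed

section \<open>Rank-one operators, tensor spans, operators given by their rows\<close>

lemma bounded_operator_rank_one:
  assumes f: "f \<in> L2 M" and u: "u \<in> L2 M"
  shows "bounded_operator M (rank_one M f u)"
  unfolding bounded_operator_def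
proof (intro conjI ballI allI)
  show "rank_one M f u h \<in> L2 M" for h unfolding rank_one_def by (rule L2_scale[OF f])
  show "AE x in M. rank_one M f u (\<lambda>y. g y + h y) x = rank_one M f u g x + rank_one M f u h x"
    if "g \<in> L2 M" "h \<in> L2 M" for g h
    using that u by (simp add: rank_one_def l2_inner_add_left distrib_right)
  show "AE x in M. rank_one M f u (\<lambda>y. c * h y) x = c * rank_one M f u h x" for c h
    by (simp add: rank_one_def l2_inner_scale_left)
  show "\<exists>C. \<forall>h\<in>L2 M. l2_norm M (rank_one M f u h) \<le> C * l2_norm M h"
  proof (intro exI ballI)
    fix h assume "h \<in> L2 M"
    from mult_right_mono[OF l2_inner_cauchy_schwarz[OF this u] l2_norm_nonneg[of M f]]
    show "l2_norm M (rank_one M f u h) \<le> (l2_norm M u * l2_norm M f) * l2_norm M h"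
      unfolding rank_one_def l2_norm_scale by (simp only: mult_ac)
  qed
qed

lemma hs_norm2_rank_one:
  assumes e: "orthonormal_basis M (onb M)" and u: "u \<in> L2 M"
  shows "hs_norm2 M (rank_one M f u) = ennreal ((l2_norm M f)\<^sup>2 * (l2_norm M u)\<^sup>2)"
proof -
  have "ennreal ((l2_norm M (rank_one M f u (onb M i)))\<^sup>2) =
      ennreal ((l2_norm M f)\<^sup>2) * ennreal ((cmod (l2_inner M u (onb M i)))\<^sup>2)" for i
    unfolding rank_one_def l2_norm_scale
    by (subst l2_inner_commute) (simp add: power_mult_distrib ennreal_mult mult.commute)
  then show ?thesis
    unfolding hs_norm2_eq by (simp add: parseval_suminf[OF e u] ennreal_mult)
qed

lemma hs_norm2_zero [simp]: "hs_norm2 M (\<lambda>h x. 0) = 0"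
  by (simp add: hs_norm2_eq)

lemma hs_norm2_scale: "hs_norm2 M (\<lambda>h x. c * T h x) = ennreal ((cmod c)\<^sup>2) * hs_norm2 M T"
  unfolding hs_norm2_eq by (simp add: l2_norm_scale power_mult_distrib ennreal_mult)

lemma bounded_operator_scaled:
  assumes T: "bounded_operator M T"
  shows "bounded_operator M (\<lambda>h x. c * T h x)"
  unfolding bounded_operator_def
proof (intro conjI ballI allI)
  show "(\<lambda>x. c * T h x) \<in> L2 M" if "h \<in> L2 M" for h
    by (rule L2_scale[OF bounded_operator_L2[OF T that]])
  show "AE x in M. c * T (\<lambda>y. g y + h y) x = c * T g x + c * T h x"
    if "g \<in> L2 M" "h \<in> L2 M" for g h
    using bounded_operator_add[OF T that] by eventually_elim (simp add: distrib_left)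
  show "AE x in M. c * T (\<lambda>y. d * h y) x = d * (c * T h x)" if "h \<in> L2 M" for d h
    using bounded_operator_scale[OF T that, of d] by eventually_elim simp
  obtain C where C: "\<And>f. f \<in> L2 M \<Longrightarrow> l2_norm M (T f) \<le> C * l2_norm M f"
    using bounded_operator_bound[OF T] by blast
  show "\<exists>C. \<forall>h\<in>L2 M. l2_norm M (\<lambda>x. c * T h x) \<le> C * l2_norm M h"
  proof (intro exI ballI)
    fix h assume "h \<in> L2 M"
    from mult_left_mono[OF C[OF this] norm_ge_zero[of c]]
    show "l2_norm M (\<lambda>x. c * T h x) \<le> (cmod c * C) * l2_norm M h"
      by (simp add: l2_norm_scale mult.assoc)
  qed
qed

lemma hilbert_schmidt_scaled: "hilbert_schmidt M T \<Longrightarrow> hilbert_schmidt M (\<lambda>h x. c * T h x)"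
  unfolding hilbert_schmidt_def
  by (auto simp: bounded_operator_scaled hs_norm2_scale ennreal_mult_less_top)

lemma hilbert_schmidt_rank_one:
  "orthonormal_basis M (onb M) \<Longrightarrow> f \<in> L2 M \<Longrightarrow> u \<in> L2 M \<Longrightarrow> hilbert_schmidt M (rank_one M f u)"
  by (simp add: hilbert_schmidt_def bounded_operator_rank_one hs_norm2_rank_one)

lemma rank_one_in_l2_tensor:
  assumes e: "orthonormal_basis M (onb M)" and f: "f \<in> L2 M" and u: "u \<in> L2 M" "u \<in> V"
  shows "rank_one M f u \<in> l2_tensor M V"
  unfolding l2_tensor_def
proof (intro CollectI conjI allI impI)
  show "hilbert_schmidt M (rank_one M f u)" by (rule hilbert_schmidt_rank_one[OF e f u(1)])
  fix \<epsilon> :: real assume "\<epsilon> > 0"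
  then show "\<exists>n fa ua. (\<forall>i<n::nat. fa i \<in> L2 M \<and> ua i \<in> V) \<and>
      hs_norm2 M (\<lambda>h x. rank_one M f u h x - (\<Sum>i<n. rank_one M (fa i) (ua i) h x)) < ennreal \<epsilon>"
    using f u by (intro exI[of _ 1] exI[of _ "\<lambda>_. f"] exI[of _ "\<lambda>_. u"]) simp
qed

text \<open>Applied with \<open>c\<close> the value of an indicator function: it shows that cutting
  a field off to a set of frequencies stays inside the image of \<open>K\<close>.\<close>

lemma l2_tensor_scaled:
  assumes T: "T \<in> l2_tensor M V"
  shows "(\<lambda>h x. c * T h x) \<in> l2_tensor M V"
  unfolding l2_tensor_def
proof (intro CollectI conjI allI impI)
  show "hilbert_schmidt M (\<lambda>h x. c * T h x)"
    using T by (intro hilbert_schmidt_scaled) (simp add: l2_tensor_def)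
  fix \<epsilon> :: real assume \<epsilon>: "\<epsilon> > 0"
  define \<delta> where "\<delta> = \<epsilon> / ((cmod c)\<^sup>2 + 1)"
  have "\<delta> > 0" using \<epsilon> by (simp add: \<delta>_def add_nonneg_pos)
  then obtain n f u where nfu: "\<forall>i<n::nat. f i \<in> L2 M \<and> u i \<in> V"
    "hs_norm2 M (\<lambda>h x. T h x - (\<Sum>i<n. rank_one M (f i) (u i) h x)) < ennreal \<delta>"
    using T unfolding l2_tensor_def by blast
  have "hs_norm2 M (\<lambda>h x. c * T h x - (\<Sum>i<n. rank_one M (\<lambda>x. c * f i x) (u i) h x)) =
      ennreal ((cmod c)\<^sup>2) * hs_norm2 M (\<lambda>h x. T h x - (\<Sum>i<n. rank_one M (f i) (u i) h x))"
    unfolding hs_norm2_scale[symmetric]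
    by (simp add: rank_one_def right_diff_distrib sum_distrib_left mult.left_commute)
  also have "\<dots> \<le> ennreal ((cmod c)\<^sup>2) * ennreal \<delta>"
    using nfu(2) by (intro mult_left_mono) auto
  also have "\<dots> = ennreal ((cmod c)\<^sup>2 * \<delta>)" using \<open>\<delta> > 0\<close> by (simp add: ennreal_mult)
  also have "\<dots> < ennreal \<epsilon>"
    using \<epsilon> by (intro ennreal_lessI) (auto simp: \<delta>_def divide_simps add_nonneg_pos)
  finally show "\<exists>n f u. (\<forall>i<n::nat. f i \<in> L2 M \<and> u i \<in> V) \<and>
      hs_norm2 M (\<lambda>h x. c * T h x - (\<Sum>i<n. rank_one M (f i) (u i) h x)) < ennreal \<epsilon>"
    using nfu(1) by (intro exI[of _ n] exI[of _ "\<lambda>i x. c * f i x"] exI[of _ u]) (auto intro: L2_scale)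
qed

text \<open>Every finite sum of rank-one operators with second factors in \<open>V\<close> acts as
  zero on the basis, so its distance from \<open>T\<close> is the norm of \<open>T\<close> itself
  and cannot be made smaller.\<close>

lemma l2_tensor_trivial:
  assumes T: "T \<in> l2_tensor M V" and V: "\<And>u. u \<in> V \<Longrightarrow> AE x in M. u x = 0" "V \<subseteq> L2 M"
    and e: "orthonormal_basis M (onb M)"
  shows "hs_norm2 M T = 0"
proof (rule ccontr)
  assume nz: "hs_norm2 M T \<noteq> 0"
  have "hs_norm2 M T < \<infinity>" using T by (simp add: l2_tensor_def hilbert_schmidt_def)
  then obtain r where r: "hs_norm2 M T = ennreal r" "r > 0"
    using nz by (cases "hs_norm2 M T") auto
  obtain n f u where nfu: "\<forall>i<n::nat. f i \<in> L2 M \<and> u i \<in> V"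
    "hs_norm2 M (\<lambda>h x. T h x - (\<Sum>i<n. rank_one M (f i) (u i) h x)) < ennreal r"
    using T r(2) unfolding l2_tensor_def by blast
  have "l2_inner M (onb M j) (u i) = 0" if "i < n" for i j
  proof -
    have u: "u i \<in> L2 M" "AE x in M. u i x = 0" using nfu(1) that V by auto
    then have "l2_norm M (u i) = 0" by (simp add: l2_norm_eq_zero_iff)
    then show ?thesis using l2_inner_cauchy_schwarz[OF orthonormal_basis_L2[OF e] u(1), of j] by simp
  qed
  then have "hs_norm2 M (\<lambda>h x. T h x - (\<Sum>i<n. rank_one M (f i) (u i) h x)) = hs_norm2 M T"
    unfolding hs_norm2_eq by (simp add: rank_one_def)
  with nfu(2) r show False by simp
qed

text \<open>The operator whose matrix has the vectors \<open>w i\<close> as conjugated rows. It is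
  given by the coordinates of its values, so the choice of representatives leaves it linear almost
  everywhere.\<close>

definition row_operator :: "'a measure \<Rightarrow> (nat \<Rightarrow> 'a \<Rightarrow> complex) \<Rightarrow> 'a l2_operator" where
  "row_operator M w h = (SOME g. g \<in> L2 M \<and> (\<forall>i. l2_inner M g (onb M i) = l2_inner M h (w i)))"

lemma row_operator:
  assumes e: "orthonormal_basis M (onb M)" and w: "\<And>i. w i \<in> L2 M"
    and sum: "summable (\<lambda>i. (l2_norm M (w i))\<^sup>2)" and h: "h \<in> L2 M"
  shows row_operator_L2: "row_operator M w h \<in> L2 M"
    and row_operator_inner: "l2_inner M (row_operator M w h) (onb M i) = l2_inner M h (w i)"
proof -
  have "summable (\<lambda>i. (cmod (l2_inner M h (w i)))\<^sup>2)"
  proof (rule summable_comparison_test)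
    show "summable (\<lambda>i. (l2_norm M h)\<^sup>2 * (l2_norm M (w i))\<^sup>2)" by (rule summable_mult[OF sum])
    show "\<exists>N. \<forall>i\<ge>N. norm ((cmod (l2_inner M h (w i)))\<^sup>2) \<le> (l2_norm M h)\<^sup>2 * (l2_norm M (w i))\<^sup>2"
      using power_mono[OF l2_inner_cauchy_schwarz[OF h w], of _ 2] by (simp add: power_mult_distrib)
  qed
  then obtain g where "g \<in> L2 M" "\<And>i. l2_inner M g (onb M i) = l2_inner M h (w i)"
    by (rule riesz_fischer[OF orthonormal_basis_family[OF e]]) blast
  then have "\<exists>g. g \<in> L2 M \<and> (\<forall>i. l2_inner M g (onb M i) = l2_inner M h (w i))" by blast
  from someI_ex[OF this, folded row_operator_def]
  show "row_operator M w h \<in> L2 M" "l2_inner M (row_operator M w h) (onb M i) = l2_inner M h (w i)"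
    by auto
qed

lemma orthonormal_basis_ext:
  assumes e: "orthonormal_basis M e" and f: "f \<in> L2 M" and g: "g \<in> L2 M"
    and eq: "\<And>i. l2_inner M f (e i) = l2_inner M g (e i)"
  shows "AE x in M. f x = g x"
proof -
  have "\<forall>i. l2_inner M (\<lambda>x. f x - g x) (e i) = 0"
    using eq f g orthonormal_basis_L2[OF e] by (simp add: l2_inner_diff_left)
  then have "AE x in M. f x - g x = 0"
    using e L2_diff[OF f g] unfolding orthonormal_basis_def by blast
  then show ?thesis by simp
qed

lemma bounded_row_operator:
  assumes e: "orthonormal_basis M (onb M)" and w: "\<And>i. w i \<in> L2 M"
    and sum: "summable (\<lambda>i. (l2_norm M (w i))\<^sup>2)"
  shows "bounded_operator M (row_operator M w)"
  unfolding bounded_operator_def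
proof (intro conjI ballI allI)
  note L = row_operator_L2[OF e w sum]
  note I = row_operator_inner[OF e w sum]
  note eL = orthonormal_basis_L2[OF e]
  show "row_operator M w h \<in> L2 M" if "h \<in> L2 M" for h by (rule L[OF that])
  show "AE x in M. row_operator M w (\<lambda>y. f y + g y) x = row_operator M w f x + row_operator M w g x"
    if "f \<in> L2 M" "g \<in> L2 M" for f g
    by (rule orthonormal_basis_ext[OF e])
      (use that w in \<open>simp_all add: L L2_add I eL l2_inner_add_left\<close>)
  show "AE x in M. row_operator M w (\<lambda>y. c * f y) x = c * row_operator M w f x"
    if "f \<in> L2 M" for c f
    by (rule orthonormal_basis_ext[OF e])
      (use that w in \<open>simp_all add: L L2_scale I eL l2_inner_scale_left\<close>)
  show "\<exists>C. \<forall>f\<in>L2 M. l2_norm M (row_operator M w f) \<le> C * l2_norm M f"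
  proof (intro exI ballI)
    fix f assume f: "f \<in> L2 M"
    have s: "(\<lambda>i. (cmod (l2_inner M f (w i)))\<^sup>2) sums (l2_norm M (row_operator M w f))\<^sup>2"
      using parseval_sums[OF e L[OF f]] by (simp add: I[OF f])
    have "(l2_norm M (row_operator M w f))\<^sup>2 \<le> (\<Sum>i. (l2_norm M f)\<^sup>2 * (l2_norm M (w i))\<^sup>2)"
      unfolding sums_unique[OF s]
    proof (rule suminf_le)
      show "(cmod (l2_inner M f (w i)))\<^sup>2 \<le> (l2_norm M f)\<^sup>2 * (l2_norm M (w i))\<^sup>2" for i
        using power_mono[OF l2_inner_cauchy_schwarz[OF f w], of i 2] by (simp add: power_mult_distrib)
    qed (use s sum in \<open>auto simp: sums_iff intro: summable_mult\<close>)
    also have "\<dots> = (sqrt (\<Sum>i. (l2_norm M (w i))\<^sup>2) * l2_norm M f)\<^sup>2"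
      by (simp add: suminf_mult[OF sum] power_mult_distrib suminf_nonneg[OF sum])
    finally show "l2_norm M (row_operator M w f) \<le> sqrt (\<Sum>i. (l2_norm M (w i))\<^sup>2) * l2_norm M f"
      by (rule power2_le_imp_le) (simp add: suminf_nonneg[OF sum])
  qed
qed

context two_step
begin

subsection \<open>Coordinates on the group\<close>

definition Zs :: "real^'k \<Rightarrow> 'v" where "Zs z = (\<Sum>k\<in>UNIV. z $ k *\<^sub>R Z k)"
definition Ys :: "real^'d \<Rightarrow> 'v" where "Ys y = (\<Sum>j\<in>UNIV. y $ j *\<^sub>R Y j)"
definition Xs :: "real^'d \<Rightarrow> 'v" where "Xs t = (\<Sum>j\<in>UNIV. t $ j *\<^sub>R X j)"

text \<open>Plain coordinates in the given basis. The map \<open>chart\<close> is a product of three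
  exponentials instead; \<open>chart_eq\<close> gives the quadratic correction between the
  two.\<close>

definition lin_chart :: "(real^'k) \<times> (real^'d) \<times> (real^'d) \<Rightarrow> 'v" where
  "lin_chart p = Zs (fst p) + Ys (fst (snd p)) + Xs (snd (snd p))"

lemma linear_Zs: "linear Zs" and linear_Ys: "linear Ys" and linear_Xs: "linear Xs"
  unfolding Zs_def Ys_def Xs_def
  by (auto intro!: linearI simp: scaleR_add_left sum.distrib scaleR_sum_right)

lemma linear_lin_chart: "linear lin_chart"
  by (rule linearI)
    (simp_all add: lin_chart_def linear_add[OF linear_Zs] linear_add[OF linear_Ys] linear_add[OF linear_Xs]
      linear_scale[OF linear_Zs] linear_scale[OF linear_Ys] linear_scale[OF linear_Xs] scaleR_add_right)

lemma range_basis: "range (case_sum Z (case_sum Y X)) = range Z \<union> range Y \<union> range X"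
proof -
  have "range (case_sum Z (case_sum Y X)) = case_sum Z (case_sum Y X) ` (range Inl \<union> Inr ` (range Inl \<union> range Inr))"
    by (simp add: UNIV_sum[symmetric])
  then show ?thesis by (simp add: image_Un image_image Un_assoc)
qed

lemma sum_basis:
  fixes c :: "'k + 'd + 'd \<Rightarrow> real"
  shows "(\<Sum>i\<in>UNIV. c i *\<^sub>R case_sum Z (case_sum Y X) i) =
    lin_chart (\<chi> k. c (Inl k), \<chi> j. c (Inr (Inl j)), \<chi> j. c (Inr (Inr j)))"
  unfolding lin_chart_def Zs_def Ys_def Xs_def
  by (simp add: UNIV_Plus_UNIV[symmetric] sum.Plus[OF finite finite] add.assoc del: UNIV_Plus_UNIV)

lemma inj_lin_chart: "inj lin_chart"
  unfolding linear_injective_0[OF linear_lin_chart]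
proof (intro allI impI)
  fix p assume p: "lin_chart p = 0"
  let ?b = "case_sum Z (case_sum Y X)"
  define c where "c = case_sum (\<lambda>k. fst p $ k) (case_sum (\<lambda>j. fst (snd p) $ j) (\<lambda>j. snd (snd p) $ j))"
  have c0: "(\<Sum>i\<in>UNIV. c i *\<^sub>R ?b i) = 0"
    unfolding sum_basis using p by (simp add: c_def)
  have "(\<Sum>v\<in>range ?b. c (inv ?b v) *\<^sub>R v) = 0"
    using c0 by (subst sum.reindex[OF basis_inj]) (simp add: inv_f_f[OF basis_inj])
  then have "c (inv ?b v) = 0" if "v \<in> range ?b" for v
    using independentD[OF basis_independent, of "range ?b" "\<lambda>v. c (inv ?b v)" v] that
    by (simp add: range_basis)
  from this[OF rangeI] have c: "c i = 0" for i by (simp add: inv_f_f[OF basis_inj])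
  have "fst p $ k = 0" "fst (snd p) $ j = 0" "snd (snd p) $ j = 0" for k j
    using c[of "Inl k"] c[of "Inr (Inl j)"] c[of "Inr (Inr j)"] by (simp_all add: c_def)
  then show "p = 0" by (simp add: prod_eq_iff vec_eq_iff)
qed

lemma surj_lin_chart: "surj lin_chart"
proof -
  let ?b = "case_sum Z (case_sum Y X)"
  have "\<exists>p. v = lin_chart p" for v
  proof -
    have "v \<in> span (range ?b)" using basis_span by (simp add: range_basis)
    then obtain u where "v = (\<Sum>w\<in>range ?b. u w *\<^sub>R w)" by (auto simp: span_finite)
    also have "\<dots> = (\<Sum>i\<in>UNIV. u (?b i) *\<^sub>R ?b i)" by (simp add: sum.reindex[OF basis_inj])
    finally show ?thesis unfolding sum_basis[of "\<lambda>i. u (?b i)"] by blast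
  qed
  then show ?thesis by (auto simp: surj_def)
qed

definition crd :: "'v \<Rightarrow> (real^'k) \<times> (real^'d) \<times> (real^'d)" where
  "crd = inv lin_chart"

lemma crd_lin_chart [simp]: "crd (lin_chart p) = p"
  by (simp add: crd_def inv_f_f[OF inj_lin_chart])

lemma lin_chart_crd [simp]: "lin_chart (crd v) = v"
  by (simp add: crd_def surj_f_inv_f[OF surj_lin_chart])

lemma linear_crd: "linear crd"
proof (rule linearI)
  show "crd (u + v) = crd u + crd v" for u v
    by (rule injD[OF inj_lin_chart]) (simp add: linear_add[OF linear_lin_chart])
  show "crd (c *\<^sub>R v) = c *\<^sub>R crd v" for c v
    by (rule injD[OF inj_lin_chart]) (simp add: linear_scale[OF linear_lin_chart])
qed

lemma span_Z: "v \<in> span (range Z) \<Longrightarrow> v = Zs (fst (crd v))"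
proof -
  assume "v \<in> span (range Z)"
  then have "v \<in> span (Z ` UNIV)" by simp
  then obtain u where u: "v = (\<Sum>w\<in>range Z. u w *\<^sub>R w)" by (auto simp: span_finite)
  have "inj Z"
  proof (rule injI)
    fix i j assume "Z i = Z j"
    then have "case_sum Z (case_sum Y X) (Inl i) = case_sum Z (case_sum Y X) (Inl j)" by simp
    from injD[OF basis_inj this] show "i = j" by simp
  qed
  then have "v = lin_chart (\<chi> k. u (Z k), 0, 0)"
    unfolding u lin_chart_def
    by (simp add: sum.reindex Zs_def linear_0[OF linear_Ys] linear_0[OF linear_Xs])
  then obtain w where w: "v = lin_chart (w, 0, 0)" by blast
  then show ?thesis unfolding w crd_lin_chart
    by (simp add: lin_chart_def linear_0[OF linear_Ys] linear_0[OF linear_Xs])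
qed

text \<open>The bracket of an \<open>X\<close>-vector and a \<open>Y\<close>-vector in central
  coordinates. It carries the whole group law, since all other brackets of basis directions
  vanish.\<close>

definition beta :: "real^'d \<Rightarrow> real^'d \<Rightarrow> real^'k" where
  "beta t y = fst (crd (br (Xs t) (Ys y)))"

lemma bilinear_beta: "bilinear beta"
  unfolding bilinear_def beta_def
  by (auto intro!: linearI simp: linear_add[OF linear_Xs] linear_add[OF linear_Ys] linear_add[OF linear_crd]
      linear_scale[OF linear_Xs] linear_scale[OF linear_Ys] linear_scale[OF linear_crd]
      bilinear_ladd[OF bilinear_br] bilinear_radd[OF bilinear_br]
      bilinear_lmul[OF bilinear_br] bilinear_rmul[OF bilinear_br])

lemma br_swap: "br u v = - br v u"
proof -
  have h: "br (u + v) (u + v) = br u v + br v u"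
    by (simp add: bilinear_ladd[OF bilinear_br] bilinear_radd[OF bilinear_br] br_self[of u] br_self[of v])
  have "br u v + br v u = 0" by (rule trans[OF sym[OF h] br_self])
  then show ?thesis by (simp add: eq_neg_iff_add_eq_0)
qed

lemma Zs_span: "Zs z \<in> span (range Z)" and Ys_span: "Ys y \<in> span (range Y)" and Xs_span: "Xs t \<in> span (range X)"
  unfolding Zs_def Ys_def Xs_def by (intro span_sum span_scale span_base rangeI)+

lemma br_Zs_left: "br (Zs z) v = 0"
  using center Zs_span[of z] by blast

lemma br_Zs_right: "br v (Zs z) = 0"
  using br_swap[of v "Zs z"] by (simp add: br_Zs_left)

lemma br_Ys_Ys: "br (Ys y) (Ys y') = 0"
  by (rule ideal_commutative) (use Ys_span span_mono[of "range Y" "range Z \<union> range Y"] in blast)+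

lemma br_Xs_Xs: "br (Xs t) (Xs t') = 0"
  by (rule X_commutative) (rule Xs_span)+

lemma br_Xs_Ys: "br (Xs t) (Ys y) = Zs (beta t y)"
proof -
  have lin: "linear (\<lambda>v. br u v)" "linear (\<lambda>v. br v u)" for u
    using bilinear_br by (simp_all add: bilinear_def)
  have "br (Xs t) (Ys y) = (\<Sum>j\<in>UNIV. y $ j *\<^sub>R (\<Sum>i\<in>UNIV. t $ i *\<^sub>R br (X i) (Y j)))"
    unfolding Xs_def Ys_def
    by (simp add: linear_sum[OF lin(1)] linear_sum[OF lin(2)] linear_scale[OF lin(1)] linear_scale[OF lin(2)])
  also have "\<dots> \<in> span (range Z)"
    by (intro span_sum span_scale br_X_Y)
  finally show ?thesis unfolding beta_def by (rule span_Z)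
qed

lemma br_lin_chart:
  "br (lin_chart (z, y, t)) (lin_chart (z', y', t')) = Zs (beta t y' - beta t' y)"
proof -
  have "br (Ys y) (Xs t') = - Zs (beta t' y)" using br_swap[of "Ys y" "Xs t'"] by (simp add: br_Xs_Ys)
  then show ?thesis
    by (simp add: lin_chart_def bilinear_ladd[OF bilinear_br] bilinear_radd[OF bilinear_br]
        br_Zs_left br_Zs_right br_Ys_Ys br_Xs_Xs br_Xs_Ys linear_diff[OF linear_Zs])
qed

lemma lin_chart_mult:
  "lin_chart (z, y, t) \<odot> lin_chart (z', y', t') =
    lin_chart (z + z' + (1/2) *\<^sub>R (beta t y' - beta t' y), y + y', t + t')"
  unfolding gmult_def br_lin_chart
  by (simp add: lin_chart_def linear_add[OF linear_Zs] linear_add[OF linear_Ys] linear_add[OF linear_Xs]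
      linear_scale[OF linear_Zs])

lemma beta_zero [simp]: "beta 0 y = 0" "beta t 0 = 0"
  by (simp_all add: bilinear_lzero[OF bilinear_beta] bilinear_rzero[OF bilinear_beta])

lemma chart_eq: "chart (z, y, t) = lin_chart (z - (1/2) *\<^sub>R beta t y, y, t)"
proof -
  have "chart (z, y, t) = lin_chart (z, 0, 0) \<odot> lin_chart (0, y, 0) \<odot> lin_chart (0, 0, t)"
    by (simp add: chart_def lin_chart_def Zs_def Ys_def Xs_def)
  then show ?thesis by (simp add: lin_chart_mult)
qed

text \<open>Moving the factor of \<open>t\<close> past that of \<open>y'\<close> costs the
  commutator \<open>beta t y'\<close>, which is central; everything else adds up. The two halves
  from the product formula and the two from \<open>chart_eq\<close> combine to this single
  term.\<close>

lemma chart_mult: "chart (z, y, t) \<odot> chart (z', y', t') = chart (z + z' + beta t y', y + y', t + t')"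
proof -
  have "(z - (1/2) *\<^sub>R beta t y) + (z' - (1/2) *\<^sub>R beta t' y') + (1/2) *\<^sub>R (beta t y' - beta t' y) =
      z + z' + beta t y' - (1/2) *\<^sub>R beta (t + t') (y + y')"
  proof -
    have half: "w = (1/2) *\<^sub>R w + (1/2) *\<^sub>R w" for w :: "real^'k"
      by (simp add: scaleR_add_left[symmetric])
    show ?thesis
      unfolding bilinear_ladd[OF bilinear_beta] bilinear_radd[OF bilinear_beta]
      by (subst (2) half[of "beta t y'"]) (simp add: scaleR_add_right scaleR_diff_right)
  qed
  then show ?thesis by (simp only: chart_eq lin_chart_mult)
qed

definition chart_inv :: "'v \<Rightarrow> (real^'k) \<times> (real^'d) \<times> (real^'d)" where
  "chart_inv v = (fst (crd v) + (1/2) *\<^sub>R beta (snd (snd (crd v))) (fst (snd (crd v))), snd (crd v))"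

lemma chart_inv_chart [simp]: "chart_inv (chart p) = p"
  by (cases p) (auto simp: chart_eq chart_inv_def)

lemma chart_chart_inv [simp]: "chart (chart_inv v) = v"
proof -
  obtain z y t where c: "crd v = (z, y, t)" by (cases "crd v") auto
  show ?thesis
    using lin_chart_crd[of v] unfolding c by (simp add: chart_inv_def c chart_eq)
qed

lemma inv_chart: "inv chart = chart_inv"
  by (rule inv_equality) simp_all

lemma chart_inj: "chart p = chart p' \<longleftrightarrow> p = p'"
  by (rule inj_eq[OF inj_on_inverseI[of UNIV chart_inv chart]]) simp

lemma continuous_beta_compose [continuous_intros]:
  "continuous_on S f \<Longrightarrow> continuous_on S g \<Longrightarrow> continuous_on S (\<lambda>x. beta (f x) (g x))"
  by (rule bounded_bilinear.continuous_on[OF iffD1[OF bilinear_conv_bounded_bilinear bilinear_beta]])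

lemma continuous_beta: "continuous_on UNIV (\<lambda>p. beta (fst p) (snd p))"
  by (intro continuous_beta_compose continuous_on_fst continuous_on_snd continuous_on_id)

lemma continuous_chart: "continuous_on UNIV chart"
proof -
  have eq: "chart = (\<lambda>p. lin_chart (fst p - (1/2) *\<^sub>R beta (snd (snd p)) (fst (snd p)), fst (snd p), snd (snd p)))"
    by (auto simp: fun_eq_iff chart_eq)
  show ?thesis unfolding eq
    by (intro linear_continuous_on_compose[OF _ linear_lin_chart] continuous_intros)
qed

lemma continuous_chart_inv: "continuous_on UNIV chart_inv"
proof -
  have c: "continuous_on UNIV crd" by (rule linear_continuous_on[OF linear_conv_bounded_linear[THEN iffD1, OF linear_crd]])
  show ?thesis unfolding chart_inv_def by (intro continuous_intros c)
qed

lemma chart_measurable [measurable]: "chart \<in> borel_measurable borel"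
  by (rule borel_measurable_continuous_onI[OF continuous_chart])

lemma chart_inv_measurable [measurable]: "chart_inv \<in> borel_measurable borel"
  by (rule borel_measurable_continuous_onI[OF continuous_chart_inv])

lemma beta_measurable [measurable (raw)]:
  assumes [measurable]: "f \<in> borel_measurable M" "g \<in> borel_measurable M"
  shows "(\<lambda>x. beta (f x) (g x)) \<in> borel_measurable M"
proof -
  have "(\<lambda>p. beta (fst p) (snd p)) \<in> borel_measurable borel"
    by (rule borel_measurable_continuous_onI[OF continuous_beta])
  from measurable_compose[OF borel_measurable_Pair[OF assms] this] show ?thesis by simp
qed

subsection \<open>The functional and the matrix\<close>

lemma functional_eq: "functional lam = (\<lambda>v. lam \<bullet> fst (crd v))"
  unfolding functional_def
proof (rule the_equality)
  have [simp]: "crd (Z k) = (axis k 1, 0, 0)" "crd (Y j) = (0, axis j 1, 0)" "crd (X j) = (0, 0, axis j 1)" for k j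
  proof -
    have "Z k = lin_chart (axis k 1, 0, 0)" "Y j = lin_chart (0, axis j 1, 0)" "X j = lin_chart (0, 0, axis j 1)"
      by (simp_all add: lin_chart_def Zs_def Ys_def Xs_def axis_def if_distrib[of "\<lambda>x. x *\<^sub>R _"] cong: if_cong)
    then show "crd (Z k) = (axis k 1, 0, 0)" "crd (Y j) = (0, axis j 1, 0)" "crd (X j) = (0, 0, axis j 1)"
      by (simp_all only: crd_lin_chart)
  qed
  have lin: "linear (\<lambda>v. lam \<bullet> fst (crd v))"
    by (rule linearI) (simp_all add: linear_add[OF linear_crd] linear_scale[OF linear_crd] inner_add_right)
  then show "linear (\<lambda>v. lam \<bullet> fst (crd v)) \<and> (\<forall>k. lam \<bullet> fst (crd (Z k)) = lam $ k) \<and>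
      (\<forall>j. lam \<bullet> fst (crd (Y j)) = 0 \<and> lam \<bullet> fst (crd (X j)) = 0)"
    by (simp add: inner_axis)
  fix l assume l: "linear l \<and> (\<forall>k. l (Z k) = lam $ k) \<and> (\<forall>j. l (Y j) = 0 \<and> l (X j) = 0)"
  show "l = (\<lambda>v. lam \<bullet> fst (crd v))"
  proof
    fix v
    obtain z y t where c: "crd v = (z, y, t)" by (cases "crd v") auto
    then have "v = lin_chart (z, y, t)" using lin_chart_crd[of v] by simp
    then have "l v = (\<Sum>k\<in>UNIV. z $ k * lam $ k)"
      using l by (simp add: lin_chart_def Zs_def Ys_def Xs_def linear_add linear_sum linear_scale)
    then show "l v = lam \<bullet> fst (crd v)" by (simp add: c inner_vec_def mult.commute)
  qed
qed

lemma B_entry: "B lam $ i $ j = - (lam \<bullet> fst (crd (br (X i) (Y j))))"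
  by (simp add: B_def B_matrix_def functional_eq)

text \<open>Links the matrix in the representation to the commutator in the group law. The minus
  sign comes from the definition of \<open>B_matrix\<close>.\<close>

lemma inner_B: "t \<bullet> (B lam *v y) = - (lam \<bullet> beta t y)"
proof -
  have lin: "linear (\<lambda>v. br u v)" "linear (\<lambda>v. br v u)" for u
    using bilinear_br by (simp_all add: bilinear_def)
  have l: "linear (\<lambda>v. lam \<bullet> fst (crd v))"
    by (rule linearI) (simp_all add: linear_add[OF linear_crd] linear_scale[OF linear_crd] inner_add_right)
  have "lam \<bullet> beta t y = (\<Sum>j\<in>UNIV. y $ j * (\<Sum>i\<in>UNIV. t $ i * (lam \<bullet> fst (crd (br (X i) (Y j))))))"
    unfolding beta_def Xs_def Ys_def
    by (simp add: linear_sum[OF lin(1)] linear_sum[OF lin(2)] linear_scale[OF lin(1)] linear_scale[OF lin(2)]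
        linear_sum[OF l] linear_scale[OF l])
  also have "\<dots> = (\<Sum>i\<in>UNIV. \<Sum>j\<in>UNIV. t $ i * (y $ j * (lam \<bullet> fst (crd (br (X i) (Y j))))))"
    unfolding sum_distrib_left by (subst sum.swap) (simp add: mult.left_commute)
  finally show ?thesis
    by (simp add: inner_vec_def matrix_vector_mult_def B_entry sum_negf[symmetric] sum_distrib_left mult_ac)
qed

lemma B_add: "B (lam + lam') = B lam + B lam'" and B_scale: "B (c *\<^sub>R lam) = c *\<^sub>R B lam"
  by (simp_all add: vec_eq_iff B_entry inner_add_left)

lemma continuous_B_entry: "continuous_on UNIV (\<lambda>lam. B lam $ i $ j)"
  unfolding B_entry by (intro continuous_intros)

lemma continuous_det_B: "continuous_on UNIV (\<lambda>lam. det (B lam))"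
  unfolding det_def by (intro continuous_intros continuous_B_entry)

lemma det_B_measurable [measurable]: "(\<lambda>lam. det (B lam)) \<in> borel_measurable borel"
  by (rule borel_measurable_continuous_onI[OF continuous_det_B])

lemma Sig_measurable [measurable]: "Sig \<in> sets borel"
proof -
  have "Sig = {lam \<in> space borel. det (B lam) \<noteq> 0}" by (simp add: Sig_def)
  also have "\<dots> \<in> sets borel" by measurable
  finally show ?thesis .
qed

lemma Sig_nonempty: "\<exists>lam. det (B lam) \<noteq> 0"
proof -
  obtain l where l: "linear l" "det (B_matrix br Y X l) \<noteq> 0" using square_integrable by blast
  have "B (\<chi> k. l (Z k)) = B_matrix br Y X l"
  proof -
    have "l v = (\<chi> k. l (Z k)) \<bullet> fst (crd v)" if "v \<in> span (range Z)" for v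
    proof -
      have "l v = l (Zs (fst (crd v)))" using span_Z[OF that] by simp
      also have "\<dots> = (\<chi> k. l (Z k)) \<bullet> fst (crd v)"
        by (simp add: Zs_def linear_sum[OF l(1)] linear_scale[OF l(1)] inner_vec_def mult.commute)
      finally show ?thesis .
    qed
    then show ?thesis using br_X_Y by (simp add: vec_eq_iff B_entry B_matrix_def)
  qed
  with l(2) show ?thesis by metis
qed

lemma det_B_line_poly: "\<exists>p :: real poly. \<forall>s. det (B (v + s *\<^sub>R w)) = poly p s"
proof -
  let ?p = "\<Sum>\<pi>\<in>{\<pi>. \<pi> permutes (UNIV :: 'd set)}. smult (of_int (sign \<pi>)) (\<Prod>i\<in>UNIV. [: B v $ i $ \<pi> i, B w $ i $ \<pi> i :])"
  have "det (B (v + s *\<^sub>R w)) = poly ?p s" for s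
    unfolding det_def B_add B_scale by (simp add: poly_sum poly_prod)
  then show ?thesis by blast
qed

lemma det_scaleR_matrix: "det (c *\<^sub>R A) = c ^ CARD('n) * det (A :: real^'n^'n)"
proof -
  have "(\<Prod>i\<in>UNIV. (c *\<^sub>R A) $ i $ \<pi> i) = c ^ CARD('n) * (\<Prod>i\<in>UNIV. A $ i $ \<pi> i)" for \<pi>
    by (simp add: prod.distrib)
  then have "det (c *\<^sub>R A) = (\<Sum>\<pi>\<in>{\<pi>. \<pi> permutes UNIV}. c ^ CARD('n) * (of_int (sign \<pi>) * (\<Prod>i\<in>UNIV. A $ i $ \<pi> i)))"
    unfolding det_def by (intro sum.cong refl) (simp only: mult.left_commute)
  then show ?thesis unfolding det_def by (simp only: sum_distrib_left)
qed

text \<open>If the polynomial vanished identically, homogeneity of the determinant would give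
  \<open>det (B (r *\<^sub>R v + w)) = 0\<close> for all nonzero \<open>r\<close>; letting
  \<open>r\<close> tend to 0 contradicts the choice of \<open>w\<close>.\<close>

lemma finite_zeros_on_line:
  assumes w: "det (B w) \<noteq> 0"
  shows "finite {s. det (B (v + s *\<^sub>R w)) = 0}"
proof -
  obtain p where p: "\<And>s. det (B (v + s *\<^sub>R w)) = poly p s" using det_B_line_poly by blast
  have "p \<noteq> 0"
  proof
    assume "p = 0"
    have z: "det (B (r *\<^sub>R v + w)) = 0" if "r \<noteq> 0" for r
    proof -
      have "r *\<^sub>R v + w = r *\<^sub>R (v + (1/r) *\<^sub>R w)" using that by (simp add: scaleR_add_right)
      then have "det (B (r *\<^sub>R v + w)) = det (r *\<^sub>R B (v + (1/r) *\<^sub>R w))"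
        by (simp only: B_scale)
      also have "\<dots> = r ^ CARD('d) * det (B (v + (1/r) *\<^sub>R w))" by (rule det_scaleR_matrix)
      also have "\<dots> = 0" unfolding p using \<open>p = 0\<close> by simp
      finally show ?thesis .
    qed
    have "(\<lambda>n. 1 / real (Suc n)) \<longlonglongrightarrow> 0" using LIMSEQ_inverse_real_of_nat by (simp add: inverse_eq_divide)
    then have "(\<lambda>n. (1 / real (Suc n)) *\<^sub>R v + w) \<longlonglongrightarrow> 0 *\<^sub>R v + w" by (intro tendsto_intros)
    then have "(\<lambda>n. det (B ((1 / real (Suc n)) *\<^sub>R v + w))) \<longlonglongrightarrow> det (B (0 *\<^sub>R v + w))"
      by (rule continuous_on_tendsto_compose[OF continuous_det_B]) simp_all
    moreover have "det (B ((1 / real (Suc n)) *\<^sub>R v + w)) = 0" for n by (rule z) simp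
    ultimately show False using w by (simp add: LIMSEQ_const_iff)
  qed
  then show ?thesis unfolding p by (rule poly_roots_finite)
qed

text \<open>On every line in a direction \<open>w \<in> \<Sigma>\<close> the determinant is a nonzero polynomial.\<close>

lemma AE_Sig: "AE lam in lborel. lam \<in> Sig"
proof -
  obtain w where w: "det (B w) \<noteq> 0" using Sig_nonempty by blast
  define N where "N = {lam. det (B lam) = 0}"
  have N [measurable]: "N \<in> sets borel"
  proof -
    have "N = {lam \<in> space borel. det (B lam) = 0}" by (simp add: N_def)
    also have "\<dots> \<in> sets borel" by measurable
    finally show ?thesis .
  qed
  \<comment> \<open>Averaging over shifts by \<open>s *\<^sub>R w\<close> with \<open>s\<close> in
    the unit interval inserts a factor 1 and does not change the measure of \<open>N\<close>; after
    exchanging the integrals each line meets \<open>N\<close> in a finite set.\<close>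
  have "emeasure lborel N = (\<integral>\<^sup>+ s. indicator {0..1} s * emeasure lborel N \<partial>(lborel :: real measure))"
    by (subst nn_integral_multc) (simp_all add: one_ennreal_def[symmetric])
  also have "\<dots> = (\<integral>\<^sup>+ s. \<integral>\<^sup>+ v. indicator {0..1} s * indicator N (s *\<^sub>R w + v) \<partial>lborel \<partial>(lborel :: real measure))"
  proof (rule nn_integral_cong)
    fix s :: real
    have "(\<integral>\<^sup>+ v. indicator N (s *\<^sub>R w + v) \<partial>lborel) = (\<integral>\<^sup>+ v. indicator N v \<partial>lborel)"
      by (rule nn_integral_lborel_translate) measurable
    then show "indicator {0..1} s * emeasure lborel N =
        (\<integral>\<^sup>+ v. indicator {0..1} s * indicator N (s *\<^sub>R w + v) \<partial>lborel)"
      by (simp add: nn_integral_cmult)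
  qed
  also have "\<dots> = (\<integral>\<^sup>+ v. \<integral>\<^sup>+ s. indicator {0..1} s * indicator N (s *\<^sub>R w + v) \<partial>(lborel :: real measure) \<partial>lborel)"
    by (rule lborel_pair.Fubini') measurable
  also have "\<dots> = (\<integral>\<^sup>+ v. 0 \<partial>(lborel :: (real^'k) measure))"
  proof (rule nn_integral_cong)
    fix v :: "real^'k"
    have "finite {s. s *\<^sub>R w + v \<in> N}"
      using finite_zeros_on_line[OF w, of v] by (simp add: N_def add.commute)
    then have "AE s in lborel. s \<notin> {s. s *\<^sub>R w + v \<in> N}"
      by (intro AE_not_in finite_imp_null_set_lborel)
    then show "(\<integral>\<^sup>+ s. indicator {0..1} s * indicator N (s *\<^sub>R w + v) \<partial>(lborel :: real measure)) = 0"
      by (subst nn_integral_0_iff_AE) (measurable, auto simp: indicator_def)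
  qed
  finally have "N \<in> null_sets lborel" by (simp add: null_sets_def)
  then have "AE lam in lborel. lam \<notin> N" by (rule AE_not_in)
  then show ?thesis by (simp add: N_def Sig_def)
qed

subsection \<open>Haar measure\<close>

lemma sets_haar [simp, measurable_cong]: "sets haar = sets borel"
  by (simp add: haar_def)

lemma space_haar [simp]: "space haar = UNIV"
  by (simp add: haar_def)

lemma nn_integral_haar:
  "f \<in> borel_measurable borel \<Longrightarrow> (\<integral>\<^sup>+ n. f n \<partial>haar) = (\<integral>\<^sup>+ p. f (chart p) \<partial>lborel)"
  unfolding haar_def by (rule nn_integral_distr) auto

lemma sigma_finite_haar: "sigma_finite_measure haar"
proof -
  define A where "A n = chart ` ball 0 (real n)" for n
  have A_eq: "A n = chart_inv -` ball 0 (real n)" for n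
  proof -
    have "v \<in> A n \<longleftrightarrow> chart_inv v \<in> ball 0 (real n)" for v
      unfolding A_def using image_eqI[of v chart "chart_inv v" "ball 0 (real n)"] by auto
    then show ?thesis by blast
  qed
  have meas: "A n \<in> sets borel" for n
    unfolding A_eq by (rule measurable_sets_borel[OF chart_inv_measurable]) simp
  show ?thesis
  proof (rule sigma_finite_measure.intro, intro exI conjI ballI)
    show "countable (range A)" by simp
    show "range A \<subseteq> sets haar" using meas by auto
    show "\<Union>(range A) = space haar"
    proof -
      have "v \<in> \<Union>(range A)" for v
        using reals_Archimedean2[of "norm (chart_inv v)"] by (auto simp: A_eq)
      then show ?thesis by auto
    qed
    fix a assume "a \<in> range A"
    then obtain n where a: "a = A n" by blast
    have "emeasure haar (A n) = emeasure lborel (chart -` A n)"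
      unfolding haar_def using meas by (subst emeasure_distr) auto
    also have "chart -` A n = ball 0 (real n)" unfolding A_eq by auto
    finally show "emeasure haar a \<noteq> \<infinity>" using emeasure_lborel_ball_finite by (simp add: a less_top[symmetric])
  qed
qed

text \<open>The central variable is innermost because multiplication shifts it by an amount
  depending on \<open>y\<close> or \<open>t\<close>: with those fixed, translation invariance
  removes the shift.\<close>

lemma nn_integral_triple:
  fixes f :: "(real^'k) \<times> (real^'d) \<times> (real^'d) \<Rightarrow> ennreal"
  assumes [measurable]: "f \<in> borel_measurable borel"
  shows "(\<integral>\<^sup>+ p. f p \<partial>lborel) = (\<integral>\<^sup>+ t. \<integral>\<^sup>+ y. \<integral>\<^sup>+ z. f (z, y, t) \<partial>lborel \<partial>lborel \<partial>lborel)"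
proof -
  have [measurable]: "f \<in> borel_measurable (lborel \<Otimes>\<^sub>M (lborel \<Otimes>\<^sub>M lborel))" by (simp add: lborel_prod)
  have "(\<integral>\<^sup>+ p. f p \<partial>lborel) = (\<integral>\<^sup>+ p. f p \<partial>(lborel \<Otimes>\<^sub>M lborel))" by (simp add: lborel_prod)
  also have "\<dots> = (\<integral>\<^sup>+ q. \<integral>\<^sup>+ z. f (z, q) \<partial>lborel \<partial>lborel)"
    by (rule lborel_pair.nn_integral_snd[symmetric]) (simp add: lborel_prod)
  also have "\<dots> = (\<integral>\<^sup>+ q. \<integral>\<^sup>+ z. f (z, q) \<partial>lborel \<partial>(lborel \<Otimes>\<^sub>M lborel))" by (simp add: lborel_prod)
  also have "\<dots> = (\<integral>\<^sup>+ t. \<integral>\<^sup>+ y. \<integral>\<^sup>+ z. f (z, y, t) \<partial>lborel \<partial>lborel \<partial>lborel)"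
    by (rule lborel_pair.nn_integral_snd[symmetric]) measurable
  finally show ?thesis .
qed

lemma gmult_measurable [measurable]: "(\<lambda>n. a \<odot> n) \<in> borel_measurable borel" "(\<lambda>n. n \<odot> a) \<in> borel_measurable borel"
proof -
  have "linear (br a)" "linear (\<lambda>n. br n a)" using bilinear_br by (simp_all add: bilinear_def)
  then have "continuous_on UNIV (br a)" "continuous_on UNIV (\<lambda>n. br n a)"
    by (auto intro!: linear_continuous_on simp: linear_conv_bounded_linear)
  then show "(\<lambda>n. a \<odot> n) \<in> borel_measurable borel" "(\<lambda>n. n \<odot> a) \<in> borel_measurable borel"
    unfolding gmult_def by (auto intro!: borel_measurable_continuous_onI continuous_intros)
qed

lemma nn_integral_haar_left:
  assumes [measurable]: "f \<in> borel_measurable borel"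
  shows "(\<integral>\<^sup>+ n. f (a \<odot> n) \<partial>haar) = (\<integral>\<^sup>+ n. f n \<partial>haar)"
proof -
  obtain z0 y0 t0 where "chart_inv a = (z0, y0, t0)" by (cases "chart_inv a") auto
  then have a: "a = chart (z0, y0, t0)" using chart_chart_inv[of a] by simp
  have "(\<integral>\<^sup>+ n. f (a \<odot> n) \<partial>haar) = (\<integral>\<^sup>+ p. f (a \<odot> chart p) \<partial>lborel)"
    by (rule nn_integral_haar) measurable
  also have "\<dots> = (\<integral>\<^sup>+ t. \<integral>\<^sup>+ y. \<integral>\<^sup>+ z. f (chart ((z0 + beta t0 y) + z, y0 + y, t0 + t)) \<partial>lborel \<partial>lborel \<partial>lborel)"
    by (subst nn_integral_triple) (simp_all add: a chart_mult ac_simps)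
  also have "\<dots> = (\<integral>\<^sup>+ t. \<integral>\<^sup>+ y. \<integral>\<^sup>+ z. f (chart (z, y0 + y, t0 + t)) \<partial>lborel \<partial>lborel \<partial>lborel)"
    by (intro nn_integral_cong nn_integral_lborel_translate) measurable
  also have "\<dots> = (\<integral>\<^sup>+ t. \<integral>\<^sup>+ y. \<integral>\<^sup>+ z. f (chart (z, y, t0 + t)) \<partial>lborel \<partial>lborel \<partial>lborel)"
    by (intro nn_integral_cong nn_integral_lborel_translate[of "\<lambda>y. \<integral>\<^sup>+ z. f (chart (z, y, _)) \<partial>lborel"]) measurable
  also have "\<dots> = (\<integral>\<^sup>+ t. \<integral>\<^sup>+ y. \<integral>\<^sup>+ z. f (chart (z, y, t)) \<partial>lborel \<partial>lborel \<partial>lborel)"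
    by (rule nn_integral_lborel_translate[of "\<lambda>t. \<integral>\<^sup>+ y. \<integral>\<^sup>+ z. f (chart (z, y, t)) \<partial>lborel \<partial>lborel"]) measurable
  also have "\<dots> = (\<integral>\<^sup>+ n. f n \<partial>haar)"
    by (subst nn_integral_haar, measurable) (subst nn_integral_triple, auto)
  finally show ?thesis .
qed

text \<open>Now the central shift depends on \<open>t\<close> instead of \<open>y\<close>, and the
  same order of integration works. Right invariance is what moves right translates of the tile in
  \<open>density_ge_1\<close>.\<close>

lemma nn_integral_haar_right:
  assumes [measurable]: "f \<in> borel_measurable borel"
  shows "(\<integral>\<^sup>+ n. f (n \<odot> a) \<partial>haar) = (\<integral>\<^sup>+ n. f n \<partial>haar)"
proof -
  obtain z0 y0 t0 where "chart_inv a = (z0, y0, t0)" by (cases "chart_inv a") auto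
  then have a: "a = chart (z0, y0, t0)" using chart_chart_inv[of a] by simp
  have "(\<integral>\<^sup>+ n. f (n \<odot> a) \<partial>haar) = (\<integral>\<^sup>+ p. f (chart p \<odot> a) \<partial>lborel)"
    by (rule nn_integral_haar) measurable
  also have "\<dots> = (\<integral>\<^sup>+ t. \<integral>\<^sup>+ y. \<integral>\<^sup>+ z. f (chart ((z0 + beta t y0) + z, y0 + y, t0 + t)) \<partial>lborel \<partial>lborel \<partial>lborel)"
    by (subst nn_integral_triple) (simp_all add: a chart_mult ac_simps)
  also have "\<dots> = (\<integral>\<^sup>+ t. \<integral>\<^sup>+ y. \<integral>\<^sup>+ z. f (chart (z, y0 + y, t0 + t)) \<partial>lborel \<partial>lborel \<partial>lborel)"
    by (intro nn_integral_cong nn_integral_lborel_translate) measurable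
  also have "\<dots> = (\<integral>\<^sup>+ t. \<integral>\<^sup>+ y. \<integral>\<^sup>+ z. f (chart (z, y, t0 + t)) \<partial>lborel \<partial>lborel \<partial>lborel)"
    by (intro nn_integral_cong nn_integral_lborel_translate[of "\<lambda>y. \<integral>\<^sup>+ z. f (chart (z, y, _)) \<partial>lborel"]) measurable
  also have "\<dots> = (\<integral>\<^sup>+ t. \<integral>\<^sup>+ y. \<integral>\<^sup>+ z. f (chart (z, y, t)) \<partial>lborel \<partial>lborel \<partial>lborel)"
    by (rule nn_integral_lborel_translate[of "\<lambda>t. \<integral>\<^sup>+ y. \<integral>\<^sup>+ z. f (chart (z, y, t)) \<partial>lborel \<partial>lborel"]) measurable
  also have "\<dots> = (\<integral>\<^sup>+ n. f n \<partial>haar)"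
    by (subst nn_integral_haar, measurable) (subst nn_integral_triple, auto)
  finally show ?thesis .
qed

lemma haar_distr_left: "distr haar borel (\<lambda>n. a \<odot> n) = haar"
proof (rule measure_eqI)
  fix A assume "A \<in> sets (distr haar borel (\<lambda>n. a \<odot> n))"
  then have A [measurable]: "A \<in> sets borel" by simp
  have "emeasure (distr haar borel (\<lambda>n. a \<odot> n)) A = (\<integral>\<^sup>+ n. indicator A n \<partial>distr haar borel (\<lambda>n. a \<odot> n))" by simp
  also have "\<dots> = (\<integral>\<^sup>+ n. indicator A (a \<odot> n) \<partial>haar)" by (rule nn_integral_distr) measurable
  also have "\<dots> = (\<integral>\<^sup>+ n. indicator A n \<partial>haar)" by (rule nn_integral_haar_left) measurable
  finally show "emeasure (distr haar borel (\<lambda>n. a \<odot> n)) A = emeasure haar A" by simp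
qed simp

lemma integral_haar_left:
  fixes f :: "'v \<Rightarrow> 'b::{banach, second_countable_topology}"
  assumes "f \<in> borel_measurable borel"
  shows "(LINT n|haar. f (a \<odot> n)) = (LINT n|haar. f n)"
  using assms by (subst (2) haar_distr_left[of a, symmetric]) (simp add: integral_distr)

lemma integrable_haar_left:
  fixes f :: "'v \<Rightarrow> 'b::{banach, second_countable_topology}"
  assumes "f \<in> borel_measurable borel"
  shows "integrable haar (\<lambda>n. f (a \<odot> n)) \<longleftrightarrow> integrable haar f"
  using assms by (subst (2) haar_distr_left[of a, symmetric]) (simp add: integrable_distr_eq)

lemma left_translate_L2: "f \<in> L2 haar \<Longrightarrow> left_translate x f \<in> L2 haar"
  unfolding L2_def left_translate_def
  using integrable_haar_left[of "\<lambda>n. (cmod (f n))\<^sup>2" "- x"] by auto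

lemma left_translate_inner:
  assumes "f \<in> L2 haar" "g \<in> L2 haar"
  shows "l2_inner haar (left_translate x f) g = l2_inner haar f (left_translate (- x) g)"
proof -
  have [measurable]: "f \<in> borel_measurable borel" "g \<in> borel_measurable borel"
    using assms by (auto simp: L2_def)
  have "l2_inner haar f (left_translate (- x) g) = (LINT n|haar. f ((- x) \<odot> n) * cnj (g (x \<odot> ((- x) \<odot> n))))"
    unfolding l2_inner_def left_translate_def
    by (subst integral_haar_left[of _ "- x", symmetric]) auto
  then show ?thesis
    by (simp add: l2_inner_def left_translate_def gmult_assoc[symmetric] gmult_uminus gmult_zero)
qed

lemma left_translate_mult: "left_translate x (left_translate y f) = left_translate (x \<odot> y) f"
proof -
  have "(- y) \<odot> (- x) = - (x \<odot> y)"
    using br_swap[of y x]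
    by (simp add: gmult_def bilinear_lneg[OF bilinear_br] bilinear_rneg[OF bilinear_br])
  then have "(- y) \<odot> ((- x) \<odot> n) = (- (x \<odot> y)) \<odot> n" for n
    by (simp only: gmult_assoc[symmetric])
  then show ?thesis by (simp add: left_translate_def)
qed

end

subsection \<open>Linear change of variables\<close>

lemma borel_measurable_vec_nth [measurable (raw)]:
  fixes f :: "'a \<Rightarrow> real^'n"
  assumes "f \<in> borel_measurable M"
  shows "(\<lambda>x. f x $ i) \<in> borel_measurable M"
  by (rule measurable_compose[OF assms]) (intro borel_measurable_continuous_onI continuous_intros)

text \<open>Insert a weight of mass 1 in an auxiliary variable \<open>s\<close> and translate
  \<open>x\<close> by \<open>s\<close> in direction \<open>m\<close>. The coordinate
  \<open>x $ n\<close> is unaffected, so the shear becomes a translation of the integral over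
  \<open>s\<close> and disappears. The result is independent of \<open>c\<close>, and
  \<open>c = 0\<close> gives the claim.\<close>

lemma nn_integral_lborel_shear:
  fixes H :: "real^'n \<Rightarrow> ennreal"
  assumes [measurable]: "H \<in> borel_measurable borel" and mn: "m \<noteq> n"
  shows "(\<integral>\<^sup>+ x. H (x + (c * x $ n) *\<^sub>R axis m 1) \<partial>lborel) = (\<integral>\<^sup>+ x. H x \<partial>lborel)"
proof -
  let ?e = "axis m 1 :: real^'n"
  define w :: "real \<Rightarrow> ennreal" where "w = indicator {0..1}"
  have [measurable]: "w \<in> borel_measurable borel" unfolding w_def by measurable
  have w1: "(\<integral>\<^sup>+ s. w (a + s) \<partial>lborel) = 1" for a
  proof -
    have "(\<integral>\<^sup>+ s. w (a + s) \<partial>lborel) = (\<integral>\<^sup>+ s. w s \<partial>lborel)"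
      by (rule nn_integral_lborel_translate) measurable
    then show ?thesis by (simp add: w_def)
  qed
  have main: "(\<integral>\<^sup>+ x. H (x + (c * x $ n) *\<^sub>R ?e) \<partial>lborel) =
      (\<integral>\<^sup>+ x. w (x $ m) * (\<integral>\<^sup>+ s. H (x - s *\<^sub>R ?e) \<partial>lborel) \<partial>lborel)" for c
  proof -
    have "(\<integral>\<^sup>+ x. H (x + (c * x $ n) *\<^sub>R ?e) \<partial>lborel) =
        (\<integral>\<^sup>+ x. \<integral>\<^sup>+ s. H (x + (c * x $ n) *\<^sub>R ?e) * w (x $ m + s) \<partial>lborel \<partial>lborel)"
      by (simp add: nn_integral_cmult w1)
    also have "\<dots> = (\<integral>\<^sup>+ s. \<integral>\<^sup>+ x. H (x + (c * x $ n) *\<^sub>R ?e) * w (x $ m + s) \<partial>lborel \<partial>lborel)"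
      by (rule lborel_pair.Fubini'[symmetric]) measurable
    also have "\<dots> = (\<integral>\<^sup>+ s. \<integral>\<^sup>+ x. H (- s *\<^sub>R ?e + x + (c * x $ n) *\<^sub>R ?e) * w (x $ m) \<partial>lborel \<partial>lborel)"
    proof (rule nn_integral_cong)
      fix s :: real
      have "(\<integral>\<^sup>+ x. H (- s *\<^sub>R ?e + x + (c * (- s *\<^sub>R ?e + x) $ n) *\<^sub>R ?e) * w ((- s *\<^sub>R ?e + x) $ m + s) \<partial>lborel) =
          (\<integral>\<^sup>+ x. H (x + (c * x $ n) *\<^sub>R ?e) * w (x $ m + s) \<partial>lborel)"
        by (rule nn_integral_lborel_translate) measurable
      moreover have "(- s *\<^sub>R ?e + x) $ n = x $ n" "(- s *\<^sub>R ?e + x) $ m + s = x $ m" for x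
        using mn by (simp_all add: axis_def)
      ultimately show "(\<integral>\<^sup>+ x. H (x + (c * x $ n) *\<^sub>R ?e) * w (x $ m + s) \<partial>lborel) =
          (\<integral>\<^sup>+ x. H (- s *\<^sub>R ?e + x + (c * x $ n) *\<^sub>R ?e) * w (x $ m) \<partial>lborel)" by (simp only:)
    qed
    also have "\<dots> = (\<integral>\<^sup>+ x. \<integral>\<^sup>+ s. H (- s *\<^sub>R ?e + x + (c * x $ n) *\<^sub>R ?e) * w (x $ m) \<partial>lborel \<partial>lborel)"
      by (rule lborel_pair.Fubini') measurable
    also have "\<dots> = (\<integral>\<^sup>+ x. w (x $ m) * (\<integral>\<^sup>+ s. H (x - s *\<^sub>R ?e) \<partial>lborel) \<partial>lborel)"
    proof (rule nn_integral_cong)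
      fix x :: "real^'n"
      have "(\<integral>\<^sup>+ s. H (- s *\<^sub>R ?e + x + (c * x $ n) *\<^sub>R ?e) * w (x $ m) \<partial>lborel) =
          w (x $ m) * (\<integral>\<^sup>+ s. H (x - (- (c * x $ n) + s) *\<^sub>R ?e) \<partial>lborel)"
        by (subst nn_integral_cmult[symmetric], measurable) (simp add: algebra_simps)
      also have "(\<integral>\<^sup>+ s. H (x - (- (c * x $ n) + s) *\<^sub>R ?e) \<partial>lborel) = (\<integral>\<^sup>+ s. H (x - s *\<^sub>R ?e) \<partial>lborel)"
        by (rule nn_integral_lborel_translate) measurable
      finally show "(\<integral>\<^sup>+ s. H (- s *\<^sub>R ?e + x + (c * x $ n) *\<^sub>R ?e) * w (x $ m) \<partial>lborel) =
          w (x $ m) * (\<integral>\<^sup>+ s. H (x - s *\<^sub>R ?e) \<partial>lborel)" .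
    qed
    finally show ?thesis .
  qed
  show ?thesis using main[of c] main[of 0] by simp
qed

lemma Basis_cart: "(Basis :: (real^'n) set) = range (\<lambda>i. axis i 1)"
  by (auto simp: Basis_vec_def)

lemma prod_Basis_cart: "(\<Prod>b\<in>(Basis :: (real^'n) set). f b) = (\<Prod>i\<in>UNIV. f (axis i 1))"
  unfolding Basis_cart by (subst prod.reindex) (auto simp: inj_on_def axis_eq_axis)

lemma sum_Basis_cart: "(\<Sum>b\<in>(Basis :: (real^'n) set). f b) = (\<Sum>i\<in>UNIV. f (axis i 1))"
  unfolding Basis_cart by (subst sum.reindex) (auto simp: inj_on_def axis_eq_axis)

lemma nn_integral_lborel_diagonal:
  fixes H :: "real^'n \<Rightarrow> ennreal"
  assumes [measurable]: "H \<in> borel_measurable borel" and c: "\<And>i. c i \<noteq> 0"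
  shows "(\<integral>\<^sup>+ x. H x \<partial>lborel) = ennreal \<bar>\<Prod>i\<in>UNIV. c i\<bar> * (\<integral>\<^sup>+ x. H (\<chi> i. c i * x $ i) \<partial>lborel)"
proof -
  \<comment> \<open>Recovers the diagonal entry \<open>c i\<close> from the basis vector
    \<open>axis i 1\<close>, because the affine change of variables indexes its factors by basis
    vectors.\<close>
  define d where "d b = (\<Sum>i\<in>UNIV. c i * (b $ i)\<^sup>2)" for b :: "real^'n"
  have d: "d (axis i 1) = c i" for i
    unfolding d_def by (simp add: axis_def if_distrib[of "\<lambda>x. x\<^sup>2"] if_distrib[of "\<lambda>x. c _ * x"] cong: if_cong)
  have T: "(0::real^'n) + (\<Sum>j\<in>Basis. (d j * (x \<bullet> j)) *\<^sub>R j) = (\<chi> i. c i * x $ i)" for x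
    unfolding sum_Basis_cart d inner_axis
    by (simp add: vec_eq_iff axis_def if_distrib[of "\<lambda>x. _ * x"] cong: if_cong)
  have eq: "(lborel :: (real^'n) measure) =
      density (distr lborel borel (\<lambda>x. 0 + (\<Sum>j\<in>Basis. (d j * (x \<bullet> j)) *\<^sub>R j))) (\<lambda>_. (\<Prod>j\<in>Basis. \<bar>d j\<bar>))"
    by (rule lborel_affine_euclidean) (auto simp: Basis_cart d c)
  have [measurable]: "(\<lambda>x::real^'n. \<chi> i. c i * x $ i) \<in> borel_measurable borel"
    by (intro borel_measurable_continuous_onI continuous_intros)
  have p: "(\<Prod>j\<in>(Basis :: (real^'n) set). \<bar>d j\<bar>) = \<bar>\<Prod>i\<in>UNIV. c i\<bar>"
    unfolding prod_Basis_cart d by (simp add: abs_prod)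
  show ?thesis
    by (subst eq, unfold T p) (simp add: nn_integral_density nn_integral_distr nn_integral_cmult)
qed

lemma lborel_distr_transpose:
  "distr lborel borel (\<lambda>x::real^'n. \<chi> i. x $ Transposition.transpose m n i) = lborel"
proof (rule lborel_eqI[symmetric])
  let ?t = "Transposition.transpose m n"
  let ?T = "\<lambda>x::real^'n. \<chi> i. x $ ?t i"
  have [measurable]: "?T \<in> borel_measurable borel"
    by (intro borel_measurable_continuous_onI continuous_intros)
  fix l u :: "real^'n" assume lu: "\<And>b. b \<in> Basis \<Longrightarrow> l \<bullet> b \<le> u \<bullet> b"
  have lu': "l $ i \<le> u $ i" for i using lu[of "axis i 1"] by (simp add: inner_axis Basis_cart)
  have "?T -` box l u = box (?T l) (?T u)"
  proof (intro set_eqI)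
    fix x
    have "(\<forall>i. l $ i < x $ ?t i \<and> x $ ?t i < u $ i) \<longleftrightarrow> (\<forall>i. l $ ?t i < x $ i \<and> x $ i < u $ ?t i)"
      by (metis transpose_involutory)
    then show "x \<in> ?T -` box l u \<longleftrightarrow> x \<in> box (?T l) (?T u)" by (simp add: mem_box_cart)
  qed
  then have "emeasure (distr lborel borel ?T) (box l u) = emeasure lborel (box (?T l) (?T u))"
    by (simp add: emeasure_distr)
  also have "\<dots> = (\<Prod>b\<in>Basis. (?T u - ?T l) \<bullet> b)"
    by (rule emeasure_lborel_box) (auto simp: Basis_cart inner_axis lu')
  also have "(\<Prod>b\<in>Basis. (?T u - ?T l) \<bullet> b) = (\<Prod>i\<in>UNIV. (u - l) $ ?t i)"
    by (simp add: prod_Basis_cart inner_axis)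
  also have "\<dots> = (\<Prod>i\<in>UNIV. (u - l) $ i)"
    using prod.permute[OF permutes_swap_id[of m UNIV n], of "\<lambda>i. (u - l) $ i"] by (simp add: comp_def)
  also have "\<dots> = (\<Prod>b\<in>Basis. (u - l) \<bullet> b)" by (simp add: prod_Basis_cart inner_axis)
  finally show "emeasure (distr lborel borel ?T) (box l u) = (\<Prod>b\<in>Basis. (u - l) \<bullet> b)" .
qed simp

text \<open>Both sides are multiplicative in \<open>A\<close>, so elementary matrices suffice. A
  zero row is excluded by the determinant; the remaining cases are scaling, exchange of coordinates
  and shear.\<close>

theorem nn_integral_lborel_linear:
  fixes A :: "real^'n^'n"
  shows "det A \<noteq> 0 \<Longrightarrow> H \<in> borel_measurable borel \<Longrightarrow>
    (\<integral>\<^sup>+ x. H x \<partial>lborel) = ennreal \<bar>det A\<bar> * (\<integral>\<^sup>+ x. H (A *v x) \<partial>lborel)"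
proof (induction A arbitrary: H rule: induct_matrix_elementary_alt[case_names mult zero_row diagonal swap1 idplus])
  case (mult A B)
  have d: "det A \<noteq> 0" "det B \<noteq> 0" using mult.prems by (auto simp: det_mul)
  have "(*v) A \<in> borel_measurable borel"
    by (intro borel_measurable_continuous_onI matrix_vector_mult_linear_continuous_on)
  then have "(\<lambda>x. H (A *v x)) \<in> borel_measurable borel" using mult.prems(2) by (rule measurable_compose)
  from mult.IH(1)[OF d(1) mult.prems(2)] mult.IH(2)[OF d(2) this]
  show ?case
    by (simp add: det_mul abs_mult ennreal_mult matrix_vector_mul_assoc mult.assoc)
next
  case (zero_row A i)
  then have "det A = 0" by (intro det_zero_row(1)) (auto simp: row_def vec_eq_iff)
  with zero_row show ?case by simp
next
  case (diagonal A)
  have dA: "det A = (\<Prod>i\<in>UNIV. A $ i $ i)" by (rule det_diagonal) (use diagonal in auto)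
  then have nz: "A $ i $ i \<noteq> 0" for i using diagonal.prems by auto
  have "A *v x = (\<chi> i. A $ i $ i * x $ i)" for x
  proof -
    have "(\<Sum>j\<in>UNIV. A $ i $ j * x $ j) = (\<Sum>j\<in>UNIV. if j = i then A $ i $ i * x $ i else 0)" for i
      by (rule sum.cong) (use diagonal.hyps in auto)
    then show ?thesis by (simp add: matrix_vector_mult_def)
  qed
  with nn_integral_lborel_diagonal[of H "\<lambda>i. A $ i $ i"] diagonal.prems nz show ?case
    by (simp add: dA)
next
  case (swap1 m n)
  let ?A = "(\<chi> i j. mat 1 $ i $ Transposition.transpose m n j) :: real^'n^'n"
  have "?A *v x = (\<chi> i. x $ Transposition.transpose m n i)" for x
  proof -
    have "(\<Sum>j\<in>UNIV. mat 1 $ i $ Transposition.transpose m n j * x $ j) =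
        (\<Sum>j\<in>UNIV. if j = Transposition.transpose m n i then x $ j else 0)" for i
      by (rule sum.cong) (auto simp: mat_def)
    then show ?thesis by (simp add: matrix_vector_mult_def)
  qed
  moreover have "\<bar>det ?A\<bar> = 1"
  proof -
    have "det ?A = of_int (sign (Transposition.transpose m n)) * det (mat 1 :: real^'n^'n)"
      by (rule det_permute_columns) (simp add: permutes_swap_id)
    then show ?thesis using swap1.hyps by (simp add: sign_swap_id)
  qed
  moreover have "(\<lambda>x::real^'n. \<chi> i. x $ Transposition.transpose m n i) \<in> borel_measurable borel"
    by (intro borel_measurable_continuous_onI continuous_intros)
  ultimately show ?case
    using swap1.prems by (subst lborel_distr_transpose[of m n, symmetric]) (simp add: nn_integral_distr)
next
  case (idplus m n)
  let ?A = "(\<chi> i j. of_bool (i = m \<and> j = n \<or> i = j)) :: real^'n^'n"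
  have mul: "?A *v x = x + (1 * x $ n) *\<^sub>R axis m 1" for x
  proof -
    have "(\<Sum>j\<in>UNIV. of_bool (i = m \<and> j = n \<or> i = j) * x $ j) =
        (\<Sum>j\<in>UNIV. (if j = i then x $ j else 0) + (if j = n then (if i = m then x $ j else 0) else 0))" for i
      using idplus.hyps by (intro sum.cong) auto
    then show ?thesis by (simp add: matrix_vector_mult_def vec_eq_iff sum.distrib axis_def)
  qed
  have "?A = (\<chi> k. if k = m then row m (mat 1) + 1 *s row n (mat 1) else row k (mat 1))"
    using idplus.hyps by (auto simp: vec_eq_iff row_def mat_def)
  then have "det ?A = det (mat 1 :: real^'n^'n)" by (simp only: det_row_operation[OF idplus.hyps])
  then have d: "ennreal \<bar>det ?A\<bar> = 1" by (simp only: det_I abs_one ennreal_1)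
  show ?case unfolding d mul nn_integral_lborel_shear[OF idplus.prems(2) idplus.hyps] by simp
qed

section \<open>Reflection and rebracketing of Lebesgue measure\<close>

lemma onb_lborel: "orthonormal_basis (lborel :: 'a::euclidean_space measure) (onb lborel)"
  by (rule orthonormal_basis_onb[OF exists_orthonormal_basis_lborel])

lemma onb_L2: "onb (lborel :: 'a::euclidean_space measure) j \<in> L2 lborel"
  by (rule orthonormal_basis_L2[OF onb_lborel])

lemma onb_measurable [measurable]: "onb (lborel :: 'a::euclidean_space measure) j \<in> borel_measurable borel"
proof -
  have "onb (lborel :: 'a measure) j \<in> borel_measurable lborel" by (rule L2_measurable[OF onb_L2])
  then show ?thesis by simp
qed

lemma
  fixes c :: "'a::euclidean_space"
  shows lborel_distr_reflect: "distr lborel borel (\<lambda>x. c - x) = lborel"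
  using lborel_affine[of "-1" c] by (simp add: density_1 one_ennreal_def[symmetric])

lemma nn_integral_lborel_reflect:
  fixes f :: "'a::euclidean_space \<Rightarrow> ennreal"
  assumes [measurable]: "f \<in> borel_measurable borel"
  shows "(\<integral>\<^sup>+x. f (c - x) \<partial>lborel) = (\<integral>\<^sup>+x. f x \<partial>lborel)"
  by (subst (2) lborel_distr_reflect[of c, symmetric]) (simp add: nn_integral_distr)

lemma integral_lborel_reflect:
  fixes f :: "'a::euclidean_space \<Rightarrow> 'b::{banach, second_countable_topology}"
  assumes [measurable]: "f \<in> borel_measurable borel"
  shows "(LINT x|lborel. f (c - x)) = (LINT x|lborel. f x)"
  by (subst (2) lborel_distr_reflect[of c, symmetric]) (simp add: integral_distr)

lemma integrable_lborel_reflect: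
  fixes f :: "'a::euclidean_space \<Rightarrow> 'b::{banach, second_countable_topology}"
  assumes [measurable]: "f \<in> borel_measurable borel"
  shows "integrable lborel (\<lambda>x. f (c - x)) \<longleftrightarrow> integrable lborel f"
  by (subst (2) lborel_distr_reflect[of c, symmetric]) (simp add: integrable_distr_eq)

lemma
  fixes f :: "'a::euclidean_space \<Rightarrow> complex"
  assumes "f \<in> L2 lborel"
  shows L2_lborel_translate: "(\<lambda>x. f (c + x)) \<in> L2 lborel"
    and L2_lborel_reflect: "(\<lambda>x. f (c - x)) \<in> L2 lborel"
proof -
  have [measurable]: "f \<in> borel_measurable borel" and i: "integrable lborel (\<lambda>x. (cmod (f x))\<^sup>2)"
    using assms by (auto simp: L2_def)
  show "(\<lambda>x. f (c + x)) \<in> L2 lborel"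
    using i integrable_lborel_translate_iff[of "\<lambda>x. (cmod (f x))\<^sup>2" c] by (simp add: L2_def)
  show "(\<lambda>x. f (c - x)) \<in> L2 lborel"
    using i integrable_lborel_reflect[of "\<lambda>x. (cmod (f x))\<^sup>2" c] by (simp add: L2_def)
qed

text \<open>Lebesgue measure is determined by boxes, and rebracketing takes boxes to boxes of the
  same volume.\<close>

lemma lborel_distr_assoc:
  "distr lborel borel (\<lambda>p. (fst (fst p), snd (fst p), snd p)) =
    (lborel :: ('a::euclidean_space \<times> 'b::euclidean_space \<times> 'c::euclidean_space) measure)"
proof (rule lborel_eqI[symmetric])
  let ?T = "\<lambda>p::('a \<times> 'b) \<times> 'c. (fst (fst p), snd (fst p), snd p)"
  have [measurable]: "?T \<in> borel_measurable borel"
    by (intro borel_measurable_continuous_onI continuous_intros)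
  fix l u :: "'a \<times> 'b \<times> 'c" assume lu: "\<And>b. b \<in> Basis \<Longrightarrow> l \<bullet> b \<le> u \<bullet> b"
  obtain l1 l2 l3 u1 u2 u3 where l: "l = (l1, l2, l3)" and u: "u = (u1, u2, u3)" by (cases l, cases u) auto
  have box: "box (a, b) (c, d) = box a c \<times> box b d" for a c :: "'x::euclidean_space" and b d :: "'y::euclidean_space"
    by (auto simp: box_def Basis_prod_def ball_Un)
  have pre: "?T -` box l u = (box l1 u1 \<times> box l2 u2) \<times> box l3 u3"
    unfolding l u box by auto
  have le: "\<And>b. b \<in> Basis \<Longrightarrow> l1 \<bullet> b \<le> u1 \<bullet> b" "\<And>b. b \<in> Basis \<Longrightarrow> l2 \<bullet> b \<le> u2 \<bullet> b"
    "\<And>b. b \<in> Basis \<Longrightarrow> l3 \<bullet> b \<le> u3 \<bullet> b"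
  proof -
    show "l1 \<bullet> b \<le> u1 \<bullet> b" if "b \<in> Basis" for b
    proof -
      have "(b, 0, 0) \<in> (Basis :: ('a \<times> 'b \<times> 'c) set)" using that by (force simp: Basis_prod_def zero_prod_def image_iff)
      from lu[OF this] show ?thesis by (simp add: l u)
    qed
    show "l2 \<bullet> b \<le> u2 \<bullet> b" if "b \<in> Basis" for b
    proof -
      have "(0, b, 0) \<in> (Basis :: ('a \<times> 'b \<times> 'c) set)" using that by (force simp: Basis_prod_def zero_prod_def image_iff)
      from lu[OF this] show ?thesis by (simp add: l u)
    qed
    show "l3 \<bullet> b \<le> u3 \<bullet> b" if "b \<in> Basis" for b
    proof -
      have "(0, 0, b) \<in> (Basis :: ('a \<times> 'b \<times> 'c) set)" using that by (force simp: Basis_prod_def zero_prod_def image_iff)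
      from lu[OF this] show ?thesis by (simp add: l u)
    qed
  qed
  have "emeasure (distr lborel borel ?T) (box l u) = emeasure (lborel \<Otimes>\<^sub>M lborel) ((box l1 u1 \<times> box l2 u2) \<times> box l3 u3)"
    by (simp add: emeasure_distr pre lborel_prod)
  also have "\<dots> = emeasure (lborel \<Otimes>\<^sub>M lborel) (box l1 u1 \<times> box l2 u2) * emeasure lborel (box l3 u3)"
    by (subst lborel.emeasure_pair_measure_Times) (auto simp: lborel_prod intro!: borel_open open_Times)
  also have "\<dots> = emeasure lborel (box l1 u1) * emeasure lborel (box l2 u2) * emeasure lborel (box l3 u3)"
    by (subst lborel.emeasure_pair_measure_Times) simp_all
  also have "\<dots> = emeasure lborel (box l1 u1) * emeasure (lborel \<Otimes>\<^sub>M lborel) (box l2 u2 \<times> box l3 u3)"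
    by (subst lborel.emeasure_pair_measure_Times) (simp_all add: mult.assoc)
  also have "\<dots> = emeasure (lborel \<Otimes>\<^sub>M lborel) (box l1 u1 \<times> box l2 u2 \<times> box l3 u3)"
    by (subst lborel.emeasure_pair_measure_Times) (auto simp: lborel_prod intro!: borel_open open_Times)
  also have "\<dots> = emeasure lborel (box l u)" by (simp add: lborel_prod l u box)
  also have "\<dots> = (\<Prod>b\<in>Basis. (u - l) \<bullet> b)" by (rule emeasure_lborel_box[OF lu])
  finally show "emeasure (distr lborel borel ?T) (box l u) = (\<Prod>b\<in>Basis. (u - l) \<bullet> b)" .
qed simp

context two_step
begin

text \<open>Groups \<open>z\<close> and \<open>y\<close>, the variables of the partial Fourier
  transform, into one Euclidean variable and separates them from \<open>t\<close>.\<close>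

abbreviation chart2 :: "((real^'k) \<times> (real^'d)) \<times> (real^'d) \<Rightarrow> 'v" where
  "chart2 p \<equiv> chart (fst (fst p), snd (fst p), snd p)"

lemma haar_distr_chart2: "haar = distr (lborel \<Otimes>\<^sub>M lborel) borel chart2"
proof -
  have [measurable]: "(\<lambda>p. (fst (fst p), snd (fst p), snd p)) \<in>
      (borel :: (((real^'k) \<times> (real^'d)) \<times> (real^'d)) measure) \<rightarrow>\<^sub>M (borel :: ((real^'k) \<times> (real^'d) \<times> (real^'d)) measure)"
    by (intro borel_measurable_continuous_onI continuous_intros)
  have "haar = distr (distr lborel borel (\<lambda>p. (fst (fst p), snd (fst p), snd p))) borel chart"
    unfolding haar_def lborel_distr_assoc ..
  also have "\<dots> = distr lborel borel chart2"
    by (subst distr_distr) (auto simp: comp_def)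
  finally show ?thesis by (simp add: lborel_prod)
qed

lemma chart2_measurable [measurable]: "chart2 \<in> borel_measurable (lborel \<Otimes>\<^sub>M lborel)"
proof -
  have "(\<lambda>p. (fst (fst p), snd (fst p), snd p)) \<in>
      (borel :: (((real^'k) \<times> (real^'d)) \<times> (real^'d)) measure) \<rightarrow>\<^sub>M (borel :: ((real^'k) \<times> (real^'d) \<times> (real^'d)) measure)"
    by (intro borel_measurable_continuous_onI continuous_intros)
  from measurable_compose[OF this chart_measurable] show ?thesis by (simp add: lborel_prod)
qed

lemma L2_haar_measurable: "f \<in> L2 haar \<Longrightarrow> f \<in> borel_measurable borel"
proof -
  assume "f \<in> L2 haar"
  then have "f \<in> borel_measurable haar" by (rule L2_measurable)
  then show ?thesis by (subst (asm) measurable_cong_sets[OF sets_haar refl])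
qed

lemma nn_integral_haar2:
  "f \<in> borel_measurable borel \<Longrightarrow> (\<integral>\<^sup>+ n. f n \<partial>haar) = (\<integral>\<^sup>+ p. f (chart2 p) \<partial>(lborel \<Otimes>\<^sub>M lborel))"
  unfolding haar_distr_chart2 by (rule nn_integral_distr) measurable

lemma integral_haar2:
  fixes f :: "'v \<Rightarrow> 'b::{banach, second_countable_topology}"
  shows "f \<in> borel_measurable borel \<Longrightarrow> (LINT n|haar. f n) = (LINT p|(lborel \<Otimes>\<^sub>M lborel). f (chart2 p))"
  unfolding haar_distr_chart2 by (rule integral_distr) measurable

lemma integrable_haar2:
  fixes f :: "'v \<Rightarrow> 'b::{banach, second_countable_topology}"
  shows "f \<in> borel_measurable borel \<Longrightarrow> integrable haar f \<longleftrightarrow> integrable (lborel \<Otimes>\<^sub>M lborel) (\<lambda>p. f (chart2 p))"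
  unfolding haar_distr_chart2 by (rule integrable_distr_eq) measurable

subsection \<open>The representations\<close>

lemma pi_rep_chart: "pi_rep lam (chart (z, y, t)) F =
    (\<lambda>x. cis (2 * pi * (lam \<bullet> z)) * cis (2 * pi * (x \<bullet> (B lam *v y))) * F (x - t))"
  by (simp add: pi_rep_def inv_chart)

lemma chart_cases:
  obtains z y t where "n = chart (z, y, t)"
proof -
  obtain z y t where "chart_inv n = (z, y, t)" by (cases "chart_inv n") auto
  then have "n = chart (z, y, t)" using chart_chart_inv[of n] by simp
  then show ?thesis by (rule that)
qed

text \<open>By \<open>inner_B\<close> the term \<open>beta t y'\<close> of the group law is exactly
  the phase picked up when \<open>x\<close> is replaced by \<open>x - t\<close> in the character of
  \<open>y'\<close>.\<close>

lemma pi_rep_mult: "pi_rep lam (a \<odot> b) F = pi_rep lam a (pi_rep lam b F)"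
proof -
  obtain z y t where a: "a = chart (z, y, t)" by (rule chart_cases)
  obtain z' y' t' where b: "b = chart (z', y', t')" by (rule chart_cases)
  show ?thesis
  proof
    fix x
    have "2 * pi * (lam \<bullet> (z + z' + beta t y')) + 2 * pi * (x \<bullet> (B lam *v (y + y'))) =
        2 * pi * (lam \<bullet> z) + 2 * pi * (x \<bullet> (B lam *v y)) + (2 * pi * (lam \<bullet> z') + 2 * pi * ((x - t) \<bullet> (B lam *v y')))"
      by (simp add: inner_add_right matrix_vector_right_distrib inner_diff_left inner_diff_right inner_B
        bilinear_lsub[OF bilinear_beta] algebra_simps)
    then show "pi_rep lam (a \<odot> b) F x = pi_rep lam a (pi_rep lam b F) x"
      unfolding a b chart_mult pi_rep_chart
      by (simp add: cis_mult mult.assoc[symmetric] diff_diff_eq)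
  qed
qed

lemma chart_zero: "chart 0 = 0"
proof -
  have "lin_chart (0, 0, 0) = 0" using linear_0[OF linear_lin_chart] by (simp only: zero_prod_def)
  then have "chart (0, 0, 0) = 0" unfolding chart_eq by (simp only: beta_zero scaleR_zero_right diff_0_right)
  then show ?thesis by (simp only: zero_prod_def)
qed

lemma pi_rep_zero: "pi_rep lam 0 F = F"
proof -
  have "pi_rep lam (chart (0, 0, 0)) F = F" by (simp add: pi_rep_chart)
  then show ?thesis using chart_zero by (simp add: zero_prod_def)
qed

lemma pi_rep_neg: "pi_rep lam a (pi_rep lam (- a) F) = F" "pi_rep lam (- a) (pi_rep lam a F) = F"
  by (simp_all add: pi_rep_mult[symmetric] gmult_uminus pi_rep_zero)

lemma cmod_pi_rep: "cmod (pi_rep lam (chart (z, y, t)) F x) = cmod (F (x - t))"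
  by (simp add: pi_rep_chart norm_mult)

lemma pi_rep_measurable_pair:
  assumes [measurable]: "F \<in> borel_measurable borel" "f \<in> borel_measurable M" "g \<in> borel_measurable M" "h \<in> borel_measurable M"
  shows "(\<lambda>w. pi_rep (f w) (chart (g w)) F (h w)) \<in> borel_measurable M"
proof -
  have [measurable]: "(\<lambda>w. h w \<bullet> (B (f w) *v fst (snd (g w)))) \<in> borel_measurable M"
  proof -
    have [measurable]: "(\<lambda>w. fst (snd (g w))) \<in> borel_measurable M"
      by (rule measurable_compose[OF assms(3)]) (intro borel_measurable_continuous_onI continuous_intros)
    show ?thesis unfolding inner_B by measurable
  qed
  have "pi_rep (f w) (chart (g w)) F (h w) =
      cis (2 * pi * (f w \<bullet> fst (g w))) * cis (2 * pi * (h w \<bullet> (B (f w) *v fst (snd (g w))))) * F (h w - snd (snd (g w)))" for w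
    by (cases "g w") (simp add: pi_rep_chart)
  moreover have "(\<lambda>w. fst (g w)) \<in> borel_measurable M" "(\<lambda>w. snd (snd (g w))) \<in> borel_measurable M"
    by (rule measurable_compose[OF assms(3)], intro borel_measurable_continuous_onI continuous_intros)+
  ultimately show ?thesis by simp
qed

lemma pi_rep_measurable [measurable (raw)]:
  assumes "F \<in> borel_measurable borel" "f \<in> borel_measurable M" "g \<in> borel_measurable M" "h \<in> borel_measurable M"
  shows "(\<lambda>w. pi_rep (f w) (g w) F (h w)) \<in> borel_measurable M"
proof -
  have "(\<lambda>w. chart_inv (g w)) \<in> borel_measurable M"
    by (rule measurable_compose[OF assms(3) chart_inv_measurable])
  from pi_rep_measurable_pair[OF assms(1,2) this assms(4)] show ?thesis by simp
qed

lemma pi_rep_L2: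
  assumes F: "F \<in> L2 lborel"
  shows "pi_rep lam a F \<in> L2 lborel"
proof -
  obtain z y t where a: "a = chart (z, y, t)" by (rule chart_cases)
  have m: "F \<in> borel_measurable borel" using F by (simp add: L2_def)
  show ?thesis
  proof (rule L2_bound[OF _ L2_lborel_translate[OF F, of "- t"]])
    have "(\<lambda>x. pi_rep lam a F x) \<in> borel_measurable lborel" using m by measurable
    then show "pi_rep lam a F \<in> borel_measurable lborel" by simp
    show "cmod (pi_rep lam a F x) \<le> cmod (F (- t + x))" for x
      by (simp add: a cmod_pi_rep)
  qed
qed

lemma pi_rep_inner: "l2_inner lborel (pi_rep lam a F) (pi_rep lam a G) = l2_inner lborel F G"
proof -
  obtain z y t where a: "a = chart (z, y, t)" by (rule chart_cases)
  have u: "cis r * cnj (cis r) = 1" for r by (simp add: cis_cnj cis_mult)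
  have "pi_rep lam a F x * cnj (pi_rep lam a G x) = F (- t + x) * cnj (G (- t + x))" for x
  proof -
    have "pi_rep lam a F x * cnj (pi_rep lam a G x) =
        (cis (2 * pi * (lam \<bullet> z)) * cnj (cis (2 * pi * (lam \<bullet> z)))) *
        (cis (2 * pi * (x \<bullet> (B lam *v y))) * cnj (cis (2 * pi * (x \<bullet> (B lam *v y))))) *
        (F (x - t) * cnj (G (x - t)))"
      unfolding a pi_rep_chart complex_cnj_mult by (simp only: mult_ac)
    then show ?thesis by (simp add: u)
  qed
  then have "l2_inner lborel (pi_rep lam a F) (pi_rep lam a G) = (LINT x|lborel. F (- t + x) * cnj (G (- t + x)))"
    unfolding l2_inner_def by simp
  also have "\<dots> = l2_inner lborel F G"
    unfolding l2_inner_def by (rule integral_lborel_translate[of "\<lambda>x. F x * cnj (G x)"])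
  finally show ?thesis .
qed

lemma pi_rep_norm: "l2_norm lborel (pi_rep lam a F) = l2_norm lborel F"
proof -
  have "(l2_norm lborel (pi_rep lam a F))\<^sup>2 = (l2_norm lborel F)\<^sup>2"
    using pi_rep_inner[of lam a F F] unfolding l2_inner_self by (simp only: of_real_eq_iff)
  then show ?thesis by (rule power2_eq_imp_eq) simp_all
qed

lemma pi_rep_adjoint: "l2_inner lborel (pi_rep lam a F) G = l2_inner lborel F (pi_rep lam (- a) G)"
  using pi_rep_inner[of lam a F "pi_rep lam (- a) G"] by (simp add: pi_rep_neg)

lemma pi_rep_linear:
  "pi_rep lam a (\<lambda>x. F x + G x) x = pi_rep lam a F x + pi_rep lam a G x"
  "pi_rep lam a (\<lambda>x. F x - G x) x = pi_rep lam a F x - pi_rep lam a G x"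
  "pi_rep lam a (\<lambda>x. c * F x) x = c * pi_rep lam a F x"
  by (cases a rule: chart_cases; simp add: pi_rep_chart algebra_simps)+

lemma bounded_pi_rep: "bounded_operator lborel (pi_rep lam a)"
  unfolding bounded_operator_def
  by (auto intro!: pi_rep_L2 exI[of _ 1] simp: pi_rep_linear pi_rep_norm)

subsection \<open>The Plancherel measure\<close>

lemma space_mu [simp]: "space mu = Sig"
  by (simp add: mu_def space_restrict_space)

lemma sets_mu: "sets mu = sets (restrict_space borel Sig)"
  unfolding mu_def sets_density by (rule sets_restrict_space_cong) simp

lemma borel_measurable_mu: "f \<in> borel_measurable borel \<Longrightarrow> f \<in> borel_measurable mu"
  unfolding measurable_cong_sets[OF sets_mu refl] by (rule measurable_restrict_space1)

lemma id_measurable_mu [measurable]: "(\<lambda>x. x) \<in> borel_measurable mu"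
  by (rule borel_measurable_mu) simp

lemma det_B_measurable_mu [measurable]: "(\<lambda>lam. det (B lam)) \<in> borel_measurable mu"
  by (rule borel_measurable_mu) simp

lemma nn_integral_mu:
  assumes "f \<in> borel_measurable mu"
  shows "(\<integral>\<^sup>+ lam. f lam \<partial>mu) = (\<integral>\<^sup>+ lam. ennreal \<bar>det (B lam)\<bar> * f lam * indicator Sig lam \<partial>lborel)"
proof -
  have f: "f \<in> borel_measurable (restrict_space lborel Sig)"
    using assms by (simp add: mu_def)
  have "(\<lambda>lam. ennreal \<bar>det (B lam)\<bar>) \<in> borel_measurable (restrict_space lborel Sig)"
    by (intro measurable_restrict_space1) simp
  then have "(\<integral>\<^sup>+ lam. f lam \<partial>mu) = (\<integral>\<^sup>+ lam. ennreal \<bar>det (B lam)\<bar> * f lam \<partial>restrict_space lborel Sig)"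
    unfolding mu_def by (rule nn_integral_density[OF _ f])
  also have "\<dots> = (\<integral>\<^sup>+ lam. ennreal \<bar>det (B lam)\<bar> * f lam * indicator Sig lam \<partial>lborel)"
    by (rule nn_integral_restrict_space) simp
  finally show ?thesis .
qed

lemma nn_integral_mu_borel:
  assumes "f \<in> borel_measurable borel"
  shows "(\<integral>\<^sup>+ lam. f lam \<partial>mu) = (\<integral>\<^sup>+ lam. ennreal \<bar>det (B lam)\<bar> * f lam \<partial>lborel)"
  unfolding nn_integral_mu[OF borel_measurable_mu[OF assms]]
  by (rule nn_integral_cong_AE) (use AE_Sig in \<open>auto simp: indicator_def\<close>)

text \<open>The density is positive on \<open>Sig\<close>, whose complement is null, so the two
  measures have the same null sets.\<close>

lemma AE_mu: "(AE lam in mu. P lam) \<longleftrightarrow> (AE lam in lborel. P lam)"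
proof -
  have "(\<lambda>lam. ennreal \<bar>det (B lam)\<bar>) \<in> borel_measurable (restrict_space lborel Sig)"
    by (intro measurable_restrict_space1) simp
  then have "(AE lam in mu. P lam) \<longleftrightarrow> (AE lam in restrict_space lborel Sig. 0 < ennreal \<bar>det (B lam)\<bar> \<longrightarrow> P lam)"
    unfolding mu_def by (rule AE_density)
  also have "\<dots> \<longleftrightarrow> (AE lam in lborel. lam \<in> Sig \<longrightarrow> 0 < ennreal \<bar>det (B lam)\<bar> \<longrightarrow> P lam)"
    by (rule AE_restrict_space_iff) simp
  also have "\<dots> \<longleftrightarrow> (AE lam in lborel. P lam)"
    using AE_Sig by (auto simp: Sig_def elim!: eventually_rev_mp)
  finally show ?thesis .
qed

lemma sigma_finite_mu: "sigma_finite_measure mu"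
proof -
  have "sigma_finite_measure (restrict_space lborel Sig)"
    by (rule sigma_finite_measure_restrict_space) (simp_all add: sigma_finite_lborel)
  then interpret sigma_finite_measure "restrict_space lborel Sig" .
  have "(\<lambda>lam. ennreal \<bar>det (B lam)\<bar>) \<in> borel_measurable (restrict_space lborel Sig)"
    by (intro measurable_restrict_space1) simp
  then show ?thesis unfolding mu_def by (subst sigma_finite_iff_density_finite) auto
qed


sublocale haar: sigma_finite_measure haar
  by (rule sigma_finite_haar)

sublocale mu: sigma_finite_measure mu
  by (rule sigma_finite_mu)

subsection \<open>The integrated representation\<close>

lemma nn_integral_pi_rep:
  assumes f: "f \<in> borel_measurable borel" and h: "h \<in> L2 lborel"
  shows "(\<integral>\<^sup>+ x. \<integral>\<^sup>+ n. ennreal (cmod (f n)) * ennreal ((cmod (pi_rep lam n h x))\<^sup>2) \<partial>haar \<partial>lborel) =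
    (\<integral>\<^sup>+ n. ennreal (cmod (f n)) \<partial>haar) * ennreal ((l2_norm lborel h)\<^sup>2)"
proof -
  interpret P: pair_sigma_finite haar "lborel :: (real^'d) measure" ..
  have [measurable]: "h \<in> borel_measurable borel" "f \<in> borel_measurable borel" using h f by (auto simp: L2_def)
  have "(\<integral>\<^sup>+ x. \<integral>\<^sup>+ n. ennreal (cmod (f n)) * ennreal ((cmod (pi_rep lam n h x))\<^sup>2) \<partial>haar \<partial>lborel) =
      (\<integral>\<^sup>+ n. \<integral>\<^sup>+ x. ennreal (cmod (f n)) * ennreal ((cmod (pi_rep lam n h x))\<^sup>2) \<partial>lborel \<partial>haar)"
    by (rule P.Fubini') measurable
  also have "\<dots> = (\<integral>\<^sup>+ n. ennreal (cmod (f n)) * ennreal ((l2_norm lborel h)\<^sup>2) \<partial>haar)"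
  proof (rule nn_integral_cong)
    fix n
    have "(\<integral>\<^sup>+ x. ennreal ((cmod (pi_rep lam n h x))\<^sup>2) \<partial>lborel) = ennreal ((l2_norm lborel h)\<^sup>2)"
      using ennreal_l2_norm_square[OF pi_rep_L2[OF h]] by (simp add: pi_rep_norm)
    then show "(\<integral>\<^sup>+ x. ennreal (cmod (f n)) * ennreal ((cmod (pi_rep lam n h x))\<^sup>2) \<partial>lborel) =
        ennreal (cmod (f n)) * ennreal ((l2_norm lborel h)\<^sup>2)"
      by (subst nn_integral_cmult) measurable
  qed
  also have "\<dots> = (\<integral>\<^sup>+ n. ennreal (cmod (f n)) \<partial>haar) * ennreal ((l2_norm lborel h)\<^sup>2)"
    by (rule nn_integral_multc) measurable
  finally show ?thesis .
qed

text \<open>Young's inequality, from the Cauchy--Schwarz inequality with the weight \<open>\<bar>f\<bar>\<close>.\<close>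

lemma nn_integral_young:
  assumes f: "integrable haar f" and h: "h \<in> L2 lborel"
  shows "(\<integral>\<^sup>+ x. (\<integral>\<^sup>+ n. ennreal (cmod (f n * pi_rep lam n h x)) \<partial>haar)\<^sup>2 \<partial>lborel) \<le>
    ennreal (((LINT n|haar. cmod (f n)) * l2_norm lborel h)\<^sup>2)"
proof -
  have [measurable]: "h \<in> borel_measurable borel" "f \<in> borel_measurable borel" using h f by (auto simp: L2_def)
  have f1: "(\<integral>\<^sup>+ n. ennreal (cmod (f n)) \<partial>haar) = ennreal (LINT n|haar. cmod (f n))"
    using f by (intro nn_integral_eq_integral) auto
  have "(\<integral>\<^sup>+ n. ennreal (cmod (f n * pi_rep lam n h x)) \<partial>haar)\<^sup>2 \<le>
      ennreal (LINT n|haar. cmod (f n)) * (\<integral>\<^sup>+ n. ennreal (cmod (f n)) * ennreal ((cmod (pi_rep lam n h x))\<^sup>2) \<partial>haar)" for x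
  proof -
    have "(\<integral>\<^sup>+ n. ennreal (cmod (f n * pi_rep lam n h x)) \<partial>haar) =
        (\<integral>\<^sup>+ n. ennreal (sqrt (cmod (f n))) * ennreal (sqrt (cmod (f n)) * cmod (pi_rep lam n h x)) \<partial>haar)"
      by (intro nn_integral_cong) (simp add: ennreal_mult[symmetric] norm_mult mult.assoc[symmetric])
    moreover have "(\<integral>\<^sup>+ n. ennreal (sqrt (cmod (f n))) * ennreal (sqrt (cmod (f n)) * cmod (pi_rep lam n h x)) \<partial>haar)\<^sup>2 \<le>
        (\<integral>\<^sup>+ n. (ennreal (sqrt (cmod (f n))))\<^sup>2 \<partial>haar) * (\<integral>\<^sup>+ n. (ennreal (sqrt (cmod (f n)) * cmod (pi_rep lam n h x)))\<^sup>2 \<partial>haar)"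
      by (rule Cauchy_Schwarz_nn_integral) measurable
    moreover have "(\<integral>\<^sup>+ n. (ennreal (sqrt (cmod (f n))))\<^sup>2 \<partial>haar) = ennreal (LINT n|haar. cmod (f n))"
      unfolding f1[symmetric] by (intro nn_integral_cong) (simp add: ennreal_power)
    moreover have "(\<integral>\<^sup>+ n. (ennreal (sqrt (cmod (f n)) * cmod (pi_rep lam n h x)))\<^sup>2 \<partial>haar) =
        (\<integral>\<^sup>+ n. ennreal (cmod (f n)) * ennreal ((cmod (pi_rep lam n h x))\<^sup>2) \<partial>haar)"
      by (intro nn_integral_cong) (simp add: ennreal_power power_mult_distrib ennreal_mult)
    ultimately show ?thesis by simp
  qed
  then have "(\<integral>\<^sup>+ x. (\<integral>\<^sup>+ n. ennreal (cmod (f n * pi_rep lam n h x)) \<partial>haar)\<^sup>2 \<partial>lborel) \<le>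
      (\<integral>\<^sup>+ x. ennreal (LINT n|haar. cmod (f n)) * (\<integral>\<^sup>+ n. ennreal (cmod (f n)) * ennreal ((cmod (pi_rep lam n h x))\<^sup>2) \<partial>haar) \<partial>lborel)"
    by (intro nn_integral_mono)
  also have "\<dots> = ennreal (LINT n|haar. cmod (f n)) * ((\<integral>\<^sup>+ n. ennreal (cmod (f n)) \<partial>haar) * ennreal ((l2_norm lborel h)\<^sup>2))"
    by (subst nn_integral_cmult) (measurable, simp add: nn_integral_pi_rep[OF _ h])
  also have "\<dots> = ennreal (((LINT n|haar. cmod (f n)) * l2_norm lborel h)\<^sup>2)"
    unfolding f1 by (simp add: ennreal_mult[symmetric] power2_eq_square mult_ac)
  finally show ?thesis .
qed

lemma AE_integrable_pi_rep:
  assumes f: "integrable haar f" and h: "h \<in> L2 lborel"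
  shows "AE x in lborel. integrable haar (\<lambda>n. f n * pi_rep lam n h x)"
proof -
  have [measurable]: "h \<in> borel_measurable borel" "f \<in> borel_measurable borel" using h f by (auto simp: L2_def)
  have "AE x in lborel. (\<integral>\<^sup>+ n. ennreal (cmod (f n * pi_rep lam n h x)) \<partial>haar)\<^sup>2 \<noteq> \<infinity>"
  proof (rule nn_integral_noteq_infinite)
    show "(\<integral>\<^sup>+ x. (\<integral>\<^sup>+ n. ennreal (cmod (f n * pi_rep lam n h x)) \<partial>haar)\<^sup>2 \<partial>lborel) \<noteq> \<infinity>"
      using nn_integral_young[OF f h, of lam] by (auto simp: top_unique)
  qed measurable
  then show ?thesis
  proof eventually_elim
    case (elim x)
    then have "(\<integral>\<^sup>+ n. ennreal (cmod (f n * pi_rep lam n h x)) \<partial>haar) < \<infinity>"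
      by (auto simp: less_top[symmetric] power_eq_top_ennreal)
    then show ?case by (intro integrableI_bounded) measurable
  qed
qed

lemma pi_integral_measurable_pair [measurable]:
  assumes [measurable]: "f \<in> borel_measurable borel" "h \<in> borel_measurable borel"
  shows "(\<lambda>p. pi_integral (fst p) f h (snd p)) \<in> borel_measurable (borel \<Otimes>\<^sub>M borel)"
  unfolding pi_integral_def by measurable

lemma pi_integral_measurable:
  assumes [measurable]: "f \<in> borel_measurable borel" "h \<in> borel_measurable borel"
  shows "pi_integral lam f h \<in> borel_measurable borel"
  unfolding pi_integral_def by measurable

lemma pi_integral_bound:
  assumes f: "integrable haar f" and h: "h \<in> L2 lborel"
  shows pi_integral_L2: "pi_integral lam f h \<in> L2 lborel"
    and pi_integral_norm_le: "l2_norm lborel (pi_integral lam f h) \<le> (LINT n|haar. cmod (f n)) * l2_norm lborel h"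
proof -
  have [measurable]: "h \<in> borel_measurable borel" "f \<in> borel_measurable borel" using h f by (auto simp: L2_def)
  have "ennreal ((cmod (pi_integral lam f h x))\<^sup>2) \<le> (\<integral>\<^sup>+ n. ennreal (cmod (f n * pi_rep lam n h x)) \<partial>haar)\<^sup>2" for x
  proof -
    have "ennreal (cmod (pi_integral lam f h x)) \<le> (\<integral>\<^sup>+ n. ennreal (cmod (f n * pi_rep lam n h x)) \<partial>haar)"
    proof (cases "integrable haar (\<lambda>n. f n * pi_rep lam n h x)")
      case True
      then show ?thesis unfolding pi_integral_def by (rule integral_norm_bound_ennreal)
    next
      case False
      \<comment> \<open>Where the integral does not converge absolutely it takes the default value
        0, so the pointwise estimate holds for every \<open>x\<close>.\<close>
      then have "pi_integral lam f h x = 0" unfolding pi_integral_def by (rule not_integrable_integral_eq)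
      then show ?thesis by simp
    qed
    then show ?thesis by (simp add: ennreal_power[symmetric] power_mono)
  qed
  then have le: "(\<integral>\<^sup>+ x. ennreal ((cmod (pi_integral lam f h x))\<^sup>2) \<partial>lborel) \<le>
      ennreal (((LINT n|haar. cmod (f n)) * l2_norm lborel h)\<^sup>2)"
    by (intro order_trans[OF nn_integral_mono nn_integral_young[OF f h, of lam]])
  show L: "pi_integral lam f h \<in> L2 lborel"
    by (rule L2I_nn_integral) (use pi_integral_measurable le in \<open>auto intro: le_less_trans\<close>)
  have "(l2_norm lborel (pi_integral lam f h))\<^sup>2 \<le> ((LINT n|haar. cmod (f n)) * l2_norm lborel h)\<^sup>2"
    using le unfolding ennreal_l2_norm_square[OF L, symmetric] by simp
  then show "l2_norm lborel (pi_integral lam f h) \<le> (LINT n|haar. cmod (f n)) * l2_norm lborel h"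
    by (rule power2_le_imp_le) simp
qed

lemma bounded_pi_integral:
  assumes f: "integrable haar f"
  shows "bounded_operator lborel (pi_integral lam f)"
  unfolding bounded_operator_def
proof (intro conjI ballI allI)
  show "pi_integral lam f h \<in> L2 lborel" if "h \<in> L2 lborel" for h by (rule pi_integral_L2[OF f that])
  show "AE x in lborel. pi_integral lam f (\<lambda>y. g y + h y) x = pi_integral lam f g x + pi_integral lam f h x"
    if "g \<in> L2 lborel" "h \<in> L2 lborel" for g h
    using AE_integrable_pi_rep[OF f that(1), of lam] AE_integrable_pi_rep[OF f that(2), of lam]
    by eventually_elim (simp add: pi_integral_def pi_rep_linear distrib_left)
  show "AE x in lborel. pi_integral lam f (\<lambda>y. c * h y) x = c * pi_integral lam f h x"
    if "h \<in> L2 lborel" for c h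
    by (simp add: pi_integral_def pi_rep_linear mult.left_commute[of _ c])
  show "\<exists>C. \<forall>h\<in>L2 lborel. l2_norm lborel (pi_integral lam f h) \<le> C * l2_norm lborel h"
    using pi_integral_norm_le[OF f] by blast
qed

lemma pi_integral_diff:
  assumes f: "integrable haar f" and g: "integrable haar g" and h: "h \<in> L2 lborel"
  shows "AE x in lborel. pi_integral lam (\<lambda>n. f n - g n) h x = pi_integral lam f h x - pi_integral lam g h x"
  using AE_integrable_pi_rep[OF f h, of lam] AE_integrable_pi_rep[OF g h, of lam]
  by eventually_elim (simp add: pi_integral_def left_diff_distrib)

lemma pi_integral_translate:
  assumes [measurable]: "f \<in> borel_measurable borel" "h \<in> borel_measurable borel"
  shows "pi_integral lam (left_translate a f) h = pi_rep lam a (pi_integral lam f h)"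
proof
  fix x
  obtain z y t where a: "a = chart (z, y, t)" by (rule chart_cases)
  have "pi_integral lam (left_translate a f) h x = (LINT n|haar. f ((- a) \<odot> (a \<odot> n)) * pi_rep lam (a \<odot> n) h x)"
    unfolding pi_integral_def left_translate_def
    by (rule integral_haar_left[symmetric]) measurable
  also have "\<dots> = (LINT n|haar. f n * pi_rep lam a (pi_rep lam n h) x)"
    by (simp add: gmult_assoc[symmetric] gmult_uminus gmult_zero pi_rep_mult)
  also have "\<dots> = (LINT n|haar. (cis (2 * pi * (lam \<bullet> z)) * cis (2 * pi * (x \<bullet> (B lam *v y)))) * (f n * pi_rep lam n h (x - t)))"
    unfolding a pi_rep_chart by (intro Bochner_Integration.integral_cong refl) (simp only: mult_ac)
  also have "\<dots> = pi_rep lam a (pi_integral lam f h) x"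
    unfolding a pi_rep_chart pi_integral_def by (rule integral_mult_right_zero)
  finally show "pi_integral lam (left_translate a f) h x = pi_rep lam a (pi_integral lam f h) x" .
qed

subsection \<open>Plancherel's theorem for the group\<close>

text \<open>For fixed \<open>t\<close> the Fourier transform in \<open>z\<close> and
  \<open>y\<close>. Evaluated at \<open>(lam, x v* B lam)\<close> it is the convolution-type kernel
  of the integrated representation.\<close>

definition slice_ft :: "('v \<Rightarrow> complex) \<Rightarrow> real^'d \<Rightarrow> (real^'k) \<times> (real^'d) \<Rightarrow> complex" where
  "slice_ft f t = ft (\<lambda>q. f (chart2 (q, t)))"

lemma slice_ft_measurable [measurable (raw)]:
  assumes [measurable]: "f \<in> borel_measurable borel"
    and g: "g \<in> borel_measurable M" "h \<in> borel_measurable M"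
  shows "(\<lambda>w. slice_ft f (g w) (h w)) \<in> borel_measurable M"
proof -
  have "(\<lambda>p. slice_ft f (fst p) (snd p)) \<in> borel_measurable (borel \<Otimes>\<^sub>M borel)"
  proof -
    have [measurable]: "(\<lambda>p. chart2 p) \<in> borel_measurable (borel \<Otimes>\<^sub>M borel)"
      using chart2_measurable by (simp add: measurable_def space_pair_measure sets_pair_measure)
    have "(\<lambda>p. f (chart2 (snd p, fst (fst p)))) \<in> borel_measurable ((borel \<Otimes>\<^sub>M borel) \<Otimes>\<^sub>M borel)"
      by measurable
    then show ?thesis unfolding slice_ft_def ft_def by measurable
  qed
  from measurable_compose[OF measurable_Pair[OF g] this] show ?thesis by simp
qed

text \<open>For almost every \<open>t\<close> the slice lies in both L1 and L2, so the Euclidean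
  theorem applies to it; integrating over \<open>t\<close> recovers the norm on the group.\<close>

lemma slice_ft_plancherel:
  assumes f1: "integrable haar f" and f2: "f \<in> L2 haar"
  shows "(\<integral>\<^sup>+ p. \<integral>\<^sup>+ t. ennreal ((cmod (slice_ft f t p))\<^sup>2) \<partial>lborel \<partial>lborel) = ennreal ((l2_norm haar f)\<^sup>2)"
proof -
  have [measurable]: "f \<in> borel_measurable borel" by (rule L2_haar_measurable[OF f2])
  have mc [measurable]: "(\<lambda>p. f (chart2 p)) \<in> borel_measurable (lborel \<Otimes>\<^sub>M lborel)" by measurable
  have i1: "integrable (lborel \<Otimes>\<^sub>M lborel) (\<lambda>p. f (chart2 p))"
    using f1 by (simp add: integrable_haar2)
  have i2: "integrable (lborel \<Otimes>\<^sub>M lborel) (\<lambda>p. (cmod (f (chart2 p)))\<^sup>2)"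
    using f2 by (simp add: L2_def integrable_haar2[of "\<lambda>n. (cmod (f n))\<^sup>2"])
  have a1: "AE t in lborel. integrable lborel (\<lambda>q. f (chart2 (q, t)))"
    using lborel_pair.AE_integrable_snd[of "\<lambda>q t. f (chart2 (q, t))"] i1 by (simp add: case_prod_beta')
  have a2: "AE t in lborel. integrable lborel (\<lambda>q. (cmod (f (chart2 (q, t))))\<^sup>2)"
    using lborel_pair.AE_integrable_snd[of "\<lambda>q t. (cmod (f (chart2 (q, t))))\<^sup>2"] i2 by (simp add: case_prod_beta')
  have "(\<integral>\<^sup>+ p. \<integral>\<^sup>+ t. ennreal ((cmod (slice_ft f t p))\<^sup>2) \<partial>lborel \<partial>lborel) =
      (\<integral>\<^sup>+ t. \<integral>\<^sup>+ p. ennreal ((cmod (slice_ft f t p))\<^sup>2) \<partial>lborel \<partial>lborel)"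
    by (rule lborel_pair.Fubini') measurable
  also have "\<dots> = (\<integral>\<^sup>+ t. \<integral>\<^sup>+ q. ennreal ((cmod (f (chart2 (q, t))))\<^sup>2) \<partial>lborel \<partial>lborel)"
  proof (rule nn_integral_cong_AE)
    show "AE t in lborel. (\<integral>\<^sup>+ p. ennreal ((cmod (slice_ft f t p))\<^sup>2) \<partial>lborel) =
        (\<integral>\<^sup>+ q. ennreal ((cmod (f (chart2 (q, t))))\<^sup>2) \<partial>lborel)"
      using a1 a2
    proof eventually_elim
      case (elim t)
      then have "(\<lambda>q. f (chart2 (q, t))) \<in> L2 lborel" by (simp add: L2_def)
      with plancherel_euclidean[OF elim(1) this] show ?case
        unfolding slice_ft_def by (simp add: ennreal_l2_norm_square)
    qed
  qed
  also have "\<dots> = (\<integral>\<^sup>+ p. ennreal ((cmod (f (chart2 p)))\<^sup>2) \<partial>(lborel \<Otimes>\<^sub>M lborel))"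
    by (rule lborel_pair.nn_integral_snd) measurable
  also have "\<dots> = (\<integral>\<^sup>+ n. ennreal ((cmod (f n))\<^sup>2) \<partial>haar)"
    by (rule nn_integral_haar2[symmetric]) measurable
  finally show ?thesis by (simp add: ennreal_l2_norm_square[OF f2])
qed

text \<open>The two phases of \<open>pi_rep\<close> combine into one character of
  \<open>(z, y)\<close> with frequency \<open>(lam, x v* B lam)\<close>; integrating these variables
  first leaves the partial transform against \<open>h (x - t)\<close>.\<close>

lemma pi_integral_kernel:
  assumes f: "integrable haar f" and h: "h \<in> L2 lborel"
  shows "AE x in lborel. pi_integral lam f h x = (LINT t|lborel. slice_ft f t (lam, x v* B lam) * h (x - t))"
  using AE_integrable_pi_rep[OF f h, of lam]
proof eventually_elim
  case (elim x)
  have [measurable]: "h \<in> borel_measurable borel" "f \<in> borel_measurable borel" using h f by (auto simp: L2_def)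
  have pr: "pi_rep lam (chart2 (q, t)) h x = cis (2 * pi * ((lam, x v* B lam) \<bullet> q)) * h (x - t)" for q t
    by (cases q) (simp add: pi_rep_chart cis_mult distrib_left dot_lmul_matrix)
  have i: "integrable (lborel \<Otimes>\<^sub>M lborel) (\<lambda>p. f (chart2 p) * pi_rep lam (chart2 p) h x)"
    using elim by (subst (asm) integrable_haar2) measurable
  have "pi_integral lam f h x = (LINT p|(lborel \<Otimes>\<^sub>M lborel). f (chart2 p) * pi_rep lam (chart2 p) h x)"
    unfolding pi_integral_def by (rule integral_haar2) measurable
  also have "\<dots> = (LINT t|lborel. LINT q|lborel. f (chart2 (q, t)) * pi_rep lam (chart2 (q, t)) h x)"
    using lborel_pair.integral_snd[of "\<lambda>q t. f (chart2 (q, t)) * pi_rep lam (chart2 (q, t)) h x"] i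
    by (simp add: case_prod_beta')
  also have "\<dots> = (LINT t|lborel. slice_ft f t (lam, x v* B lam) * h (x - t))"
  proof (rule Bochner_Integration.integral_cong[OF refl])
    fix t
    have "(LINT q|lborel. f (chart2 (q, t)) * pi_rep lam (chart2 (q, t)) h x) =
        (LINT q|lborel. (f (chart2 (q, t)) * cis (2 * pi * ((lam, x v* B lam) \<bullet> q))) * h (x - t))"
      by (simp only: pr mult.assoc)
    then show "(LINT q|lborel. f (chart2 (q, t)) * pi_rep lam (chart2 (q, t)) h x) =
        slice_ft f t (lam, x v* B lam) * h (x - t)"
      by (simp add: slice_ft_def ft_def)
  qed
  finally show ?case .
qed

text \<open>Parseval for the reflected and conjugated function \<open>v\<close>: up to conjugation
  the integrals are its coefficients in the basis.\<close>

lemma kernel_row_norm: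
  assumes w: "(\<lambda>t. w t) \<in> L2 (lborel :: (real^'d) measure)"
  shows "(\<Sum>j. ennreal ((cmod (LINT t|lborel. w t * onb lborel j (x - t)))\<^sup>2)) = (\<integral>\<^sup>+ t. ennreal ((cmod (w t))\<^sup>2) \<partial>lborel)"
proof -
  note L = onb_L2
  have wm [measurable]: "w \<in> borel_measurable borel" using w by (simp add: L2_def)
  define v where "v s = cnj (w (x - s))" for s
  have v: "v \<in> L2 lborel" unfolding v_def by (intro L2_cnj L2_lborel_reflect w)
  have "cmod (LINT t|lborel. w t * onb lborel j (x - t)) = cmod (l2_inner lborel v (onb lborel j))" for j
  proof -
    have "(LINT t|lborel. w t * onb lborel j (x - t)) = (LINT s|lborel. w (x - s) * onb lborel j (x - (x - s)))"
      by (rule integral_lborel_reflect[symmetric]) measurable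
    also have "\<dots> = cnj (l2_inner lborel v (onb lborel j))"
      unfolding l2_inner_def v_def Bochner_Integration.integral_cnj[symmetric] by simp
    finally show ?thesis by simp
  qed
  then have "(\<Sum>j. ennreal ((cmod (LINT t|lborel. w t * onb lborel j (x - t)))\<^sup>2)) = ennreal ((l2_norm lborel v)\<^sup>2)"
    by (simp add: parseval_suminf[OF onb_lborel v])
  also have "\<dots> = (\<integral>\<^sup>+ s. ennreal ((cmod (w (x - s)))\<^sup>2) \<partial>lborel)"
    by (simp add: ennreal_l2_norm_square[OF v] v_def)
  also have "\<dots> = (\<integral>\<^sup>+ t. ennreal ((cmod (w t))\<^sup>2) \<partial>lborel)"
    by (rule nn_integral_lborel_reflect[of "\<lambda>t. ennreal ((cmod (w t))\<^sup>2)"]) measurable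
  finally show ?thesis .
qed

lemma hs_norm2_pi_integral_measurable:
  assumes f: "integrable haar f"
  shows "(\<lambda>lam. hs_norm2 lborel (pi_integral lam f)) \<in> borel_measurable borel"
proof -
  note L = onb_L2
  have [measurable]: "f \<in> borel_measurable borel" using f by auto
  have "hs_norm2 lborel (pi_integral lam f) =
      (\<Sum>j. \<integral>\<^sup>+ x. ennreal ((cmod (pi_integral lam f (onb lborel j) x))\<^sup>2) \<partial>lborel)" for lam
    unfolding hs_norm2_eq by (simp add: ennreal_l2_norm_square[OF pi_integral_L2[OF f L]])
  moreover have "(\<lambda>lam. \<integral>\<^sup>+ x. ennreal ((cmod (pi_integral lam f (onb lborel j) x))\<^sup>2) \<partial>lborel) \<in> borel_measurable borel" for j
  proof -
    have [measurable]: "(\<lambda>p. pi_integral (fst p) f (onb lborel j) (snd p)) \<in> borel_measurable (borel \<Otimes>\<^sub>M lborel)"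
      using pi_integral_measurable_pair[of f "onb lborel j"] by (simp cong: measurable_cong_sets sets_pair_measure_cong)
    have "(\<lambda>lam. \<integral>\<^sup>+ x. ennreal ((cmod (pi_integral (fst (lam, x)) f (onb lborel j) (snd (lam, x))))\<^sup>2) \<partial>lborel) \<in> borel_measurable borel"
      by measurable
    then show ?thesis by simp
  qed
  ultimately show ?thesis by simp
qed

text \<open>The squared Hilbert--Schmidt norm is the squared L2 norm of the kernel. Its first
  variable enters as \<open>x v* B lam\<close>, and substituting it away produces the factor |det
  B|, the density of \<open>mu\<close>. What remains is the integral computed in
  \<open>slice_ft_plancherel\<close>.\<close>

theorem plancherel_group:
  assumes f1: "integrable haar f" and f2: "f \<in> L2 haar"
  shows "(\<integral>\<^sup>+ lam. hs_norm2 lborel (pi_integral lam f) \<partial>mu) = ennreal ((l2_norm haar f)\<^sup>2)"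
proof -
  note L = onb_L2
  have [measurable]: "f \<in> borel_measurable borel" by (rule L2_haar_measurable[OF f2])
  define J where "J p = (\<integral>\<^sup>+ t. ennreal ((cmod (slice_ft f t p))\<^sup>2) \<partial>lborel)" for p
  have J_meas [measurable]: "J \<in> borel_measurable borel" unfolding J_def by measurable
  have J_total: "(\<integral>\<^sup>+ lam. \<integral>\<^sup>+ \<eta>. J (lam, \<eta>) \<partial>lborel \<partial>lborel) = ennreal ((l2_norm haar f)\<^sup>2)"
  proof -
    have "(\<integral>\<^sup>+ lam. \<integral>\<^sup>+ \<eta>. J (lam, \<eta>) \<partial>lborel \<partial>lborel) = (\<integral>\<^sup>+ p. J p \<partial>(lborel \<Otimes>\<^sub>M lborel))"
      by (rule lborel.nn_integral_fst) (simp add: lborel_prod)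
    then show ?thesis unfolding lborel_prod J_def slice_ft_plancherel[OF f1 f2] .
  qed
  have cv: "(\<integral>\<^sup>+ \<eta>. J (lam, \<eta>) \<partial>lborel) = ennreal \<bar>det (B lam)\<bar> * (\<integral>\<^sup>+ x. J (lam, x v* B lam) \<partial>lborel)"
    if "lam \<in> Sig" for lam
  proof -
    have "det (transpose (B lam)) \<noteq> 0" using that by (simp add: Sig_def)
    moreover have "(\<lambda>\<eta>. J (lam, \<eta>)) \<in> borel_measurable borel" by measurable
    ultimately show ?thesis
      using nn_integral_lborel_linear[of "transpose (B lam)" "\<lambda>\<eta>. J (lam, \<eta>)"] by simp
  qed
  \<comment> \<open>Finiteness is assumed because Parseval applies only to those kernel rows that
    lie in L2. It holds for almost every \<lambda>, since the integral over \<lambda> is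
    finite.\<close>
  have hs: "hs_norm2 lborel (pi_integral lam f) = (\<integral>\<^sup>+ x. J (lam, x v* B lam) \<partial>lborel)"
    if fin: "(\<integral>\<^sup>+ \<eta>. J (lam, \<eta>) \<partial>lborel) \<noteq> \<infinity>" and lam: "lam \<in> Sig" for lam
  proof -
    have [measurable]: "(\<lambda>x. x v* B lam) \<in> borel_measurable borel"
      unfolding transpose_matrix_vector[symmetric]
      by (intro borel_measurable_continuous_onI matrix_vector_mult_linear_continuous_on)
    have "(\<integral>\<^sup>+ x. J (lam, x v* B lam) \<partial>lborel) \<noteq> \<infinity>"
      using fin lam unfolding cv[OF lam] by (auto simp: Sig_def ennreal_mult_eq_top_iff)
    then have "AE x in lborel. J (lam, x v* B lam) \<noteq> \<infinity>"
      by (intro nn_integral_noteq_infinite) measurable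
    moreover have "AE x in lborel. \<forall>j. pi_integral lam f (onb lborel j) x =
        (LINT t|lborel. slice_ft f t (lam, x v* B lam) * onb lborel j (x - t))"
      using pi_integral_kernel[OF f1 L] by (intro AE_all_countable[THEN iffD2] allI)
    ultimately have ae: "AE x in lborel. (\<Sum>j. ennreal ((cmod (pi_integral lam f (onb lborel j) x))\<^sup>2)) = J (lam, x v* B lam)"
    proof eventually_elim
      case (elim x)
      have "(\<lambda>t. slice_ft f t (lam, x v* B lam)) \<in> L2 lborel"
        by (rule L2I_nn_integral) (use elim(1) in \<open>auto simp: J_def less_top\<close>)
      from kernel_row_norm[OF this, of x] elim(2) show ?case by (simp add: J_def)
    qed
    have "hs_norm2 lborel (pi_integral lam f) =
        (\<Sum>j. \<integral>\<^sup>+ x. ennreal ((cmod (pi_integral lam f (onb lborel j) x))\<^sup>2) \<partial>lborel)"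
      unfolding hs_norm2_eq by (simp add: ennreal_l2_norm_square[OF pi_integral_L2[OF f1 L]])
    also have "\<dots> = (\<integral>\<^sup>+ x. (\<Sum>j. ennreal ((cmod (pi_integral lam f (onb lborel j) x))\<^sup>2)) \<partial>lborel)"
      by (rule nn_integral_suminf[symmetric])
        (use L2_measurable[OF pi_integral_L2[OF f1 L]] in measurable)
    also have "\<dots> = (\<integral>\<^sup>+ x. J (lam, x v* B lam) \<partial>lborel)" by (rule nn_integral_cong_AE[OF ae])
    finally show ?thesis .
  qed
  have "AE lam in lborel. (\<integral>\<^sup>+ \<eta>. J (lam, \<eta>) \<partial>lborel) \<noteq> \<infinity>"
    by (rule nn_integral_noteq_infinite) (measurable, simp add: J_total)
  then have ae: "AE lam in lborel. ennreal \<bar>det (B lam)\<bar> * hs_norm2 lborel (pi_integral lam f) = (\<integral>\<^sup>+ \<eta>. J (lam, \<eta>) \<partial>lborel)"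
    using AE_Sig by eventually_elim (simp add: hs cv)
  have "(\<integral>\<^sup>+ lam. hs_norm2 lborel (pi_integral lam f) \<partial>mu) =
      (\<integral>\<^sup>+ lam. ennreal \<bar>det (B lam)\<bar> * hs_norm2 lborel (pi_integral lam f) \<partial>lborel)"
    by (rule nn_integral_mu_borel[OF hs_norm2_pi_integral_measurable[OF f1]])
  also have "\<dots> = (\<integral>\<^sup>+ lam. \<integral>\<^sup>+ \<eta>. J (lam, \<eta>) \<partial>lborel \<partial>lborel)" by (rule nn_integral_cong_AE[OF ae])
  finally show ?thesis by (simp add: J_total)
qed

end

text \<open>Parseval writes the pairing as a countable sum of products of coordinates, so
  measurability of the coordinates suffices although the functions themselves vary without further
  control.\<close>

lemma borel_measurable_l2_inner:
  assumes "\<And>i. (\<lambda>w. l2_inner lborel (f w) (onb (lborel :: 'a::euclidean_space measure) i)) \<in> borel_measurable M"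
    and "\<And>i. (\<lambda>w. l2_inner lborel (g w) (onb (lborel :: 'a measure) i)) \<in> borel_measurable M"
    and L: "\<And>w. w \<in> space M \<Longrightarrow> f w \<in> L2 lborel" "\<And>w. w \<in> space M \<Longrightarrow> g w \<in> L2 lborel"
  shows "(\<lambda>w. l2_inner lborel (f w) (g w)) \<in> borel_measurable M"
proof -
  note [measurable] = assms(1,2)
  have m: "(\<lambda>w. \<Sum>i. l2_inner lborel (f w) (onb (lborel :: 'a measure) i) * cnj (l2_inner lborel (g w) (onb (lborel :: 'a measure) i)))
      \<in> borel_measurable M" by measurable
  have eq: "l2_inner lborel (f w) (g w) =
      (\<Sum>i. l2_inner lborel (f w) (onb (lborel :: 'a measure) i) * cnj (l2_inner lborel (g w) (onb (lborel :: 'a measure) i)))"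
    if "w \<in> space M" for w
    by (rule sums_unique[OF parseval_inner[OF onb_lborel L(1)[OF that] L(2)[OF that]]])
  show ?thesis by (rule measurable_cong[THEN iffD2, OF eq m])
qed

lemma L2_truncation:
  assumes f: "f \<in> L2 M" and A: "\<And>i::nat. A i \<in> sets M"
    and ex: "\<And>x. x \<in> space M \<Longrightarrow> eventually (\<lambda>i. x \<in> A i) sequentially"
  shows "(\<lambda>i. l2_norm M (\<lambda>x. indicator (A i) x * f x - f x)) \<longlonglongrightarrow> 0"
proof -
  note [measurable] = L2_measurable[OF f] A
  have "(\<lambda>i. LINT x|M. (cmod (indicator (A i) x * f x - f x))\<^sup>2) \<longlonglongrightarrow> (LINT x|M. 0)"
  proof (rule integral_dominated_convergence[where w="\<lambda>x. (cmod (f x))\<^sup>2"])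
    show "AE x in M. (\<lambda>i. (cmod (indicator (A i) x * f x - f x))\<^sup>2) \<longlonglongrightarrow> 0"
    proof (rule AE_I2)
      fix x assume "x \<in> space M"
      from ex[OF this] have "eventually (\<lambda>i. (cmod (indicator (A i) x * f x - f x))\<^sup>2 = 0) sequentially"
        by eventually_elim simp
      then show "(\<lambda>i. (cmod (indicator (A i) x * f x - f x))\<^sup>2) \<longlonglongrightarrow> 0" by (rule tendsto_eventually)
    qed
    show "AE x in M. norm ((cmod (indicator (A i) x * f x - f x))\<^sup>2) \<le> (cmod (f x))\<^sup>2" for i
      by (rule AE_I2) (auto simp: indicator_def)
  qed (use f in \<open>auto simp: L2_def\<close>)
  then have "(\<lambda>i. sqrt (LINT x|M. (cmod (indicator (A i) x * f x - f x))\<^sup>2)) \<longlonglongrightarrow> sqrt 0"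
    by (intro tendsto_real_sqrt) simp
  then show ?thesis by (simp add: l2_norm_def)
qed

subsection \<open>The Plancherel transform\<close>

text \<open>The matrix of \<open>T\<close>, column index first, flattened to a sequence, so that a
  Hilbert--Schmidt operator becomes a square-summable sequence.\<close>

definition dcoef :: "('a::euclidean_space) l2_operator \<Rightarrow> nat \<Rightarrow> complex" where
  "dcoef T n = l2_inner lborel (T (onb lborel (fst (prod_decode n)))) (onb lborel (snd (prod_decode n)))"

lemma hs_norm2_dcoef:
  assumes "\<And>j. T (onb (lborel :: 'a::euclidean_space measure) j) \<in> L2 lborel"
  shows "hs_norm2 lborel T = (\<Sum>n. ennreal ((cmod (dcoef T n))\<^sup>2))"
proof -
  define f where "f p = ennreal ((cmod (l2_inner lborel (T (onb (lborel :: 'a measure) (fst p))) (onb (lborel :: 'a measure) (snd p))))\<^sup>2)" for p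
  have "(\<Sum>n. f (prod_decode n)) = suminf (\<lambda>j. \<Sum>i. f (j, i))"
    by (rule suminf_ennreal_2dimen[of "\<lambda>j. \<Sum>i. f (j, i)" f, OF refl])
  then show ?thesis
    unfolding hs_norm2_double[of lborel T, OF onb_lborel assms] dcoef_def f_def fst_conv snd_conv by (rule sym)
qed

lemma dcoef_L2:
  assumes "\<And>j. T (onb (lborel :: 'a::euclidean_space measure) j) \<in> L2 lborel" and "hs_norm2 lborel T < \<infinity>"
  shows "dcoef T \<in> L2 (count_space UNIV)"
proof (rule L2I_nn_integral)
  show "(\<integral>\<^sup>+ n. ennreal ((cmod (dcoef T n))\<^sup>2) \<partial>count_space UNIV) < \<infinity>"
    unfolding nn_integral_count_space_nat hs_norm2_dcoef[of T, OF assms(1), symmetric] by (rule assms(2))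
qed simp

lemma dcoef_norm:
  assumes "\<And>j. T (onb (lborel :: 'a::euclidean_space measure) j) \<in> L2 lborel" and "hs_norm2 lborel T < \<infinity>"
  shows "ennreal ((l2_norm (count_space UNIV) (dcoef T))\<^sup>2) = hs_norm2 lborel T"
  unfolding ennreal_l2_norm_square[OF dcoef_L2[OF assms]] nn_integral_count_space_nat
    hs_norm2_dcoef[of T, OF assms(1)] ..

lemma dcoef_diff:
  assumes "\<And>j. T (onb (lborel :: 'a::euclidean_space measure) j) \<in> L2 lborel"
    and "\<And>j. S (onb (lborel :: 'a measure) j) \<in> L2 lborel"
  shows "dcoef (\<lambda>h x. T h x - S h x) n = dcoef T n - dcoef S n"
  unfolding dcoef_def by (rule l2_inner_diff_left[OF assms onb_L2])

lemma dcoef_scale: "dcoef (\<lambda>h x. c * T h x) n = c * dcoef T n"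
  unfolding dcoef_def by (rule l2_inner_scale_left)

lemma hilbert_schmidt_onb_L2:
  "hilbert_schmidt lborel T \<Longrightarrow> T (onb (lborel :: 'a::euclidean_space measure) j) \<in> L2 lborel"
  unfolding hilbert_schmidt_def by (elim conjE) (rule bounded_operator_L2[OF _ onb_L2])

text \<open>Both coefficient sequences are square-summable, so their product is summable over pairs
  and the sum may be taken column by column; each column is Parseval for the images of one basis
  vector.\<close>

lemma dcoef_inner:
  fixes S T :: "('a::euclidean_space) l2_operator"
  assumes S: "hilbert_schmidt lborel S" and T: "hilbert_schmidt lborel T"
  shows "(\<lambda>j. l2_inner lborel (S (onb lborel j)) (T (onb lborel j))) sums l2_inner (count_space UNIV) (dcoef S) (dcoef T)"
proof -
  note SL = hilbert_schmidt_onb_L2[OF S] and TL = hilbert_schmidt_onb_L2[OF T]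
  have fin: "hs_norm2 lborel S < \<infinity>" "hs_norm2 lborel T < \<infinity>" using S T by (auto simp: hilbert_schmidt_def)
  define h where "h p = l2_inner lborel (S (onb lborel (fst p))) (onb lborel (snd p)) *
    cnj (l2_inner lborel (T (onb lborel (fst p))) (onb lborel (snd p)))" for p
  have bij: "bij_betw prod_decode UNIV (UNIV :: (nat \<times> nat) set)" by (rule bij_prod_decode)
  have cs: "(count_space UNIV :: (nat \<times> nat) measure) = count_space UNIV \<Otimes>\<^sub>M count_space UNIV"
    using pair_measure_countable[of "UNIV :: nat set" "UNIV :: nat set"] by simp
  interpret C: sigma_finite_measure "count_space (UNIV :: nat set)"
    by (rule sigma_finite_measure_count_space_countable) simp
  interpret P: pair_sigma_finite "count_space (UNIV :: nat set)" "count_space (UNIV :: nat set)" ..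
  have "integrable (count_space UNIV) (\<lambda>n. dcoef S n * cnj (dcoef T n))"
    by (intro integrable_l2_inner dcoef_L2 SL TL fin)
  then have "integrable (count_space UNIV) (\<lambda>n. h (prod_decode n))" by (simp add: h_def dcoef_def)
  then have i: "integrable (count_space UNIV \<Otimes>\<^sub>M count_space UNIV) h"
    unfolding integrable_bij_count_space[OF bij, of h] cs .
  have inner: "(LINT i|count_space UNIV. h (j, i)) = l2_inner lborel (S (onb lborel j)) (T (onb lborel j))" for j
  proof -
    have s: "(\<lambda>i. h (j, i)) sums l2_inner lborel (S (onb lborel j)) (T (onb lborel j))"
      unfolding h_def fst_conv snd_conv by (rule parseval_inner[OF onb_lborel SL TL])
    have "integrable (count_space UNIV) (\<lambda>i. h (j, i))"
      using P.AE_integrable_fst'[OF i] by (simp add: AE_count_space)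
    then show ?thesis using s by (subst integral_count_space_nat) (auto dest: sums_unique)
  qed
  have "l2_inner (count_space UNIV) (dcoef S) (dcoef T) = (LINT n|count_space UNIV. h (prod_decode n))"
    by (simp add: l2_inner_def h_def dcoef_def)
  also have "\<dots> = (LINT p|(count_space UNIV \<Otimes>\<^sub>M count_space UNIV). h p)"
    unfolding integral_bij_count_space[OF bij, of h] cs ..
  also have "\<dots> = (LINT j|count_space UNIV. LINT i|count_space UNIV. h (j, i))"
    by (rule P.integral_fst'[OF i, symmetric])
  finally have eq: "l2_inner (count_space UNIV) (dcoef S) (dcoef T) =
      (LINT j|count_space UNIV. l2_inner lborel (S (onb lborel j)) (T (onb lborel j)))"
    by (simp add: inner)
  have "integrable (count_space UNIV) (\<lambda>j. l2_inner lborel (S (onb lborel j)) (T (onb lborel j)))"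
    using P.integrable_fst'[OF i] by (simp add: inner)
  then show ?thesis unfolding eq by (rule sums_integral_count_space_nat)
qed

text \<open>Pairing with a rank-one operator evaluates \<open>T\<close> at the vector
  \<open>u\<close>: this is how single vectors are extracted from the Plancherel identity for
  fields.\<close>

lemma dcoef_rank_one_inner:
  fixes T :: "('a::euclidean_space) l2_operator"
  assumes T: "hilbert_schmidt lborel T" and f: "f \<in> L2 lborel" and u: "u \<in> L2 lborel"
  shows "l2_inner (count_space UNIV) (dcoef (rank_one lborel f u)) (dcoef T) = l2_inner lborel f (T u)"
proof -
  have Tb: "bounded_operator lborel T" using T by (simp add: hilbert_schmidt_def)
  have "(\<lambda>j. cnj (l2_inner lborel u (onb lborel j) * l2_inner lborel (T (onb lborel j)) f)) sums cnj (l2_inner lborel (T u) f)"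
    unfolding sums_cnj by (rule bounded_operator_inner_expand[OF onb_lborel Tb u f])
  moreover have "cnj (l2_inner lborel u (onb lborel j) * l2_inner lborel (T (onb lborel j)) f) =
      l2_inner lborel (rank_one lborel f u (onb lborel j)) (T (onb lborel j))" for j
    unfolding rank_one_def l2_inner_scale_left complex_cnj_mult l2_inner_commute[symmetric] ..
  ultimately have "(\<lambda>j. l2_inner lborel (rank_one lborel f u (onb lborel j)) (T (onb lborel j))) sums l2_inner lborel f (T u)"
    unfolding l2_inner_commute[symmetric] by simp
  with dcoef_inner[OF hilbert_schmidt_rank_one[OF onb_lborel f u] T] show ?thesis by (rule sums_unique2)
qed

context two_step
begin

definition coef_measure :: "(nat \<times> (real^'k)) measure" where
  "coef_measure = count_space UNIV \<Otimes>\<^sub>M mu"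

definition fcoef :: "(real^'k \<Rightarrow> (real^'d) l2_operator) \<Rightarrow> nat \<times> (real^'k) \<Rightarrow> complex" where
  "fcoef F p = dcoef (F (snd p)) (fst p)"

lemma measurable_coef_measure: "(\<And>n. (\<lambda>lam. f (n, lam)) \<in> borel_measurable mu) \<Longrightarrow> f \<in> borel_measurable coef_measure"
  unfolding coef_measure_def by (rule measurable_pair_measure_countable1[OF countableI_type])

lemma measurable_coef_measure_section: "f \<in> borel_measurable coef_measure \<Longrightarrow> (\<lambda>lam. f (n, lam)) \<in> borel_measurable mu"
  unfolding coef_measure_def by (rule measurable_compose[OF measurable_Pair1'[of n "count_space UNIV" mu]]) simp_all

lemma space_coef_measure: "space coef_measure = UNIV \<times> Sig"
  by (simp add: coef_measure_def space_pair_measure)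

lemma nn_integral_coef_measure:
  assumes f: "f \<in> borel_measurable coef_measure"
  shows "(\<integral>\<^sup>+ p. f p \<partial>coef_measure) = (\<integral>\<^sup>+ lam. (\<Sum>n. f (n, lam)) \<partial>mu)"
proof -
  have "(\<integral>\<^sup>+ p. f p \<partial>coef_measure) = (\<integral>\<^sup>+ n. \<integral>\<^sup>+ lam. f (n, lam) \<partial>mu \<partial>count_space UNIV)"
    unfolding coef_measure_def by (rule mu.nn_integral_fst[symmetric]) (use f in \<open>simp add: coef_measure_def\<close>)
  also have "\<dots> = (\<Sum>n. \<integral>\<^sup>+ lam. f (n, lam) \<partial>mu)" by (rule nn_integral_count_space_nat)
  also have "\<dots> = (\<integral>\<^sup>+ lam. (\<Sum>n. f (n, lam)) \<partial>mu)"
    by (rule nn_integral_suminf[symmetric]) (rule measurable_coef_measure_section[OF f])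
  finally show ?thesis .
qed

text \<open>Only the images of basis vectors and their entries are constrained; boundedness is not
  part of it. This makes it stable under differences such as those between an approximating
  \<open>pi_integral\<close> and its limit field.\<close>

definition regular_field :: "(real^'k \<Rightarrow> (real^'d) l2_operator) \<Rightarrow> bool" where
  "regular_field F \<longleftrightarrow> (\<forall>lam\<in>Sig. \<forall>j. F lam (onb lborel j) \<in> L2 lborel) \<and>
     (\<forall>n. (\<lambda>lam. dcoef (F lam) n) \<in> borel_measurable mu)"

lemma regular_fcoef_measurable: "regular_field F \<Longrightarrow> fcoef F \<in> borel_measurable coef_measure"
  by (rule measurable_coef_measure) (simp add: regular_field_def fcoef_def)

lemma regular_hs_norm2:
  assumes "regular_field F" "lam \<in> Sig"
  shows "hs_norm2 lborel (F lam) = (\<Sum>n. ennreal ((cmod (fcoef F (n, lam)))\<^sup>2))"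
  unfolding fcoef_def fst_conv snd_conv
  by (rule hs_norm2_dcoef) (use assms in \<open>simp add: regular_field_def\<close>)

lemma regular_hs_measurable:
  assumes "regular_field F"
  shows "(\<lambda>lam. hs_norm2 lborel (F lam)) \<in> borel_measurable mu"
proof -
  have [measurable]: "(\<lambda>lam. fcoef F (n, lam)) \<in> borel_measurable mu" for n
    using assms by (simp add: regular_field_def fcoef_def)
  have "(\<lambda>lam. \<Sum>n. ennreal ((cmod (fcoef F (n, lam)))\<^sup>2)) \<in> borel_measurable mu" by measurable
  from measurable_cong[THEN iffD2, OF _ this] show ?thesis
    by (simp add: regular_hs_norm2[OF assms])
qed

lemma regular_nn_integral:
  assumes F: "regular_field F"
  shows "(\<integral>\<^sup>+ p. ennreal ((cmod (fcoef F p))\<^sup>2) \<partial>coef_measure) = (\<integral>\<^sup>+ lam. hs_norm2 lborel (F lam) \<partial>mu)"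
proof -
  have m: "(\<lambda>p. ennreal ((cmod (fcoef F p))\<^sup>2)) \<in> borel_measurable coef_measure"
    using regular_fcoef_measurable[OF F] by measurable
  show ?thesis unfolding nn_integral_coef_measure[OF m]
    by (intro nn_integral_cong) (simp add: regular_hs_norm2[OF F])
qed

lemma regular_fcoef_L2:
  assumes F: "regular_field F" and fin: "(\<integral>\<^sup>+ lam. hs_norm2 lborel (F lam) \<partial>mu) < \<infinity>"
  shows "fcoef F \<in> L2 coef_measure"
  by (rule L2I_nn_integral[OF regular_fcoef_measurable[OF F]]) (simp only: regular_nn_integral[OF F] fin)

lemma regular_fcoef_norm:
  assumes F: "regular_field F" and fin: "(\<integral>\<^sup>+ lam. hs_norm2 lborel (F lam) \<partial>mu) < \<infinity>"
  shows "ennreal ((l2_norm coef_measure (fcoef F))\<^sup>2) = (\<integral>\<^sup>+ lam. hs_norm2 lborel (F lam) \<partial>mu)"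
  by (simp only: ennreal_l2_norm_square[OF regular_fcoef_L2[OF F fin]] regular_nn_integral[OF F])

lemma regular_diff:
  assumes "regular_field F" "regular_field G"
  shows "regular_field (\<lambda>lam h x. F lam h x - G lam h x)"
    and "p \<in> space coef_measure \<Longrightarrow> fcoef (\<lambda>lam h x. F lam h x - G lam h x) p = fcoef F p - fcoef G p"
proof -
  have d: "dcoef (\<lambda>h x. F lam h x - G lam h x) n = dcoef (F lam) n - dcoef (G lam) n" if "lam \<in> Sig" for lam n
    by (rule dcoef_diff) (use assms that in \<open>simp_all add: regular_field_def\<close>)
  show "regular_field (\<lambda>lam h x. F lam h x - G lam h x)"
    unfolding regular_field_def
  proof (intro conjI ballI allI)
    show "(\<lambda>x. F lam (onb lborel j) x - G lam (onb lborel j) x) \<in> L2 lborel" if "lam \<in> Sig" for lam j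
      by (rule L2_diff) (use assms that in \<open>simp_all add: regular_field_def\<close>)
    have "(\<lambda>lam. dcoef (F lam) n - dcoef (G lam) n) \<in> borel_measurable mu" for n
      by (rule borel_measurable_diff) (use assms in \<open>simp_all add: regular_field_def\<close>)
    from measurable_cong[THEN iffD2, OF _ this]
    show "(\<lambda>lam. dcoef (\<lambda>h x. F lam h x - G lam h x) n) \<in> borel_measurable mu" for n
      by (simp add: d)
  qed
  show "p \<in> space coef_measure \<Longrightarrow> fcoef (\<lambda>lam h x. F lam h x - G lam h x) p = fcoef F p - fcoef G p"
    by (auto simp: fcoef_def space_coef_measure d)
qed

lemma hs_fields_measurable:
  "F \<in> hs_fields \<Longrightarrow> h \<in> L2 lborel \<Longrightarrow> u \<in> L2 lborel \<Longrightarrow>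
    (\<lambda>lam. l2_inner lborel (F lam h) u) \<in> borel_measurable mu"
  by (simp add: hs_fields_def measurable_field_def)

lemma hs_fields_regular:
  assumes F: "F \<in> hs_fields"
  shows "regular_field F" "(\<integral>\<^sup>+ lam. hs_norm2 lborel (F lam) \<partial>mu) < \<infinity>"
    "fcoef F \<in> L2 coef_measure" "lam \<in> Sig \<Longrightarrow> hilbert_schmidt lborel (F lam)"
proof -
  show hs: "lam \<in> Sig \<Longrightarrow> hilbert_schmidt lborel (F lam)" for lam using F by (simp add: hs_fields_def)
  show r: "regular_field F"
    unfolding regular_field_def dcoef_def
    by (intro conjI ballI allI hilbert_schmidt_onb_L2 hs hs_fields_measurable[OF F] onb_L2)
  show fin: "(\<integral>\<^sup>+ lam. hs_norm2 lborel (F lam) \<partial>mu) < \<infinity>" using F by (simp add: hs_fields_def)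
  show "fcoef F \<in> L2 coef_measure" by (rule regular_fcoef_L2[OF r fin])
qed

text \<open>The entries determine all weak coefficients: expand first in \<open>h\<close>, using
  boundedness, then in \<open>u\<close>.\<close>

lemma regular_measurable_field:
  assumes r: "regular_field F" and b: "\<And>lam. lam \<in> Sig \<Longrightarrow> bounded_operator lborel (F lam)"
  shows "measurable_field F"
  unfolding measurable_field_def
proof (intro ballI)
  fix h u :: "real^'d \<Rightarrow> complex" assume h: "h \<in> L2 lborel" and u: "u \<in> L2 lborel"
  have "(\<lambda>lam. l2_inner lborel (F lam h) (onb lborel i)) \<in> borel_measurable mu" for i
  proof -
    have [measurable]: "(\<lambda>lam. l2_inner lborel (F lam (onb lborel j)) (onb lborel i)) \<in> borel_measurable mu" for j
    proof -
      have "(\<lambda>lam. dcoef (F lam) (prod_encode (j, i))) \<in> borel_measurable mu"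
        using r by (simp add: regular_field_def)
      then show ?thesis by (simp add: dcoef_def)
    qed
    have m: "(\<lambda>lam. \<Sum>j. l2_inner lborel h (onb lborel j) * l2_inner lborel (F lam (onb lborel j)) (onb lborel i)) \<in> borel_measurable mu"
      by measurable
    have eq: "l2_inner lborel (F lam h) (onb lborel i) =
        (\<Sum>j. l2_inner lborel h (onb lborel j) * l2_inner lborel (F lam (onb lborel j)) (onb lborel i))"
      if "lam \<in> space mu" for lam
      using that by (intro sums_unique bounded_operator_inner_expand[OF onb_lborel b h onb_L2]) simp
    show ?thesis by (rule measurable_cong[THEN iffD2, OF eq m])
  qed
  then show "(\<lambda>lam. l2_inner lborel (F lam h) u) \<in> borel_measurable mu"
  proof (rule borel_measurable_l2_inner)
    show "F lam h \<in> L2 lborel" if "lam \<in> space mu" for lam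
      using that by (intro bounded_operator_L2[OF b h]) simp
  qed (simp_all add: u)
qed

lemma hs_fieldsI:
  assumes "regular_field F" "\<And>lam. lam \<in> Sig \<Longrightarrow> hilbert_schmidt lborel (F lam)"
    "(\<integral>\<^sup>+ lam. hs_norm2 lborel (F lam) \<partial>mu) < \<infinity>"
  shows "F \<in> hs_fields"
proof -
  have "measurable_field F"
    by (rule regular_measurable_field[OF assms(1)]) (use assms(2) in \<open>simp add: hilbert_schmidt_def\<close>)
  then show ?thesis using assms(2,3) by (simp add: hs_fields_def)
qed

lemma inner_coef_measure:
  assumes F: "F \<in> hs_fields" and G: "G \<in> hs_fields"
  shows "integrable mu (\<lambda>lam. l2_inner (count_space UNIV) (dcoef (F lam)) (dcoef (G lam)))"
    and "l2_inner coef_measure (fcoef F) (fcoef G) = (LINT lam|mu. l2_inner (count_space UNIV) (dcoef (F lam)) (dcoef (G lam)))"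
proof -
  interpret C: sigma_finite_measure "count_space (UNIV :: nat set)"
    by (rule sigma_finite_measure_count_space_countable) simp
  interpret P: pair_sigma_finite "count_space (UNIV :: nat set)" mu ..
  have i: "integrable (count_space UNIV \<Otimes>\<^sub>M mu) (\<lambda>(n, lam). dcoef (F lam) n * cnj (dcoef (G lam) n))"
    using integrable_l2_inner[OF hs_fields_regular(3)[OF F] hs_fields_regular(3)[OF G]]
    by (simp add: coef_measure_def fcoef_def case_prod_beta')
  show "integrable mu (\<lambda>lam. l2_inner (count_space UNIV) (dcoef (F lam)) (dcoef (G lam)))"
    unfolding l2_inner_def by (rule P.integrable_snd[OF i])
  show "l2_inner coef_measure (fcoef F) (fcoef G) = (LINT lam|mu. l2_inner (count_space UNIV) (dcoef (F lam)) (dcoef (G lam)))"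
    using P.integral_snd[OF i] by (simp add: l2_inner_def coef_measure_def fcoef_def case_prod_beta')
qed

lemma pi_regular:
  assumes f: "integrable haar f"
  shows "regular_field (\<lambda>lam. pi_integral lam f)"
  unfolding regular_field_def
proof (intro conjI ballI allI)
  have [measurable]: "f \<in> borel_measurable borel"
    using borel_measurable_integrable[OF f] by (subst (asm) measurable_cong_sets[OF sets_haar refl])
  show "pi_integral lam f (onb lborel j) \<in> L2 lborel" for lam j by (rule pi_integral_L2[OF f onb_L2])
  have "(\<lambda>lam. LINT x|lborel. pi_integral lam f (onb lborel j) x * cnj (onb lborel i x)) \<in> borel_measurable borel" for j i
  proof -
    have [measurable]: "(\<lambda>p. pi_integral (fst p) f (onb lborel j) (snd p)) \<in> borel_measurable (borel \<Otimes>\<^sub>M lborel)"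
      using pi_integral_measurable_pair[of f "onb lborel j"] by (simp cong: measurable_cong_sets sets_pair_measure_cong)
    have "(\<lambda>lam. LINT x|lborel. pi_integral (fst (lam, x)) f (onb lborel j) (snd (lam, x)) * cnj (onb lborel i x)) \<in> borel_measurable borel"
      by measurable
    then show ?thesis by simp
  qed
  then show "(\<lambda>lam. dcoef (pi_integral lam f) n) \<in> borel_measurable mu" for n
    unfolding dcoef_def l2_inner_def by (intro borel_measurable_mu)
qed

lemma fcoef_pi:
  assumes f1: "integrable haar f" and f2: "f \<in> L2 haar"
  shows fcoef_pi_L2: "fcoef (\<lambda>lam. pi_integral lam f) \<in> L2 coef_measure"
    and fcoef_pi_norm: "l2_norm coef_measure (fcoef (\<lambda>lam. pi_integral lam f)) = l2_norm haar f"
proof -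
  have fin: "(\<integral>\<^sup>+ lam. hs_norm2 lborel (pi_integral lam f) \<partial>mu) < \<infinity>"
    by (simp add: plancherel_group[OF f1 f2])
  show "fcoef (\<lambda>lam. pi_integral lam f) \<in> L2 coef_measure" by (rule regular_fcoef_L2[OF pi_regular[OF f1] fin])
  have "ennreal ((l2_norm coef_measure (fcoef (\<lambda>lam. pi_integral lam f)))\<^sup>2) = ennreal ((l2_norm haar f)\<^sup>2)"
    unfolding regular_fcoef_norm[OF pi_regular[OF f1] fin] by (rule plancherel_group[OF f1 f2])
  then show "l2_norm coef_measure (fcoef (\<lambda>lam. pi_integral lam f)) = l2_norm haar f"
    by (simp add: power2_eq_iff_nonneg)
qed

text \<open>The integrated representation is additive only for almost every \<open>x\<close>, but
  its coefficients are additive everywhere.\<close>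

lemma fcoef_pi_diff:
  assumes f: "integrable haar f" and g: "integrable haar g"
  shows "fcoef (\<lambda>lam. pi_integral lam (\<lambda>n. f n - g n)) p =
    fcoef (\<lambda>lam. pi_integral lam f) p - fcoef (\<lambda>lam. pi_integral lam g) p"
proof -
  have "l2_inner lborel (pi_integral lam (\<lambda>n. f n - g n) (onb lborel j)) (onb lborel i) =
      l2_inner lborel (\<lambda>x. pi_integral lam f (onb lborel j) x - pi_integral lam g (onb lborel j) x) (onb lborel i)" for lam j i
    by (rule l2_inner_cong_AE[OF pi_integral_diff[OF f g onb_L2]])
      (intro AE_I2 refl L2_measurable L2_diff pi_integral_L2 onb_L2 f g Bochner_Integration.integrable_diff)+
  then show ?thesis
    unfolding fcoef_def dcoef_def
    by (simp add: l2_inner_diff_left pi_integral_L2 f g onb_L2)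
qed

lemma fcoef_pi_scale:
  "fcoef (\<lambda>lam. pi_integral lam (\<lambda>n. c * f n)) p = c * fcoef (\<lambda>lam. pi_integral lam f) p"
proof -
  have "pi_integral lam (\<lambda>n. c * f n) = (\<lambda>h x. c * pi_integral lam f h x)" for lam
    by (simp add: fun_eq_iff pi_integral_def mult.assoc)
  then show ?thesis by (simp only: fcoef_def dcoef_scale)
qed

text \<open>Polarisation: the norm of a difference yields the real part, and replacing
  \<open>g\<close> by \<open>\<i> * g\<close> yields the imaginary part.\<close>

lemma fcoef_pi_inner:
  assumes f: "integrable haar f" "f \<in> L2 haar" and g: "integrable haar g" "g \<in> L2 haar"
  shows "l2_inner coef_measure (fcoef (\<lambda>lam. pi_integral lam f)) (fcoef (\<lambda>lam. pi_integral lam g)) = l2_inner haar f g"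
proof -
  have Re: "Re (l2_inner coef_measure (fcoef (\<lambda>lam. pi_integral lam f)) (fcoef (\<lambda>lam. pi_integral lam g))) = Re (l2_inner haar f g)"
    if g: "integrable haar g" "g \<in> L2 haar" for g
  proof -
    have "l2_norm coef_measure (\<lambda>p. fcoef (\<lambda>lam. pi_integral lam f) p - fcoef (\<lambda>lam. pi_integral lam g) p) =
        l2_norm haar (\<lambda>n. f n - g n)"
      unfolding fcoef_pi_diff[OF f(1) g(1), symmetric]
      using fcoef_pi_norm[of "\<lambda>n. f n - g n"] f g by (simp add: L2_diff)
    then show ?thesis
      using l2_norm_diff_square[OF fcoef_pi_L2[OF f] fcoef_pi_L2[OF g]] l2_norm_diff_square[OF f(2) g(2)]
      by (simp add: fcoef_pi_norm f g)
  qed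
  have "Re (l2_inner coef_measure (fcoef (\<lambda>lam. pi_integral lam f)) (fcoef (\<lambda>lam. pi_integral lam (\<lambda>n. \<i> * g n)))) =
      Re (l2_inner haar f (\<lambda>n. \<i> * g n))"
    by (rule Re) (use g in \<open>auto intro: L2_scale\<close>)
  then have "Re (cnj \<i> * l2_inner coef_measure (fcoef (\<lambda>lam. pi_integral lam f)) (fcoef (\<lambda>lam. pi_integral lam g))) =
      Re (cnj \<i> * l2_inner haar f g)"
    unfolding l2_inner_scale_right[symmetric] fcoef_pi_scale .
  then show ?thesis using Re[OF g] by (simp add: complex_eq_iff)
qed

lemma is_plancherel_approx:
  assumes "is_plancherel f F"
  obtains g where "\<And>i::nat. integrable haar (g i)" "\<And>i. g i \<in> L2 haar"
    "(\<lambda>i. l2_norm haar (\<lambda>n. g i n - f n)) \<longlonglongrightarrow> 0"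
    "(\<lambda>i. l2_norm coef_measure (\<lambda>p. fcoef (\<lambda>lam. pi_integral lam (g i)) p - fcoef F p)) \<longlonglongrightarrow> 0"
proof -
  have F: "F \<in> hs_fields" using assms by (simp add: is_plancherel_def)
  obtain g where g: "\<And>i::nat. integrable haar (g i)" "\<And>i. g i \<in> L2 haar"
    "(\<lambda>i. l2_norm haar (\<lambda>n. g i n - f n)) \<longlonglongrightarrow> 0"
    and lim: "(\<lambda>i. \<integral>\<^sup>+ lam. hs_norm2 lborel (\<lambda>h x. pi_integral lam (g i) h x - F lam h x) \<partial>mu) \<longlonglongrightarrow> 0"
    using assms unfolding is_plancherel_def by blast
  have dL: "(\<lambda>p. fcoef (\<lambda>lam. pi_integral lam (g i)) p - fcoef F p) \<in> L2 coef_measure" for i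
    by (intro L2_diff fcoef_pi_L2 g hs_fields_regular(3)[OF F])
  have eq: "ennreal ((l2_norm coef_measure (\<lambda>p. fcoef (\<lambda>lam. pi_integral lam (g i)) p - fcoef F p))\<^sup>2) =
      (\<integral>\<^sup>+ lam. hs_norm2 lborel (\<lambda>h x. pi_integral lam (g i) h x - F lam h x) \<partial>mu)" for i
  proof -
    note r = regular_diff[OF pi_regular[OF g(1)[of i]] hs_fields_regular(1)[OF F]]
    show ?thesis
      unfolding ennreal_l2_norm_square[OF dL] regular_nn_integral[OF r(1), symmetric]
      by (rule nn_integral_cong) (simp add: r(2))
  qed
  have "(\<lambda>i. ennreal ((l2_norm coef_measure (\<lambda>p. fcoef (\<lambda>lam. pi_integral lam (g i)) p - fcoef F p))\<^sup>2)) \<longlonglongrightarrow> ennreal 0"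
    unfolding eq using lim by simp
  then have "(\<lambda>i. (l2_norm coef_measure (\<lambda>p. fcoef (\<lambda>lam. pi_integral lam (g i)) p - fcoef F p))\<^sup>2) \<longlonglongrightarrow> 0"
    by (subst (asm) tendsto_ennreal_iff) auto
  then have "(\<lambda>i. sqrt ((l2_norm coef_measure (\<lambda>p. fcoef (\<lambda>lam. pi_integral lam (g i)) p - fcoef F p))\<^sup>2)) \<longlonglongrightarrow> sqrt 0"
    by (rule tendsto_real_sqrt)
  then show ?thesis using g by (intro that) simp_all
qed

lemma is_plancherelD: "is_plancherel f F \<Longrightarrow> f \<in> L2 haar" "is_plancherel f F \<Longrightarrow> F \<in> hs_fields"
  by (simp_all add: is_plancherel_def)

text \<open>The identity holds along the integrable approximants, and both sides are continuous
  under the two convergences that define the transform.\<close>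

theorem is_plancherel_inner:
  assumes fF: "is_plancherel f F" and gG: "is_plancherel g G"
  shows "l2_inner haar f g = l2_inner coef_measure (fcoef F) (fcoef G)"
proof -
  obtain f' where f': "\<And>i::nat. integrable haar (f' i)" "\<And>i. f' i \<in> L2 haar"
    "(\<lambda>i. l2_norm haar (\<lambda>n. f' i n - f n)) \<longlonglongrightarrow> 0"
    "(\<lambda>i. l2_norm coef_measure (\<lambda>p. fcoef (\<lambda>lam. pi_integral lam (f' i)) p - fcoef F p)) \<longlonglongrightarrow> 0"
    using is_plancherel_approx[OF fF] by blast
  obtain g' where g': "\<And>i::nat. integrable haar (g' i)" "\<And>i. g' i \<in> L2 haar"
    "(\<lambda>i. l2_norm haar (\<lambda>n. g' i n - g n)) \<longlonglongrightarrow> 0"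
    "(\<lambda>i. l2_norm coef_measure (\<lambda>p. fcoef (\<lambda>lam. pi_integral lam (g' i)) p - fcoef G p)) \<longlonglongrightarrow> 0"
    using is_plancherel_approx[OF gG] by blast
  have "(\<lambda>i. l2_inner haar (f' i) (g' i)) \<longlonglongrightarrow> l2_inner haar f g"
    by (rule tendsto_l2_inner[OF f'(2) is_plancherelD(1)[OF fF] f'(3) g'(2) is_plancherelD(1)[OF gG] g'(3)])
  moreover have "(\<lambda>i. l2_inner coef_measure (fcoef (\<lambda>lam. pi_integral lam (f' i))) (fcoef (\<lambda>lam. pi_integral lam (g' i))))
      \<longlonglongrightarrow> l2_inner coef_measure (fcoef F) (fcoef G)"
    by (rule tendsto_l2_inner[OF fcoef_pi_L2[OF f'(1,2)] hs_fields_regular(3)[OF is_plancherelD(2)[OF fF]] f'(4)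
          fcoef_pi_L2[OF g'(1,2)] hs_fields_regular(3)[OF is_plancherelD(2)[OF gG]] g'(4)])
  ultimately show ?thesis
    unfolding fcoef_pi_inner[OF f'(1,2) g'(1,2)] by (rule LIMSEQ_unique)
qed

theorem is_plancherel_norm:
  assumes fF: "is_plancherel f F"
  shows "ennreal ((l2_norm haar f)\<^sup>2) = (\<integral>\<^sup>+ lam. hs_norm2 lborel (F lam) \<partial>mu)"
proof -
  note r = hs_fields_regular[OF is_plancherelD(2)[OF fF]]
  have "(l2_norm haar f)\<^sup>2 = (l2_norm coef_measure (fcoef F))\<^sup>2"
    using is_plancherel_inner[OF fF fF] unfolding l2_inner_self by (simp only: of_real_eq_iff)
  then show ?thesis using regular_fcoef_norm[OF r(1,2)] by simp
qed

text \<open>The field \<open>F\<close> is only weakly measurable, so the representation is moved by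
  its adjoint onto a fixed basis vector, where the coefficients depend measurably on \<lambda> as
  integrals with a parameter.\<close>

lemma regular_translate:
  assumes F: "F \<in> hs_fields"
  shows "regular_field (\<lambda>lam h. pi_rep lam a (F lam h))"
  unfolding regular_field_def
proof (intro conjI ballI allI)
  note hs = hs_fields_regular[OF F]
  show "pi_rep lam a (F lam (onb lborel j)) \<in> L2 lborel" if "lam \<in> Sig" for lam j
    by (intro pi_rep_L2 hilbert_schmidt_onb_L2 hs(4) that)
  have "(\<lambda>lam. l2_inner lborel (F lam (onb lborel j)) (pi_rep lam (- a) (onb lborel i))) \<in> borel_measurable mu" for j i
  proof (rule borel_measurable_l2_inner)
    show "(\<lambda>lam. l2_inner lborel (F lam (onb lborel j)) (onb lborel l)) \<in> borel_measurable mu" for l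
      by (intro hs_fields_measurable[OF F] onb_L2)
    have "(\<lambda>lam. LINT x|lborel. pi_rep lam (- a) (onb lborel i) x * cnj (onb lborel l x)) \<in> borel_measurable borel" for l
      by measurable
    then show "(\<lambda>lam. l2_inner lborel (pi_rep lam (- a) (onb lborel i)) (onb lborel l)) \<in> borel_measurable mu" for l
      unfolding l2_inner_def by (rule borel_measurable_mu)
  qed (simp_all add: hilbert_schmidt_onb_L2 hs(4) pi_rep_L2 onb_L2)
  then show "(\<lambda>lam. dcoef (\<lambda>h. pi_rep lam a (F lam h)) n) \<in> borel_measurable mu" for n
    unfolding dcoef_def pi_rep_adjoint .
qed

lemma hs_norm2_pi_rep: "hs_norm2 lborel (\<lambda>h. pi_rep lam a (T h)) = hs_norm2 lborel T"
  by (simp add: hs_norm2_eq pi_rep_norm)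

lemma bounded_operator_pi_rep_comp:
  assumes T: "bounded_operator lborel T"
  shows "bounded_operator lborel (\<lambda>h. pi_rep lam a (T h))"
  unfolding bounded_operator_def
proof (intro conjI ballI allI)
  note TL = bounded_operator_L2[OF T]
  note cong = bounded_operator_cong_AE[OF bounded_pi_rep[of lam a]]
  show "pi_rep lam a (T f) \<in> L2 lborel" if "f \<in> L2 lborel" for f by (intro pi_rep_L2 TL that)
  show "AE x in lborel. pi_rep lam a (T (\<lambda>y. f y + g y)) x = pi_rep lam a (T f) x + pi_rep lam a (T g) x"
    if "f \<in> L2 lborel" "g \<in> L2 lborel" for f g
    using cong[OF TL[OF L2_add[OF that]] L2_add[OF TL[OF that(1)] TL[OF that(2)]] bounded_operator_add[OF T that]]
    by (simp add: pi_rep_linear)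
  show "AE x in lborel. pi_rep lam a (T (\<lambda>y. c * f y)) x = c * pi_rep lam a (T f) x"
    if "f \<in> L2 lborel" for c f
    using cong[OF TL[OF L2_scale[OF that]] L2_scale[OF TL[OF that]] bounded_operator_scale[OF T that, of c]]
    by (simp add: pi_rep_linear)
  show "\<exists>C. \<forall>f\<in>L2 lborel. l2_norm lborel (pi_rep lam a (T f)) \<le> C * l2_norm lborel f"
    unfolding pi_rep_norm using T by (simp add: bounded_operator_def)
qed

lemma hs_fields_translate:
  assumes F: "F \<in> hs_fields"
  shows "(\<lambda>lam h. pi_rep lam a (F lam h)) \<in> hs_fields"
proof (rule hs_fieldsI[OF regular_translate[OF F]])
  note hs = hs_fields_regular[OF F]
  show "hilbert_schmidt lborel (\<lambda>h. pi_rep lam a (F lam h))" if "lam \<in> Sig" for lam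
    using hs(4)[OF that] by (simp add: hilbert_schmidt_def hs_norm2_pi_rep bounded_operator_pi_rep_comp)
  show "(\<integral>\<^sup>+ lam. hs_norm2 lborel (\<lambda>h. pi_rep lam a (F lam h)) \<partial>mu) < \<infinity>"
    unfolding hs_norm2_pi_rep by (rule hs(2))
qed

lemma left_translate_norm: "f \<in> L2 haar \<Longrightarrow> l2_norm haar (left_translate a f) = l2_norm haar f"
  unfolding l2_norm_def left_translate_def
  using integral_haar_left[of "\<lambda>n. (cmod (f n))\<^sup>2" "- a"] L2_haar_measurable[of f] by simp

text \<open>The translates of the approximants serve as approximants: translation and
  \<open>pi_rep\<close> are isometric, and on integrable functions the first becomes the second
  exactly.\<close>

theorem is_plancherel_translate:
  assumes fF: "is_plancherel f F"
  shows "is_plancherel (left_translate a f) (\<lambda>lam h. pi_rep lam a (F lam h))"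
proof -
  obtain g where g: "\<And>i::nat. integrable haar (g i)" "\<And>i. g i \<in> L2 haar"
    "(\<lambda>i. l2_norm haar (\<lambda>n. g i n - f n)) \<longlonglongrightarrow> 0"
    and lim: "(\<lambda>i. \<integral>\<^sup>+ lam. hs_norm2 lborel (\<lambda>h x. pi_integral lam (g i) h x - F lam h x) \<partial>mu) \<longlonglongrightarrow> 0"
    using fF unfolding is_plancherel_def by blast
  have gm: "g i \<in> borel_measurable borel" for i by (rule L2_haar_measurable[OF g(2)])
  have f: "f \<in> L2 haar" by (rule is_plancherelD(1)[OF fF])
  show ?thesis
    unfolding is_plancherel_def
  proof (intro conjI exI[of _ "\<lambda>i. left_translate a (g i)"] allI)
    show "left_translate a f \<in> L2 haar" by (rule left_translate_L2[OF f])
    show "(\<lambda>lam h. pi_rep lam a (F lam h)) \<in> hs_fields" by (rule hs_fields_translate[OF is_plancherelD(2)[OF fF]])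
    show "integrable haar (left_translate a (g i))" for i
      using integrable_haar_left[OF gm[of i], where a="- a"] g(1)[of i] by (simp add: left_translate_def)
    show "left_translate a (g i) \<in> L2 haar" for i by (rule left_translate_L2[OF g(2)])
    have "l2_norm haar (\<lambda>n. left_translate a (g i) n - left_translate a f n) = l2_norm haar (\<lambda>n. g i n - f n)" for i
      using left_translate_norm[OF L2_diff[OF g(2) f], of a i] by (simp add: left_translate_def)
    then show "(\<lambda>i. l2_norm haar (\<lambda>n. left_translate a (g i) n - left_translate a f n)) \<longlonglongrightarrow> 0"
      using g(3) by simp
    have "hs_norm2 lborel (\<lambda>h x. pi_integral lam (left_translate a (g i)) h x - pi_rep lam a (F lam h) x) =
        hs_norm2 lborel (\<lambda>h x. pi_integral lam (g i) h x - F lam h x)" for lam i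
    proof -
      have "l2_norm lborel (\<lambda>x. pi_integral lam (left_translate a (g i)) (onb lborel j) x - pi_rep lam a (F lam (onb lborel j)) x) =
          l2_norm lborel (\<lambda>x. pi_integral lam (g i) (onb lborel j) x - F lam (onb lborel j) x)" for j
        unfolding pi_integral_translate[OF gm onb_measurable] pi_rep_linear(2)[symmetric]
        by (rule pi_rep_norm)
      then show ?thesis by (simp add: hs_norm2_eq)
    qed
    then show "(\<lambda>i. \<integral>\<^sup>+ lam. hs_norm2 lborel (\<lambda>h x. pi_integral lam (left_translate a (g i)) h x - pi_rep lam a (F lam h) x) \<partial>mu) \<longlonglongrightarrow> 0"
      using lim by simp
  qed
qed


section \<open>Existence of the Plancherel transform\<close>

definition chart_ball :: "nat \<Rightarrow> 'v set" where
  "chart_ball i = chart_inv -` ball 0 (real i)"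

lemma chart_ball_measurable [measurable]: "chart_ball i \<in> sets borel"
  unfolding chart_ball_def by (rule measurable_sets_borel[OF chart_inv_measurable]) simp

lemma chart_ball_finite: "emeasure haar (chart_ball i) < \<infinity>"
proof -
  have "emeasure haar (chart_ball i) = emeasure lborel (chart -` chart_ball i)"
    unfolding haar_def by (subst emeasure_distr) auto
  also have "chart -` chart_ball i = ball 0 (real i)" unfolding chart_ball_def by auto
  finally show ?thesis using emeasure_lborel_ball_finite by simp
qed

lemma chart_ball_exhausts: "eventually (\<lambda>i. n \<in> chart_ball i) sequentially"
proof -
  obtain N :: nat where N: "norm (chart_inv n) < real N" using reals_Archimedean2 by blast
  show ?thesis
    using eventually_ge_at_top[of N]
    by eventually_elim (use N in \<open>simp add: chart_ball_def\<close>)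
qed

text \<open>Cutting off to sets of finite Haar measure makes a square-integrable function
  integrable, so that the integral formula for the transform applies to it.\<close>

lemma truncation_L1_L2:
  assumes f: "f \<in> L2 haar"
  shows truncation_L1: "integrable haar (\<lambda>n. indicator (chart_ball i) n * f n)"
    and truncation_L2: "(\<lambda>n. indicator (chart_ball i) n * f n) \<in> L2 haar"
    and truncation_lim: "(\<lambda>i. l2_norm haar (\<lambda>n. indicator (chart_ball i) n * f n - f n)) \<longlonglongrightarrow> 0"
proof -
  have m: "chart_ball i \<in> sets haar" for i by simp
  have "integrable haar (\<lambda>n. complex_of_real (indicator (chart_ball i) n) * f n)"
    by (intro integrable_mult_L2 L2_indicator m chart_ball_finite f)
  then show "integrable haar (\<lambda>n. indicator (chart_ball i) n * f n)" by (simp add: of_real_indicator)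
  show "(\<lambda>n. indicator (chart_ball i) n * f n) \<in> L2 haar"
  proof (rule L2_bound[OF _ f])
    show "(\<lambda>n. indicator (chart_ball i) n * f n) \<in> borel_measurable haar"
      using L2_measurable[OF f] m by measurable
  qed (simp add: indicator_def)
  show "(\<lambda>i. l2_norm haar (\<lambda>n. indicator (chart_ball i) n * f n - f n)) \<longlonglongrightarrow> 0"
    by (rule L2_truncation[OF f m chart_ball_exhausts])
qed

lemma nn_integral_coef_measure_norm:
  assumes c: "c \<in> L2 coef_measure"
  shows "ennreal ((l2_norm coef_measure c)\<^sup>2) = (\<integral>\<^sup>+ lam. (\<Sum>n. ennreal ((cmod (c (n, lam)))\<^sup>2)) \<partial>mu)"
proof -
  have "(\<lambda>p. ennreal ((cmod (c p))\<^sup>2)) \<in> borel_measurable coef_measure" using L2_measurable[OF c] by measurable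
  from nn_integral_coef_measure[OF this] show ?thesis by (simp add: ennreal_l2_norm_square[OF c])
qed

lemma suminf_matrix:
  fixes a :: "nat \<Rightarrow> ennreal"
  shows "(\<Sum>n. a n) = (\<Sum>i. \<Sum>j. a (prod_encode (j, i)))"
proof -
  have "(\<Sum>n. a (prod_encode (prod_decode n))) = suminf (\<lambda>j. \<Sum>i. a (prod_encode (j, i)))"
    by (rule suminf_ennreal_2dimen[of "\<lambda>j. \<Sum>i. a (prod_encode (j, i))" "\<lambda>p. a (prod_encode p)", OF refl])
  also have "\<dots> = (\<Sum>i. \<Sum>j. a (prod_encode (j, i)))" by (rule suminf_ennreal_swap)
  finally show ?thesis by simp
qed

text \<open>Each row of the array, conjugated, is square-summable and hence the coefficient sequence
  of a vector \<open>w i\<close>; finiteness of the total sum makes the squared norms of these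
  vectors summable, as \<open>row_operator\<close> requires.\<close>

lemma matrix_operator:
  fixes c :: "nat \<Rightarrow> complex"
  assumes fin: "(\<Sum>n. ennreal ((cmod (c n))\<^sup>2)) < \<infinity>"
  shows "\<exists>T :: (real^'d) l2_operator. hilbert_schmidt lborel T \<and> dcoef T = c"
proof -
  have S: "(\<Sum>i. \<Sum>j. ennreal ((cmod (c (prod_encode (j, i))))\<^sup>2)) < \<infinity>"
    using fin unfolding suminf_matrix[of "\<lambda>n. ennreal ((cmod (c n))\<^sup>2)"] .
  have "\<exists>w :: real^'d \<Rightarrow> complex. w \<in> L2 lborel \<and> (\<forall>j. l2_inner lborel w (onb lborel j) = cnj (c (prod_encode (j, i))))" for i
  proof -
    define r where "r i = (\<Sum>j. ennreal ((cmod (c (prod_encode (j, i))))\<^sup>2))" for i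
    have "r i = sum r {i}" by simp
    also have "\<dots> \<le> suminf r" by (rule sum_le_suminf) simp_all
    finally have "r i < \<infinity>" using S unfolding r_def[symmetric] by (rule le_less_trans)
    then have t: "(\<Sum>j. ennreal ((cmod (c (prod_encode (j, i))))\<^sup>2)) \<noteq> \<top>" unfolding r_def by simp
    have "summable (\<lambda>j. (cmod (c (prod_encode (j, i))))\<^sup>2)"
      by (rule summable_suminf_not_top[OF _ t]) simp
    then have s: "summable (\<lambda>j. (cmod (cnj (c (prod_encode (j, i)))))\<^sup>2)" by simp
    obtain w :: "real^'d \<Rightarrow> complex" where w: "w \<in> L2 lborel" "\<And>j. l2_inner lborel w (onb lborel j) = cnj (c (prod_encode (j, i)))"
      and "(\<lambda>n. l2_norm lborel (\<lambda>x. (\<Sum>j<n. cnj (c (prod_encode (j, i))) * onb lborel j x) - w x)) \<longlonglongrightarrow> 0"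
      by (rule riesz_fischer[OF orthonormal_basis_family[OF onb_lborel] s]) (rule that)
    show ?thesis by (intro exI[of _ w] conjI allI w)
  qed
  from choice[OF allI[OF this]] obtain w :: "nat \<Rightarrow> real^'d \<Rightarrow> complex" where
    "\<forall>i. w i \<in> L2 lborel \<and> (\<forall>j. l2_inner lborel (w i) (onb lborel j) = cnj (c (prod_encode (j, i))))" ..
  then have w: "w i \<in> L2 lborel" "l2_inner lborel (w i) (onb lborel j) = cnj (c (prod_encode (j, i)))" for i j
    by simp_all
  have "ennreal ((l2_norm lborel (w i))\<^sup>2) = (\<Sum>j. ennreal ((cmod (c (prod_encode (j, i))))\<^sup>2))" for i
    unfolding parseval_suminf[OF onb_lborel w(1), symmetric] w(2) by simp
  then have t: "(\<Sum>i. ennreal ((l2_norm lborel (w i))\<^sup>2)) \<noteq> \<top>" using S by simp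
  have sw: "summable (\<lambda>i. (l2_norm lborel (w i))\<^sup>2)"
    by (rule summable_suminf_not_top[OF _ t]) simp
  define T where "T = row_operator lborel w"
  have b: "bounded_operator lborel T" unfolding T_def by (rule bounded_row_operator[OF onb_lborel w(1) sw])
  have d: "dcoef T = c"
  proof
    fix n
    have "dcoef T n = l2_inner lborel (onb lborel (fst (prod_decode n))) (w (snd (prod_decode n)))"
      unfolding dcoef_def T_def by (rule row_operator_inner[OF onb_lborel w(1) sw onb_L2])
    also have "\<dots> = cnj (cnj (c (prod_encode (fst (prod_decode n), snd (prod_decode n)))))"
      unfolding w(2)[symmetric] by (rule l2_inner_commute)
    finally show "dcoef T n = c n" by simp
  qed
  have "hs_norm2 lborel T < \<infinity>"
    unfolding hs_norm2_dcoef[of T, OF bounded_operator_L2[OF b onb_L2]] d by (rule fin)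
  with b d show ?thesis unfolding hilbert_schmidt_def by (intro exI[of _ T] conjI)
qed

lemma bounded_operator_zero: "bounded_operator M (\<lambda>h x. 0)"
  unfolding bounded_operator_def by (auto intro!: exI[of _ 0])

text \<open>Completeness of the space of square-integrable matrix fields provides the extension by
  continuity.\<close>

theorem exists_plancherel:
  assumes f: "f \<in> L2 haar"
  shows "\<exists>F. is_plancherel f F"
proof -
  define g where "g i = (\<lambda>n. indicator (chart_ball i) n * f n)" for i
  have g1: "integrable haar (g i)" and g2: "g i \<in> L2 haar" for i
    unfolding g_def by (rule truncation_L1[OF f], rule truncation_L2[OF f])
  have glim: "(\<lambda>i. l2_norm haar (\<lambda>n. g i n - f n)) \<longlonglongrightarrow> 0"
    unfolding g_def by (rule truncation_lim[OF f])
  define a where "a i = fcoef (\<lambda>lam. pi_integral lam (g i))" for i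
  have a: "a i \<in> L2 coef_measure" for i unfolding a_def by (rule fcoef_pi_L2[OF g1 g2])
  have adiff: "l2_norm coef_measure (\<lambda>p. a i p - a j p) = l2_norm haar (\<lambda>n. g i n - g j n)" for i j
    unfolding a_def fcoef_pi_diff[OF g1 g1, symmetric]
    by (rule fcoef_pi_norm) (use g1 g2 in \<open>auto intro: L2_diff\<close>)
  have "\<exists>N. \<forall>m\<ge>N. \<forall>n\<ge>N. l2_norm coef_measure (\<lambda>p. a m p - a n p) < \<epsilon>" if pos: "\<epsilon> > 0" for \<epsilon>
  proof -
    have "eventually (\<lambda>i. l2_norm haar (\<lambda>n. g i n - f n) < \<epsilon>/2) sequentially"
      by (rule order_tendstoD(2)[OF glim]) (use pos in simp)
    then obtain N where N: "\<And>i. i \<ge> N \<Longrightarrow> l2_norm haar (\<lambda>n. g i n - f n) < \<epsilon>/2"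
      unfolding eventually_sequentially by blast
    have "l2_norm coef_measure (\<lambda>p. a m p - a n p) < \<epsilon>" if "m \<ge> N" "n \<ge> N" for m n
    proof -
      have "l2_norm haar (\<lambda>x. g m x - g n x) \<le> l2_norm haar (\<lambda>x. g m x - f x) + l2_norm haar (\<lambda>x. f x - g n x)"
        by (rule l2_norm_triangle_diff[OF g2 f g2])
      moreover have "l2_norm haar (\<lambda>x. f x - g n x) = l2_norm haar (\<lambda>x. g n x - f x)"
        by (rule l2_norm_minus_commute)
      ultimately show ?thesis using N[OF that(1)] N[OF that(2)] unfolding adiff by simp
    qed
    then show ?thesis by blast
  qed
  then obtain c where c: "c \<in> L2 coef_measure" and clim: "(\<lambda>i. l2_norm coef_measure (\<lambda>p. a i p - c p)) \<longlonglongrightarrow> 0"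
    by (rule L2_complete[of a coef_measure, OF a])
  define S where "S lam = (\<Sum>n. ennreal ((cmod (c (n, lam)))\<^sup>2))" for lam
  have cm [measurable]: "(\<lambda>lam. c (n, lam)) \<in> borel_measurable mu" for n
    by (rule measurable_coef_measure_section[OF L2_measurable[OF c]])
  have Sm [measurable]: "S \<in> borel_measurable mu" unfolding S_def by measurable
  have ST: "(\<integral>\<^sup>+ lam. S lam \<partial>mu) = ennreal ((l2_norm coef_measure c)\<^sup>2)"
    unfolding S_def by (rule nn_integral_coef_measure_norm[OF c, symmetric])
  have Sfin: "AE lam in mu. S lam < \<infinity>"
    using nn_integral_noteq_infinite[OF Sm] ST by (simp add: less_top)
  \<comment> \<open>The choice is made separately for each \<lambda>. Measurability survives because
    the matrix entries of the chosen operator are those of \<open>c\<close>.\<close>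
  define T where "T lam = (SOME T :: (real^'d) l2_operator. hilbert_schmidt lborel T \<and> dcoef T = (\<lambda>n. c (n, lam)))" for lam
  have T: "hilbert_schmidt lborel (T lam) \<and> dcoef (T lam) = (\<lambda>n. c (n, lam))" if "S lam < \<infinity>" for lam
    unfolding T_def by (rule someI_ex[OF matrix_operator]) (use that in \<open>simp add: S_def\<close>)
  \<comment> \<open>On the null set where the entries are not square-summable, the zero operator
    keeps every fibre Hilbert--Schmidt.\<close>
  define F where "F lam = (if S lam < \<infinity> then T lam else (\<lambda>h x. 0))" for lam
  have F1: "F lam = T lam" if "S lam < \<infinity>" for lam unfolding F_def by (rule if_P[OF that])
  have F0: "F lam = (\<lambda>h x. 0)" if "\<not> S lam < \<infinity>" for lam unfolding F_def by (rule if_not_P[OF that])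
  have Fhs: "hilbert_schmidt lborel (F lam)" for lam
  proof (cases "S lam < \<infinity>")
    case True
    then show ?thesis unfolding F1[OF True] by (rule T[THEN conjunct1])
  next
    case False
    show ?thesis unfolding F0[OF False] hilbert_schmidt_def
      by (intro conjI bounded_operator_zero) simp
  qed
  have Fd: "dcoef (F lam) n = (if S lam < \<infinity> then c (n, lam) else 0)" for lam n
  proof (cases "S lam < \<infinity>")
    case True
    show ?thesis unfolding F1[OF True] T[OF True, THEN conjunct2] if_P[OF True] ..
  next
    case False
    show ?thesis unfolding F0[OF False] if_not_P[OF False] dcoef_def by simp
  qed
  have FL: "F lam (onb lborel j) \<in> L2 lborel" for lam j by (rule hilbert_schmidt_onb_L2[OF Fhs])
  have reg: "regular_field F"
    unfolding regular_field_def Fd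
  proof (intro conjI ballI allI FL)
    show "(\<lambda>lam. if S lam < \<infinity> then c (n, lam) else 0) \<in> borel_measurable mu" for n by measurable
  qed
  have "(\<integral>\<^sup>+ lam. hs_norm2 lborel (F lam) \<partial>mu) = (\<integral>\<^sup>+ lam. S lam \<partial>mu)"
  proof (rule nn_integral_cong_AE)
    show "AE lam in mu. hs_norm2 lborel (F lam) = S lam"
      using Sfin
    proof eventually_elim
      case (elim lam)
      then show ?case unfolding hs_norm2_dcoef[of "F lam", OF FL] Fd by (simp add: S_def)
    qed
  qed
  then have fin: "(\<integral>\<^sup>+ lam. hs_norm2 lborel (F lam) \<partial>mu) < \<infinity>" by (simp add: ST)
  have Fh: "F \<in> hs_fields" by (rule hs_fieldsI[OF reg Fhs fin])
  have eq: "(\<integral>\<^sup>+ lam. hs_norm2 lborel (\<lambda>h x. pi_integral lam (g i) h x - F lam h x) \<partial>mu) =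
      ennreal ((l2_norm coef_measure (\<lambda>p. a i p - c p))\<^sup>2)" for i
  proof -
    note r = regular_diff[OF pi_regular[OF g1[of i]] reg]
    have ac: "(\<lambda>p. a i p - c p) \<in> L2 coef_measure" by (rule L2_diff[OF a c])
    show ?thesis
      unfolding nn_integral_coef_measure_norm[OF ac]
    proof (rule nn_integral_cong_AE)
      have sp: "AE lam in mu. lam \<in> space mu" by (rule AE_space)
      show "AE lam in mu. hs_norm2 lborel (\<lambda>h x. pi_integral lam (g i) h x - F lam h x) =
          (\<Sum>n. ennreal ((cmod (a i (n, lam) - c (n, lam)))\<^sup>2))"
        using Sfin sp
      proof eventually_elim
        case (elim lam)
        have sp: "(n, lam) \<in> space coef_measure" for n unfolding space_coef_measure using elim(2) unfolding space_mu by (intro SigmaI UNIV_I)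
        have c: "fcoef (\<lambda>lam h x. pi_integral lam (g i) h x - F lam h x) (n, lam) = a i (n, lam) - c (n, lam)" for n
          unfolding r(2)[OF sp] a_def[symmetric] fcoef_def[of F] fst_conv snd_conv Fd if_P[OF elim(1)] ..
        show ?case unfolding regular_hs_norm2[OF r(1) elim(2)[unfolded space_mu]] c ..
      qed
    qed
  qed
  have "(\<lambda>i. ennreal ((l2_norm coef_measure (\<lambda>p. a i p - c p))\<^sup>2)) \<longlonglongrightarrow> ennreal (0\<^sup>2)"
    by (intro tendsto_ennrealI tendsto_power clim)
  then have "(\<lambda>i. \<integral>\<^sup>+ lam. hs_norm2 lborel (\<lambda>h x. pi_integral lam (g i) h x - F lam h x) \<partial>mu) \<longlonglongrightarrow> 0"
    unfolding eq by simp
  then have "is_plancherel f F"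
    unfolding is_plancherel_def by (intro conjI exI[of _ g] allI f Fh g1 g2 glim)
  then show ?thesis by blast
qed

section \<open>Integration against the Plancherel measure and cutting off fields\<close>

lemma integral_mu:
  fixes f :: "real^'k \<Rightarrow> 'b::{banach, second_countable_topology}"
  assumes "f \<in> borel_measurable mu"
  shows "(LINT lam|mu. f lam) = (LINT lam|lborel. indicator Sig lam *\<^sub>R (\<bar>det (B lam)\<bar> *\<^sub>R f lam))"
    and "integrable mu f \<longleftrightarrow> integrable lborel (\<lambda>lam. indicator Sig lam *\<^sub>R (\<bar>det (B lam)\<bar> *\<^sub>R f lam))"
proof -
  have f: "f \<in> borel_measurable (restrict_space lborel Sig)" using assms by (simp add: mu_def)
  have d: "(\<lambda>lam. \<bar>det (B lam)\<bar>) \<in> borel_measurable (restrict_space lborel Sig)"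
    by (intro measurable_restrict_space1) simp
  have "(LINT lam|mu. f lam) = (LINT lam|restrict_space lborel Sig. \<bar>det (B lam)\<bar> *\<^sub>R f lam)"
    unfolding mu_def by (rule integral_density[OF f d]) simp
  also have "\<dots> = (LINT lam|lborel. indicator Sig lam *\<^sub>R (\<bar>det (B lam)\<bar> *\<^sub>R f lam))"
    by (rule integral_restrict_space) simp
  finally show "(LINT lam|mu. f lam) = (LINT lam|lborel. indicator Sig lam *\<^sub>R (\<bar>det (B lam)\<bar> *\<^sub>R f lam))" .
  have "integrable mu f \<longleftrightarrow> integrable (restrict_space lborel Sig) (\<lambda>lam. \<bar>det (B lam)\<bar> *\<^sub>R f lam)"
    unfolding mu_def by (rule integrable_density[OF f d]) simp
  also have "\<dots> \<longleftrightarrow> integrable lborel (\<lambda>lam. indicator Sig lam *\<^sub>R (\<bar>det (B lam)\<bar> *\<^sub>R f lam))"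
    by (rule integrable_restrict_space) simp
  finally show "integrable mu f \<longleftrightarrow> integrable lborel (\<lambda>lam. indicator Sig lam *\<^sub>R (\<bar>det (B lam)\<bar> *\<^sub>R f lam))" .
qed

lemma borel_measurable_indicator_Sig:
  fixes f :: "real^'k \<Rightarrow> 'b::{banach, second_countable_topology}"
  assumes "f \<in> borel_measurable mu"
  shows "(\<lambda>lam. indicator Sig lam *\<^sub>R f lam) \<in> borel_measurable borel"
proof -
  have "f \<in> borel_measurable (restrict_space borel Sig)"
    using assms by (subst (asm) measurable_cong_sets[OF sets_mu refl])
  then show ?thesis by (subst (asm) borel_measurable_restrict_space_iff) auto
qed

lemma hs_fields_cutoff:
  assumes F: "F \<in> hs_fields" and E: "E \<in> sets borel"
  shows "(\<lambda>lam h x. indicator E lam * F lam h x) \<in> hs_fields"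
proof -
  note hs = hs_fields_regular[OF F]
  have Em [measurable]: "(\<lambda>lam. indicator E lam :: complex) \<in> borel_measurable mu"
    by (intro borel_measurable_mu borel_measurable_indicator E)
  show ?thesis
  proof (rule hs_fieldsI)
    show "regular_field (\<lambda>lam h x. indicator E lam * F lam h x)"
      unfolding regular_field_def dcoef_scale
    proof (intro conjI ballI allI)
      show "(\<lambda>x. indicator E lam * F lam (onb lborel j) x) \<in> L2 lborel" if "lam \<in> Sig" for lam j
        by (intro L2_scale hilbert_schmidt_onb_L2 hs(4) that)
      have [measurable]: "(\<lambda>lam. dcoef (F lam) n) \<in> borel_measurable mu" for n
        using hs(1) by (simp add: regular_field_def)
      show "(\<lambda>lam. indicator E lam * dcoef (F lam) n) \<in> borel_measurable mu" for n by measurable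
    qed
    show "hilbert_schmidt lborel (\<lambda>h x. indicator E lam * F lam h x)" if "lam \<in> Sig" for lam
      by (intro hilbert_schmidt_scaled hs(4) that)
    have "(\<integral>\<^sup>+ lam. hs_norm2 lborel (\<lambda>h x. indicator E lam * F lam h x) \<partial>mu) \<le> (\<integral>\<^sup>+ lam. hs_norm2 lborel (F lam) \<partial>mu)"
      by (rule nn_integral_mono) (simp add: hs_norm2_scale indicator_def)
    then show "(\<integral>\<^sup>+ lam. hs_norm2 lborel (\<lambda>h x. indicator E lam * F lam h x) \<partial>mu) < \<infinity>"
      using hs(2) by (rule le_less_trans)
  qed
qed

end

text \<open>The integral inequality contradicts the strict pointwise one unless \<open>E\<close> is
  null; finiteness of the smaller integral permits the subtraction.\<close>

lemma AE_notin_if_nn_integral_le: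
  assumes p: "p \<in> borel_measurable M" and q: "q \<in> borel_measurable M" and E: "E \<in> sets M"
    and less: "\<And>x. x \<in> E \<Longrightarrow> q x < p x"
    and le: "(\<integral>\<^sup>+ x. indicator E x * p x \<partial>M) \<le> (\<integral>\<^sup>+ x. indicator E x * q x \<partial>M)"
    and fin: "(\<integral>\<^sup>+ x. indicator E x * q x \<partial>M) < \<infinity>"
  shows "AE x in M. x \<notin> E"
proof -
  have pm: "(\<lambda>x. indicator E x * p x) \<in> borel_measurable M" and qm: "(\<lambda>x. indicator E x * q x) \<in> borel_measurable M"
    using p q E by measurable
  have mono: "AE x in M. indicator E x * q x \<le> indicator E x * p x"
    using less by (intro AE_I2) (auto simp: indicator_def intro: less_imp_le)
  have "(\<integral>\<^sup>+ x. indicator E x * p x - indicator E x * q x \<partial>M) = 0"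
    using nn_integral_diff[OF pm qm _ mono] le fin by (simp add: diff_eq_0_ennreal)
  then have "AE x in M. indicator E x * p x - indicator E x * q x = 0"
    by (subst (asm) nn_integral_0_iff_AE) (use pm qm in measurable)
  then show ?thesis
  proof eventually_elim
    case (elim x)
    show ?case
    proof
      assume x: "x \<in> E"
      with elim have "p x - q x = 0" by simp
      moreover have "0 < p x - q x" using less[OF x] by (simp add: diff_gr0_ennreal)
      ultimately show False by simp
    qed
  qed
qed

subsection \<open>The quasi-lattice\<close>

text \<open>Turns the frame sum into an integral against counting measure, so that Tonelli can
  exchange it with integration over the group.\<close>

lemma has_sum_nn_integral:
  fixes f :: "'a \<Rightarrow> real"
  assumes s: "(f has_sum s) A" and nn: "\<And>x. 0 \<le> f x"
  shows "(\<integral>\<^sup>+ x. ennreal (f x) \<partial>count_space A) = ennreal s"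
proof -
  have "f summable_on A" using s by (rule has_sum_imp_summable)
  then have "Infinite_Sum.abs_summable_on f A" using nn by simp
  then have a: "Infinite_Set_Sum.abs_summable_on f A" unfolding abs_summable_equivalent .
  have "(\<integral>\<^sup>+ x. ennreal (f x) \<partial>count_space A) = ennreal (infsetsum f A)"
    by (rule nn_integral_conv_infsetsum[OF a nn])
  also have "infsetsum f A = s" unfolding infsetsum_infsum[OF a] by (rule infsumI[OF s])
  finally show ?thesis .
qed

lemma emeasure_lborel_box_reciprocal:
  fixes c :: "real^'n"
  assumes c: "\<And>i. c $ i > 0"
  shows "emeasure lborel (box 0 (\<chi> i. 1 / c $ i)) = ennreal (1 / (\<Prod>i\<in>UNIV. c $ i))"
    and "emeasure lborel (cbox 0 (\<chi> i. 1 / c $ i)) = ennreal (1 / (\<Prod>i\<in>UNIV. c $ i))"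
proof -
  have b: "0 \<bullet> b \<le> (\<chi> i. 1 / c $ i) \<bullet> b" if "b \<in> Basis" for b :: "real^'n"
    using that c by (auto simp: Basis_cart inner_axis less_imp_le)
  have p: "(\<Prod>b\<in>(Basis :: (real^'n) set). ((\<chi> i. 1 / c $ i) - 0) \<bullet> b) = 1 / (\<Prod>i\<in>UNIV. c $ i)"
    unfolding prod_Basis_cart by (simp add: inner_axis prod_dividef)
  show "emeasure lborel (box 0 (\<chi> i. 1 / c $ i)) = ennreal (1 / (\<Prod>i\<in>UNIV. c $ i))"
    by (subst emeasure_lborel_box) (use b p in simp_all)
  show "emeasure lborel (cbox 0 (\<chi> i. 1 / c $ i)) = ennreal (1 / (\<Prod>i\<in>UNIV. c $ i))"
    by (subst emeasure_lborel_cbox) (use b p in simp_all)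
qed

text \<open>After scaling by \<open>c\<close>, two points of the open cell differ by less than 1 in
  each coordinate, so the integer shifts agree. Open cells serve for disjointness and closed ones
  for covering; both have the same volume.\<close>

lemma box_translates_disjoint:
  fixes c :: "real^'n" and m m' :: "'n \<Rightarrow> int"
  assumes c: "\<And>i. c $ i > 0"
    and z: "z \<in> box 0 (\<chi> i. 1 / c $ i)" "z' \<in> box 0 (\<chi> i. 1 / c $ i)"
    and eq: "z + (\<chi> i. of_int (m i) / c $ i) = z' + (\<chi> i. of_int (m' i) / c $ i)"
  shows "z = z'" "m = m'"
proof -
  have "m i = m' i" for i
  proof -
    have "z $ i + of_int (m i) / c $ i = z' $ i + of_int (m' i) / c $ i"
      using arg_cong[OF eq, of "\<lambda>v. v $ i"] by simp
    then have e: "c $ i * z $ i + of_int (m i) = c $ i * z' $ i + of_int (m' i)"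
      using c[of i] by (simp add: field_simps)
    have zi: "0 < z $ i \<and> z $ i < 1 / c $ i" "0 < z' $ i \<and> z' $ i < 1 / c $ i"
      using z by (simp_all add: mem_box_cart)
    have "0 < c $ i * z $ i" "c $ i * z $ i < 1" "0 < c $ i * z' $ i" "c $ i * z' $ i < 1"
      using zi c[of i] by (simp_all add: field_simps)
    then have "of_int (m i - m' i) < (1::real)" "(-1::real) < of_int (m i - m' i)" using e by simp_all
    then show ?thesis by linarith
  qed
  then show m: "m = m'" ..
  show "z = z'" using eq unfolding m by simp
qed

lemma cbox_translates_cover:
  fixes c z :: "real^'n"
  assumes c: "\<And>i. c $ i > 0"
  obtains m :: "'n \<Rightarrow> int" where "z + (\<chi> i. of_int (m i) / c $ i) \<in> cbox 0 (\<chi> i. 1 / c $ i)"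
proof -
  define m where "m i = - \<lfloor>c $ i * z $ i\<rfloor>" for i
  have "0 \<le> z $ i + of_int (m i) / c $ i \<and> z $ i + of_int (m i) / c $ i \<le> 1 / c $ i" for i
  proof -
    have "0 \<le> c $ i * z $ i + of_int (m i)" "c $ i * z $ i + of_int (m i) \<le> 1"
      unfolding m_def by linarith+
    moreover have "z $ i + of_int (m i) / c $ i = (c $ i * z $ i + of_int (m i)) / c $ i"
      using c[of i] by (simp add: field_simps)
    ultimately show ?thesis using c[of i] by (simp add: divide_le_cancel)
  qed
  then show thesis by (intro that[of m]) (simp add: mem_box_cart)
qed

context two_step
begin

definition lattice_point :: "real^'k \<Rightarrow> real^'d \<Rightarrow> real^'d \<Rightarrow> ('k \<Rightarrow> int) \<times> ('d \<Rightarrow> int) \<times> ('d \<Rightarrow> int) \<Rightarrow> 'v" where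
  "lattice_point a q b = (\<lambda>(m, k, n).
     chart (\<chi> i. of_int (m i) / a $ i, \<chi> j. of_int (k j) / q $ j, \<chi> j. of_int (n j) / b $ j))"

lemma quasi_lattice_eq: "quasi_lattice a q b = range (lattice_point a q b)"
  unfolding quasi_lattice_def lattice_point_def by (simp add: set_eq_iff image_iff split_paired_Ex)

lemma countable_quasi_lattice: "countable (quasi_lattice a q b)"
  unfolding quasi_lattice_eq by (rule countable_image) simp

definition tile :: "real^'k \<Rightarrow> real^'d \<Rightarrow> real^'d \<Rightarrow> 'v set" where
  "tile a q b = chart_inv -` (box 0 (\<chi> i. 1 / a $ i) \<times> box 0 (\<chi> j. 1 / q $ j) \<times> box 0 (\<chi> j. 1 / b $ j))"

lemma tile_measurable [measurable]: "tile a q b \<in> sets borel"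
  unfolding tile_def
  by (rule measurable_sets_borel[OF chart_inv_measurable]) (intro borel_open open_Times open_box)

text \<open>The \<open>y\<close> and \<open>t\<close> coordinates of a product simply add, so they
  and their lattice parts are determined first. The central twist is then the same on both sides,
  and the central coordinates can be compared as well.\<close>

lemma tiles_disjoint:
  assumes pos: "\<And>i. a $ i > 0" "\<And>j. q $ j > 0" "\<And>j. b $ j > 0"
    and u: "u \<in> tile a q b" "u' \<in> tile a q b"
    and g: "g \<in> quasi_lattice a q b" "g' \<in> quasi_lattice a q b"
    and eq: "u \<odot> g = u' \<odot> g'"
  shows "g = g'"
proof -
  obtain m k n where gp: "g = lattice_point a q b (m, k, n)" using g(1) unfolding quasi_lattice_eq by auto
  obtain m' k' n' where gp': "g' = lattice_point a q b (m', k', n')" using g(2) unfolding quasi_lattice_eq by auto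
  obtain z y t where up: "u = chart (z, y, t)" by (rule chart_cases)
  obtain z' y' t' where up': "u' = chart (z', y', t')" by (rule chart_cases)
  have zb: "z \<in> box 0 (\<chi> i. 1 / a $ i)" "z' \<in> box 0 (\<chi> i. 1 / a $ i)"
    and yb: "y \<in> box 0 (\<chi> j. 1 / q $ j)" "y' \<in> box 0 (\<chi> j. 1 / q $ j)"
    and tb: "t \<in> box 0 (\<chi> j. 1 / b $ j)" "t' \<in> box 0 (\<chi> j. 1 / b $ j)"
    using u unfolding up up' tile_def by simp_all
  note e = eq[unfolded up up' gp gp' lattice_point_def prod.case chart_mult chart_inj prod.inject]
  have te: "t + (\<chi> j. of_int (n j) / b $ j) = t' + (\<chi> j. of_int (n' j) / b $ j)"
    and ye: "y + (\<chi> j. of_int (k j) / q $ j) = y' + (\<chi> j. of_int (k' j) / q $ j)" using e by simp_all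
  note t = box_translates_disjoint[OF pos(3) tb te] and y = box_translates_disjoint[OF pos(2) yb ye]
  have m: "m = m'" by (rule box_translates_disjoint(2)[OF pos(1) zb]) (use e t y in simp)
  show ?thesis unfolding gp gp' m t(2) y(2) ..
qed

lemma nn_integral_tile:
  assumes pos: "\<And>i. a $ i > 0" "\<And>j. q $ j > 0" "\<And>j. b $ j > 0"
  shows "(\<integral>\<^sup>+ x. indicator (tile a q b) x \<partial>haar) =
    ennreal (1 / ((\<Prod>i\<in>UNIV. a $ i) * (\<Prod>j\<in>UNIV. q $ j) * (\<Prod>j\<in>UNIV. b $ j)))"
proof -
  define A where "A = box 0 (\<chi> i. 1 / a $ i)"
  define C where "C = box 0 (\<chi> j. 1 / q $ j)"
  define D where "D = box 0 (\<chi> j. 1 / b $ j)"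
  have [measurable]: "A \<in> sets borel" "C \<in> sets borel" "D \<in> sets borel" by (simp_all add: A_def C_def D_def)
  have i: "indicator (tile a q b) (chart (z, y, t)) = (indicator A z * (indicator C y * indicator D t) :: ennreal)" for z y t
    by (simp add: tile_def A_def C_def D_def indicator_def)
  have "(\<integral>\<^sup>+ x. indicator (tile a q b) x \<partial>haar) = (\<integral>\<^sup>+ p. indicator (tile a q b) (chart p) \<partial>lborel)"
    by (rule nn_integral_haar) simp
  also have "\<dots> = (\<integral>\<^sup>+ t. \<integral>\<^sup>+ y. \<integral>\<^sup>+ z. indicator (tile a q b) (chart (z, y, t)) \<partial>lborel \<partial>lborel \<partial>lborel)"
    by (rule nn_integral_triple) measurable
  also have "\<dots> = emeasure lborel A * (emeasure lborel C * emeasure lborel D)"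
    unfolding i by (simp add: nn_integral_multc nn_integral_cmult)
  also have "\<dots> = ennreal (1 / (\<Prod>i\<in>UNIV. a $ i) * (1 / (\<Prod>j\<in>UNIV. q $ j) * (1 / (\<Prod>j\<in>UNIV. b $ j))))"
    unfolding A_def C_def D_def emeasure_lborel_box_reciprocal(1)[of a, OF pos(1)]
      emeasure_lborel_box_reciprocal(1)[of q, OF pos(2)] emeasure_lborel_box_reciprocal(1)[of b, OF pos(3)]
    by (simp add: ennreal_mult[symmetric] prod_nonneg less_imp_le pos)
  finally show ?thesis by (simp add: mult.assoc)
qed

text \<open>The frame identity for the translate of \<open>f\<close> by \<open>- x\<close>, which
  lies in \<open>K\<close> and has the same norm. It extends the identity to all shifted lattices
  and thereby permits averaging over \<open>x\<close>.\<close>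

lemma frame_translate_sum:
  assumes K: "K \<subseteq> L2 haar" "left_invariant K" and fr: "parseval_frame K \<Gamma> \<phi>" and phi: "\<phi> \<in> K" and f: "f \<in> K"
  shows "(\<integral>\<^sup>+ \<gamma>. ennreal ((cmod (l2_inner haar f (left_translate (x \<odot> \<gamma>) \<phi>)))\<^sup>2) \<partial>count_space \<Gamma>) =
    ennreal ((l2_norm haar f)\<^sup>2)"
proof -
  have f': "left_translate (- x) f \<in> K" using K(2) f unfolding left_invariant_def by simp
  note fL = subsetD[OF K(1) f] and pL = subsetD[OF K(1) phi]
  have e: "l2_inner haar f (left_translate (x \<odot> \<gamma>) \<phi>) = l2_inner haar (left_translate (- x) f) (left_translate \<gamma> \<phi>)" for \<gamma>
    unfolding left_translate_inner[OF fL left_translate_L2[OF pL]] minus_minus left_translate_mult ..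
  have "((\<lambda>\<gamma>. (cmod (l2_inner haar (left_translate (- x) f) (left_translate \<gamma> \<phi>)))\<^sup>2) has_sum
      (l2_norm haar (left_translate (- x) f))\<^sup>2) \<Gamma>"
    using fr f' unfolding parseval_frame_def by simp
  then show ?thesis
    unfolding e left_translate_norm[OF fL] by (rule has_sum_nn_integral) simp
qed

text \<open>The tiles \<open>Q \<gamma>\<close> are disjoint, so integrating the squared wavelet coefficients of \<open>\<phi>\<close>
  over their union and summing the frame identity over \<open>Q\<close> compares the volume of \<open>Q\<close> with \<open>1\<close>.\<close>

lemma density_ge_1:
  assumes pos: "\<And>i. a $ i > 0" "\<And>j. q $ j > 0" "\<And>j. b $ j > 0"
    and K: "K \<subseteq> L2 haar" "left_invariant K" and fr: "parseval_frame K (quasi_lattice a q b) \<phi>"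
    and wave: "continuous_wavelet K \<phi>" and nz: "l2_norm haar \<phi> \<noteq> 0"
  shows "1 \<le> (\<Prod>i\<in>UNIV. a $ i) * (\<Prod>j\<in>UNIV. q $ j) * (\<Prod>j\<in>UNIV. b $ j)"
proof -
  define V where "V = 1 / ((\<Prod>i\<in>UNIV. a $ i) * (\<Prod>j\<in>UNIV. q $ j) * (\<Prod>j\<in>UNIV. b $ j))"
  define \<Gamma> where "\<Gamma> = quasi_lattice a q b"
  define Q where "Q = tile a q b"
  define p where "p x = ennreal ((cmod (l2_inner haar \<phi> (left_translate x \<phi>)))\<^sup>2)" for x
  \<comment> \<open>The squared coefficient at \<open>x\<close>, restricted to the right translate
    of \<open>Q\<close> by \<gamma>.\<close>
  define J where "J \<gamma> x = (indicator Q (x \<odot> (- \<gamma>)) * p x :: ennreal)" for \<gamma> x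
  have phi: "\<phi> \<in> K" using wave by (simp add: continuous_wavelet_def)
  have c: "(\<lambda>x. l2_inner haar \<phi> (left_translate x \<phi>)) \<in> L2 haar"
    and cn: "l2_norm haar (\<lambda>x. l2_inner haar \<phi> (left_translate x \<phi>)) = l2_norm haar \<phi>"
    using wave phi unfolding continuous_wavelet_def by simp_all
  have pm [measurable]: "p \<in> borel_measurable borel" unfolding p_def using L2_haar_measurable[OF c] by measurable
  have [measurable]: "Q \<in> sets borel" unfolding Q_def by simp
  have Jm [measurable]: "J \<gamma> \<in> borel_measurable borel" for \<gamma> unfolding J_def by measurable
  have sum1: "(\<integral>\<^sup>+ \<gamma>. J \<gamma> x \<partial>count_space \<Gamma>) \<le> p x" for x
  proof (cases "\<exists>\<gamma>0\<in>\<Gamma>. x \<odot> (- \<gamma>0) \<in> Q")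
    case True
    then obtain \<gamma>0 where g0: "\<gamma>0 \<in> \<Gamma>" "x \<odot> (- \<gamma>0) \<in> Q" ..
    have uniq: "\<gamma> = \<gamma>0" if "\<gamma> \<in> \<Gamma>" "x \<odot> (- \<gamma>) \<in> Q" for \<gamma>
    proof (rule tiles_disjoint[OF pos])
      show "x \<odot> (- \<gamma>) \<in> tile a q b" "x \<odot> (- \<gamma>0) \<in> tile a q b" using that(2) g0(2) by (simp_all add: Q_def)
      show "\<gamma> \<in> quasi_lattice a q b" "\<gamma>0 \<in> quasi_lattice a q b" using that(1) g0(1) by (simp_all add: \<Gamma>_def)
      show "x \<odot> (- \<gamma>) \<odot> \<gamma> = x \<odot> (- \<gamma>0) \<odot> \<gamma>0" unfolding gmult_assoc gmult_uminus gmult_zero ..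
    qed
    have "(\<integral>\<^sup>+ \<gamma>. J \<gamma> x \<partial>count_space \<Gamma>) \<le> (\<integral>\<^sup>+ \<gamma>. p x * indicator {\<gamma>0} \<gamma> \<partial>count_space \<Gamma>)"
    proof (rule nn_integral_mono)
      fix \<gamma> assume "\<gamma> \<in> space (count_space \<Gamma>)"
      then have "\<gamma> \<in> \<Gamma>" by simp
      then show "J \<gamma> x \<le> p x * indicator {\<gamma>0} \<gamma>"
        using uniq[of \<gamma>] unfolding J_def by (cases "x \<odot> (- \<gamma>) \<in> Q") simp_all
    qed
    also have "\<dots> = p x" using g0(1) by (simp add: nn_integral_cmult_indicator)
    finally show ?thesis .
  next
    case False
    then have "(\<integral>\<^sup>+ \<gamma>. J \<gamma> x \<partial>count_space \<Gamma>) = (\<integral>\<^sup>+ \<gamma>. 0 \<partial>count_space \<Gamma>)"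
      by (intro nn_integral_cong) (simp add: J_def)
    then show ?thesis by simp
  qed
  \<comment> \<open>The tiles are right translates of \<open>Q\<close>; right invariance of Haar
    measure moves each of them back to \<open>Q\<close>.\<close>
  have inner: "(\<integral>\<^sup>+ x. J \<gamma> x \<partial>haar) = (\<integral>\<^sup>+ x. indicator Q x * p (x \<odot> \<gamma>) \<partial>haar)" for \<gamma>
  proof -
    have "(\<integral>\<^sup>+ x. J \<gamma> x \<partial>haar) = (\<integral>\<^sup>+ x. J \<gamma> (x \<odot> \<gamma>) \<partial>haar)" by (rule nn_integral_haar_right[symmetric]) simp
    then show ?thesis unfolding J_def gmult_assoc gmult_uminus gmult_zero .
  qed
  have "ennreal (1 / ((\<Prod>i\<in>UNIV. a $ i) * (\<Prod>j\<in>UNIV. q $ j) * (\<Prod>j\<in>UNIV. b $ j))) * ennreal ((l2_norm haar \<phi>)\<^sup>2) =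
      (\<integral>\<^sup>+ x. indicator Q x * ennreal ((l2_norm haar \<phi>)\<^sup>2) \<partial>haar)"
    unfolding Q_def nn_integral_tile[OF pos, symmetric] by (rule nn_integral_multc[symmetric]) simp
  also have "\<dots> = (\<integral>\<^sup>+ x. \<integral>\<^sup>+ \<gamma>. indicator Q x * p (x \<odot> \<gamma>) \<partial>count_space \<Gamma> \<partial>haar)"
  proof (rule nn_integral_cong)
    fix x
    have "(\<integral>\<^sup>+ \<gamma>. p (x \<odot> \<gamma>) \<partial>count_space \<Gamma>) = ennreal ((l2_norm haar \<phi>)\<^sup>2)"
      unfolding p_def \<Gamma>_def by (rule frame_translate_sum[OF K fr phi phi])
    then show "indicator Q x * ennreal ((l2_norm haar \<phi>)\<^sup>2) = (\<integral>\<^sup>+ \<gamma>. indicator Q x * p (x \<odot> \<gamma>) \<partial>count_space \<Gamma>)"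
      by (simp add: nn_integral_cmult)
  qed
  also have "\<dots> = (\<integral>\<^sup>+ \<gamma>. \<integral>\<^sup>+ x. indicator Q x * p (x \<odot> \<gamma>) \<partial>haar \<partial>count_space \<Gamma>)"
  proof (rule nn_integral_count_space_nn_integral)
    show "countable \<Gamma>" unfolding \<Gamma>_def by (rule countable_quasi_lattice)
    show "(\<lambda>x. indicator Q x * p (x \<odot> \<gamma>)) \<in> borel_measurable haar" for \<gamma> by measurable
  qed
  also have "\<dots> = (\<integral>\<^sup>+ \<gamma>. \<integral>\<^sup>+ x. J \<gamma> x \<partial>haar \<partial>count_space \<Gamma>)" unfolding inner ..
  also have "\<dots> = (\<integral>\<^sup>+ x. \<integral>\<^sup>+ \<gamma>. J \<gamma> x \<partial>count_space \<Gamma> \<partial>haar)"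
  proof (rule nn_integral_count_space_nn_integral[symmetric])
    show "countable \<Gamma>" unfolding \<Gamma>_def by (rule countable_quasi_lattice)
  qed measurable
  also have "\<dots> \<le> (\<integral>\<^sup>+ x. p x \<partial>haar)" by (rule nn_integral_mono) (rule sum1)
  also have "\<dots> = ennreal ((l2_norm haar \<phi>)\<^sup>2)" unfolding p_def ennreal_l2_norm_square[OF c, symmetric] cn ..
  finally have le: "ennreal V * ennreal ((l2_norm haar \<phi>)\<^sup>2) \<le> ennreal ((l2_norm haar \<phi>)\<^sup>2)" unfolding V_def .
  have V0: "0 \<le> V" unfolding V_def by (intro divide_nonneg_nonneg mult_nonneg_nonneg prod_nonneg) (use pos in \<open>simp_all add: less_imp_le\<close>)
  have "V * (l2_norm haar \<phi>)\<^sup>2 \<le> (l2_norm haar \<phi>)\<^sup>2"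
    using le unfolding ennreal_mult[OF V0 zero_le_power2, symmetric] by (simp add: ennreal_le_iff)
  moreover have "0 < (l2_norm haar \<phi>)\<^sup>2" using nz by simp
  ultimately have "V \<le> 1" by (simp add: mult_le_cancel_right1)
  moreover have "0 < (\<Prod>i\<in>UNIV. a $ i) * (\<Prod>j\<in>UNIV. q $ j) * (\<Prod>j\<in>UNIV. b $ j)"
    using pos by (intro mult_pos_pos prod_pos) simp_all
  ultimately show ?thesis unfolding V_def by (simp only: divide_le_eq_1_pos)
qed


text \<open>As a measurability rule, this would make the prover route Borel functions through \<open>\<mu>\<close>.\<close>

declare id_measurable_mu [measurable del]

subsection \<open>Central translates\<close>

text \<open>The function g of the overview, with respect to Lebesgue measure. The conversion
  \<open>enn2real\<close> loses nothing for members of \<open>hs_fields\<close>, whose fibres over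
  \<open>Sig\<close> have finite norm.\<close>

definition hs_density :: "(real^'k \<Rightarrow> (real^'d) l2_operator) \<Rightarrow> real^'k \<Rightarrow> real" where
  "hs_density F lam = indicator Sig lam * (\<bar>det (B lam)\<bar> * enn2real (hs_norm2 lborel (F lam)))"

lemma hs_density_nonneg: "0 \<le> hs_density F lam"
  by (simp add: hs_density_def)

lemma hs_fields_hs_measurable: "F \<in> hs_fields \<Longrightarrow> (\<lambda>lam. hs_norm2 lborel (F lam)) \<in> borel_measurable mu"
  by (rule regular_hs_measurable[OF hs_fields_regular(1)])

lemma hs_density_measurable:
  assumes F: "F \<in> hs_fields"
  shows "hs_density F \<in> borel_measurable borel"
proof -
  have "(\<lambda>lam. \<bar>det (B lam)\<bar> * enn2real (hs_norm2 lborel (F lam))) \<in> borel_measurable mu"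
    using hs_fields_hs_measurable[OF F] det_B_measurable_mu by measurable
  from borel_measurable_indicator_Sig[OF this] show ?thesis
    unfolding hs_density_def by simp
qed

lemma hs_fields_finite:
  "F \<in> hs_fields \<Longrightarrow> lam \<in> Sig \<Longrightarrow> ennreal (enn2real (hs_norm2 lborel (F lam))) = hs_norm2 lborel (F lam)"
  using hs_fields_regular(4)[of F lam] by (simp add: hilbert_schmidt_def)

lemma nn_integral_hs_density:
  assumes F: "F \<in> hs_fields" and E: "E \<in> sets borel"
  shows "(\<integral>\<^sup>+ lam. indicator E lam * hs_norm2 lborel (F lam) \<partial>mu) =
    (\<integral>\<^sup>+ lam. indicator E lam * ennreal (hs_density F lam) \<partial>lborel)"
proof -
  have Em: "(\<lambda>lam. indicator E lam :: ennreal) \<in> borel_measurable mu"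
    by (intro borel_measurable_mu borel_measurable_indicator E)
  have m: "(\<lambda>lam. indicator E lam * hs_norm2 lborel (F lam)) \<in> borel_measurable mu"
    using Em hs_fields_hs_measurable[OF F] by measurable
  show ?thesis
    unfolding nn_integral_mu[OF m]
  proof (rule nn_integral_cong)
    fix lam
    show "ennreal \<bar>det (B lam)\<bar> * (indicator E lam * hs_norm2 lborel (F lam)) * indicator Sig lam =
        indicator E lam * ennreal (hs_density F lam)"
    proof (cases "lam \<in> Sig")
      case True
      have "ennreal (hs_density F lam) = ennreal \<bar>det (B lam)\<bar> * ennreal (enn2real (hs_norm2 lborel (F lam)))"
        using True by (simp add: hs_density_def ennreal_mult)
      then show ?thesis unfolding hs_fields_finite[OF F True] using True by (simp add: mult_ac)
    next
      case False
      then show ?thesis by (simp add: hs_density_def)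
    qed
  qed
qed

text \<open>On the centre the representation is multiplication by a character of \<lambda>, so the
  pairing of the fibres is that character times the squared norm on \<open>E\<close>. The translate
  is by \<open>- z\<close> because conjugation in the second argument flips the sign, giving the one
  in \<open>ft\<close>.\<close>

lemma central_coefficients:
  assumes F: "is_plancherel f (\<lambda>lam h x. indicator E lam * \<Phi> lam h x)" and P: "is_plancherel \<phi> \<Phi>"
  shows "l2_inner haar f (left_translate (chart (- z, 0, 0)) \<phi>) =
    ft (\<lambda>lam. of_real (indicator E lam * hs_density \<Phi> lam)) z"
proof -
  note Ph = is_plancherelD(2)[OF P]
  note T = is_plancherel_translate[OF P, of "chart (- z, 0, 0)"]
  define w where "w lam = indicator E lam * of_real (enn2real (hs_norm2 lborel (\<Phi> lam))) * cis (2 * pi * (lam \<bullet> z))" for lam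
  have e: "l2_inner (count_space UNIV) (dcoef (\<lambda>h x. indicator E lam * \<Phi> lam h x))
      (dcoef (\<lambda>h. pi_rep lam (chart (- z, 0, 0)) (\<Phi> lam h))) = w lam" if lam: "lam \<in> Sig" for lam
  proof -
    note hs = hs_fields_regular(4)[OF Ph lam]
    have p: "(\<lambda>h. pi_rep lam (chart (- z, 0, 0)) (\<Phi> lam h)) = (\<lambda>h x. cis (2 * pi * (lam \<bullet> - z)) * \<Phi> lam h x)"
      unfolding pi_rep_chart by simp
    have d: "dcoef (\<lambda>h. pi_rep lam (chart (- z, 0, 0)) (\<Phi> lam h)) = (\<lambda>n. cis (2 * pi * (lam \<bullet> - z)) * dcoef (\<Phi> lam) n)"
      unfolding p by (rule ext) (rule dcoef_scale)
    have d': "dcoef (\<lambda>h x. indicator E lam * \<Phi> lam h x) = (\<lambda>n. indicator E lam * dcoef (\<Phi> lam) n)"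
      by (rule ext) (rule dcoef_scale)
    have "ennreal ((l2_norm (count_space UNIV) (dcoef (\<Phi> lam)))\<^sup>2) = hs_norm2 lborel (\<Phi> lam)"
      by (rule dcoef_norm) (use hs in \<open>simp_all add: hilbert_schmidt_def hilbert_schmidt_onb_L2\<close>)
    from arg_cong[OF this, of enn2real]
    have n: "(l2_norm (count_space UNIV) (dcoef (\<Phi> lam)))\<^sup>2 = enn2real (hs_norm2 lborel (\<Phi> lam))"
      by (simp only: enn2real_ennreal zero_le_power2)
    show ?thesis
      unfolding d d' l2_inner_scale_left l2_inner_scale_right l2_inner_self n w_def
      by (simp add: cis_cnj)
  qed
  have "l2_inner haar f (left_translate (chart (- z, 0, 0)) \<phi>) =
      (LINT lam|mu. l2_inner (count_space UNIV) (dcoef (\<lambda>h x. indicator E lam * \<Phi> lam h x))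
        (dcoef (\<lambda>h. pi_rep lam (chart (- z, 0, 0)) (\<Phi> lam h))))"
    unfolding is_plancherel_inner[OF F T] by (rule inner_coef_measure(2)[OF is_plancherelD(2)[OF F] is_plancherelD(2)[OF T]])
  also have "\<dots> = (LINT lam|lborel. indicator Sig lam *\<^sub>R (\<bar>det (B lam)\<bar> *\<^sub>R
      l2_inner (count_space UNIV) (dcoef (\<lambda>h x. indicator E lam * \<Phi> lam h x))
        (dcoef (\<lambda>h. pi_rep lam (chart (- z, 0, 0)) (\<Phi> lam h)))))"
    by (rule integral_mu(1)[OF borel_measurable_integrable[OF inner_coef_measure(1)[OF is_plancherelD(2)[OF F] is_plancherelD(2)[OF T]]]])
  also have "\<dots> = ft (\<lambda>lam. of_real (indicator E lam * hs_density \<Phi> lam)) z"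
    unfolding ft_def
  proof (rule Bochner_Integration.integral_cong[OF refl])
    fix lam
    show "indicator Sig lam *\<^sub>R (\<bar>det (B lam)\<bar> *\<^sub>R
      l2_inner (count_space UNIV) (dcoef (\<lambda>h x. indicator E lam * \<Phi> lam h x))
        (dcoef (\<lambda>h. pi_rep lam (chart (- z, 0, 0)) (\<Phi> lam h)))) =
      of_real (indicator E lam * hs_density \<Phi> lam) * cis (2 * pi * (z \<bullet> lam))"
    proof (cases "lam \<in> Sig")
      case True
      then show ?thesis unfolding e[OF True] w_def hs_density_def
        by (simp add: scaleR_conv_of_real of_real_indicator inner_commute mult_ac)
    next
      case False
      then show ?thesis by (simp add: hs_density_def)
    qed
  qed
  finally show ?thesis .
qed

text \<open>The translates of the closed cell by central lattice points cover the centre, so the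
  integral over the centre is at most an integral over one cell of partial frame sums. Each of these
  is at most the squared norm of \<open>f\<close>, and the cell has volume
  \<open>1 / (\<Prod>i\<in>UNIV. a $ i)\<close>.\<close>

lemma central_translates_bound:
  assumes a: "\<And>i. a $ i > 0"
    and K: "K \<subseteq> L2 haar" "left_invariant K" and fr: "parseval_frame K (quasi_lattice a q b) \<phi>"
    and phi: "\<phi> \<in> K" and f: "f \<in> K"
    and m: "(\<lambda>z. l2_inner haar f (left_translate (chart (- z, 0, 0)) \<phi>)) \<in> borel_measurable borel"
  shows "(\<integral>\<^sup>+ z. ennreal ((cmod (l2_inner haar f (left_translate (chart (- z, 0, 0)) \<phi>)))\<^sup>2) \<partial>lborel) \<le>
    ennreal (1 / (\<Prod>i\<in>UNIV. a $ i)) * ennreal ((l2_norm haar f)\<^sup>2)"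
proof -
  define \<Gamma> where "\<Gamma> = quasi_lattice a q b"
  define A where "A = cbox 0 (\<chi> i. 1 / a $ i)"
  define h where "h z = ennreal ((cmod (l2_inner haar f (left_translate (chart (- z, 0, 0)) \<phi>)))\<^sup>2)" for z
  define v where "v \<gamma> = fst (chart_inv \<gamma>)" for \<gamma>
  \<comment> \<open>Selects the central lattice points while the sum keeps running over the whole
    lattice, so that the frame identity applies at the end; only nonnegative terms are lost.\<close>
  define J where "J \<gamma> = (if snd (chart_inv \<gamma>) = 0 then 1 else 0 :: ennreal)" for \<gamma>
  have [measurable]: "h \<in> borel_measurable borel" unfolding h_def using m by measurable
  have [measurable]: "A \<in> sets borel" by (simp add: A_def)
  have cover: "h z \<le> (\<integral>\<^sup>+ \<gamma>. J \<gamma> * (indicator A (v \<gamma> + z) * h z) \<partial>count_space \<Gamma>)" for z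
  proof -
    obtain m :: "'k \<Rightarrow> int" where m: "z + (\<chi> i. of_int (m i) / a $ i) \<in> A"
      unfolding A_def by (rule cbox_translates_cover[OF a])
    define \<gamma> where "\<gamma> = lattice_point a q b (m, \<lambda>j. 0, \<lambda>j. 0)"
    have g: "\<gamma> = chart (\<chi> i. of_int (m i) / a $ i, 0, 0)"
      unfolding \<gamma>_def lattice_point_def by (simp add: vec_eq_iff zero_vec_def)
    have "\<gamma> \<in> \<Gamma>" unfolding \<Gamma>_def quasi_lattice_eq \<gamma>_def by simp
    moreover have "J \<gamma> * (indicator A (v \<gamma> + z) * h z) = h z"
      using m by (simp add: g J_def v_def add.commute zero_prod_def)
    ultimately show ?thesis
      using nn_integral_ge_point[of \<gamma> \<Gamma> "\<lambda>\<gamma>. J \<gamma> * (indicator A (v \<gamma> + z) * h z)"] by simp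
  qed
  have shift: "J \<gamma> * h (- v \<gamma> + z) \<le> ennreal ((cmod (l2_inner haar f (left_translate (chart (- z, 0, 0) \<odot> \<gamma>) \<phi>)))\<^sup>2)" for \<gamma> z
  proof (cases "snd (chart_inv \<gamma>) = 0")
    case True
    then have "chart_inv \<gamma> = (v \<gamma>, 0, 0)" by (simp add: v_def prod_eq_iff)
    then have "\<gamma> = chart (v \<gamma>, 0, 0)" using chart_chart_inv[of \<gamma>] by (simp only:)
    then have "chart (- z, 0, 0) \<odot> \<gamma> = chart (- z, 0, 0) \<odot> chart (v \<gamma>, 0, 0)" by simp
    also have "\<dots> = chart (- (- v \<gamma> + z), 0, 0)" unfolding chart_mult by (simp add: add.commute)
    finally show ?thesis using True by (simp add: J_def h_def)
  next
    case False
    then show ?thesis by (simp add: J_def)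
  qed
  have "(\<integral>\<^sup>+ z. h z \<partial>lborel) \<le> (\<integral>\<^sup>+ z. \<integral>\<^sup>+ \<gamma>. J \<gamma> * (indicator A (v \<gamma> + z) * h z) \<partial>count_space \<Gamma> \<partial>lborel)"
    by (rule nn_integral_mono) (rule cover)
  also have "\<dots> = (\<integral>\<^sup>+ \<gamma>. \<integral>\<^sup>+ z. J \<gamma> * (indicator A (v \<gamma> + z) * h z) \<partial>lborel \<partial>count_space \<Gamma>)"
  proof (rule nn_integral_count_space_nn_integral)
    show "countable \<Gamma>" unfolding \<Gamma>_def by (rule countable_quasi_lattice)
    show "(\<lambda>z. J \<gamma> * (indicator A (v \<gamma> + z) * h z)) \<in> borel_measurable lborel" for \<gamma> by measurable
  qed
  also have "\<dots> = (\<integral>\<^sup>+ \<gamma>. \<integral>\<^sup>+ z. J \<gamma> * (indicator A z * h (- v \<gamma> + z)) \<partial>lborel \<partial>count_space \<Gamma>)"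
  proof (rule nn_integral_cong)
    fix \<gamma>
    have "(\<integral>\<^sup>+ z. J \<gamma> * (indicator A (v \<gamma> + (- v \<gamma> + z)) * h (- v \<gamma> + z)) \<partial>lborel) =
        (\<integral>\<^sup>+ z. J \<gamma> * (indicator A (v \<gamma> + z) * h z) \<partial>lborel)"
      by (rule nn_integral_lborel_translate) measurable
    then show "(\<integral>\<^sup>+ z. J \<gamma> * (indicator A (v \<gamma> + z) * h z) \<partial>lborel) =
        (\<integral>\<^sup>+ z. J \<gamma> * (indicator A z * h (- v \<gamma> + z)) \<partial>lborel)" by simp
  qed
  also have "\<dots> = (\<integral>\<^sup>+ z. \<integral>\<^sup>+ \<gamma>. J \<gamma> * (indicator A z * h (- v \<gamma> + z)) \<partial>count_space \<Gamma> \<partial>lborel)"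
  proof (rule nn_integral_count_space_nn_integral[symmetric])
    show "countable \<Gamma>" unfolding \<Gamma>_def by (rule countable_quasi_lattice)
    show "(\<lambda>z. J \<gamma> * (indicator A z * h (- v \<gamma> + z))) \<in> borel_measurable lborel" for \<gamma> by measurable
  qed
  also have "\<dots> \<le> (\<integral>\<^sup>+ z. indicator A z * ennreal ((l2_norm haar f)\<^sup>2) \<partial>lborel)"
  proof (rule nn_integral_mono)
    fix z
    have "(\<integral>\<^sup>+ \<gamma>. J \<gamma> * (indicator A z * h (- v \<gamma> + z)) \<partial>count_space \<Gamma>) =
        indicator A z * (\<integral>\<^sup>+ \<gamma>. J \<gamma> * h (- v \<gamma> + z) \<partial>count_space \<Gamma>)"
      by (subst nn_integral_cmult[symmetric]) (simp_all add: mult_ac)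
    also have "\<dots> \<le> indicator A z *
        (\<integral>\<^sup>+ \<gamma>. ennreal ((cmod (l2_inner haar f (left_translate (chart (- z, 0, 0) \<odot> \<gamma>) \<phi>)))\<^sup>2) \<partial>count_space \<Gamma>)"
      by (intro mult_left_mono nn_integral_mono shift) simp
    also have "\<dots> = indicator A z * ennreal ((l2_norm haar f)\<^sup>2)"
      unfolding \<Gamma>_def frame_translate_sum[OF K fr phi f] ..
    finally show "(\<integral>\<^sup>+ \<gamma>. J \<gamma> * (indicator A z * h (- v \<gamma> + z)) \<partial>count_space \<Gamma>) \<le> indicator A z * ennreal ((l2_norm haar f)\<^sup>2)" .
  qed
  also have "\<dots> = emeasure lborel A * ennreal ((l2_norm haar f)\<^sup>2)"
    by (simp add: nn_integral_multc)
  also have "emeasure lborel A = ennreal (1 / (\<Prod>i\<in>UNIV. a $ i))"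
    unfolding A_def by (rule emeasure_lborel_box_reciprocal(2)[OF a])
  finally show ?thesis unfolding h_def .
qed

lemma plancherel_imageE:
  assumes "plancherel_image K I m"
  obtains P where "\<And>lam. lam \<in> Sig \<Longrightarrow> orthogonal_projection lborel (P lam)" "measurable_field P"
    "\<And>f F. f \<in> K \<Longrightarrow> is_plancherel f F \<Longrightarrow> F \<in> hs_fields \<and> (AE lam in mu. F lam \<in> l2_tensor lborel (P lam ` L2 lborel))"
    "\<And>F. F \<in> hs_fields \<Longrightarrow> (AE lam in mu. F lam \<in> l2_tensor lborel (P lam ` L2 lborel)) \<Longrightarrow> \<exists>f\<in>K. is_plancherel f F"
    "AE lam in mu. lam \<notin> I \<longrightarrow> (\<forall>h\<in>L2 lborel. AE x in lborel. P lam h x = 0)"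
    "\<And>lam. lam \<in> I \<Longrightarrow> m lam = operator_rank lborel (P lam)"
proof -
  obtain P where P: "\<forall>lam\<in>Sig. orthogonal_projection lborel (P lam)" "measurable_field P"
    "{F. \<exists>f\<in>K. is_plancherel f F} =
       {F \<in> hs_fields. AE lam in mu. F lam \<in> l2_tensor lborel (P lam ` L2 lborel)}"
    "AE lam in mu. lam \<notin> I \<longrightarrow> (\<forall>h\<in>L2 lborel. AE x in lborel. P lam h x = 0)"
    "\<forall>lam\<in>I. m lam = operator_rank lborel (P lam)"
    using assms unfolding plancherel_image_def by (elim exE conjE)
  have iff: "(\<exists>f\<in>K. is_plancherel f F) \<longleftrightarrow> F \<in> hs_fields \<and> (AE lam in mu. F lam \<in> l2_tensor lborel (P lam ` L2 lborel))" for F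
    using P(3) unfolding set_eq_iff mem_Collect_eq by (rule spec)
  show thesis
  proof (rule that[of P])
    show "F \<in> hs_fields \<and> (AE lam in mu. F lam \<in> l2_tensor lborel (P lam ` L2 lborel))" if "f \<in> K" "is_plancherel f F" for f F
      by (rule iffD1[OF iff]) (rule bexI[of _ f], rule that(2), rule that(1))
    show "\<exists>f\<in>K. is_plancherel f F" if "F \<in> hs_fields" "AE lam in mu. F lam \<in> l2_tensor lborel (P lam ` L2 lborel)" for F
      by (rule iffD2[OF iff]) (rule conjI[OF that])
    show "orthogonal_projection lborel (P lam)" if "lam \<in> Sig" for lam by (rule bspec[OF P(1) that])
    show "m lam = operator_rank lborel (P lam)" if "lam \<in> I" for lam by (rule bspec[OF P(5) that])
  qed (fact P(2) P(4))+
qed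

lemma hs_density_le:
  assumes a: "\<And>i. a $ i > 0"
    and K: "K \<subseteq> L2 haar" "left_invariant K" and fr: "parseval_frame K (quasi_lattice a q b) \<phi>"
    and phi: "\<phi> \<in> K" and P: "is_plancherel \<phi> \<Phi>" and im: "plancherel_image K I m"
  shows "AE lam in lborel. hs_density \<Phi> lam \<le> 1 / (\<Prod>i\<in>UNIV. a $ i)"
proof -
  define \<alpha> where "\<alpha> = 1 / (\<Prod>i\<in>UNIV. a $ i)"
  have al: "0 \<le> \<alpha>" unfolding \<alpha>_def by (intro divide_nonneg_nonneg prod_nonneg) (use a in \<open>simp_all add: less_imp_le\<close>)
  note Ph = is_plancherelD(2)[OF P]
  define g where "g = hs_density \<Phi>"
  have gm [measurable]: "g \<in> borel_measurable borel" unfolding g_def by (rule hs_density_measurable[OF Ph])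
  have g0: "0 \<le> g lam" for lam unfolding g_def by (rule hs_density_nonneg)
  have fing: "(\<integral>\<^sup>+ lam. ennreal (g lam) \<partial>lborel) < \<infinity>"
    using nn_integral_hs_density[OF Ph, of UNIV] hs_fields_regular(2)[OF Ph] by (simp add: g_def)
  have bad: "AE lam in lborel. lam \<notin> {lam. \<alpha> < g lam \<and> g lam \<le> real N}" for N :: nat
  proof -
    \<comment> \<open>The cutoff at \<open>real N\<close> makes g square-integrable on
      \<open>E\<close>, as Euclidean Plancherel requires; its integral is finite anyway.\<close>
    define E where "E = {lam. \<alpha> < g lam \<and> g lam \<le> real N}"
    have E [measurable]: "E \<in> sets borel" unfolding E_def by measurable
    define F where "F = (\<lambda>lam h x. indicator E lam * \<Phi> lam h x)"
    have "\<exists>f\<in>K. is_plancherel f F"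
    proof (rule plancherel_imageE[OF im])
      fix Q
      assume 1: "\<And>f F. f \<in> K \<Longrightarrow> is_plancherel f F \<Longrightarrow> F \<in> hs_fields \<and> (AE lam in mu. F lam \<in> l2_tensor lborel (Q lam ` L2 lborel))"
        and 2: "\<And>F. F \<in> hs_fields \<Longrightarrow> (AE lam in mu. F lam \<in> l2_tensor lborel (Q lam ` L2 lborel)) \<Longrightarrow> \<exists>f\<in>K. is_plancherel f F"
      show ?thesis
      proof (rule 2)
        show "F \<in> hs_fields" unfolding F_def by (rule hs_fields_cutoff[OF Ph E])
        have "AE lam in mu. \<Phi> lam \<in> l2_tensor lborel (Q lam ` L2 lborel)" using 1[OF phi P] by (rule conjunct2)
        then show "AE lam in mu. F lam \<in> l2_tensor lborel (Q lam ` L2 lborel)"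
          unfolding F_def by eventually_elim (rule l2_tensor_scaled)
      qed
    qed
    then obtain f where f: "f \<in> K" and fF: "is_plancherel f F" ..
    note c = central_coefficients[OF fF[unfolded F_def] P]
    define G where "G lam = complex_of_real (indicator E lam * g lam)" for lam
    have Gm [measurable]: "G \<in> borel_measurable borel" unfolding G_def by measurable
    have Gn: "cmod (G lam) = indicator E lam * g lam" for lam
      unfolding G_def using g0[of lam] by (simp add: norm_mult abs_mult)
    have nf: "ennreal ((l2_norm haar f)\<^sup>2) = (\<integral>\<^sup>+ lam. indicator E lam * ennreal (g lam) \<partial>lborel)"
    proof -
      have "hs_norm2 lborel (F lam) = indicator E lam * hs_norm2 lborel (\<Phi> lam)" for lam
        unfolding F_def hs_norm2_scale by (simp add: indicator_def)
      then show ?thesis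
        unfolding is_plancherel_norm[OF fF] g_def nn_integral_hs_density[OF Ph E, symmetric] by simp
    qed
    have finE: "(\<integral>\<^sup>+ lam. indicator E lam * ennreal (g lam) \<partial>lborel) < \<infinity>" unfolding nf[symmetric] by simp
    have e1: "ennreal (cmod (G lam)) = indicator E lam * ennreal (g lam)" for lam
      unfolding Gn using g0[of lam] by (simp add: ennreal_mult ennreal_indicator)
    have e2: "ennreal ((cmod (G lam))\<^sup>2) = indicator E lam * (ennreal (g lam) * ennreal (g lam))" for lam
      unfolding Gn using g0[of lam] by (simp add: indicator_def power2_eq_square ennreal_mult)
    have G1: "integrable lborel G"
      by (rule integrableI_bounded) (use finE in \<open>simp_all add: e1\<close>)
    have G2: "G \<in> L2 lborel"
    proof (rule L2I_nn_integral)
      have "(\<integral>\<^sup>+ lam. ennreal ((cmod (G lam))\<^sup>2) \<partial>lborel) \<le> (\<integral>\<^sup>+ lam. ennreal (real N) * (indicator E lam * ennreal (g lam)) \<partial>lborel)"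
      proof (rule nn_integral_mono)
        fix lam
        show "ennreal ((cmod (G lam))\<^sup>2) \<le> ennreal (real N) * (indicator E lam * ennreal (g lam))"
          unfolding e2
        proof (cases "lam \<in> E")
          case True
          then have "ennreal (g lam) \<le> ennreal (real N)" unfolding E_def by (intro ennreal_leI) simp
          then have "ennreal (g lam) * ennreal (g lam) \<le> ennreal (real N) * ennreal (g lam)" by (rule mult_right_mono) simp
          then show "indicator E lam * (ennreal (g lam) * ennreal (g lam)) \<le> ennreal (real N) * (indicator E lam * ennreal (g lam))"
            using True by simp
        qed simp
      qed
      also have "\<dots> = ennreal (real N) * (\<integral>\<^sup>+ lam. indicator E lam * ennreal (g lam) \<partial>lborel)"
        by (rule nn_integral_cmult) measurable
      also have "\<dots> < \<infinity>" using finE by (simp add: ennreal_mult_less_top)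
      finally show "(\<integral>\<^sup>+ lam. ennreal ((cmod (G lam))\<^sup>2) \<partial>lborel) < \<infinity>" .
    qed simp
    have c': "l2_inner haar f (left_translate (chart (- z, 0, 0)) \<phi>) = ft G z" for z
      unfolding c G_def g_def ..
    have "(\<integral>\<^sup>+ lam. indicator E lam * (ennreal (g lam) * ennreal (g lam)) \<partial>lborel) = (\<integral>\<^sup>+ lam. ennreal ((cmod (G lam))\<^sup>2) \<partial>lborel)"
      unfolding e2 ..
    also have "\<dots> = ennreal ((l2_norm lborel G)\<^sup>2)" by (rule ennreal_l2_norm_square[OF G2, symmetric])
    also have "\<dots> = (\<integral>\<^sup>+ z. ennreal ((cmod (ft G z))\<^sup>2) \<partial>lborel)" by (rule plancherel_euclidean[OF G1 G2, symmetric])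
    also have "\<dots> \<le> ennreal \<alpha> * ennreal ((l2_norm haar f)\<^sup>2)"
      using central_translates_bound[OF a K fr phi f, unfolded c'] unfolding \<alpha>_def by simp
    also have "\<dots> = (\<integral>\<^sup>+ lam. indicator E lam * (ennreal \<alpha> * ennreal (g lam)) \<partial>lborel)"
      unfolding nf by (subst nn_integral_cmult[symmetric]) (simp_all add: mult_ac)
    finally have le: "(\<integral>\<^sup>+ lam. indicator E lam * (ennreal (g lam) * ennreal (g lam)) \<partial>lborel) \<le>
        (\<integral>\<^sup>+ lam. indicator E lam * (ennreal \<alpha> * ennreal (g lam)) \<partial>lborel)" .
    have "AE lam in lborel. lam \<notin> E"
    proof (rule AE_notin_if_nn_integral_le[OF _ _ _ _ le])
      show "(\<lambda>lam. ennreal (g lam) * ennreal (g lam)) \<in> borel_measurable lborel"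
        "(\<lambda>lam. ennreal \<alpha> * ennreal (g lam)) \<in> borel_measurable lborel" by measurable
      show "E \<in> sets lborel" by simp
      show "ennreal \<alpha> * ennreal (g lam) < ennreal (g lam) * ennreal (g lam)" if "lam \<in> E" for lam
      proof -
        have "\<alpha> < g lam" using that by (simp add: E_def)
        then have "\<alpha> * g lam < g lam * g lam" using al by (intro mult_strict_right_mono) simp_all
        then show ?thesis using al g0[of lam] by (simp add: ennreal_mult[symmetric] ennreal_less_iff)
      qed
      have "(\<integral>\<^sup>+ lam. indicator E lam * (ennreal \<alpha> * ennreal (g lam)) \<partial>lborel) = ennreal \<alpha> * ennreal ((l2_norm haar f)\<^sup>2)"
        unfolding nf by (subst nn_integral_cmult[symmetric]) (simp_all add: mult_ac)
      also have "\<dots> < \<infinity>" by (simp add: ennreal_mult_less_top)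
      finally show "(\<integral>\<^sup>+ lam. indicator E lam * (ennreal \<alpha> * ennreal (g lam)) \<partial>lborel) < \<infinity>" .
    qed
    then show ?thesis unfolding E_def .
  qed
  have "AE lam in lborel. \<forall>N::nat. lam \<notin> {lam. \<alpha> < g lam \<and> g lam \<le> real N}"
    unfolding AE_all_countable by (rule allI) (rule bad)
  then show ?thesis
  proof eventually_elim
    case (elim lam)
    obtain N :: nat where "g lam \<le> real N" using real_arch_simple by blast
    then have "\<not> \<alpha> < g lam" using elim[THEN spec, of N] by simp
    then show ?case unfolding \<alpha>_def g_def by simp
  qed
qed

end

section \<open>Weak integrals and vector fields over the frequencies\<close>

lemma integrable_pairI:
  fixes f :: "'a \<times> 'b \<Rightarrow> complex"
  assumes M: "sigma_finite_measure M" and N: "sigma_finite_measure N"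
    and f: "f \<in> borel_measurable (M \<Otimes>\<^sub>M N)"
    and i: "\<And>x. x \<in> space M \<Longrightarrow> integrable N (\<lambda>y. f (x, y))"
    and b: "\<And>x. x \<in> space M \<Longrightarrow> (LINT y|N. cmod (f (x, y))) \<le> g x" and g: "integrable M g"
  shows "integrable (M \<Otimes>\<^sub>M N) f"
proof -
  interpret M: sigma_finite_measure M by (rule M)
  interpret N: sigma_finite_measure N by (rule N)
  interpret pair_sigma_finite M N ..
  show ?thesis
  proof (rule Fubini_integrable[OF f])
    show "integrable M (\<lambda>x. LINT y|N. norm (f (x, y)))"
    proof (rule Bochner_Integration.integrable_bound[OF g])
      have "(\<lambda>(x, y). norm (f (x, y))) \<in> borel_measurable (M \<Otimes>\<^sub>M N)"
        using f by (simp add: split_beta')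
      then show "(\<lambda>x. LINT y|N. norm (f (x, y))) \<in> borel_measurable M"
        by (rule N.borel_measurable_lebesgue_integral)
      show "AE x in M. norm (LINT y|N. norm (f (x, y))) \<le> norm (g x)"
      proof (rule AE_I2)
        fix x assume x: "x \<in> space M"
        have "0 \<le> (LINT y|N. norm (f (x, y)))" by (rule integral_nonneg_AE) simp
        then show "norm (LINT y|N. norm (f (x, y))) \<le> norm (g x)" using b[OF x] by simp
      qed
    qed
    show "AE x in M. integrable N (\<lambda>y. f (x, y))" using i by (rule AE_I2)
  qed
qed

context two_step
begin

lemma pi_rep_inner_le:
  assumes v: "v \<in> L2 lborel" and e: "e \<in> L2 lborel"
  shows "cmod (l2_inner lborel (pi_rep lam n v) e) \<le> l2_norm lborel v * l2_norm lborel e"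
  using l2_inner_cauchy_schwarz[OF pi_rep_L2[OF v] e] unfolding pi_rep_norm .

text \<open>\<open>pi_integral\<close> is defined pointwise in \<open>x\<close>; Fubini identifies
  it with the weak operator-valued integral.\<close>

lemma pi_integral_inner:
  assumes H: "integrable haar H" and v: "v \<in> L2 lborel" and e: "e \<in> L2 lborel"
  shows "l2_inner lborel (pi_integral lam H v) e = (LINT n|haar. H n * l2_inner lborel (pi_rep lam n v) e)"
proof -
  define f where "f n x = H n * pi_rep lam n v x * cnj (e x)" for n x
  have Hm [measurable]: "H \<in> borel_measurable borel" using borel_measurable_integrable[OF H] by simp
  have vm [measurable]: "v \<in> borel_measurable borel" using L2_measurable[OF v] by simp
  have em [measurable]: "e \<in> borel_measurable borel" using L2_measurable[OF e] by simp
  have fm: "(\<lambda>p. f (fst p) (snd p)) \<in> borel_measurable (haar \<Otimes>\<^sub>M lborel)"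
    unfolding f_def by measurable
  have ce: "(\<lambda>x. cnj (e x)) \<in> L2 lborel" by (rule L2_cnj[OF e])
  have int: "integrable lborel (\<lambda>x. pi_rep lam n v x * cnj (e x))" for n
    by (rule integrable_mult_L2[OF pi_rep_L2[OF v] ce])
  have "integrable (haar \<Otimes>\<^sub>M lborel) (\<lambda>p. f (fst p) (snd p))"
  proof (rule integrable_pairI[OF sigma_finite_haar sigma_finite_lborel fm])
    show "integrable lborel (\<lambda>x. f (fst (n, x)) (snd (n, x)))" for n
      unfolding f_def fst_conv snd_conv mult.assoc by (rule integrable_mult_right) (rule int)
    show "(LINT x|lborel. cmod (f (fst (n, x)) (snd (n, x)))) \<le> cmod (H n) * (l2_norm lborel v * l2_norm lborel (\<lambda>x. cnj (e x)))" for n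
    proof -
      have "(LINT x|lborel. cmod (f n x)) = cmod (H n) * (LINT x|lborel. cmod (pi_rep lam n v x * cnj (e x)))"
        unfolding f_def mult.assoc norm_mult[of "H n"] by (rule integral_mult_right_zero)
      also have "\<dots> \<le> cmod (H n) * (l2_norm lborel v * l2_norm lborel (\<lambda>x. cnj (e x)))"
        using integral_cmod_mult_le[OF pi_rep_L2[OF v] ce, of lam n] unfolding pi_rep_norm
        by (rule mult_left_mono) simp
      finally show ?thesis by simp
    qed
    show "integrable haar (\<lambda>n. cmod (H n) * (l2_norm lborel v * l2_norm lborel (\<lambda>x. cnj (e x))))"
      by (intro integrable_mult_left integrable_norm H)
  qed
  then have I: "integrable (haar \<Otimes>\<^sub>M lborel) (case_prod f)" by (simp add: split_beta')
  interpret pair_sigma_finite haar "lborel :: (real^'d) measure" ..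
  have "l2_inner lborel (pi_integral lam H v) e = (LINT x|lborel. (LINT n|haar. f n x))"
    unfolding l2_inner_def pi_integral_def f_def
    by (rule Bochner_Integration.integral_cong[OF refl]) simp
  also have "\<dots> = (LINT n|haar. (LINT x|lborel. f n x))" by (rule Fubini_integral[OF I])
  also have "\<dots> = (LINT n|haar. H n * l2_inner lborel (pi_rep lam n v) e)"
    unfolding l2_inner_def f_def mult.assoc
    by (rule Bochner_Integration.integral_cong[OF refl]) simp
  finally show ?thesis .
qed

subsection \<open>The rank of the projections\<close>

text \<open>Coordinates determine a vector up to null sets, so measurability of the coordinates is
  independent of the representatives chosen at each \<lambda>.\<close>

definition weak_field :: "(real^'k \<Rightarrow> (real^'d) \<Rightarrow> complex) \<Rightarrow> bool" where
  "weak_field v \<longleftrightarrow> (\<forall>lam\<in>Sig. v lam \<in> L2 lborel) \<and>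
     (\<forall>i. (\<lambda>lam. l2_inner lborel (v lam) (onb lborel i)) \<in> borel_measurable mu)"

lemma weak_field_L2: "weak_field v \<Longrightarrow> lam \<in> Sig \<Longrightarrow> v lam \<in> L2 lborel"
  by (simp add: weak_field_def)

lemma weak_field_norm_measurable:
  assumes v: "weak_field v"
  shows "(\<lambda>lam. l2_norm lborel (v lam)) \<in> borel_measurable mu"
proof -
  have m: "(\<lambda>lam. l2_inner lborel (v lam) (onb lborel i)) \<in> borel_measurable mu" for i
    using v by (simp add: weak_field_def)
  have "(\<lambda>lam. l2_inner lborel (v lam) (v lam)) \<in> borel_measurable mu"
    by (rule borel_measurable_l2_inner[OF m m]) (use v in \<open>simp_all add: weak_field_L2\<close>)
  then have "(\<lambda>lam. sqrt (Re (l2_inner lborel (v lam) (v lam)))) \<in> borel_measurable mu"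
    by measurable
  then show ?thesis by (simp add: l2_inner_self)
qed

text \<open>Operator and argument both vary with \<lambda>; expanding the argument in the basis
  exhibits each coordinate as a limit of finite sums of products of measurable functions.\<close>

lemma weak_field_apply:
  assumes F: "F \<in> hs_fields" and u: "weak_field u"
  shows "weak_field (\<lambda>lam. F lam (u lam))"
  unfolding weak_field_def
proof (intro conjI ballI allI)
  show "F lam (u lam) \<in> L2 lborel" if "lam \<in> Sig" for lam
    by (rule bounded_operator_L2[OF _ weak_field_L2[OF u that]])
      (use hs_fields_regular(4)[OF F that] in \<open>simp add: hilbert_schmidt_def\<close>)
  fix i
  have c: "(\<lambda>lam. l2_inner lborel (u lam) (onb lborel j)) \<in> borel_measurable mu" for j
    using u by (simp add: weak_field_def)
  have d: "(\<lambda>lam. l2_inner lborel (F lam (onb lborel j)) (onb lborel i)) \<in> borel_measurable mu" for j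
    by (rule hs_fields_measurable[OF F onb_L2 onb_L2])
  have lim: "(\<lambda>n. \<Sum>j<n. l2_inner lborel (u lam) (onb lborel j) * l2_inner lborel (F lam (onb lborel j)) (onb lborel i))
      \<longlonglongrightarrow> l2_inner lborel (F lam (u lam)) (onb lborel i)" if "lam \<in> space mu" for lam
  proof -
    have lam: "lam \<in> Sig" using that by simp
    have "bounded_operator lborel (F lam)"
      using hs_fields_regular(4)[OF F lam] by (simp add: hilbert_schmidt_def)
    from bounded_operator_inner_expand[OF onb_lborel this weak_field_L2[OF u lam] onb_L2]
    show ?thesis unfolding sums_def .
  qed
  show "(\<lambda>lam. l2_inner lborel (F lam (u lam)) (onb lborel i)) \<in> borel_measurable mu"
  proof (rule borel_measurable_LIMSEQ_metric[OF _ lim])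
    show "(\<lambda>lam. \<Sum>j<n. l2_inner lborel (u lam) (onb lborel j) * l2_inner lborel (F lam (onb lborel j)) (onb lborel i))
        \<in> borel_measurable mu" for n
      by (intro borel_measurable_sum borel_measurable_times c d)
  qed
qed

text \<open>Joint measurability in the group element and \<lambda>, needed for Fubini. Since
  \<open>v\<close> has no joint measurability in \<lambda> and \<open>x\<close>, the representation
  is moved onto the fixed function \<open>e\<close>.\<close>

lemma weak_field_coefficient_measurable:
  assumes v: "weak_field v" and e: "e \<in> L2 lborel"
  shows "(\<lambda>p. l2_inner lborel (pi_rep (snd p) (fst p) (v (snd p))) e) \<in> borel_measurable (haar \<Otimes>\<^sub>M mu)"
proof -
  have em [measurable]: "e \<in> borel_measurable borel" using L2_measurable[OF e] by simp
  have om [measurable]: "onb lborel i \<in> borel_measurable borel" for i by (rule onb_measurable)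
  have c: "(\<lambda>p. l2_inner lborel (v (snd p)) (onb lborel i)) \<in> borel_measurable (haar \<Otimes>\<^sub>M mu)" for i
    by (rule measurable_compose[OF measurable_snd]) (use v in \<open>simp add: weak_field_def\<close>)
  have s: "(\<lambda>p. snd p) \<in> borel_measurable (haar \<Otimes>\<^sub>M mu)"
    by (rule measurable_compose[OF measurable_snd id_measurable_mu])
  have f: "(\<lambda>p. fst p) \<in> borel_measurable (haar \<Otimes>\<^sub>M mu)"
    using measurable_fst[of haar mu] by (simp add: measurable_cong_sets[OF refl sets_haar])
  have d: "(\<lambda>p. l2_inner lborel (pi_rep (snd p) (- fst p) e) (onb lborel i)) \<in> borel_measurable (haar \<Otimes>\<^sub>M mu)" for i
  proof -
    have 1: "(\<lambda>w. snd (fst w)) \<in> borel_measurable ((haar \<Otimes>\<^sub>M mu) \<Otimes>\<^sub>M lborel)"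
      by (rule measurable_compose[OF measurable_fst s])
    have 2: "(\<lambda>w. - fst (fst w)) \<in> borel_measurable ((haar \<Otimes>\<^sub>M mu) \<Otimes>\<^sub>M lborel)"
      by (rule borel_measurable_uminus[OF measurable_compose[OF measurable_fst f]])
    have 3: "(\<lambda>w. snd w) \<in> borel_measurable ((haar \<Otimes>\<^sub>M mu) \<Otimes>\<^sub>M lborel)"
      using measurable_snd[of "haar \<Otimes>\<^sub>M mu" lborel] by simp
    have "(\<lambda>w. pi_rep (snd (fst w)) (- fst (fst w)) e (snd w)) \<in> borel_measurable ((haar \<Otimes>\<^sub>M mu) \<Otimes>\<^sub>M lborel)"
      by (rule pi_rep_measurable[OF em 1 2 3])
    moreover have "(\<lambda>w. cnj (onb lborel i (snd w))) \<in> borel_measurable ((haar \<Otimes>\<^sub>M mu) \<Otimes>\<^sub>M lborel)"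
      by (rule borel_measurable_cnj[OF measurable_compose[OF 3 om]])
    ultimately have "(\<lambda>w. pi_rep (snd (fst w)) (- fst (fst w)) e (snd w) * cnj (onb lborel i (snd w)))
        \<in> borel_measurable ((haar \<Otimes>\<^sub>M mu) \<Otimes>\<^sub>M lborel)"
      by (rule borel_measurable_times)
    then show ?thesis
      unfolding l2_inner_def
      by (intro lborel.borel_measurable_lebesgue_integral) (simp add: split_beta')
  qed
  have "(\<lambda>p. l2_inner lborel (v (snd p)) (pi_rep (snd p) (- fst p) e)) \<in> borel_measurable (haar \<Otimes>\<^sub>M mu)"
  proof (rule borel_measurable_l2_inner[OF c d])
    show "v (snd p) \<in> L2 lborel" if "p \<in> space (haar \<Otimes>\<^sub>M mu)" for p
      using that by (intro weak_field_L2[OF v]) (simp add: space_pair_measure mem_Times_iff)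
    show "pi_rep (snd p) (- fst p) e \<in> L2 lborel" for p by (rule pi_rep_L2[OF e])
  qed
  then show ?thesis unfolding pi_rep_adjoint .
qed

text \<open>The integrand is dominated by a product of a function on the group and one of \<lambda>,
  namely \<open>cmod (H x)\<close> and a multiple of the norm of \<open>v lam\<close>; hence
  integrability of the norm itself, not of its square.\<close>

lemma integral_coefficients_swap:
  assumes H: "integrable haar H" and v: "weak_field v" and n: "integrable mu (\<lambda>lam. l2_norm lborel (v lam))"
    and e: "e \<in> L2 lborel"
  shows "(LINT lam|mu. l2_inner lborel (pi_integral lam H (v lam)) e) =
      (LINT x|haar. H x * (LINT lam|mu. l2_inner lborel (pi_rep lam x (v lam)) e))"
    and "integrable mu (\<lambda>lam. l2_inner lborel (pi_integral lam H (v lam)) e)"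
proof -
  define f where "f x lam = H x * l2_inner lborel (pi_rep lam x (v lam)) e" for x lam
  note cm = weak_field_coefficient_measurable[OF v e]
  have Hm: "(\<lambda>p. H (fst p)) \<in> borel_measurable (haar \<Otimes>\<^sub>M mu)"
    by (rule measurable_compose[OF measurable_fst borel_measurable_integrable[OF H]])
  have fm: "(\<lambda>p. f (fst p) (snd p)) \<in> borel_measurable (haar \<Otimes>\<^sub>M mu)"
    unfolding f_def by (rule borel_measurable_times[OF Hm cm])
  have g: "integrable (haar \<Otimes>\<^sub>M mu) (\<lambda>p. cmod (H (fst p)) * (l2_norm lborel (v (snd p)) * l2_norm lborel e))"
    by (rule integrable_pair_mult[OF sigma_finite_haar sigma_finite_mu])
      (rule integrable_norm[OF H], rule integrable_mult_left, rule n)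
  have "integrable (haar \<Otimes>\<^sub>M mu) (\<lambda>p. f (fst p) (snd p))"
  proof (rule Bochner_Integration.integrable_bound[OF g fm], rule AE_I2)
    fix p assume "p \<in> space (haar \<Otimes>\<^sub>M mu)"
    then have "snd p \<in> Sig" by (simp add: space_pair_measure mem_Times_iff)
    from pi_rep_inner_le[OF weak_field_L2[OF v this] e]
    have "cmod (f (fst p) (snd p)) \<le> cmod (H (fst p)) * (l2_norm lborel (v (snd p)) * l2_norm lborel e)"
      unfolding f_def norm_mult by (rule mult_left_mono) simp
    then show "norm (f (fst p) (snd p)) \<le> norm (cmod (H (fst p)) * (l2_norm lborel (v (snd p)) * l2_norm lborel e))"
      by simp
  qed
  then have I: "integrable (haar \<Otimes>\<^sub>M mu) (case_prod f)" by (simp add: split_beta')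
  interpret pair_sigma_finite haar mu ..
  have eq: "(LINT x|haar. f x lam) = l2_inner lborel (pi_integral lam H (v lam)) e" if "lam \<in> space mu" for lam
  proof -
    have "lam \<in> Sig" using that by simp
    from pi_integral_inner[OF H weak_field_L2[OF v this] e] show ?thesis unfolding f_def by simp
  qed
  have "(LINT lam|mu. l2_inner lborel (pi_integral lam H (v lam)) e) = (LINT lam|mu. (LINT x|haar. f x lam))"
    by (rule Bochner_Integration.integral_cong[OF refl]) (rule eq[symmetric])
  also have "\<dots> = (LINT x|haar. (LINT lam|mu. f x lam))" by (rule Fubini_integral[OF I])
  also have "\<dots> = (LINT x|haar. H x * (LINT lam|mu. l2_inner lborel (pi_rep lam x (v lam)) e))"
    unfolding f_def by simp
  finally show "(LINT lam|mu. l2_inner lborel (pi_integral lam H (v lam)) e) =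
      (LINT x|haar. H x * (LINT lam|mu. l2_inner lborel (pi_rep lam x (v lam)) e))" .
  have "integrable mu (\<lambda>lam. LINT x|haar. f x lam)" by (rule integrable_snd[OF I])
  then show "integrable mu (\<lambda>lam. l2_inner lborel (pi_integral lam H (v lam)) e)"
    by (rule Bochner_Integration.integrable_cong[THEN iffD1, OF refl, rotated]) (rule eq)
qed

end

text \<open>The arithmetic-geometric mean inequality, applied with \<open>h\<close> a squared
  Hilbert--Schmidt norm and \<open>V\<close> a squared vector norm.\<close>

lemma two_mult_le_of_square_le:
  fixes h :: ennreal
  assumes w: "0 \<le> w" and le: "ennreal (w\<^sup>2) \<le> ennreal V * h" and V: "0 \<le> V"
  shows "ennreal (2 * w) \<le> h + ennreal V"
proof (cases h)
  case (real r)
  have "ennreal (w\<^sup>2) \<le> ennreal (V * r)" using le V real by (simp add: ennreal_mult)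
  then have "w\<^sup>2 \<le> V * r" using V real by (simp add: ennreal_le_iff)
  moreover have "4 * (V * r) \<le> (r + V)\<^sup>2" using zero_le_power2[of "r - V"] by (simp add: power2_eq_square algebra_simps)
  ultimately have "(2 * w)\<^sup>2 \<le> (r + V)\<^sup>2" by (simp add: power_mult_distrib)
  then have "2 * w \<le> r + V" by (rule power2_le_imp_le) (use V real in simp)
  then have "ennreal (2 * w) \<le> ennreal (r + V)" by (rule ennreal_leI)
  then show ?thesis using V real by (simp add: ennreal_plus)
qed simp

context two_step
begin

lemma rank_one_field:
  assumes u: "weak_field u" and f: "f \<in> L2 lborel"
    and fin: "(\<integral>\<^sup>+ lam. ennreal ((l2_norm lborel (u lam))\<^sup>2) \<partial>mu) < \<infinity>"
  shows "(\<lambda>lam. rank_one lborel f (u lam)) \<in> hs_fields"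
proof (rule hs_fieldsI)
  show "regular_field (\<lambda>lam. rank_one lborel f (u lam))"
    unfolding regular_field_def
  proof (intro conjI ballI allI)
    show "rank_one lborel f (u lam) (onb lborel j) \<in> L2 lborel" for lam j
      unfolding rank_one_def by (rule L2_scale[OF f])
    have c: "(\<lambda>lam. l2_inner lborel (u lam) (onb lborel j)) \<in> borel_measurable mu" for j
      using u by (simp add: weak_field_def)
    have d: "dcoef (rank_one lborel f (u lam)) n =
        cnj (l2_inner lborel (u lam) (onb lborel (fst (prod_decode n)))) * l2_inner lborel f (onb lborel (snd (prod_decode n)))" for lam n
      unfolding dcoef_def rank_one_def l2_inner_scale_left
      by (subst l2_inner_commute) (rule refl)
    show "(\<lambda>lam. dcoef (rank_one lborel f (u lam)) n) \<in> borel_measurable mu" for n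
      unfolding d by (rule borel_measurable_times[OF borel_measurable_cnj[OF c] borel_measurable_const])
  qed
  show "hilbert_schmidt lborel (rank_one lborel f (u lam))" if "lam \<in> Sig" for lam
    by (rule hilbert_schmidt_rank_one[OF onb_lborel f weak_field_L2[OF u that]])
  have m: "(\<lambda>lam. ennreal ((l2_norm lborel (u lam))\<^sup>2)) \<in> borel_measurable mu"
    using weak_field_norm_measurable[OF u] by measurable
  have "(\<integral>\<^sup>+ lam. hs_norm2 lborel (rank_one lborel f (u lam)) \<partial>mu) =
      (\<integral>\<^sup>+ lam. ennreal ((l2_norm lborel f)\<^sup>2) * ennreal ((l2_norm lborel (u lam))\<^sup>2) \<partial>mu)"
  proof (rule nn_integral_cong)
    fix lam assume "lam \<in> space mu"
    then have "lam \<in> Sig" by simp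
    from hs_norm2_rank_one[OF onb_lborel weak_field_L2[OF u this], of f]
    show "hs_norm2 lborel (rank_one lborel f (u lam)) = ennreal ((l2_norm lborel f)\<^sup>2) * ennreal ((l2_norm lborel (u lam))\<^sup>2)"
      by (simp add: ennreal_mult)
  qed
  also have "\<dots> = ennreal ((l2_norm lborel f)\<^sup>2) * (\<integral>\<^sup>+ lam. ennreal ((l2_norm lborel (u lam))\<^sup>2) \<partial>mu)"
    by (rule nn_integral_cmult[OF m])
  also have "\<dots> < \<infinity>" using fin by (simp add: ennreal_mult_less_top)
  finally show "(\<integral>\<^sup>+ lam. hs_norm2 lborel (rank_one lborel f (u lam)) \<partial>mu) < \<infinity>" .
qed

text \<open>The conjugate is taken so that the integrand is linear in the vector field, which stands
  in the first argument of the inner product.\<close>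

lemma rank_one_coefficients:
  assumes F: "is_plancherel f (\<lambda>lam. rank_one lborel e (u lam))" and P: "is_plancherel \<phi> \<Phi>"
    and u: "weak_field u" and e: "e \<in> L2 lborel"
  shows "cnj (l2_inner haar f (left_translate x \<phi>)) = (LINT lam|mu. l2_inner lborel (pi_rep lam x (\<Phi> lam (u lam))) e)"
proof -
  note T = is_plancherel_translate[OF P, of x]
  have "l2_inner haar f (left_translate x \<phi>) =
      (LINT lam|mu. l2_inner (count_space UNIV) (dcoef (rank_one lborel e (u lam))) (dcoef (\<lambda>h. pi_rep lam x (\<Phi> lam h))))"
    unfolding is_plancherel_inner[OF F T] by (rule inner_coef_measure(2)[OF is_plancherelD(2)[OF F] is_plancherelD(2)[OF T]])
  also have "\<dots> = (LINT lam|mu. l2_inner lborel e (pi_rep lam x (\<Phi> lam (u lam))))"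
  proof (rule Bochner_Integration.integral_cong[OF refl])
    fix lam assume "lam \<in> space mu"
    then have lam: "lam \<in> Sig" by simp
    show "l2_inner (count_space UNIV) (dcoef (rank_one lborel e (u lam))) (dcoef (\<lambda>h. pi_rep lam x (\<Phi> lam h))) =
        l2_inner lborel e (pi_rep lam x (\<Phi> lam (u lam)))"
      by (rule dcoef_rank_one_inner[OF hs_fields_regular(4)[OF is_plancherelD(2)[OF T] lam] e weak_field_L2[OF u lam]])
  qed
  also have "\<dots> = (LINT lam|mu. cnj (l2_inner lborel (pi_rep lam x (\<Phi> lam (u lam))) e))"
    by (rule Bochner_Integration.integral_cong[OF refl]) (rule l2_inner_commute)
  also have "\<dots> = cnj (LINT lam|mu. l2_inner lborel (pi_rep lam x (\<Phi> lam (u lam))) e)"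
    by (rule Bochner_Integration.integral_cnj)
  finally show ?thesis by simp
qed

text \<open>Dualising against truncations \<open>H\<close> of the coefficient function reduces the bound to
  Plancherel for integrable functions, since \<open>\<langle>\<pi>(H) v, e\<rangle>\<close> is at most
  the Hilbert--Schmidt norm of \<open>\<pi>(H)\<close> times the norm of \<open>v\<close>.\<close>

lemma coefficients_norm_le:
  assumes v: "weak_field v" and n: "integrable mu (\<lambda>lam. l2_norm lborel (v lam))"
    and c: "c \<in> L2 haar" and eq: "\<And>x. cnj (c x) = (LINT lam|mu. l2_inner lborel (pi_rep lam x (v lam)) (onb lborel 0))"
  shows "ennreal ((l2_norm haar c)\<^sup>2) \<le> (\<integral>\<^sup>+ lam. ennreal ((l2_norm lborel (v lam))\<^sup>2) \<partial>mu)"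
proof -
  define H where "H i = (\<lambda>x. indicator (chart_ball i) x * c x)" for i
  have H1: "integrable haar (H i)" and H2: "H i \<in> L2 haar" for i
    unfolding H_def by (rule truncation_L1[OF c], rule truncation_L2[OF c])
  define S where "S = (\<integral>\<^sup>+ lam. ennreal ((l2_norm lborel (v lam))\<^sup>2) \<partial>mu)"
  have bound: "ennreal ((l2_norm haar (H i))\<^sup>2) \<le> S" for i
  proof -
    define w where "w lam = l2_inner lborel (pi_integral lam (H i) (v lam)) (onb lborel 0)" for lam
    have wi: "integrable mu w" unfolding w_def by (rule integral_coefficients_swap(2)[OF H1 v n onb_L2])
    have "complex_of_real ((l2_norm haar (H i))\<^sup>2) = (LINT x|haar. H i x * cnj (H i x))"
      unfolding l2_inner_self[symmetric] l2_inner_def ..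
    also have "\<dots> = (LINT x|haar. H i x * cnj (c x))"
      by (rule Bochner_Integration.integral_cong[OF refl]) (simp add: H_def indicator_def)
    also have "\<dots> = (LINT lam|mu. w lam)"
      unfolding eq w_def by (rule integral_coefficients_swap(1)[OF H1 v n onb_L2, symmetric])
    finally have "(l2_norm haar (H i))\<^sup>2 = cmod (LINT lam|mu. w lam)"
      by (metis norm_of_real abs_of_nonneg zero_le_power2)
    also have "ennreal \<dots> \<le> (\<integral>\<^sup>+ lam. ennreal (cmod (w lam)) \<partial>mu)" by (rule integral_norm_bound_ennreal[OF wi])
    finally have le: "ennreal ((l2_norm haar (H i))\<^sup>2) \<le> (\<integral>\<^sup>+ lam. ennreal (cmod (w lam)) \<partial>mu)" .
    have wm: "(\<lambda>lam. ennreal (cmod (w lam))) \<in> borel_measurable mu"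
      using borel_measurable_integrable[OF wi] by measurable
    have hm: "(\<lambda>lam. hs_norm2 lborel (pi_integral lam (H i))) \<in> borel_measurable mu"
      by (rule borel_measurable_mu[OF hs_norm2_pi_integral_measurable[OF H1]])
    have vm: "(\<lambda>lam. ennreal ((l2_norm lborel (v lam))\<^sup>2)) \<in> borel_measurable mu"
      using weak_field_norm_measurable[OF v] by measurable
    \<comment> \<open>The mean inequality bounds twice the modulus of \<open>w lam\<close>.
      Plancherel for \<open>H i\<close> returns one copy of its squared norm on the right, which
      cancels.\<close>
    have "ennreal ((l2_norm haar (H i))\<^sup>2) + ennreal ((l2_norm haar (H i))\<^sup>2) \<le>
        (\<integral>\<^sup>+ lam. ennreal (cmod (w lam)) \<partial>mu) + (\<integral>\<^sup>+ lam. ennreal (cmod (w lam)) \<partial>mu)"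
      using le le by (rule add_mono)
    also have "\<dots> = (\<integral>\<^sup>+ lam. ennreal (2 * cmod (w lam)) \<partial>mu)"
      unfolding nn_integral_add[OF wm wm, symmetric] by (simp add: ennreal_plus[symmetric] del: ennreal_plus)
    also have "\<dots> \<le> (\<integral>\<^sup>+ lam. hs_norm2 lborel (pi_integral lam (H i)) + ennreal ((l2_norm lborel (v lam))\<^sup>2) \<partial>mu)"
    proof (rule nn_integral_mono)
      fix lam assume "lam \<in> space mu"
      then have lam: "lam \<in> Sig" by simp
      show "ennreal (2 * cmod (w lam)) \<le> hs_norm2 lborel (pi_integral lam (H i)) + ennreal ((l2_norm lborel (v lam))\<^sup>2)"
        unfolding w_def
        by (rule two_mult_le_of_square_le[OF norm_ge_zero
              hs_operator_bound[OF onb_lborel bounded_pi_integral[OF H1] weak_field_L2[OF v lam]] zero_le_power2])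
    qed
    also have "\<dots> = ennreal ((l2_norm haar (H i))\<^sup>2) + S"
      unfolding nn_integral_add[OF hm vm] plancherel_group[OF H1 H2] S_def ..
    finally show ?thesis by (rule ennreal_add_left_cancel_le[THEN iffD1, THEN disjE]) simp_all
  qed
  have "(\<lambda>i. l2_norm haar (H i)) \<longlonglongrightarrow> l2_norm haar c"
    by (rule tendsto_l2_norm[OF H2 c]) (unfold H_def, rule truncation_lim[OF c])
  then have "(\<lambda>i. ennreal ((l2_norm haar (H i))\<^sup>2)) \<longlonglongrightarrow> ennreal ((l2_norm haar c)\<^sup>2)"
    by (intro tendsto_ennrealI tendsto_power)
  then have "ennreal ((l2_norm haar c)\<^sup>2) \<le> S"
    by (rule LIMSEQ_le_const2) (use bound in simp)
  then show ?thesis unfolding S_def .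
qed

lemma emeasure_mu_cball_finite: "(\<integral>\<^sup>+ lam. indicator (cball 0 r) lam \<partial>mu) < \<infinity>"
proof -
  have "compact ((\<lambda>lam. \<bar>det (B lam)\<bar>) ` cball (0 :: real^'k) r)"
    by (intro compact_continuous_image continuous_on_rabs continuous_on_subset[OF continuous_det_B]) auto
  then have "bounded ((\<lambda>lam. \<bar>det (B lam)\<bar>) ` cball (0 :: real^'k) r)" by (rule compact_imp_bounded)
  then obtain C where "\<forall>x\<in>(\<lambda>lam. \<bar>det (B lam)\<bar>) ` cball 0 r. norm x \<le> C" unfolding bounded_iff ..
  then have C: "\<bar>det (B lam)\<bar> \<le> C" if "lam \<in> cball 0 r" for lam
    using bspec[OF _ imageI[OF that, of "\<lambda>lam. \<bar>det (B lam)\<bar>"]] by simp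
  have "(\<integral>\<^sup>+ lam. indicator (cball 0 r) lam \<partial>mu) = (\<integral>\<^sup>+ lam. ennreal \<bar>det (B lam)\<bar> * indicator (cball 0 r) lam \<partial>lborel)"
    by (intro nn_integral_mu_borel borel_measurable_indicator) simp
  also have "\<dots> \<le> (\<integral>\<^sup>+ lam. ennreal C * indicator (cball (0 :: real^'k) r) lam \<partial>lborel)"
    by (rule nn_integral_mono) (auto simp: indicator_def intro!: ennreal_leI C)
  also have "\<dots> = ennreal C * emeasure lborel (cball (0 :: real^'k) r)"
    by (rule nn_integral_cmult_indicator) simp
  also have "\<dots> < \<infinity>" using emeasure_lborel_cball_finite[of "0 :: real^'k" r] by (simp add: ennreal_mult_less_top)
  finally show ?thesis .
qed

lemma measurable_field_weak:
  assumes P: "measurable_field P" "\<And>lam. lam \<in> Sig \<Longrightarrow> orthogonal_projection lborel (P lam)"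
    and h: "h \<in> L2 lborel"
  shows "weak_field (\<lambda>lam. P lam h)"
  unfolding weak_field_def
proof (intro conjI ballI allI)
  show "P lam h \<in> L2 lborel" if "lam \<in> Sig" for lam
    by (rule bounded_operator_L2[OF projection_bounded[OF P(2)[OF that]] h])
  show "(\<lambda>lam. l2_inner lborel (P lam h) (onb lborel i)) \<in> borel_measurable mu" for i
    by (rule bspec[OF bspec[OF P(1)[unfolded measurable_field_def] h] onb_L2])
qed

lemma weak_field_cutoff:
  assumes u: "weak_field u" and E: "E \<in> sets borel"
  shows "weak_field (\<lambda>lam x. indicator E lam * u lam x)"
  unfolding weak_field_def l2_inner_scale_left
proof (intro conjI ballI allI)
  show "(\<lambda>x. indicator E lam * u lam x) \<in> L2 lborel" if "lam \<in> Sig" for lam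
    by (rule L2_scale[OF weak_field_L2[OF u that]])
  have "(\<lambda>lam. indicator E lam :: complex) \<in> borel_measurable mu"
    by (intro borel_measurable_mu borel_measurable_indicator E)
  moreover have "(\<lambda>lam. l2_inner lborel (u lam) (onb lborel i)) \<in> borel_measurable mu" for i
    using u by (simp add: weak_field_def)
  ultimately show "(\<lambda>lam. indicator E lam * l2_inner lborel (u lam) (onb lborel i)) \<in> borel_measurable mu" for i
    by (rule borel_measurable_times)
qed

text \<open>On the set \<open>E\<close> where the inequality fails, the isometry of the wavelet
  transform and \<open>coefficients_norm_le\<close> give the opposite inequality in integrated form.
  The first factor of the rank-one operators is a unit vector, so the norm of the test field at
  \<lambda> in \<open>E\<close> is that of \<open>P lam h\<close>.\<close>

lemma projected_norm_le:
  assumes P: "\<And>lam. lam \<in> Sig \<Longrightarrow> orthogonal_projection lborel (P lam)" "measurable_field P"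
    and im: "\<And>F. F \<in> hs_fields \<Longrightarrow> (AE lam in mu. F lam \<in> l2_tensor lborel (P lam ` L2 lborel)) \<Longrightarrow> \<exists>f\<in>K. is_plancherel f F"
    and wave: "continuous_wavelet K \<phi>" and p: "is_plancherel \<phi> \<Phi>" and h: "h \<in> L2 lborel"
    and hs: "\<And>lam. lam \<in> Sig \<Longrightarrow> ennreal ((l2_norm lborel (\<Phi> lam (P lam h)))\<^sup>2) \<le> hs_norm2 lborel (\<Phi> lam)"
  shows "AE lam in mu. l2_norm lborel (P lam h) \<le> l2_norm lborel (\<Phi> lam (P lam h))"
proof -
  note Ph = is_plancherelD(2)[OF p]
  have wP: "weak_field (\<lambda>lam. P lam h)" by (rule measurable_field_weak[OF P(2) _ h]) (rule P(1))
  note wF = weak_field_apply[OF Ph wP]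
  define \<alpha> where "\<alpha> lam = ennreal ((l2_norm lborel (P lam h))\<^sup>2)" for lam
  define \<beta> where "\<beta> lam = ennreal ((l2_norm lborel (\<Phi> lam (P lam h)))\<^sup>2)" for lam
  have am [measurable]: "\<alpha> \<in> borel_measurable mu"
    unfolding \<alpha>_def using weak_field_norm_measurable[OF wP] by measurable
  have bm [measurable]: "\<beta> \<in> borel_measurable mu"
    unfolding \<beta>_def using weak_field_norm_measurable[OF wF] by measurable
  have bad: "AE lam in mu. lam \<notin> {lam \<in> space mu. \<beta> lam < \<alpha> lam} \<inter> cball 0 (real N)" for N :: nat
  proof -
    \<comment> \<open>The ball gives \<open>E\<close> finite \<open>mu\<close>-measure, because the
      density is bounded on bounded sets.\<close>
    define E where "E = {lam \<in> space mu. \<beta> lam < \<alpha> lam} \<inter> cball 0 (real N)"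
    have "{lam \<in> space mu. \<beta> lam < \<alpha> lam} \<in> sets mu" by measurable
    then have "{lam \<in> space mu. \<beta> lam < \<alpha> lam} \<in> sets borel"
      unfolding sets_mu by (simp add: sets_restrict_space_iff)
    then have E: "E \<in> sets borel" unfolding E_def by (rule sets.Int) simp
    have ES: "E \<subseteq> Sig" unfolding E_def by auto
    have Emu: "E \<in> sets mu" unfolding sets_mu using E ES by (simp add: sets_restrict_space_iff)
    define u where "u = (\<lambda>lam x. indicator E lam * P lam h x)"
    have wu: "weak_field u" unfolding u_def by (rule weak_field_cutoff[OF wP E])
    define v where "v = (\<lambda>lam. \<Phi> lam (u lam))"
    have wv: "weak_field v" unfolding v_def by (rule weak_field_apply[OF Ph wu])
    have un: "l2_norm lborel (u lam) = indicator E lam * l2_norm lborel (P lam h)" for lam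
      unfolding u_def l2_norm_scale by (simp add: indicator_def)
    have u2: "ennreal ((l2_norm lborel (u lam))\<^sup>2) = indicator E lam * \<alpha> lam" for lam
      unfolding un \<alpha>_def by (simp add: indicator_def)
    have vn: "l2_norm lborel (v lam) = indicator E lam * l2_norm lborel (\<Phi> lam (P lam h))" if lam: "lam \<in> Sig" for lam
    proof -
      have b: "bounded_operator lborel (\<Phi> lam)"
        using hs_fields_regular(4)[OF Ph lam] by (simp add: hilbert_schmidt_def)
      have "l2_norm lborel (v lam) = l2_norm lborel (\<lambda>x. indicator E lam * \<Phi> lam (P lam h) x)"
      proof (rule l2_norm_cong_AE)
        show "AE x in lborel. v lam x = indicator E lam * \<Phi> lam (P lam h) x"
          unfolding v_def u_def by (rule bounded_operator_scale[OF b weak_field_L2[OF wP lam]])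
        show "v lam \<in> borel_measurable lborel" by (rule L2_measurable[OF weak_field_L2[OF wv lam]])
        show "(\<lambda>x. indicator E lam * \<Phi> lam (P lam h) x) \<in> borel_measurable lborel"
          by (rule L2_measurable[OF L2_scale[OF weak_field_L2[OF wF lam]]])
      qed
      then show ?thesis unfolding l2_norm_scale by (simp add: indicator_def)
    qed
    have v2: "ennreal ((l2_norm lborel (v lam))\<^sup>2) = indicator E lam * \<beta> lam" if "lam \<in> Sig" for lam
      unfolding vn[OF that] \<beta>_def by (simp add: indicator_def)
    have Efin: "(\<integral>\<^sup>+ lam. indicator E lam \<partial>mu) < \<infinity>"
      by (rule le_less_trans[OF nn_integral_mono emeasure_mu_cball_finite[of "real N"]])
        (simp add: E_def indicator_def)
    have hn: "l2_norm lborel (P lam h) \<le> l2_norm lborel h" if "lam \<in> Sig" for lam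
      by (rule projection_norm_le[OF P(1)[OF that] h])
    have Im: "(\<lambda>lam. indicator E lam :: ennreal) \<in> borel_measurable mu" using Emu by measurable
    have afin: "(\<integral>\<^sup>+ lam. indicator E lam * \<alpha> lam \<partial>mu) < \<infinity>"
    proof -
      have "(\<integral>\<^sup>+ lam. indicator E lam * \<alpha> lam \<partial>mu) \<le> (\<integral>\<^sup>+ lam. ennreal ((l2_norm lborel h)\<^sup>2) * indicator E lam \<partial>mu)"
      proof (rule nn_integral_mono)
        fix lam assume "lam \<in> space mu"
        then have "\<alpha> lam \<le> ennreal ((l2_norm lborel h)\<^sup>2)"
          unfolding \<alpha>_def by (intro ennreal_leI power_mono hn) simp_all
        then show "indicator E lam * \<alpha> lam \<le> ennreal ((l2_norm lborel h)\<^sup>2) * indicator E lam"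
          by (simp add: indicator_def)
      qed
      also have "\<dots> = ennreal ((l2_norm lborel h)\<^sup>2) * (\<integral>\<^sup>+ lam. indicator E lam \<partial>mu)"
        by (rule nn_integral_cmult[OF Im])
      also have "\<dots> < \<infinity>" using Efin by (simp add: ennreal_mult_less_top)
      finally show ?thesis .
    qed
    have bfin: "(\<integral>\<^sup>+ lam. indicator E lam * \<beta> lam \<partial>mu) < \<infinity>"
    proof (rule le_less_trans[OF nn_integral_mono hs_fields_regular(2)[OF Ph]])
      fix lam assume "lam \<in> space mu"
      then have "\<beta> lam \<le> hs_norm2 lborel (\<Phi> lam)" unfolding \<beta>_def by (intro hs) simp
      then show "indicator E lam * \<beta> lam \<le> hs_norm2 lborel (\<Phi> lam)" by (simp add: indicator_def)
    qed
    \<comment> \<open>Only the squared norm is known to be integrable; on a set of finite measure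
      the bound of \<open>r\<close> by \<open>1 + r\<^sup>2\<close> yields integrability of the
      norm, which Fubini needs.\<close>
    have vi: "integrable mu (\<lambda>lam. l2_norm lborel (v lam))"
    proof (rule integrableI_bounded)
      show "(\<lambda>lam. l2_norm lborel (v lam)) \<in> borel_measurable mu" by (rule weak_field_norm_measurable[OF wv])
      have "(\<integral>\<^sup>+ lam. ennreal (norm (l2_norm lborel (v lam))) \<partial>mu) \<le> (\<integral>\<^sup>+ lam. indicator E lam + indicator E lam * \<beta> lam \<partial>mu)"
      proof (rule nn_integral_mono)
        fix lam assume "lam \<in> space mu"
        then have lam: "lam \<in> Sig" by simp
        define r where "r = l2_norm lborel (\<Phi> lam (P lam h))"
        have "r \<le> 1 + r\<^sup>2" using zero_le_power2[of "r - 1/2"] by (simp add: power2_eq_square algebra_simps)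
        then have "ennreal r \<le> ennreal (1 + r\<^sup>2)" by (rule ennreal_leI)
        also have "\<dots> = 1 + ennreal (r\<^sup>2)" by simp
        finally have "ennreal r \<le> 1 + \<beta> lam" unfolding r_def \<beta>_def .
        then show "ennreal (norm (l2_norm lborel (v lam))) \<le> indicator E lam + indicator E lam * \<beta> lam"
          unfolding vn[OF lam] r_def[symmetric] by (simp add: indicator_def r_def)
      qed
      also have "\<dots> = (\<integral>\<^sup>+ lam. indicator E lam \<partial>mu) + (\<integral>\<^sup>+ lam. indicator E lam * \<beta> lam \<partial>mu)"
        by (rule nn_integral_add[OF Im borel_measurable_times_ennreal[OF Im bm]])
      also have "\<dots> < \<infinity>" using Efin bfin by simp
      finally show "(\<integral>\<^sup>+ lam. ennreal (norm (l2_norm lborel (v lam))) \<partial>mu) < \<infinity>" .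
    qed
    define F where "F = (\<lambda>lam. rank_one lborel (onb lborel 0) (u lam))"
    have Ffin: "(\<integral>\<^sup>+ lam. ennreal ((l2_norm lborel (u lam))\<^sup>2) \<partial>mu) < \<infinity>" unfolding u2 by (rule afin)
    have Fh: "F \<in> hs_fields" unfolding F_def by (rule rank_one_field[OF wu onb_L2 Ffin])
    have "AE lam in mu. F lam \<in> l2_tensor lborel (P lam ` L2 lborel)"
    proof (rule AE_I2)
      fix lam assume "lam \<in> space mu"
      then have lam: "lam \<in> Sig" by simp
      have "rank_one lborel (onb lborel 0) (P lam h) \<in> l2_tensor lborel (P lam ` L2 lborel)"
        by (rule rank_one_in_l2_tensor[OF onb_lborel onb_L2 weak_field_L2[OF wP lam]]) (rule imageI[OF h])
      from l2_tensor_scaled[OF this, of "indicator E lam"]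
      have "(\<lambda>h' x. indicator E lam * rank_one lborel (onb lborel 0) (P lam h) h' x) \<in> l2_tensor lborel (P lam ` L2 lborel)" .
      moreover have "F lam = (\<lambda>h' x. indicator E lam * rank_one lborel (onb lborel 0) (P lam h) h' x)"
        unfolding F_def u_def rank_one_def l2_inner_scale_right by (simp add: fun_eq_iff indicator_def)
      ultimately show "F lam \<in> l2_tensor lborel (P lam ` L2 lborel)" by (simp only:)
    qed
    from im[OF Fh this] obtain f where f: "f \<in> K" and fF: "is_plancherel f F" ..
    define c where "c x = l2_inner haar f (left_translate x \<phi>)" for x
    have c: "c \<in> L2 haar" and cn: "l2_norm haar c = l2_norm haar f"
      using wave f unfolding continuous_wavelet_def c_def[abs_def] by simp_all
    have cc: "cnj (c x) = (LINT lam|mu. l2_inner lborel (pi_rep lam x (v lam)) (onb lborel 0))" for x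
      unfolding c_def v_def by (rule rank_one_coefficients[OF fF[unfolded F_def] p wu onb_L2])
    have "(\<integral>\<^sup>+ lam. indicator E lam * \<alpha> lam \<partial>mu) = (\<integral>\<^sup>+ lam. hs_norm2 lborel (F lam) \<partial>mu)"
    proof (rule nn_integral_cong)
      fix lam assume "lam \<in> space mu"
      then have lam: "lam \<in> Sig" by simp
      show "indicator E lam * \<alpha> lam = hs_norm2 lborel (F lam)"
        unfolding F_def hs_norm2_rank_one[OF onb_lborel weak_field_L2[OF wu lam]] u2[symmetric]
          orthonormal_basis_norm[OF onb_lborel] by simp
    qed
    also have "\<dots> = ennreal ((l2_norm haar c)\<^sup>2)" unfolding is_plancherel_norm[OF fF, symmetric] cn ..
    also have "\<dots> \<le> (\<integral>\<^sup>+ lam. ennreal ((l2_norm lborel (v lam))\<^sup>2) \<partial>mu)"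
      by (rule coefficients_norm_le[OF wv vi c cc])
    also have "\<dots> = (\<integral>\<^sup>+ lam. indicator E lam * \<beta> lam \<partial>mu)"
      by (rule nn_integral_cong) (rule v2, simp)
    finally have le: "(\<integral>\<^sup>+ lam. indicator E lam * \<alpha> lam \<partial>mu) \<le> (\<integral>\<^sup>+ lam. indicator E lam * \<beta> lam \<partial>mu)" .
    have "AE lam in mu. lam \<notin> E"
    proof (rule AE_notin_if_nn_integral_le[OF am bm Emu _ le bfin])
      show "\<beta> lam < \<alpha> lam" if "lam \<in> E" for lam using that by (simp add: E_def)
    qed
    then show ?thesis unfolding E_def .
  qed
  have all: "AE lam in mu. \<forall>N::nat. lam \<notin> {lam \<in> space mu. \<beta> lam < \<alpha> lam} \<inter> cball 0 (real N)"
    unfolding AE_all_countable by (rule allI) (rule bad)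
  have sp: "AE lam in mu. lam \<in> space mu" by (rule AE_space)
  from all sp show ?thesis
  proof eventually_elim
    case (elim lam)
    obtain N :: nat where "norm lam \<le> real N" using real_arch_simple by blast
    then have "lam \<in> cball 0 (real N)" by simp
    then have "\<not> \<beta> lam < \<alpha> lam" using elim(1)[THEN spec, of N] elim(2) by simp
    then have "\<alpha> lam \<le> \<beta> lam" by (simp only: not_less)
    then have "(l2_norm lborel (P lam h))\<^sup>2 \<le> (l2_norm lborel (\<Phi> lam (P lam h)))\<^sup>2"
      unfolding \<alpha>_def \<beta>_def by (simp add: ennreal_le_iff)
    then show ?case by (rule power2_le_imp_le) simp
  qed
qed

lemma operator_rank_le_hs:
  assumes P: "\<And>lam. lam \<in> Sig \<Longrightarrow> orthogonal_projection lborel (P lam)" "measurable_field P"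
    and im: "\<And>F. F \<in> hs_fields \<Longrightarrow> (AE lam in mu. F lam \<in> l2_tensor lborel (P lam ` L2 lborel)) \<Longrightarrow> \<exists>f\<in>K. is_plancherel f F"
    and wave: "continuous_wavelet K \<phi>" and p: "is_plancherel \<phi> \<Phi>"
  shows "AE lam in mu. ennreal_of_enat (operator_rank lborel (P lam)) \<le> hs_norm2 lborel (\<Phi> lam)"
proof -
  note Ph = is_plancherelD(2)[OF p]
  have sum: "(\<Sum>j. ennreal ((l2_norm lborel (\<Phi> lam (P lam (onb lborel j))))\<^sup>2)) \<le> hs_norm2 lborel (\<Phi> lam)"
    if lam: "lam \<in> Sig" for lam
    by (rule hs_norm2_comp_projection_le[OF onb_lborel hs_fields_regular(4)[OF Ph lam] P(1)[OF lam]])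
  \<comment> \<open>One term of the sum just bounded. It provides the integrable majorant under
    which \<open>projected_norm_le\<close> compares integrals.\<close>
  have single: "ennreal ((l2_norm lborel (\<Phi> lam (P lam (onb lborel j))))\<^sup>2) \<le> hs_norm2 lborel (\<Phi> lam)"
    if lam: "lam \<in> Sig" for lam j
  proof -
    define r where "r j = ennreal ((l2_norm lborel (\<Phi> lam (P lam (onb lborel j))))\<^sup>2)" for j
    have "r j = sum r {j}" by simp
    also have "\<dots> \<le> suminf r" by (rule sum_le_suminf) simp_all
    also have "\<dots> \<le> hs_norm2 lborel (\<Phi> lam)" unfolding r_def by (rule sum[OF lam])
    finally show ?thesis unfolding r_def .
  qed
  have "AE lam in mu. l2_norm lborel (P lam (onb lborel j)) \<le> l2_norm lborel (\<Phi> lam (P lam (onb lborel j)))" for j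
    by (rule projected_norm_le[OF P im wave p onb_L2 single])
  then have all: "AE lam in mu. \<forall>j. l2_norm lborel (P lam (onb lborel j)) \<le> l2_norm lborel (\<Phi> lam (P lam (onb lborel j)))"
    unfolding AE_all_countable by (rule allI)
  have sp: "AE lam in mu. lam \<in> space mu" by (rule AE_space)
  from all sp show ?thesis
  proof eventually_elim
    case (elim lam)
    then have lam: "lam \<in> Sig" by simp
    have "ennreal_of_enat (operator_rank lborel (P lam)) \<le> hs_norm2 lborel (P lam)"
      by (rule operator_rank_le_hs_norm2[OF onb_lborel P(1)[OF lam]])
    also have "\<dots> \<le> (\<Sum>j. ennreal ((l2_norm lborel (\<Phi> lam (P lam (onb lborel j))))\<^sup>2))"
      unfolding hs_norm2_eq by (intro suminf_le ennreal_leI power_mono elim(1)[THEN spec]) simp_all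
    also have "\<dots> \<le> hs_norm2 lborel (\<Phi> lam)" by (rule sum[OF lam])
    finally show ?case .
  qed
qed

end

section \<open>Combination of the density, rank and volume estimates\<close>

theorem proposition25:
  fixes br :: "'v::euclidean_space \<Rightarrow> 'v \<Rightarrow> 'v"
    and Z :: "'k::finite \<Rightarrow> 'v" and Y X :: "'d::finite \<Rightarrow> 'v"
    and a :: "real^'k" and q b :: "real^'d"
    and I :: "(real^'k) set" and m :: "real^'k \<Rightarrow> enat"
    and K :: "('v \<Rightarrow> complex) set" and \<phi> :: "'v \<Rightarrow> complex"
  assumes "two_step br Z Y X"
    and "\<And>i. a $ i > 0" and "\<And>j. q $ j > 0" and "\<And>j. b $ j > 0"
    and "I \<in> sets lebesgue"
    and "I \<subseteq> {lam \<in> two_step.Sig br Z Y X. \<forall>i. 0 \<le> lam $ i \<and> lam $ i \<le> a $ i}"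
    and "closed_subspace (two_step.haar br Z Y X) K"
    and "two_step.left_invariant br K"
    and "two_step.band_limited br Z Y X K"
    and "two_step.plancherel_image br Z Y X K I m"
    and "\<phi> \<in> K"
    and "two_step.continuous_wavelet br Z Y X K \<phi>"
    and "two_step.parseval_frame br Z Y X K (two_step.quasi_lattice br Z Y X a q b) \<phi>"
  shows "(AE lam in lebesgue. lam \<in> I \<longrightarrow>
            ennreal_of_enat (m lam)
              \<le> ennreal (1 / ((\<Prod>i\<in>UNIV. a $ i) * \<bar>det (two_step.B br Z Y X lam)\<bar>))) \<and>
         (l2_norm (two_step.haar br Z Y X) \<phi>)\<^sup>2
           \<le> (LINT lam:I|lebesgue. (\<Prod>j\<in>UNIV. b $ j) * (\<Prod>j\<in>UNIV. q $ j))"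
proof -
  interpret two_step br Z Y X by (rule assms(1))
  note inv = assms(8) and fr = assms(13) and wave = assms(12) and phi = assms(11)
  have KL: "K \<subseteq> L2 haar" using assms(7) by (simp add: closed_subspace_def)
  define A where "A = (\<Prod>i\<in>UNIV. a $ i)"
  define C where "C = (\<Prod>j\<in>UNIV. b $ j) * (\<Prod>j\<in>UNIV. q $ j)"
  have A: "0 < A" unfolding A_def by (intro prod_pos) (use assms(2) in simp)
  have C: "0 < C" unfolding C_def by (intro mult_pos_pos prod_pos) (use assms(3,4) in simp_all)
  obtain \<Phi> where p: "is_plancherel \<phi> \<Phi>" using exists_plancherel[OF subsetD[OF KL phi]] ..
  note Ph = is_plancherelD(2)[OF p]
  show ?thesis
  proof (rule plancherel_imageE[OF assms(10)])
    fix P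
    assume P: "\<And>lam. lam \<in> Sig \<Longrightarrow> orthogonal_projection lborel (P lam)" "measurable_field P"
      and im1: "\<And>f F. f \<in> K \<Longrightarrow> is_plancherel f F \<Longrightarrow> F \<in> hs_fields \<and> (AE lam in mu. F lam \<in> l2_tensor lborel (P lam ` L2 lborel))"
      and im2: "\<And>F. F \<in> hs_fields \<Longrightarrow> (AE lam in mu. F lam \<in> l2_tensor lborel (P lam ` L2 lborel)) \<Longrightarrow> \<exists>f\<in>K. is_plancherel f F"
      and off: "AE lam in mu. lam \<notin> I \<longrightarrow> (\<forall>h\<in>L2 lborel. AE x in lborel. P lam h x = 0)"
      and rank: "\<And>lam. lam \<in> I \<Longrightarrow> m lam = operator_rank lborel (P lam)"
    have dens: "AE lam in lborel. hs_density \<Phi> lam \<le> 1 / A"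
      unfolding A_def by (rule hs_density_le[OF assms(2) KL inv fr phi p assms(10)])
    have "AE lam in mu. ennreal_of_enat (operator_rank lborel (P lam)) \<le> hs_norm2 lborel (\<Phi> lam)"
      by (rule operator_rank_le_hs[OF P im2 wave p])
    then have "AE lam in lborel. ennreal_of_enat (operator_rank lborel (P lam)) \<le> hs_norm2 lborel (\<Phi> lam)"
      unfolding AE_mu .
    with dens have "AE lam in lborel. lam \<in> I \<longrightarrow> ennreal_of_enat (m lam) \<le> ennreal (1 / (A * \<bar>det (B lam)\<bar>))"
    proof eventually_elim
      case (elim lam)
      show ?case
      proof
        assume I: "lam \<in> I"
        then have S: "lam \<in> Sig" using assms(6) by blast
        then have d: "0 < \<bar>det (B lam)\<bar>" by (simp add: Sig_def)
        have "\<bar>det (B lam)\<bar> * enn2real (hs_norm2 lborel (\<Phi> lam)) \<le> 1 / A"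
          using elim(1) S by (simp add: hs_density_def)
        then have "enn2real (hs_norm2 lborel (\<Phi> lam)) \<le> 1 / (A * \<bar>det (B lam)\<bar>)"
          using A d by (simp add: field_simps)
        then have "ennreal (enn2real (hs_norm2 lborel (\<Phi> lam))) \<le> ennreal (1 / (A * \<bar>det (B lam)\<bar>))"
          by (rule ennreal_leI)
        then show "ennreal_of_enat (m lam) \<le> ennreal (1 / (A * \<bar>det (B lam)\<bar>))"
          using elim(2) unfolding hs_fields_finite[OF Ph S] rank[OF I] by (rule order_trans[rotated])
      qed
    qed
    then have 1: "AE lam in lebesgue. lam \<in> I \<longrightarrow> ennreal_of_enat (m lam) \<le> ennreal (1 / (A * \<bar>det (B lam)\<bar>))"
      by (rule AE_completion)
    have "(l2_norm haar \<phi>)\<^sup>2 \<le> C * measure lebesgue I"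
    \<comment> \<open>The volume comparison divides by the norm of \<phi>, so norm 0 is treated
      apart.\<close>
    proof (cases "l2_norm haar \<phi> = 0")
      case True
      then show ?thesis using C by simp
    next
      case False
      have "1 \<le> A * (\<Prod>j\<in>UNIV. q $ j) * (\<Prod>j\<in>UNIV. b $ j)"
        unfolding A_def by (rule density_ge_1[OF assms(2,3,4) KL inv fr wave False])
      then have "1 / A \<le> C" using A by (simp add: C_def field_simps)
      then have dens': "AE lam in lborel. hs_density \<Phi> lam \<le> C"
        using dens by (auto elim!: eventually_mono)
      have sp: "AE lam in mu. lam \<in> space mu" by (rule AE_space)
      \<comment> \<open>Off \<open>I\<close> the projection is zero, and so is the fibre of \<Phi>,
        which lies in the tensor span of its range.\<close>
      have "AE lam in mu. lam \<notin> I \<longrightarrow> hs_density \<Phi> lam = 0"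
        using off im1[OF phi p, THEN conjunct2] sp
      proof eventually_elim
        case (elim lam)
        show ?case
        proof
          assume I: "lam \<notin> I"
          have S: "lam \<in> Sig" using elim(3) by simp
          have "hs_norm2 lborel (\<Phi> lam) = 0"
          proof (rule l2_tensor_trivial[OF elim(2) _ _ onb_lborel])
            show "AE x in lborel. u x = 0" if "u \<in> P lam ` L2 lborel" for u
              using that elim(1)[rule_format, OF I] by (elim imageE) simp
            show "P lam ` L2 lborel \<subseteq> L2 lborel"
              by (rule image_subsetI) (rule bounded_operator_L2[OF projection_bounded[OF P(1)[OF S]]])
          qed
          then show "hs_density \<Phi> lam = 0" by (simp add: hs_density_def)
        qed
      qed
      then have "AE lam in lborel. lam \<notin> I \<longrightarrow> hs_density \<Phi> lam = 0" unfolding AE_mu .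
      with dens' have "AE lam in lborel. ennreal (hs_density \<Phi> lam) \<le> ennreal C * indicator I lam"
      proof eventually_elim
        case (elim lam)
        then show ?case by (cases "lam \<in> I") (simp_all add: ennreal_leI)
      qed
      then have le: "AE lam in lebesgue. ennreal (hs_density \<Phi> lam) \<le> ennreal C * indicator I lam"
        by (rule AE_completion)
      \<comment> \<open>Boundedness makes the measure of \<open>I\<close> finite; otherwise
        \<open>measure\<close> would return the default value 0.\<close>
      have "I \<subseteq> cbox 0 a" using assms(6) by (auto simp: mem_box_cart)
      then have bd: "bounded I" by (rule bounded_subset[OF bounded_cbox])
      have fin: "emeasure lebesgue I \<noteq> \<top>"
        by (rule fmeasurableD2[OF bounded_set_imp_lmeasurable[OF bd assms(5)]])
      have "ennreal ((l2_norm haar \<phi>)\<^sup>2) = (\<integral>\<^sup>+ lam. ennreal (hs_density \<Phi> lam) \<partial>lborel)"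
        unfolding is_plancherel_norm[OF p] using nn_integral_hs_density[OF Ph, of UNIV] by simp
      also have "\<dots> = (\<integral>\<^sup>+ lam. ennreal (hs_density \<Phi> lam) \<partial>lebesgue)" by (rule nn_integral_completion[symmetric])
      also have "\<dots> \<le> (\<integral>\<^sup>+ lam. ennreal C * indicator I lam \<partial>lebesgue)" by (rule nn_integral_mono_AE[OF le])
      also have "\<dots> = ennreal C * emeasure lebesgue I" by (rule nn_integral_cmult_indicator[OF assms(5)])
      also have "\<dots> = ennreal C * ennreal (measure lebesgue I)"
        using fin by (simp add: emeasure_eq_ennreal_measure)
      also have "\<dots> = ennreal (C * measure lebesgue I)" using C by (simp add: ennreal_mult)
      finally show ?thesis using C by (simp add: ennreal_le_iff)
    qed
    also have "C * measure lebesgue I = (LINT lam:I|lebesgue. C)"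
      unfolding set_lebesgue_integral_def using assms(5) by (simp add: mult.commute)
    finally show ?thesis using 1 unfolding A_def C_def by (intro conjI)
  qed
qed

end
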